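(* Let $1<\alpha<2$, $\gamma=1/\alpha$, $T>0$, let $X,m,A$ be as in the context, and let $$f\in W^{1,q}((0,T);L^2(X)),\qquad\text{for }\frac1p+\frac1q=1\text{ and }1\le p<\frac1{2-\alpha}.$$ Consider the linear system $$\mathbb D_t^\alpha u(x,t)+Au(x,t)=f(x,t)\ \text{ in } X\times(0,T),\qquad u(\cdot,0)=u_0,\quad \partial_tu(\cdot,0)=u_1\ \text{ in } X.$$ Then the following assertions hold. (a) If $u_0\in V_\gamma$ and $u_1\in L^2(X)$, then the system has a unique strong solution (in the sense defined in the context), given by $$u(\cdot,t)=\sum_{n=1}^\infty (u_0,\varphi_n)E_{\alpha,1}(-\lambda_nt^\alpha)\varphi_n+\sum_{n=1}^\infty (u_1,\varphi_n)tE_{\alpha,2}(-\lambda_nt^\alpha)\varphi_n+\sum_{n=1}^\infty\left(\int_0^t (f(\cdot,\tau),\varphi_n)(t-\tau)^{\alpha-1}E_{\alpha,\alpha}(-\lambda_n(t-\tau)^\alpha)\,d\tau\right)\varphi_n .$$ In particular there is a constant $C>0$ such that for every $t\in(0,T)$, $$\|\mathbb D_t^\alpha u(\cdot,t)\|_{L^2(X)}+\|Au(\cdot,t)\|_{L^2(X)}\le Ct^{1-\alpha}\left(\|u_0\|_{V_\gamma}+\|u_1\|_{L^2(X)}\right)+C\left(\|f(\cdot,t)\|_{L^2(X)}+\|f(\cdot,0)\|_{L^2(X)}+Ct^{\frac1p}\|\partial_tf\|_{L^q((0,T);L^2(X))}\right).$$ (b) If $u_0\in V_\sigma$ for some $\sigma>\frac1\alpha$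 and $u_1\in V_\beta$ for some $\beta>\frac{\alpha-1}{\alpha}$, then the strong solution also satisfies $u\in W^{2,1}((0,T);L^2(X))$ and there is a constant $C>0$ such that $$\|\partial_t^2u\|_{L^1((0,T);L^2(X))}\le C\left(T^{\alpha\sigma-1}\|u_0\|_{V_\sigma}+T^{1-\alpha(1-\beta)}\|u_1\|_{V_\beta}+T^{\frac1p+\alpha-1}\|\partial_tf\|_{L^q((0,T);L^2(X))}+T^{\alpha-1}\|f(\cdot,0)\|_{L^2(X)}\right).$$ In addition, the initial conditions are satisfied in the strong sense $$\lim_{t\to0^+}\|u(\cdot,t)-u_0\|_{V_\gamma}=0,\qquad \lim_{t\to0^+}\|\partial_tu(\cdot,t)-u_1\|_{L^2(X)}=0.$$
   Context: Setting. $X$ is a relatively compact metric space and $m$ is a Radon measure on $X$ with $\mathrm{supp}(m)=X$ and $m(X)<\infty$; $L^p(X)=L^p(X,m)$ (real-valued), and $(\cdot,\cdot)$ is the inner product of $L^2(X)$; "a.e. in $X$" means $m$-a.e. A Dirichlet form on $L^2(X)$ is a symmetric, non-negative, bilinear form $\mathcal E_A:V_{1/2}\times V_{1/2}\to\mathbb R$ whose domain $V_{1/2}=D(\mathcal E_A)$ is a dense linear subspace of $L^2(X)$, which is closed ($V_{1/2}$ is complete for the inner product $\mathcal E_A(u,v)+\lambda(u,v)$, $\lambda>0$) and Markovian: for each $\epsilon>0$ there is $\phi_\epsilon\in C^\infty(\mathbb R)$ with $\phi_\epsilon(t)=t$ on $[0,1]$, $-\epsilon\le\phi_\epsilon\le1+\epsilon$,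 $0\le\phi_\epsilon(t)-\phi_\epsilon(\tau)\le t-\tau$ for $\tau<t$, such that $u\in V_{1/2}$ implies $\phi_\epsilon(u)\in V_{1/2}$ and $\mathcal E_A(\phi_\epsilon(u),\phi_\epsilon(u))\le\mathcal E_A(u,u)$. Assumptions on $A$. $A$ is the non-negative self-adjoint operator on $L^2(X)$ associated with a Dirichlet form $\mathcal E_A$, i.e. $V_{1/2}=D(A^{1/2})$ and $\mathcal E_A(u,v)=(Au,v)$ for $u\in D(A)$, $v\in V_{1/2}$. It is assumed that $V_{1/2}$ embeds compactly in $L^2(X)$ and that $V_{1/2}\hookrightarrow L^{2q_A}(X)$ continuously for some $q_A>1$. Then $A$ has discrete spectrum $\lambda_1\le\lambda_2\le\dots\to+\infty$; throughout, $\lambda_1>0$. $(\varphi_n)_{n\in\mathbb N}$ is an orthonormal basis of $L^2(X)$ of eigenfunctions, $A\varphi_n=\lambda_n\varphi_n$. Spaces. For $s\ge0$, $V_s:=D(A^s)=\{h\in L^2(X):\sum_n|(h,\varphi_n)|^2\lambda_n^{2s}<\infty\}$, with norm $\|h\|_{V_s}=(\sum_n|(h,\varphi_n)|^2\lambda_n^{2s})^{1/2}$. Identifying $L^2(X)$ with its dual, $V_{-s}:=(V_s)^*$, with norm $(\sum_n|\langle h,\varphi_n\rangle|^2\lambda_n^{-2s})^{1/2}$; $\langle\cdot,\cdot\rangle_{V_{-s},V_s}$ is the duality bracket. Mittag-Leffler functions: $E_{\alpha,\beta}(z)=\sum_{n=0}^\infty \frac{z^n}{\Gamma(\alpha n+\beta)}$.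 Caputo derivative: $\mathbb D_t^\alpha u(x,t)=\frac1{\Gamma(2-\alpha)}\int_0^t(t-s)^{1-\alpha}\partial_s^2u(x,s)\,ds$, which for sufficiently smooth $u$ is equivalent to the weaker form $\frac{1}{\Gamma(2-\alpha)}\partial_t^2\int_0^t(t-s)^{1-\alpha}\big(u(x,s)-u(x,0)-s\,\partial_su(x,0)\big)ds$ (which requires less smoothness of $u$). Weak solution of the linear system on $(0,T)$. A function $u$ such that: (1) $u\in C([0,T];V_\gamma)\cap C^1([0,T];L^2(X))$ and $\mathbb D_t^\alpha u\in C([0,T];V_{-\gamma})$; (2) $u(\cdot,0)=u_0$ and $\partial_tu(\cdot,0)=u_1$ a.e. in $X$, and $\lim_{t\to0^+}\|u(\cdot,t)-u_0\|_{V_\sigma}=0$, $\lim_{t\to0^+}\|\partial_tu(\cdot,t)-u_1\|_{V_{-\beta}}=0$ for some $\frac1\alpha>\sigma\ge0$ and $1-\frac1\alpha\ge\beta>0$; (3) for every $\varphi\in V_\gamma\hookrightarrow V_{1/2}$ and a.e. $t\in(0,T)$, $\langle\mathbb D_t^\alpha u(\cdot,t),\varphi\rangle_{V_{-\gamma},V_\gamma}+\mathcal E_A(u(\cdot,t),\varphi)=(f(\cdot,t),\varphi)$. Strong solution on $(0,T)$: a weak solution which in addition satisfies $\mathbb D_t^\alpha u\in L^1((0,T);L^2(X))$ and $u\in L^1((0,T);D(A))$; in this case the equation holds pointwise a.e. in $X\times(0,T)$. *)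

theory Defs
  imports "HOL-Analysis.Analysis" "HOL-Probability.Essential_Supremum"
begin

section \<open>Lebesgue and Bochner spaces\<close>

text \<open>Membership and (semi)norm of \<open>L^q(M; 'h)\<close> for \<open>1 \<le> q \<le> \<infinity>\<close>. Elements are functions, not
  classes. The same notion serves for \<open>L^q(X)\<close> and for \<open>L^q((0,T); L^2(X))\<close>, the latter with
  \<open>M = lebesgue_on {0<..<T}\<close>; Borel measurability is strong measurability, \<open>'h\<close> being separable.\<close>

definition Lq_space ::
  "ennreal \<Rightarrow> 'a measure \<Rightarrow> ('a \<Rightarrow> 'h::{banach,second_countable_topology}) set" where
  "Lq_space q M = {f \<in> borel_measurable M.
     if q = \<infinity> then esssup M (\<lambda>x. ereal (norm (f x))) < \<infinity>
     else integrable M (\<lambda>x. norm (f x) powr enn2real q)}"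

definition Lq_norm ::
  "ennreal \<Rightarrow> 'a measure \<Rightarrow> ('a \<Rightarrow> 'h::{banach,second_countable_topology}) \<Rightarrow> real" where
  "Lq_norm q M f =
     (if q = \<infinity> then real_of_ereal (esssup M (\<lambda>x. ereal (norm (f x))))
      else (\<integral>x. norm (f x) powr enn2real q \<partial>M) powr (1 / enn2real q))"

text \<open>Weak derivative on \<open>(0,T)\<close>, tested against \<open>C\<^sup>1\<close> functions with compact support in \<open>(0,T)\<close>.\<close>

definition test_function :: "real \<Rightarrow> (real \<Rightarrow> real) \<Rightarrow> (real \<Rightarrow> real) \<Rightarrow> bool" where
  "test_function T \<psi> \<psi>' \<longleftrightarrow>
     (\<forall>t. (\<psi> has_real_derivative \<psi>' t) (at t)) \<and> continuous_on UNIV \<psi>' \<and>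
     (\<exists>a b. 0 < a \<and> b < T \<and> (\<forall>t. t \<notin> {a..b} \<longrightarrow> \<psi> t = 0))"

definition weak_derivative ::
  "real \<Rightarrow> (real \<Rightarrow> 'h::{banach,second_countable_topology}) \<Rightarrow> (real \<Rightarrow> 'h) \<Rightarrow> bool" where
  "weak_derivative T g g' \<longleftrightarrow>
     (\<forall>\<psi> \<psi>'. test_function T \<psi> \<psi>' \<longrightarrow>
        (\<integral>t. \<psi>' t *\<^sub>R g t \<partial>lebesgue_on {0<..<T}) = - (\<integral>t. \<psi> t *\<^sub>R g' t \<partial>lebesgue_on {0<..<T}))"

text \<open>\<open>g \<in> W^{1,q}((0,T); 'h)\<close> with weak derivative \<open>g'\<close> (unique up to null sets). The
  function \<open>g\<close> is determined only almost everywhere; where pointwise values \<open>g 0\<close>, \<open>g t\<close> are used,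
  the continuous representative on \<open>[0,T]\<close> is selected by a separate \<open>continuous_on {0..T} g\<close>.\<close>

definition sobolev_W1 ::
  "ennreal \<Rightarrow> real \<Rightarrow> (real \<Rightarrow> 'h::{banach,second_countable_topology}) \<Rightarrow> (real \<Rightarrow> 'h) \<Rightarrow> bool" where
  "sobolev_W1 q T g g' \<longleftrightarrow>
     g \<in> Lq_space q (lebesgue_on {0<..<T}) \<and> g' \<in> Lq_space q (lebesgue_on {0<..<T}) \<and>
     weak_derivative T g g'"

section \<open>The space \<open>X\<close> and the Hilbert space \<open>L^2(X,m)\<close>\<close>

definition radon_measure_on :: "'x::metric_space set \<Rightarrow> 'x measure \<Rightarrow> bool" where
  "radon_measure_on X m \<longleftrightarrow>
     sets m = sets (restrict_space borel X) \<and>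
     (\<forall>K. compact K \<and> K \<subseteq> X \<longrightarrow> emeasure m K < \<infinity>) \<and>
     (\<forall>B\<in>sets m. emeasure m B = (SUP K\<in>{K. compact K \<and> K \<subseteq> B}. emeasure m K))"

definition measure_supp :: "'x::metric_space measure \<Rightarrow> 'x set" where
  "measure_supp m = {x \<in> space m. \<forall>U. open U \<and> x \<in> U \<longrightarrow> 0 < emeasure m (U \<inter> space m)}"

text \<open>The Hilbert space \<open>L^2(X,m)\<close> of classes of functions is a type \<open>'h\<close> together with the map
  \<open>cls\<close> sending a square-integrable function to its class; this fixes \<open>'h\<close> up to isometric
  isomorphism. The sort constraints on \<open>'h\<close> used below are no restriction: \<open>L^2(X,m)\<close> is complete
  by Riesz-Fischer, and separable when \<open>m\<close> is a finite Borel measure on a relatively compact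
  (hence separable) metric space.\<close>

definition is_L2 :: "'x measure \<Rightarrow> (('x \<Rightarrow> real) \<Rightarrow> 'h::real_inner) \<Rightarrow> bool" where
  "is_L2 m cls \<longleftrightarrow>
     (\<forall>g\<in>Lq_space 2 m. \<forall>h\<in>Lq_space 2 m. cls (\<lambda>x. g x + h x) = cls g + cls h) \<and>
     (\<forall>c. \<forall>g\<in>Lq_space 2 m. cls (\<lambda>x. c * g x) = c *\<^sub>R cls g) \<and>
     (\<forall>g\<in>Lq_space 2 m. \<forall>h\<in>Lq_space 2 m. inner (cls g) (cls h) = (\<integral>x. g x * h x \<partial>m)) \<and>
     cls ` Lq_space 2 m = UNIV"

section \<open>Dirichlet forms\<close>

definition smooth :: "(real \<Rightarrow> real) \<Rightarrow> bool" where
  "smooth \<phi> \<longleftrightarrow> (\<forall>k x. (deriv ^^ k) \<phi> field_differentiable at x)"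

definition bilinear_form_on :: "'h::real_inner set \<Rightarrow> ('h \<Rightarrow> 'h \<Rightarrow> real) \<Rightarrow> bool" where
  "bilinear_form_on V E \<longleftrightarrow> subspace V \<and>
     (\<forall>u\<in>V. \<forall>v\<in>V. \<forall>w\<in>V. E (u + v) w = E u w + E v w \<and> E w (u + v) = E w u + E w v) \<and>
     (\<forall>c. \<forall>u\<in>V. \<forall>w\<in>V. E (c *\<^sub>R u) w = c * E u w \<and> E w (c *\<^sub>R u) = c * E w u)"

definition form_closed :: "'h::real_inner set \<Rightarrow> ('h \<Rightarrow> 'h \<Rightarrow> real) \<Rightarrow> bool" where
  "form_closed V E \<longleftrightarrow>
     (\<forall>\<kappa>>0. \<forall>x::nat \<Rightarrow> 'h. range x \<subseteq> V \<and>
        (\<forall>\<epsilon>>0. \<exists>N. \<forall>i\<ge>N. \<forall>j\<ge>N.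
           sqrt (E (x i - x j) (x i - x j) + \<kappa> * inner (x i - x j) (x i - x j)) < \<epsilon>) \<longrightarrow>
        (\<exists>l\<in>V. (\<lambda>n. sqrt (E (x n - l) (x n - l) + \<kappa> * inner (x n - l) (x n - l)))
                 \<longlonglongrightarrow> 0))"

definition markovian ::
  "'x measure \<Rightarrow> (('x \<Rightarrow> real) \<Rightarrow> 'h::real_inner) \<Rightarrow> 'h set \<Rightarrow> ('h \<Rightarrow> 'h \<Rightarrow> real) \<Rightarrow> bool" where
  "markovian m cls V E \<longleftrightarrow>
     (\<forall>\<epsilon>>0. \<exists>\<phi>::real \<Rightarrow> real. smooth \<phi> \<and>
        (\<forall>t\<in>{0..1}. \<phi> t = t) \<and>
        (\<forall>t. - \<epsilon> \<le> \<phi> t \<and> \<phi> t \<le> 1 + \<epsilon>) \<and>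
        (\<forall>\<tau> t. \<tau> < t \<longrightarrow> 0 \<le> \<phi> t - \<phi> \<tau> \<and> \<phi> t - \<phi> \<tau> \<le> t - \<tau>) \<and>
        (\<forall>g\<in>Lq_space 2 m. cls g \<in> V \<longrightarrow>
           cls (\<phi> \<circ> g) \<in> V \<and> E (cls (\<phi> \<circ> g)) (cls (\<phi> \<circ> g)) \<le> E (cls g) (cls g)))"

definition dirichlet_form ::
  "'x measure \<Rightarrow> (('x \<Rightarrow> real) \<Rightarrow> 'h::real_inner) \<Rightarrow> 'h set \<Rightarrow> ('h \<Rightarrow> 'h \<Rightarrow> real) \<Rightarrow> bool" where
  "dirichlet_form m cls V E \<longleftrightarrow>
     bilinear_form_on V E \<and>
     (\<forall>u\<in>V. \<forall>v\<in>V. E u v = E v u) \<and>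
     (\<forall>u\<in>V. 0 \<le> E u u) \<and>
     closure V = UNIV \<and>
     form_closed V E \<and>
     markovian m cls V E"

definition form_norm :: "('h::real_inner \<Rightarrow> 'h \<Rightarrow> real) \<Rightarrow> 'h \<Rightarrow> real" where
  "form_norm E u = sqrt (E u u + inner u u)"

definition compactly_embedded :: "'h::real_inner set \<Rightarrow> ('h \<Rightarrow> 'h \<Rightarrow> real) \<Rightarrow> bool" where
  "compactly_embedded V E \<longleftrightarrow> (\<forall>R. compact (closure {u \<in> V. form_norm E u \<le> R}))"

definition embedded_in_Lr ::
  "real \<Rightarrow> 'x measure \<Rightarrow> (('x \<Rightarrow> real) \<Rightarrow> 'h::real_inner) \<Rightarrow> 'h set \<Rightarrow> ('h \<Rightarrow> 'h \<Rightarrow> real) \<Rightarrow> bool" where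
  "embedded_in_Lr r m cls V E \<longleftrightarrow>
     (\<exists>K. \<forall>g\<in>Lq_space 2 m. cls g \<in> V \<longrightarrow>
        g \<in> Lq_space (ennreal r) m \<and> Lq_norm (ennreal r) m g \<le> K * form_norm E (cls g))"

section \<open>The operator, its eigenbasis, and the spaces \<open>V_s\<close>, \<open>V_{-s}\<close>\<close>

text \<open>An unbounded operator is a total function \<open>A\<close> with its domain \<open>DA\<close>; the values of \<open>A\<close> outside
  \<open>DA\<close> are irrelevant. The last conjunct says that the domain of the adjoint is contained in \<open>DA\<close>.\<close>

definition nonneg_selfadjoint :: "'h::real_inner set \<Rightarrow> ('h \<Rightarrow> 'h) \<Rightarrow> bool" where
  "nonneg_selfadjoint DA A \<longleftrightarrow>
     subspace DA \<and> closure DA = UNIV \<and>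
     (\<forall>x\<in>DA. \<forall>y\<in>DA. A (x + y) = A x + A y) \<and> (\<forall>c. \<forall>x\<in>DA. A (c *\<^sub>R x) = c *\<^sub>R A x) \<and>
     (\<forall>x\<in>DA. 0 \<le> inner (A x) x) \<and>
     (\<forall>x\<in>DA. \<forall>y\<in>DA. inner (A x) y = inner x (A y)) \<and>
     (\<forall>y z. (\<forall>x\<in>DA. inner (A x) y = inner x z) \<longrightarrow> y \<in> DA)"

text \<open>Eigenvalues and eigenfunctions are indexed from 0, so \<open>lam 0\<close> is the first eigenvalue.\<close>

definition eigenbasis ::
  "'h::real_inner set \<Rightarrow> ('h \<Rightarrow> 'h) \<Rightarrow> (nat \<Rightarrow> 'h) \<Rightarrow> (nat \<Rightarrow> real) \<Rightarrow> bool" where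
  "eigenbasis DA A e lam \<longleftrightarrow>
     (\<forall>i j. inner (e i) (e j) = (if i = j then 1 else 0)) \<and>
     closure (span (range e)) = UNIV \<and>
     (\<forall>n. e n \<in> DA \<and> A (e n) = lam n *\<^sub>R e n) \<and>
     mono lam \<and> filterlim lam at_top sequentially \<and> 0 < lam 0"

definition V_space :: "(nat \<Rightarrow> 'h::real_inner) \<Rightarrow> (nat \<Rightarrow> real) \<Rightarrow> real \<Rightarrow> 'h set" where
  "V_space e lam s = {h. summable (\<lambda>n. (inner h (e n))\<^sup>2 * lam n powr (2 * s))}"

definition V_norm :: "(nat \<Rightarrow> 'h::real_inner) \<Rightarrow> (nat \<Rightarrow> real) \<Rightarrow> real \<Rightarrow> 'h \<Rightarrow> real" where
  "V_norm e lam s h = sqrt (\<Sum>n. (inner h (e n))\<^sup>2 * lam n powr (2 * s))"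

text \<open>The domain \<open>D(A^{1/2})\<close> is spectral, i.e. \<open>V_s\<close> at \<open>s = 1/2\<close>.\<close>

definition associated_operator ::
  "'h::real_inner set \<Rightarrow> ('h \<Rightarrow> 'h \<Rightarrow> real) \<Rightarrow> 'h set \<Rightarrow> ('h \<Rightarrow> 'h) \<Rightarrow> (nat \<Rightarrow> 'h) \<Rightarrow> (nat \<Rightarrow> real) \<Rightarrow> bool" where
  "associated_operator V E DA A e lam \<longleftrightarrow>
     V = V_space e lam (1 / 2) \<and> (\<forall>u\<in>DA. \<forall>v\<in>V. E u v = inner (A u) v)"

text \<open>Elements of \<open>V_{-s} = (V_s)^*\<close> are functionals \<open>l\<close>, of which only the restriction to
  \<open>V_s\<close> matters; \<open>l v\<close> is the duality bracket. \<open>L^2(X)\<close> is embedded by \<open>h \<mapsto> inner h\<close>.\<close>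

definition Vdual :: "(nat \<Rightarrow> 'h::real_inner) \<Rightarrow> (nat \<Rightarrow> real) \<Rightarrow> real \<Rightarrow> ('h \<Rightarrow> real) set" where
  "Vdual e lam s = {l.
     (\<forall>v\<in>V_space e lam s. \<forall>w\<in>V_space e lam s. l (v + w) = l v + l w) \<and>
     (\<forall>c. \<forall>v\<in>V_space e lam s. l (c *\<^sub>R v) = c * l v) \<and>
     (\<exists>K. \<forall>v\<in>V_space e lam s. \<bar>l v\<bar> \<le> K * V_norm e lam s v)}"

definition Vdual_norm :: "(nat \<Rightarrow> 'h::real_inner) \<Rightarrow> (nat \<Rightarrow> real) \<Rightarrow> real \<Rightarrow> ('h \<Rightarrow> real) \<Rightarrow> real" where
  "Vdual_norm e lam s l = sqrt (\<Sum>n. (l (e n))\<^sup>2 * lam n powr (- 2 * s))"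

definition continuous_into_V ::
  "(nat \<Rightarrow> 'h::real_inner) \<Rightarrow> (nat \<Rightarrow> real) \<Rightarrow> real \<Rightarrow> real \<Rightarrow> (real \<Rightarrow> 'h) \<Rightarrow> bool" where
  "continuous_into_V e lam s T u \<longleftrightarrow>
     (\<forall>t\<in>{0..T}. u t \<in> V_space e lam s \<and>
        ((\<lambda>r. V_norm e lam s (u r - u t)) \<longlongrightarrow> 0) (at t within {0..T}))"

definition continuous_into_Vdual ::
  "(nat \<Rightarrow> 'h::real_inner) \<Rightarrow> (nat \<Rightarrow> real) \<Rightarrow> real \<Rightarrow> real \<Rightarrow> (real \<Rightarrow> 'h \<Rightarrow> real) \<Rightarrow> bool" where
  "continuous_into_Vdual e lam s T F \<longleftrightarrow>
     (\<forall>t\<in>{0..T}. F t \<in> Vdual e lam s \<and>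
        ((\<lambda>r. Vdual_norm e lam s (\<lambda>v. F r v - F t v)) \<longlongrightarrow> 0) (at t within {0..T}))"

text \<open>\<open>F'\<close> is the derivative of \<open>F : [0,T] \<rightarrow> V_{-s}\<close> in the norm of \<open>V_{-s}\<close> (one-sided at 0 and \<open>T\<close>).\<close>

definition Vdual_derivative ::
  "(nat \<Rightarrow> 'h::real_inner) \<Rightarrow> (nat \<Rightarrow> real) \<Rightarrow> real \<Rightarrow> real \<Rightarrow> (real \<Rightarrow> 'h \<Rightarrow> real) \<Rightarrow> (real \<Rightarrow> 'h \<Rightarrow> real) \<Rightarrow> bool" where
  "Vdual_derivative e lam s T F F' \<longleftrightarrow>
     (\<forall>t\<in>{0..T}. F t \<in> Vdual e lam s \<and> F' t \<in> Vdual e lam s \<and>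
        ((\<lambda>r. Vdual_norm e lam s (\<lambda>v. (F r v - F t v) / (r - t) - F' t v)) \<longlongrightarrow> 0)
          (at t within {0..T}))"

definition C1_on :: "real \<Rightarrow> (real \<Rightarrow> 'h::real_normed_vector) \<Rightarrow> bool" where
  "C1_on T u \<longleftrightarrow> (\<exists>u'. continuous_on {0..T} u' \<and>
     (\<forall>t\<in>{0..T}. (u has_vector_derivative u' t) (at t within {0..T})))"

definition dt :: "real \<Rightarrow> (real \<Rightarrow> 'h::real_normed_vector) \<Rightarrow> real \<Rightarrow> 'h" where
  "dt T u t = vector_derivative u (at t within {0..T})"

section \<open>Caputo derivative, weak and strong solutions\<close>

definition mittag_leffler :: "real \<Rightarrow> real \<Rightarrow> real \<Rightarrow> real" where
  "mittag_leffler \<alpha> \<beta> z = (\<Sum>n. z ^ n / Gamma (\<alpha> * real n + \<beta>))"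

definition caputo_integral ::
  "real \<Rightarrow> real \<Rightarrow> (real \<Rightarrow> 'h::{banach,second_countable_topology}) \<Rightarrow> real \<Rightarrow> 'h" where
  "caputo_integral \<alpha> T u t =
     (1 / Gamma (2 - \<alpha>)) *\<^sub>R
       (\<integral>s. (t - s) powr (1 - \<alpha>) *\<^sub>R (u s - u 0 - s *\<^sub>R dt T u 0) \<partial>lebesgue_on {0<..<t})"

text \<open>The Caputo derivative in its weaker form. A solution is only of class \<open>C\<^sup>1\<close> with values in
  \<open>L^2(X)\<close>, so both outer time derivatives are taken in \<open>V_{-s}\<close>. For continuous \<open>D\<close> this agrees with
  the \<open>V_{-s}\<close>-valued distributional second derivative. \<open>D t\<close> is unique as a functional on \<open>V_s\<close>.\<close>

definition has_caputo_derivative ::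
  "(nat \<Rightarrow> 'h::{real_inner,banach,second_countable_topology}) \<Rightarrow> (nat \<Rightarrow> real) \<Rightarrow> real \<Rightarrow> real \<Rightarrow> real \<Rightarrow>
   (real \<Rightarrow> 'h) \<Rightarrow> (real \<Rightarrow> 'h \<Rightarrow> real) \<Rightarrow> bool" where
  "has_caputo_derivative e lam s \<alpha> T u D \<longleftrightarrow>
     (\<exists>W. Vdual_derivative e lam s T (\<lambda>t v. inner (caputo_integral \<alpha> T u t) v) W \<and>
          Vdual_derivative e lam s T W D)"

definition weak_solution ::
  "(nat \<Rightarrow> 'h::{real_inner,banach,second_countable_topology}) \<Rightarrow> (nat \<Rightarrow> real) \<Rightarrow> ('h \<Rightarrow> 'h \<Rightarrow> real) \<Rightarrow>
   real \<Rightarrow> real \<Rightarrow> (real \<Rightarrow> 'h) \<Rightarrow> 'h \<Rightarrow> 'h \<Rightarrow> (real \<Rightarrow> 'h) \<Rightarrow> bool" where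
  "weak_solution e lam E \<alpha> T f u0 u1 u \<longleftrightarrow>
     continuous_into_V e lam (1 / \<alpha>) T u \<and> C1_on T u \<and>
     u 0 = u0 \<and> dt T u 0 = u1 \<and>
     (\<exists>\<sigma> \<beta>. 0 \<le> \<sigma> \<and> \<sigma> < 1 / \<alpha> \<and> 0 < \<beta> \<and> \<beta> \<le> 1 - 1 / \<alpha> \<and>
        ((\<lambda>t. V_norm e lam \<sigma> (u t - u0)) \<longlongrightarrow> 0) (at_right 0) \<and>
        ((\<lambda>t. Vdual_norm e lam \<beta> (inner (dt T u t - u1))) \<longlongrightarrow> 0) (at_right 0)) \<and>
     (\<exists>D. has_caputo_derivative e lam (1 / \<alpha>) \<alpha> T u D \<and>
        continuous_into_Vdual e lam (1 / \<alpha>) T D \<and>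
        (\<forall>v\<in>V_space e lam (1 / \<alpha>).
           AE t in lebesgue_on {0<..<T}. D t v + E (u t) v = inner (f t) v))"

text \<open>\<open>u \<in> L^1((0,T); D(A))\<close> refers to the graph norm, so it means that \<open>u\<close> and \<open>Au\<close>
  are Bochner integrable with values in \<open>L^2(X)\<close>.\<close>

definition strong_solution ::
  "(nat \<Rightarrow> 'h::{real_inner,banach,second_countable_topology}) \<Rightarrow> (nat \<Rightarrow> real) \<Rightarrow> ('h \<Rightarrow> 'h \<Rightarrow> real) \<Rightarrow>
   'h set \<Rightarrow> ('h \<Rightarrow> 'h) \<Rightarrow> real \<Rightarrow> real \<Rightarrow> (real \<Rightarrow> 'h) \<Rightarrow> 'h \<Rightarrow> 'h \<Rightarrow> (real \<Rightarrow> 'h) \<Rightarrow> bool" where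
  "strong_solution e lam E DA A \<alpha> T f u0 u1 u \<longleftrightarrow>
     weak_solution e lam E \<alpha> T f u0 u1 u \<and>
     (\<exists>D g. has_caputo_derivative e lam (1 / \<alpha>) \<alpha> T u D \<and>
        integrable (lebesgue_on {0<..<T}) g \<and>
        (AE t in lebesgue_on {0<..<T}. \<forall>v\<in>V_space e lam (1 / \<alpha>). D t v = inner (g t) v)) \<and>
     (AE t in lebesgue_on {0<..<T}. u t \<in> DA) \<and>
     integrable (lebesgue_on {0<..<T}) u \<and>
     integrable (lebesgue_on {0<..<T}) (\<lambda>t. A (u t))"

end

theory Submission
  imports Defs "HOL-Complex_Analysis.Complex_Analysis" "HOL-Real_Asymp.Real_Asymp"
begin

text \<open>In the eigenbasis the system decouples into the scalar equations
\<open>D\<^sup>\<alpha> y + \<lambda> y = c\<close>, where \<open>\<lambda>\<close> is an eigenvalue and \<open>c\<close> a Fourier coefficient of the source. With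
\<open>g\<^sub>\<mu>(t) = t powr (\<mu> - 1) / Gamma \<mu>\<close> such an equation amounts to the Volterra equation
\<open>y = y\<^sub>0 + t y\<^sub>1 + g\<^sub>\<alpha> * (c - \<lambda> y)\<close>. Everything then rests on two properties of the kernels
\<open>e\<^sub>\<beta>(t) = t powr (\<beta> - 1) E\<^bsub>\<alpha>,\<beta>\<^esub>(- \<lambda> t powr \<alpha>)\<close>.

The first one is algebraic. The kernels \<open>g\<^sub>\<mu>\<close> form a convolution semigroup, termwise integration
gives \<open>g\<^sub>\<mu> * e\<^sub>\<beta> = e\<^bsub>\<beta>+\<mu>\<^esub>\<close> (\<open>frac_kernel_ml_kernel_convolution\<close>), and an index shift in the power series
gives \<open>\<lambda> e\<^bsub>\<beta>+\<alpha>\<^esub> = g\<^sub>\<beta> - e\<^sub>\<beta>\<close> (\<open>ml_kernel_recurrence\<close>). So \<open>e\<^sub>\<alpha>\<close> is the resolvent of the Volterra equation and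
\<open>y\<^sub>0 e\<^sub>1 + y\<^sub>1 e\<^sub>2 + e\<^sub>\<alpha> * c\<close> is its only solution (\<open>mild_volterra\<close>, \<open>volterra_unique\<close>). A function with
these coefficients is called a mild solution below.

The second one is the estimate \<open>\<bar>E\<^bsub>\<alpha>,\<beta>\<^esub>(- x)\<bar> \<le> C / (1 + x)\<close> for \<open>x \<ge> 0\<close> (\<open>mittag_leffler_decay\<close>). It implies
\<open>\<lambda> powr s \<bar>e\<^sub>\<beta>(t)\<bar> \<le> B t powr (\<beta> - 1 - \<alpha> s)\<close> for \<open>0 \<le> s \<le> 1\<close> with \<open>B\<close> independent of \<open>\<lambda>\<close> (\<open>ml_kernel_bound\<close>).
Because of this uniformity, multiplying the coefficients by such kernels is a bounded diagonal operator,
and the choice of \<open>\<beta>\<close> and \<open>s\<close> produces every regularity statement and every power of \<open>t\<close> in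
the theorem. The estimate comes from representing \<open>E\<^bsub>\<alpha>,\<beta>\<^esub>(- x)\<close> as the integral of
\<open>s powr (\<alpha> - \<beta>) exp s / (s powr \<alpha> + x)\<close> over a broken line that opens into the left half plane. It has to
open so widely that \<open>exp s\<close> decays, and so little that \<open>s powr \<alpha>\<close> stays away from the negative axis;
both are possible because \<open>\<alpha> < 2\<close>. Expanding \<open>1 / (s powr \<alpha> + x)\<close> as a geometric series reduces the
representation to Hankel's formula for the reciprocal Gamma function (\<open>mittag_leffler_sums_contour\<close>).

The Caputo derivative of a solution is a second derivative in \<open>V\<^bsub>-\<gamma>\<^esub>\<close>. The isometry \<open>A\<^bsup>-\<gamma>\<^esup>\<close> from \<open>V\<^bsub>-\<gamma>\<^esub>\<close> onto the
Hilbert space turns it into an ordinary second derivative, and the coefficients of the singular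
integral inside are \<open>g\<^bsub>2-\<alpha>\<^esub> * z\<close>, where \<open>z\<close> is the coefficient of \<open>u - u\<^sub>0 - t u\<^sub>1\<close>. For a mild solution
\<open>z = g\<^sub>\<alpha> * (c - \<lambda> y)\<close>, so that \<open>g\<^bsub>2-\<alpha>\<^esub> * z = g\<^sub>2 * (c - \<lambda> y)\<close> has the second derivative required by
the equation (\<open>mild_caputo\<close>). Conversely, for a weak solution the equation gives
\<open>g\<^bsub>2-\<alpha>\<^esub> * z = g\<^bsub>2-\<alpha>\<^esub> * g\<^sub>\<alpha> * (c - \<lambda> y)\<close>, and \<open>g\<^bsub>2-\<alpha>\<^esub>\<close> cancels after convolution with \<open>g\<^bsub>\<alpha>-1\<^esub>\<close>; hence weak
solutions are mild, and unique (\<open>weak_solution_is_mild\<close>).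

That mild solutions are strong follows from the identity \<open>\<lambda> (e\<^sub>\<alpha> * c) = c - e\<^sub>1 c(0) - e\<^sub>1 * c'\<close>, an
integration by parts: the operator \<open>A\<close> meets only \<open>e\<^sub>1\<close> and \<open>e\<^sub>2\<close>, and \<open>\<lambda> powr (1 - \<gamma>) e\<^sub>1\<close> and \<open>\<lambda> e\<^sub>2\<close> are
of order \<open>t powr (1 - \<alpha>)\<close> (\<open>mild_operator_bound\<close>). For the last assertion, the second derivative has
the coefficients \<open>- \<lambda> e\<^bsub>\<alpha>-1\<^esub> y\<^sub>0 - \<lambda> e\<^sub>\<alpha> y\<^sub>1 + e\<^bsub>\<alpha>-1\<^esub> c(0) + e\<^bsub>\<alpha>-1\<^esub> * c'\<close>. Shifting \<open>\<lambda> powr \<sigma>\<close> and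
\<open>\<lambda> powr \<beta>\<close> to the data leaves kernels of orders \<open>t powr (\<alpha> \<sigma> - 2)\<close>, \<open>t powr (\<alpha> \<beta> - 1)\<close> and \<open>t powr (\<alpha> - 2)\<close>,
which are integrable at \<open>0\<close>, and the convolution term is covered by Young's inequality
(\<open>mild_second_derivative\<close>).\<close>

section \<open>Decay of Mittag-Leffler functions on the negative half line\<close>

lemma halfline_fundamental_theorem:
  fixes F f :: "real \<Rightarrow> complex"
  assumes F: "\<And>r. r > 0 \<Longrightarrow> (F has_vector_derivative f r) (at r)"
    and h: "h integrable_on {0<..}" "\<And>r. r > 0 \<Longrightarrow> norm (f r) \<le> h r"
  shows "f integrable_on {0<..}"
    and "(\<lambda>n. F (real (Suc n)) - F (1 / real (Suc n))) \<longlonglongrightarrow> integral {0<..} f"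
proof -
  define I where "I n = {1 / real (Suc n)..real (Suc n)}" for n
  have le: "1 / real (Suc n) \<le> real (Suc n)" for n
    by (simp add: field_simps)
  have sub: "I n \<subseteq> {0<..}" for n by (auto simp: I_def) (smt (verit) divide_pos_pos of_nat_0_le_iff)
  have hi: "(f has_integral (F (real (Suc n)) - F (1 / real (Suc n)))) (I n)" for n
    unfolding I_def
    by (rule fundamental_theorem_of_calculus[OF le])
       (use sub[of n] in \<open>auto intro!: has_vector_derivative_at_within F simp: I_def\<close>)
  define g where "g n r = (if r \<in> I n then f r else 0)" for n r
  have gi: "(g n has_integral (F (real (Suc n)) - F (1 / real (Suc n)))) {0<..}" for n
    unfolding g_def using has_integral_restrict[OF sub[of n], of f] hi[of n] by simp
  have lim: "(\<lambda>n. g n r) \<longlonglongrightarrow> f r" if "r \<in> {0<..}" for r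
  proof -
    obtain N where N: "max r (1 / r) < real N" using reals_Archimedean2 by blast
    have "g n r = f r" if "n \<ge> N" for n
    proof -
      have "max r (1 / r) < real (Suc n)" using N that by simp
      then have "r \<in> I n" using \<open>r \<in> {0<..}\<close> by (auto simp: I_def field_simps)
      then show ?thesis by (simp add: g_def)
    qed
    then show ?thesis by (intro tendsto_eventually) (auto simp: eventually_sequentially)
  qed
  have nb: "norm (g n r) \<le> h r" if "r \<in> {0<..}" for n r
    using h(2)[of r] that order_trans[OF norm_ge_zero h(2)[of r]] by (auto simp: g_def)
  note dc = dominated_convergence[of g "{0<..}" h f, OF _ h(1) nb lim]
  show "f integrable_on {0<..}" by (rule dc(1)) (use gi in auto)
  have "(\<lambda>n. integral {0<..} (g n)) \<longlonglongrightarrow> integral {0<..} f" by (rule dc(2)) (use gi in auto)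
  moreover have "integral {0<..} (g n) = F (real (Suc n)) - F (1 / real (Suc n))" for n
    using gi by (rule integral_unique)
  ultimately show "(\<lambda>n. F (real (Suc n)) - F (1 / real (Suc n))) \<longlonglongrightarrow> integral {0<..} f"
    by simp
qed

lemma cpowr_eq_norm_cis:
  assumes "s \<noteq> 0"
  shows "s powr complex_of_real a = of_real (norm s powr a) * cis (a * Arg s)"
  using assms by (simp add: powr_def Ln_Arg exp_add ring_distribs cis_conv_exp mult_ac flip: exp_of_real)

lemma norm_cpowr_real: "s \<noteq> 0 \<Longrightarrow> norm (s powr complex_of_real a) = norm s powr a"
  by (simp add: cpowr_eq_norm_cis norm_mult)

text \<open>Rotating by half the argument \<open>\<psi>\<close> of \<open>s powr a\<close> turns both summands to an angle of at most \<open>\<bar>\<psi>\<bar> / 2 < pi / 2\<close>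
from the positive axis, so that their real parts add up without cancellation.\<close>

lemma norm_cpowr_add_ge:
  assumes "s \<noteq> 0" "0 \<le> x" "0 \<le> a" "\<bar>Arg s\<bar> \<le> \<theta>" "a * \<theta> \<le> pi"
  shows "cos (a * \<theta> / 2) * (norm s powr a + x) \<le> norm (s powr complex_of_real a + of_real x)"
proof -
  define \<psi> where "\<psi> = a * Arg s"
  have 1: "\<bar>\<psi>\<bar> \<le> a * \<theta>" using assms by (simp add: \<psi>_def abs_mult mult_left_mono)
  have "cos (a * \<theta> / 2) \<le> cos (\<bar>\<psi>\<bar> / 2)"
    by (rule cos_monotone_0_pi_le) (use 1 assms pi_gt_zero in linarith)+
  then have "cos (a * \<theta> / 2) \<le> cos (\<psi> / 2)" by (cases "\<psi> \<ge> 0") auto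
  then have "cos (a * \<theta> / 2) * (norm s powr a + x) \<le> cos (\<psi> / 2) * (norm s powr a + x)"
    by (rule mult_right_mono) (use assms in auto)
  also have "\<dots> = Re ((s powr complex_of_real a + of_real x) * cis (- \<psi> / 2))"
    using assms by (simp add: cpowr_eq_norm_cis \<psi>_def[symmetric] ring_distribs mult.assoc cis_mult)
  also have "\<dots> \<le> norm ((s powr complex_of_real a + of_real x) * cis (- \<psi> / 2))"
    by (rule complex_Re_le_cmod)
  finally show ?thesis by (simp add: norm_mult)
qed

text \<open>For \<open>pi / 2 < \<omega> < pi\<close> this is a convex domain containing the positive axis and the rays used below, on which
arguments stay below \<open>\<omega>\<close> in absolute value. Working in a convex domain replaces contour deformation by
the existence of primitives.\<close>

definition half_plane :: "real \<Rightarrow> complex set" where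
  "half_plane \<omega> = {s. Im (s * cis (- \<omega>)) < 0}"

lemma open_half_plane: "open (half_plane \<omega>)"
  unfolding half_plane_def by (intro open_Collect_less continuous_intros)

lemma convex_half_plane: "convex (half_plane \<omega>)"
proof (rule convexI)
  fix x y and u v :: real
  assume *: "x \<in> half_plane \<omega>" "y \<in> half_plane \<omega>" "0 \<le> u" "0 \<le> v" "u + v = 1"
  have "Im ((u *\<^sub>R x + v *\<^sub>R y) * cis (- \<omega>)) = u * Im (x * cis (- \<omega>)) + v * Im (y * cis (- \<omega>))"
    by (simp add: algebra_simps)
  also have "\<dots> < 0"
  proof (cases "u = 0")
    case True then show ?thesis using * by (simp add: half_plane_def)
  next
    case False
    then have "u * Im (x * cis (- \<omega>)) < 0"
      using * by (simp add: half_plane_def mult_pos_neg)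
    moreover have "v * Im (y * cis (- \<omega>)) \<le> 0"
      using * by (simp add: half_plane_def mult_nonneg_nonpos)
    ultimately show ?thesis by linarith
  qed
  finally show "u *\<^sub>R x + v *\<^sub>R y \<in> half_plane \<omega>" by (simp add: half_plane_def)
qed

lemma half_plane_Arg:
  assumes "s \<in> half_plane \<omega>" "pi / 2 < \<omega>" "\<omega> < pi"
  shows "s \<noteq> 0" "\<bar>Arg s\<bar> < \<omega>" "s \<notin> \<real>\<^sub>\<le>\<^sub>0"
proof -
  show s: "s \<noteq> 0" using assms by (auto simp: half_plane_def)
  have "s = of_real (norm s) * cis (Arg s)"
    using rcis_cmod_Arg[of s] by (simp add: rcis_def)
  then have "Im (s * cis (- \<omega>)) = Im (of_real (norm s) * cis (Arg s) * cis (- \<omega>))" by simp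
  also have "\<dots> = norm s * sin (Arg s - \<omega>)" by (simp add: mult.assoc cis_mult)
  finally have neg: "sin (Arg s - \<omega>) < 0"
    using assms(1) by (metis (mono_tags) half_plane_def mem_Collect_eq mult_nonneg_nonneg norm_ge_zero not_le)
  have A: "- pi < Arg s" "Arg s \<le> pi" using Arg_bounded by auto
  have 1: "Arg s < \<omega>"
    using neg sin_ge_zero[of "Arg s - \<omega>"] assms A by fastforce
  have 2: "Arg s > \<omega> - pi"
  proof (rule ccontr)
    assume "\<not> ?thesis"
    then have "sin (Arg s - \<omega> + 2 * pi) \<ge> 0"
      using assms A by (intro sin_ge_zero) linarith+
    then show False using neg by (simp add: sin_add)
  qed
  show "\<bar>Arg s\<bar> < \<omega>" using 1 2 assms by linarith
  have "Arg s \<noteq> pi" using 1 assms by linarith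
  then show "s \<notin> \<real>\<^sub>\<le>\<^sub>0" using s by (metis Arg_eq_pi complex_nonpos_Reals_iff complex_eq_iff less_eq_real_def zero_complex.simps)
qed

text \<open>The contour is the broken line through \<open>v > 0\<close> with directions \<open>cis \<theta>\<close> and \<open>cis (- \<theta>)\<close>. All
  integrands take conjugate values at conjugate points, so the lower half contributes the conjugate
  of the upper half and only the upper ray appears: the integral over the whole contour is
  \<open>2 \<i>\<close> times the imaginary part of the one over the ray.\<close>

definition ray :: "real \<Rightarrow> real \<Rightarrow> real \<Rightarrow> complex" where
  "ray \<theta> v r = of_real v + of_real r * cis \<theta>"

definition ray_integral :: "real \<Rightarrow> (complex \<Rightarrow> complex) \<Rightarrow> real \<Rightarrow> complex" where
  "ray_integral \<theta> G v = integral {0<..} (\<lambda>r. G (ray \<theta> v r) * cis \<theta>)"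

lemma Re_ray [simp]: "Re (ray \<theta> v r) = v + r * cos \<theta>"
  and Im_ray [simp]: "Im (ray \<theta> v r) = r * sin \<theta>"
  and ray_0 [simp]: "ray \<theta> v 0 = of_real v"
  by (simp_all add: ray_def)

lemma ray_in_half_plane:
  assumes "0 < v" "0 \<le> r" "0 < \<theta>" "\<theta> \<le> \<omega>" "\<omega> < pi"
  shows "ray \<theta> v r \<in> half_plane \<omega>"
proof -
  have "Im (ray \<theta> v r * cis (- \<omega>)) = - v * sin \<omega> - r * sin (\<omega> - \<theta>)"
    by (simp add: ray_def sin_diff algebra_simps)
  moreover have "v * sin \<omega> > 0" using assms by (intro mult_pos_pos sin_gt_zero) auto
  moreover have "r * sin (\<omega> - \<theta>) \<ge> 0" using assms by (intro mult_nonneg_nonneg sin_ge_zero) auto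
  ultimately show ?thesis by (simp add: half_plane_def)
qed

lemma ray_norm_bounds:
  assumes "0 < v" "0 \<le> r" "0 < \<theta>" "\<theta> < pi"
  shows "v * sin \<theta> \<le> norm (ray \<theta> v r)" "r * sin \<theta> \<le> norm (ray \<theta> v r)" "norm (ray \<theta> v r) \<le> v + r"
proof -
  have "Im (ray \<theta> v r * cis (- \<theta>)) = - v * sin \<theta>"
    by (simp add: ray_def algebra_simps)
  then have "v * sin \<theta> \<le> \<bar>Im (ray \<theta> v r * cis (- \<theta>))\<bar>" by simp
  also have "\<dots> \<le> norm (ray \<theta> v r)" using abs_Im_le_cmod[of "ray \<theta> v r * cis (- \<theta>)"] by (simp add: norm_mult)
  finally show "v * sin \<theta> \<le> norm (ray \<theta> v r)" .
  show "r * sin \<theta> \<le> norm (ray \<theta> v r)" using abs_Im_le_cmod[of "ray \<theta> v r"] by simp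
  show "norm (ray \<theta> v r) \<le> v + r"
    unfolding ray_def using norm_triangle_ineq[of "of_real v" "of_real r * cis \<theta>"] assms
    by (simp add: norm_mult)
qed

lemma exp_decay_integrable:
  assumes "\<eta> > (0::real)"
  shows "(\<lambda>r. C * exp (- \<eta> * r)) integrable_on {0<..}"
proof -
  have "(\<lambda>r. exp (- \<eta> * r)) integrable_on {0..}"
    using integrable_on_exp_minus_to_infinity[OF assms] by simp
  then have "(\<lambda>r. exp (- \<eta> * r)) integrable_on {0<..}"
    by (rule integrable_spike_set) (auto intro: negligible_subset[of "{0}"])
  then show ?thesis by (rule integrable_on_mult_right)
qed

lemma exp_decay_integral:
  assumes "\<eta> > (0::real)"
  shows "integral {0<..} (\<lambda>r. C * exp (- \<eta> * r)) = C / \<eta>"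
proof -
  have "((\<lambda>r. exp (- \<eta> * r)) has_integral (1 / \<eta>)) {0..}"
    using has_integral_exp_minus_to_infinity[OF assms, of 0] by simp
  then have "((\<lambda>r. exp (- \<eta> * r)) has_integral (1 / \<eta>)) {0<..}"
    by (subst has_integral_spike_set_eq[of _ "{0..}"]) (auto intro: negligible_subset[of "{0}"])
  then have "((\<lambda>r. C * exp (- \<eta> * r)) has_integral (C * (1 / \<eta>))) {0<..}"
    by (rule has_integral_mult_right)
  then show ?thesis by (metis integral_unique mult.right_neutral times_divide_eq_right)
qed

lemma ray_has_vector_derivative:
  assumes "(P has_field_derivative d) (at (ray \<theta> v r))"
  shows "((\<lambda>r. P (ray \<theta> v r)) has_vector_derivative d * cis \<theta>) (at r)"
proof -
  have "(ray \<theta> v has_vector_derivative cis \<theta>) (at r)"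
    unfolding ray_def by (auto intro!: derivative_eq_intros simp: has_vector_derivative_def scaleR_conv_of_real)
  from field_vector_diff_chain_at[OF this, of P d] assms show ?thesis by (simp add: o_def mult.commute)
qed

lemma ray_integral_props:
  assumes \<theta>: "0 < \<theta>" "\<theta> \<le> \<omega>" "\<omega> < pi" and \<eta>: "\<eta> > 0" and v: "0 < v"
    and hol: "G holomorphic_on half_plane \<omega>"
    and bd: "\<And>r. r > 0 \<Longrightarrow> norm (G (ray \<theta> v r)) \<le> C * exp (- \<eta> * r)"
  shows "(\<lambda>r. G (ray \<theta> v r) * cis \<theta>) integrable_on {0<..}"
    and "norm (ray_integral \<theta> G v) \<le> C / \<eta>"
    and "\<And>P. (\<And>s. s \<in> half_plane \<omega> \<Longrightarrow> (P has_field_derivative G s) (at s)) \<Longrightarrow>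
        (\<lambda>n. P (ray \<theta> v (real (Suc n)))) \<longlonglongrightarrow> ray_integral \<theta> G v + P (of_real v)"
proof -
  have in_H: "ray \<theta> v r \<in> half_plane \<omega>" if "r \<ge> 0" for r
    using that assms by (intro ray_in_half_plane) auto
  obtain P0 where P0: "\<And>s. s \<in> half_plane \<omega> \<Longrightarrow> (P0 has_field_derivative G s) (at s)"
    using holomorphic_convex_primitive'[OF convex_half_plane open_half_plane hol]
    at_within_open[OF _ open_half_plane] by metis
  have nb: "norm (G (ray \<theta> v r) * cis \<theta>) \<le> C * exp (- \<eta> * r)" if "r > 0" for r
    using bd[OF that] by (simp add: norm_mult)
  note F = halfline_fundamental_theorem[where f = "\<lambda>r. G (ray \<theta> v r) * cis \<theta>"
      and h = "\<lambda>r. C * exp (- \<eta> * r)", OF _ exp_decay_integrable[OF \<eta>] nb]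
  show int: "(\<lambda>r. G (ray \<theta> v r) * cis \<theta>) integrable_on {0<..}"
    by (rule F(1)[where F = "\<lambda>r. P0 (ray \<theta> v r)"]) (auto intro!: ray_has_vector_derivative P0 in_H)
  show "norm (ray_integral \<theta> G v) \<le> C / \<eta>"
    unfolding ray_integral_def exp_decay_integral[OF \<eta>, symmetric]
    by (rule integral_norm_bound_integral[OF int exp_decay_integrable[OF \<eta>]]) (use nb in auto)
  fix P assume P: "\<And>s. s \<in> half_plane \<omega> \<Longrightarrow> (P has_field_derivative G s) (at s)"
  have *: "(\<lambda>n. P (ray \<theta> v (real (Suc n))) - P (ray \<theta> v (1 / real (Suc n)))) \<longlonglongrightarrow> ray_integral \<theta> G v"
    unfolding ray_integral_def
    by (rule F(2)[where F = "\<lambda>r. P (ray \<theta> v r)"]) (auto intro!: ray_has_vector_derivative P in_H)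
  have "isCont (\<lambda>r. P (ray \<theta> v r)) 0"
    by (rule has_vector_derivative_continuous[OF ray_has_vector_derivative[OF P[OF in_H]]]) simp
  moreover have "(\<lambda>n. 1 / real (Suc n)) \<longlonglongrightarrow> 0" using LIMSEQ_inverse_real_of_nat by (simp add: inverse_eq_divide)
  ultimately have "(\<lambda>n. P (ray \<theta> v (1 / real (Suc n)))) \<longlonglongrightarrow> P (of_real v)"
    using isCont_tendsto_compose[of 0 "\<lambda>r. P (ray \<theta> v r)"] by fastforce
  from tendsto_add[OF * this] show "(\<lambda>n. P (ray \<theta> v (real (Suc n)))) \<longlonglongrightarrow> ray_integral \<theta> G v + P (of_real v)"
    by simp
qed

text \<open>Two rays with the same direction differ by the segment \<open>[v1, v2]\<close> of the real axis, over which the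
integral of \<open>G\<close> is real, and by a horizontal segment near infinity, where \<open>G\<close> is exponentially
small.\<close>

lemma ray_integral_shift:
  assumes \<theta>: "0 < \<theta>" "\<theta> \<le> \<omega>" "\<omega> < pi" and \<eta>: "\<eta> > 0" and v: "0 < v1" "v1 \<le> v2"
    and hol: "G holomorphic_on half_plane \<omega>"
    and real: "\<And>x. x > 0 \<Longrightarrow> Im (G (of_real x)) = 0"
    and bd: "\<And>v r. v1 \<le> v \<Longrightarrow> v \<le> v2 \<Longrightarrow> r > 0 \<Longrightarrow> norm (G (ray \<theta> v r)) \<le> C * exp (- \<eta> * r)"
  shows "Im (ray_integral \<theta> G v1) = Im (ray_integral \<theta> G v2)"
proof -
  obtain P where P: "\<And>s. s \<in> half_plane \<omega> \<Longrightarrow> (P has_field_derivative G s) (at s)"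
    using holomorphic_convex_primitive'[OF convex_half_plane open_half_plane hol]
    at_within_open[OF _ open_half_plane] by metis
  have lim: "(\<lambda>n. P (ray \<theta> v (real (Suc n)))) \<longlonglongrightarrow> ray_integral \<theta> G v + P (of_real v)"
    if "v1 \<le> v" "v \<le> v2" for v
    by (rule ray_integral_props(3)[OF \<theta> \<eta> _ hol bd P]) (use that v in auto)
  have "(\<lambda>n. P (ray \<theta> v2 (real (Suc n))) - P (ray \<theta> v1 (real (Suc n)))) \<longlonglongrightarrow> 0"
  proof (rule Lim_null_comparison[OF eventuallyI])
    fix n
    define R where "R = real (Suc n)"
    have seg: "\<exists>v. v1 \<le> v \<and> v \<le> v2 \<and> s = ray \<theta> v R"
      if s: "s \<in> closed_segment (ray \<theta> v1 R) (ray \<theta> v2 R)" for s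
    proof -
      obtain u where u: "0 \<le> u" "u \<le> 1" "s = (1 - u) *\<^sub>R ray \<theta> v1 R + u *\<^sub>R ray \<theta> v2 R"
        using s unfolding closed_segment_def by blast
      have "s = ray \<theta> ((1 - u) * v1 + u * v2) R" unfolding u(3) ray_def by (simp add: scaleR_conv_of_real algebra_simps)
      moreover have "v1 \<le> (1 - u) * v1 + u * v2" "(1 - u) * v1 + u * v2 \<le> v2"
        using u v mult_left_mono[of v1 v2 u] mult_left_mono[of v1 v2 "1 - u"] by (auto simp: algebra_simps)
      ultimately show ?thesis by blast
    qed
    have "norm (P (ray \<theta> v2 R) - P (ray \<theta> v1 R)) \<le> C * exp (- \<eta> * R) * norm (ray \<theta> v2 R - ray \<theta> v1 R)"
    proof (rule field_differentiable_bound[where S = "closed_segment (ray \<theta> v1 R) (ray \<theta> v2 R)" and f' = G])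
      fix s assume "s \<in> closed_segment (ray \<theta> v1 R) (ray \<theta> v2 R)"
      then obtain v' where v': "v1 \<le> v'" "v' \<le> v2" "s = ray \<theta> v' R" using seg by blast
      have "s \<in> half_plane \<omega>" using v' v \<theta> by (auto intro!: ray_in_half_plane simp: R_def)
      then show "(P has_field_derivative G s) (at s within closed_segment (ray \<theta> v1 R) (ray \<theta> v2 R))"
        using P by (blast intro: has_field_derivative_at_within)
      show "norm (G s) \<le> C * exp (- \<eta> * R)" using bd[of v' R] v' by (simp add: R_def)
    qed auto
    also have "norm (ray \<theta> v2 R - ray \<theta> v1 R) = v2 - v1"
      using v by (simp add: ray_def flip: of_real_diff)
    finally show "norm (P (ray \<theta> v2 (real (Suc n))) - P (ray \<theta> v1 (real (Suc n)))) \<le> C * exp (- \<eta> * real (Suc n)) * (v2 - v1)"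
      by (simp add: R_def)
  next
    have "(\<lambda>n. C * exp (- \<eta> * real (Suc n)) * (v2 - v1)) \<longlonglongrightarrow> C * 0 * (v2 - v1)"
    proof (intro tendsto_intros)
      have "filterlim (\<lambda>n. real (Suc n)) at_top sequentially"
        by (rule filterlim_compose[OF filterlim_real_sequentially filterlim_Suc])
      then have "filterlim (\<lambda>n. \<eta> * real (Suc n)) at_top sequentially"
        by (rule filterlim_tendsto_pos_mult_at_top[OF tendsto_const \<eta>])
      then have "filterlim (\<lambda>n. - (\<eta> * real (Suc n))) at_bot sequentially"
        by (simp add: filterlim_uminus_at_bot)
      then have "filterlim (\<lambda>n. - \<eta> * real (Suc n)) at_bot sequentially" by simp
      then show "(\<lambda>n. exp (- \<eta> * real (Suc n))) \<longlonglongrightarrow> 0"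
        by (rule filterlim_compose[OF exp_at_bot])
    qed
    then show "(\<lambda>n. C * exp (- \<eta> * real (Suc n)) * (v2 - v1)) \<longlonglongrightarrow> 0" by simp
  qed
  moreover have "(\<lambda>n. P (ray \<theta> v2 (real (Suc n))) - P (ray \<theta> v1 (real (Suc n)))) \<longlonglongrightarrow>
      (ray_integral \<theta> G v2 + P (of_real v2)) - (ray_integral \<theta> G v1 + P (of_real v1))"
    by (intro tendsto_diff lim) (use v in auto)
  ultimately have *: "(ray_integral \<theta> G v2 + P (of_real v2)) - (ray_integral \<theta> G v1 + P (of_real v1)) = 0"
    using LIMSEQ_unique by blast
  have "\<exists>c. \<forall>x\<in>{0<..}. Im (P (of_real x)) = c"
  proof (rule has_field_derivative_zero_constant)
    fix x :: real assume x: "x \<in> {0<..}"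
    then have "of_real x \<in> half_plane \<omega>" using ray_in_half_plane[of x 0 \<theta> \<omega>] \<theta> by simp
    moreover have "(complex_of_real has_vector_derivative 1) (at x)"
      by (auto intro!: derivative_eq_intros simp: has_vector_derivative_def scaleR_conv_of_real)
    ultimately have "((\<lambda>x. P (of_real x)) has_vector_derivative G (of_real x)) (at x)"
      using field_vector_diff_chain_at[of of_real 1 x P "G (of_real x)"] P
      by (simp add: o_def)
    then have "((\<lambda>x. Im (P (of_real x))) has_vector_derivative Im (G (of_real x))) (at x)"
      by (rule bounded_linear.has_vector_derivative[OF bounded_linear_Im])
    then show "((\<lambda>x. Im (P (of_real x))) has_field_derivative 0) (at x within {0<..})"
      using real x by (simp add: has_real_derivative_iff_has_vector_derivative has_vector_derivative_at_within)
  qed simp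
  then have "Im (P (of_real v2)) = Im (P (of_real v1))" using v by auto
  with * show ?thesis by (metis add_diff_cancel_right' diff_add_cancel minus_complex.simps(2) plus_complex.simps(2)
    add.commute eq_iff_diff_eq_0 zero_complex.simps(2) add_left_imp_eq)
qed

text \<open>Euler's integral may be taken along any ray in the right half plane. The chords joining two such rays at
radius \<open>R\<close> have length of order \<open>R\<close>, which \<open>R powr (w - 1) exp (- R cos \<phi>)\<close> compensates both for
\<open>R\<close> tending to infinity and, since \<open>w > 0\<close>, for \<open>R\<close> tending to \<open>0\<close>.\<close>

lemma rotated_Gamma_integral:
  assumes w: "0 < w" "w < 1" and \<phi>: "\<bar>\<phi>\<bar> < pi / 2"
  defines "f \<equiv> \<lambda>\<phi> r. (of_real r * cis \<phi>) powr of_real (w - 1) * exp (- (of_real r * cis \<phi>)) * cis \<phi>"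
  shows "integral {0<..} (f \<phi>) = of_real (Gamma w)"
proof -
  define G where "G s = s powr of_real (w - 1) * exp (- s)" for s :: complex
  define S where "S = {s. 0 < Re s}"
  have S: "open S" "convex S" unfolding S_def
    by (auto intro: open_halfspace_Re_gt convex_halfspace_Re_gt)
  have nR: "s \<notin> \<real>\<^sub>\<le>\<^sub>0" if "s \<in> S" for s
    using that by (auto simp: S_def complex_nonpos_Reals_iff)
  have "G holomorphic_on S" unfolding G_def
    by (intro holomorphic_intros) (use nR in auto)
  then obtain Q where Q: "\<And>s. s \<in> S \<Longrightarrow> (Q has_field_derivative G s) (at s)"
    using holomorphic_convex_primitive'[OF S(2) S(1)] at_within_open[OF _ S(1)] by metis
  have nG: "norm (G s) = norm s powr (w - 1) * exp (- Re s)" if "s \<noteq> 0" for s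
    using that by (simp add: G_def norm_mult norm_cpowr_real norm_exp_eq_Re del: of_real_diff)
  have inS: "of_real r * cis \<psi> \<in> S" if "r > 0" "\<bar>\<psi>\<bar> < pi / 2" for r \<psi>
    using that cos_gt_zero_pi[of \<psi>] by (auto simp: S_def)
  have lim: "f \<psi> integrable_on {0<..} \<and> (\<lambda>n. Q (of_real (real (Suc n)) * cis \<psi>) - Q (of_real (1 / real (Suc n)) * cis \<psi>))
     \<longlonglongrightarrow> integral {0<..} (f \<psi>)" if \<psi>: "\<bar>\<psi>\<bar> < pi / 2" for \<psi>
  proof -
    have c: "cos \<psi> > 0" using \<psi> cos_gt_zero_pi by auto
    have "((\<lambda>r. Q (of_real r * cis \<psi>)) has_vector_derivative f \<psi> r) (at r)" if "r > 0" for r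
    proof -
      have "((\<lambda>r. of_real r * cis \<psi>) has_vector_derivative cis \<psi>) (at r)"
        by (auto intro!: derivative_eq_intros simp: has_vector_derivative_def scaleR_conv_of_real)
      from field_vector_diff_chain_at[OF this Q[OF inS[OF that \<psi>]]]
      show ?thesis by (simp add: o_def mult_ac f_def G_def)
    qed
    moreover have "(\<lambda>r. norm (complex_of_real r powr (of_real w - 1) / of_real (exp (cos \<psi> * r)))) integrable_on {0<..}"
      using absolutely_integrable_Gamma_integral[of "of_real w" "cos \<psi>"] w c
      by (simp add: absolutely_integrable_on_def)
    moreover have "norm (f \<psi> r) \<le> norm (complex_of_real r powr (of_real w - 1) / of_real (exp (cos \<psi> * r)))" if "r > 0" for r
      using that nG[of "of_real r * cis \<psi>"] norm_cpowr_real[of "of_real r" "w - 1"]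
      by (simp add: f_def G_def norm_mult norm_divide exp_minus field_simps)
    ultimately show ?thesis
      using halfline_fundamental_theorem[of "\<lambda>r. Q (of_real r * cis \<psi>)" "f \<psi>"] by blast
  qed
  have c: "0 < cos \<phi>" "cos \<phi> \<le> 1" using \<phi> cos_gt_zero_pi by auto
  define B where "B R = (R * cos \<phi>) powr (w - 1) * exp (- (R * cos \<phi>)) * (2 * R)" for R
  have chord: "norm (Q (of_real R * cis \<phi>) - Q (of_real R * cis 0)) \<le> B R" if "R > 0" for R
  proof -
    have "norm (Q (of_real R * cis \<phi>) - Q (of_real R * cis 0)) \<le>
      ((R * cos \<phi>) powr (w - 1) * exp (- (R * cos \<phi>))) * norm (of_real R * cis \<phi> - of_real R * cis 0)"
    proof (rule field_differentiable_bound[where S = "closed_segment (of_real R * cis 0) (of_real R * cis \<phi>)" and f' = G])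
      fix s assume "s \<in> closed_segment (of_real R * cis 0) (of_real R * cis \<phi>)"
      then obtain u where u: "0 \<le> u" "u \<le> 1" "s = (1 - u) *\<^sub>R (of_real R * cis 0) + u *\<^sub>R (of_real R * cis \<phi>)"
        by (auto simp: closed_segment_def)
      have "Re s = R * ((1 - u) + u * cos \<phi>)" unfolding u(3) by (simp add: algebra_simps)
      moreover have "cos \<phi> \<le> (1 - u) + u * cos \<phi>" using u c mult_left_mono[of "cos \<phi>" 1 "1 - u"] by (simp add: algebra_simps)
      ultimately have Re: "R * cos \<phi> \<le> Re s" using that by simp
      moreover have "R * cos \<phi> > 0" using that c by simp
      ultimately have s: "s \<in> S" "s \<noteq> 0" "R * cos \<phi> \<le> norm s"
        using complex_Re_le_cmod[of s] by (auto simp: S_def)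
      show "(Q has_field_derivative G s) (at s within closed_segment (of_real R * cis 0) (of_real R * cis \<phi>))"
        using Q[OF s(1)] by (rule has_field_derivative_at_within)
      have "norm s powr (w - 1) \<le> (R * cos \<phi>) powr (w - 1)"
        using s w \<open>R * cos \<phi> > 0\<close> by (intro powr_mono2') auto
      then show "norm (G s) \<le> (R * cos \<phi>) powr (w - 1) * exp (- (R * cos \<phi>))"
        using Re by (simp add: nG[OF s(2)] mult_mono)
    qed auto
    also have "norm (of_real R * cis \<phi> - of_real R * cis 0) \<le> 2 * R"
      using norm_triangle_ineq4[of "of_real R * cis \<phi>" "of_real R * cis 0"] that by (simp add: norm_mult)
    finally show ?thesis by (simp add: B_def mult_left_mono)
  qed
  have B1: "(\<lambda>n. B (real (Suc n))) \<longlonglongrightarrow> 0" and B2: "(\<lambda>n. B (1 / real (Suc n))) \<longlonglongrightarrow> 0"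
    unfolding B_def using w c by real_asymp+
  have "(\<lambda>n. Q (of_real (real (Suc n)) * cis \<phi>) - Q (of_real (real (Suc n)) * cis 0)) \<longlonglongrightarrow> 0"
    by (rule Lim_null_comparison[OF eventuallyI B1], rule chord) simp
  moreover have "(\<lambda>n. Q (of_real (1 / real (Suc n)) * cis \<phi>) - Q (of_real (1 / real (Suc n)) * cis 0)) \<longlonglongrightarrow> 0"
    by (rule Lim_null_comparison[OF eventuallyI B2], rule chord) simp
  moreover note conjunct2[OF lim[OF \<phi>]] conjunct2[OF lim[of 0]]
  ultimately have "(\<lambda>n. (Q (of_real (real (Suc n)) * cis \<phi>) - Q (of_real (real (Suc n)) * cis 0))
     - (Q (of_real (1 / real (Suc n)) * cis \<phi>) - Q (of_real (1 / real (Suc n)) * cis 0))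
     - ((Q (of_real (real (Suc n)) * cis \<phi>) - Q (of_real (1 / real (Suc n)) * cis \<phi>))
     - (Q (of_real (real (Suc n)) * cis 0) - Q (of_real (1 / real (Suc n)) * cis 0))))
     \<longlonglongrightarrow> 0 - 0 - (integral {0<..} (f \<phi>) - integral {0<..} (f 0))"
    by (intro tendsto_diff) auto
  then have "integral {0<..} (f \<phi>) = integral {0<..} (f 0)"
    by (simp add: LIMSEQ_const_iff)
  also have "\<dots> = integral {0<..} (\<lambda>t. of_real t powr (of_real w - 1) / of_real (exp t))"
    by (intro integral_cong) (simp add: f_def exp_minus field_simps exp_of_real)
  also have "\<dots> = Gamma (of_real w)"
    using Gamma_integral_complex'[of "of_real w"] w by (simp add: integral_unique)
  finally show ?thesis by (simp add: Gamma_complex_of_real)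
qed

text \<open>The first bound on \<open>\<theta>\<close> makes \<open>exp\<close> decay along the rays; the second one keeps \<open>s powr \<alpha>\<close> away from the
negative axis, so that \<open>s powr \<alpha> + x\<close> is comparable to \<open>norm s powr \<alpha> + x\<close> for \<open>x \<ge> 0\<close>.\<close>

locale ml_contour =
  fixes \<alpha> \<theta> :: real
  assumes alpha: "1 < \<alpha>" "\<alpha> < 2" and theta: "pi / 2 < \<theta>" "\<theta> < pi / \<alpha>"
begin

definition \<eta> where "\<eta> = - cos \<theta>"
definition c where "c = cos (\<alpha> * \<theta> / 2)"
definition \<omega> where "\<omega> = pi / \<alpha>"

text \<open>The Laplace transform of \<open>t powr (\<beta> - 1) E\<^bsub>\<alpha>,\<beta>\<^esub>(- x t powr \<alpha>)\<close> is \<open>s powr (\<alpha> - \<beta>) / (s powr \<alpha> + x)\<close>, so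
integrating \<open>K \<beta> x\<close> over the contour and dividing by \<open>2 pi \<i>\<close> is Laplace inversion at time \<open>1\<close>. In terms of the
ray integral \<open>A \<beta> x v\<close> defined below, the result is \<open>Im (A \<beta> x v) / pi\<close>.\<close>

definition K :: "real \<Rightarrow> real \<Rightarrow> complex \<Rightarrow> complex" where
  "K \<beta> x s = s powr of_real (\<alpha> - \<beta>) * exp s / (s powr of_real \<alpha> + of_real x)"

lemma angles: "0 < \<theta>" "\<theta> \<le> \<omega>" "\<omega> < pi" "\<theta> < pi" "pi / 2 < \<omega>" "\<theta> < \<omega>"
proof -
  show "\<omega> < pi" using alpha pi_gt_zero by (simp add: \<omega>_def divide_less_eq)
  moreover show "0 < \<theta>" using theta pi_gt_zero by linarith
  moreover show "\<theta> < \<omega>" "\<theta> \<le> \<omega>" using theta by (auto simp: \<omega>_def)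
  ultimately show "\<theta> < pi" "pi / 2 < \<omega>" using theta by linarith+
qed

lemma eta: "\<eta> > 0"
proof -
  have "cos \<theta> < cos (pi / 2)" using theta angles by (intro cos_monotone_0_pi) auto
  then show ?thesis by (simp add: \<eta>_def)
qed

lemma eta_le: "\<eta> \<le> 1" unfolding \<eta>_def using cos_ge_minus_one[of \<theta>] by linarith

lemma sin_theta: "0 < sin \<theta>" "sin \<theta> \<le> 1"
  using angles by (auto intro: sin_gt_zero)

lemma alpha_theta: "\<alpha> * \<theta> < pi"
  using theta alpha by (simp add: field_simps)

lemma c_pos: "c > 0"
  unfolding c_def using alpha_theta alpha angles mult_pos_pos[of \<alpha> \<theta>]
  by (intro cos_gt_zero) linarith+

lemma alpha_omega: "\<alpha> * \<omega> = pi" using alpha by (simp add: \<omega>_def)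

lemma denominator_nonzero:
  assumes "s \<in> half_plane \<omega>" "0 \<le> x"
  shows "s powr of_real \<alpha> + of_real x \<noteq> 0"
proof -
  have s: "s \<noteq> 0" "\<bar>Arg s\<bar> < \<omega>" using half_plane_Arg[OF assms(1)] angles by auto
  then have "\<alpha> * \<bar>Arg s\<bar> < pi" using alpha_omega alpha by (metis less_trans mult_less_cancel_left_pos zero_less_one)
  moreover have "0 \<le> \<alpha> * \<bar>Arg s\<bar>" using alpha by simp
  ultimately have "cos (\<alpha> * \<bar>Arg s\<bar> / 2) > 0" by (intro cos_gt_zero_pi) linarith+
  moreover have "norm s powr \<alpha> + x > 0" using s assms by (simp add: add_pos_nonneg)
  ultimately have "0 < norm (s powr of_real \<alpha> + of_real x)"
    using norm_cpowr_add_ge[of s x \<alpha> "\<bar>Arg s\<bar>"] s assms alpha \<open>\<alpha> * \<bar>Arg s\<bar> < pi\<close>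
    by (smt (verit) mult_pos_pos)
  then show ?thesis by auto
qed

lemma K_holomorphic: "0 \<le> x \<Longrightarrow> K \<beta> x holomorphic_on half_plane \<omega>"
  unfolding K_def using denominator_nonzero half_plane_Arg(3) angles
  by (intro holomorphic_intros) auto

lemma K_real: "x > 0 \<Longrightarrow> Im (K \<beta> y (of_real x)) = 0"
  by (simp add: K_def powr_of_real exp_of_real flip: of_real_add of_real_mult of_real_divide of_real_diff)

lemma K_zero: "s \<noteq> 0 \<Longrightarrow> K \<beta> 0 s = s powr of_real (- \<beta>) * exp s"
  by (simp add: K_def powr_diff powr_minus field_simps)

lemma K_shift:
  assumes "s \<in> half_plane \<omega>" "0 \<le> x"
  shows "K \<beta> x s = K \<beta> 0 s - of_real x * K (\<beta> + \<alpha>) x s"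
proof -
  have s: "s \<noteq> 0" using half_plane_Arg[OF assms(1)] angles by auto
  have 1: "K \<beta> x s = s powr of_real (- \<beta>) * exp s * s powr of_real \<alpha> / (s powr of_real \<alpha> + of_real x)"
    using s by (simp add: K_def powr_diff powr_minus field_simps)
  have 2: "K (\<beta> + \<alpha>) x s = s powr of_real (- \<beta>) * exp s / (s powr of_real \<alpha> + of_real x)"
    by (simp add: K_def)
  show ?thesis using denominator_nonzero[OF assms] unfolding 1 2 K_zero[OF s]
    by (simp add: divide_simps) (simp add: algebra_simps)
qed

lemma ray_nonzero: "v > 0 \<Longrightarrow> r \<ge> 0 \<Longrightarrow> ray \<theta> v r \<noteq> 0"
  using ray_norm_bounds(1)[of v r \<theta>] sin_theta(1) angles(1,4) mult_pos_pos[of v "sin \<theta>"]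
  by (metis less_le_trans less_irrefl norm_zero)

lemma K_ray_bound:
  assumes "v > 0" "r \<ge> 0" "0 \<le> x"
  shows "norm (K \<beta> x (ray \<theta> v r)) \<le>
    norm (ray \<theta> v r) powr (\<alpha> - \<beta>) * exp (v - \<eta> * r) / (c * (norm (ray \<theta> v r) powr \<alpha> + x))"
proof -
  have s: "ray \<theta> v r \<noteq> 0" by (rule ray_nonzero) fact+
  have "\<bar>Arg (ray \<theta> v r)\<bar> < \<theta>"
    by (rule half_plane_Arg(2)[OF ray_in_half_plane]) (use assms angles theta in auto)
  then have "c * (norm (ray \<theta> v r) powr \<alpha> + x) \<le> norm (ray \<theta> v r powr of_real \<alpha> + of_real x)"
    unfolding c_def using s assms alpha alpha_theta by (intro norm_cpowr_add_ge) auto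
  moreover have "c * (norm (ray \<theta> v r) powr \<alpha> + x) > 0"
    using c_pos s assms by (simp add: add_pos_nonneg)
  ultimately show ?thesis
    using s by (simp add: K_def norm_mult norm_divide norm_cpowr_real \<eta>_def mult.commute del: of_real_diff)
      (auto intro!: divide_left_mono mult_pos_pos simp: mult.commute)
qed

lemma K_ray_bound_uniform:
  assumes "v > 0" "r \<ge> 0" "0 \<le> x" "0 \<le> \<beta>"
  shows "norm (K \<beta> x (ray \<theta> v r)) \<le> (v * sin \<theta>) powr (- \<beta>) * exp v / c * exp (- \<eta> * r)"
proof -
  define n where "n = norm (ray \<theta> v r)"
  have n: "0 < n" "v * sin \<theta> \<le> n" using ray_nonzero[of v r] assms ray_norm_bounds[of v r \<theta>] angles by (auto simp: n_def)
  have "norm (K \<beta> x (ray \<theta> v r)) \<le> n powr (\<alpha> - \<beta>) * exp (v - \<eta> * r) / (c * (n powr \<alpha> + x))"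
    unfolding n_def by (rule K_ray_bound) fact+
  also have "\<dots> \<le> n powr (\<alpha> - \<beta>) * exp (v - \<eta> * r) / (c * n powr \<alpha>)"
    using c_pos n assms by (intro divide_left_mono mult_left_mono mult_pos_pos) (auto intro: add_pos_nonneg)
  also have "\<dots> = n powr (- \<beta>) * exp v / c * exp (- \<eta> * r)"
    using n c_pos by (simp add: powr_diff powr_minus exp_diff exp_minus field_simps)
  also have "\<dots> \<le> (v * sin \<theta>) powr (- \<beta>) * exp v / c * exp (- \<eta> * r)"
    using n c_pos assms sin_theta by (intro mult_right_mono divide_right_mono powr_mono2') auto
  finally show ?thesis .
qed

definition A :: "real \<Rightarrow> real \<Rightarrow> real \<Rightarrow> complex" where
  "A \<beta> x v = ray_integral \<theta> (K \<beta> x) v"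

lemma A_integrable:
  assumes "v > 0" "0 \<le> x" "0 \<le> \<beta>"
  shows "(\<lambda>r. K \<beta> x (ray \<theta> v r) * cis \<theta>) integrable_on {0<..}"
  by (rule ray_integral_props(1)[OF angles(1-3) eta assms(1) K_holomorphic[OF assms(2)]
        K_ray_bound_uniform[OF assms(1) less_imp_le assms(2,3)]])

lemma A_bound:
  assumes "v > 0" "0 \<le> x" "0 \<le> \<beta>"
  shows "norm (A \<beta> x v) \<le> (v * sin \<theta>) powr (- \<beta>) * exp v / c / \<eta>"
  unfolding A_def
  by (rule ray_integral_props(2)[OF angles(1-3) eta assms(1) K_holomorphic[OF assms(2)]
        K_ray_bound_uniform[OF assms(1) less_imp_le assms(2,3)]])

lemma A_shift:
  assumes "0 < v1" "v1 \<le> v2" "0 \<le> x" "0 \<le> \<beta>"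
  shows "Im (A \<beta> x v1) = Im (A \<beta> x v2)"
  unfolding A_def
proof (rule ray_integral_shift[OF angles(1-3) eta assms(1,2) K_holomorphic[OF assms(3)] K_real])
  fix v r :: real assume v: "v1 \<le> v" "v \<le> v2" "r > 0"
  have "norm (K \<beta> x (ray \<theta> v r)) \<le> (v * sin \<theta>) powr (- \<beta>) * exp v / c * exp (- \<eta> * r)"
    by (rule K_ray_bound_uniform) (use v assms in auto)
  also have "\<dots> \<le> (v1 * sin \<theta>) powr (- \<beta>) * exp v2 / c * exp (- \<eta> * r)"
    using v c_pos assms sin_theta by (intro mult_right_mono divide_right_mono mult_mono powr_mono2') (auto intro: less_imp_le)
  finally show "norm (K \<beta> x (ray \<theta> v r)) \<le> (v1 * sin \<theta>) powr (- \<beta>) * exp v2 / c * exp (- \<eta> * r)" .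
qed

lemma A_recurrence:
  assumes "v > 0" "0 \<le> x" "0 \<le> \<beta>"
  shows "A \<beta> x v = A \<beta> 0 v - of_real x * A (\<beta> + \<alpha>) x v"
proof -
  have "A \<beta> x v = integral {0<..} (\<lambda>r. K \<beta> 0 (ray \<theta> v r) * cis \<theta> - of_real x * (K (\<beta> + \<alpha>) x (ray \<theta> v r) * cis \<theta>))"
    unfolding A_def ray_integral_def
    using assms angles
    by (intro integral_cong, subst K_shift) (auto intro!: ray_in_half_plane simp: left_diff_distrib)
  also have "\<dots> = A \<beta> 0 v - of_real x * A (\<beta> + \<alpha>) x v"
    unfolding A_def ray_integral_def
    using integral_diff[OF A_integrable[of v 0 \<beta>] integrable_on_mult_right[OF A_integrable[of v x "\<beta> + \<alpha>"], of "of_real x"]] assms alpha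
    by (simp only: integral_mult_right)
  finally show ?thesis .
qed

text \<open>Integration by parts: \<open>s powr (- \<beta>) * exp s\<close> is a primitive of \<open>K \<beta> 0 - \<beta> * K (\<beta> + 1) 0\<close>, vanishes at
infinity, and is real at the vertex \<open>v\<close>.\<close>

lemma A_zero_step:
  assumes "v > 0" "0 < \<beta>"
  shows "Im (A \<beta> 0 v) = \<beta> * Im (A (\<beta> + 1) 0 v)"
proof -
  define G where "G s = K \<beta> 0 s - of_real \<beta> * K (\<beta> + 1) 0 s" for s
  define P where "P s = s powr of_real (- \<beta>) * exp s" for s :: complex
  define C where "C = (v * sin \<theta>) powr (- \<beta>) * exp v / c + \<beta> * ((v * sin \<theta>) powr (- (\<beta> + 1)) * exp v / c)"
  have P: "(P has_field_derivative G s) (at s)" if "s \<in> half_plane \<omega>" for s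
  proof -
    have s: "s \<noteq> 0" "s \<notin> \<real>\<^sub>\<le>\<^sub>0" using half_plane_Arg[OF that] angles by auto
    have "(P has_field_derivative (- of_real \<beta> * s powr (- of_real \<beta> - 1)) * exp s + s powr (- of_real \<beta>) * exp s) (at s)"
      unfolding P_def using s by (auto intro!: derivative_eq_intros)
    moreover have "- complex_of_real (\<beta> + 1) = - of_real \<beta> - 1" by simp
    then have "G s = (- of_real \<beta> * s powr (- of_real \<beta> - 1)) * exp s + s powr (- of_real \<beta>) * exp s"
      unfolding G_def K_zero[OF s(1)] of_real_minus by (simp add: mult_ac)
    ultimately show ?thesis by simp
  qed
  have bd: "norm (G (ray \<theta> v r)) \<le> C * exp (- \<eta> * r)" if "r > 0" for r
  proof -
    have "norm (G (ray \<theta> v r)) \<le> norm (K \<beta> 0 (ray \<theta> v r)) + \<beta> * norm (K (\<beta> + 1) 0 (ray \<theta> v r))"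
      unfolding G_def using norm_triangle_ineq4[of "K \<beta> 0 (ray \<theta> v r)" "of_real \<beta> * K (\<beta> + 1) 0 (ray \<theta> v r)"] assms
      by (simp add: norm_mult)
    also have "\<dots> \<le> (v * sin \<theta>) powr (- \<beta>) * exp v / c * exp (- \<eta> * r)
         + \<beta> * ((v * sin \<theta>) powr (- (\<beta> + 1)) * exp v / c * exp (- \<eta> * r))"
      using assms that by (intro add_mono mult_left_mono K_ray_bound_uniform) auto
    finally show ?thesis by (simp add: C_def algebra_simps)
  qed
  have hol: "G holomorphic_on half_plane \<omega>" unfolding G_def by (intro holomorphic_intros K_holomorphic) auto
  have lim: "(\<lambda>n. P (ray \<theta> v (real (Suc n)))) \<longlonglongrightarrow> ray_integral \<theta> G v + P (of_real v)"
    by (rule ray_integral_props(3)[OF angles(1-3) eta assms(1) hol bd P])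
  have "(\<lambda>n. P (ray \<theta> v (real (Suc n)))) \<longlonglongrightarrow> 0"
  proof (rule Lim_null_comparison[OF eventuallyI])
    fix n
    have s: "ray \<theta> v (real (Suc n)) \<noteq> 0" by (rule ray_nonzero) (use assms in auto)
    then have "P (ray \<theta> v (real (Suc n))) = K \<beta> 0 (ray \<theta> v (real (Suc n)))" by (simp add: P_def K_zero)
    then show "norm (P (ray \<theta> v (real (Suc n)))) \<le> (v * sin \<theta>) powr (- \<beta>) * exp v / c * exp (- \<eta> * real (Suc n))"
      using K_ray_bound_uniform[of v "real (Suc n)" 0 \<beta>] assms by simp
  next
    show "(\<lambda>n. (v * sin \<theta>) powr (- \<beta>) * exp v / c * exp (- \<eta> * real (Suc n))) \<longlonglongrightarrow> 0"
      using eta by real_asymp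
  qed
  with lim have "ray_integral \<theta> G v + P (of_real v) = 0" using LIMSEQ_unique by blast
  moreover have "Im (P (of_real v)) = 0"
    unfolding P_def using assms
    by (simp add: powr_of_real exp_of_real flip: of_real_mult of_real_minus)
  ultimately have "Im (ray_integral \<theta> G v) = 0"
    by (metis add.right_neutral plus_complex.simps(2) zero_complex.simps(2))
  moreover have "ray_integral \<theta> G v = A \<beta> 0 v - of_real \<beta> * A (\<beta> + 1) 0 v"
  proof -
    have "ray_integral \<theta> G v = integral {0<..} (\<lambda>r. K \<beta> 0 (ray \<theta> v r) * cis \<theta> - of_real \<beta> * (K (\<beta> + 1) 0 (ray \<theta> v r) * cis \<theta>))"
      unfolding ray_integral_def by (simp add: G_def algebra_simps)
    also have "\<dots> = A \<beta> 0 v - of_real \<beta> * A (\<beta> + 1) 0 v"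
      unfolding A_def ray_integral_def
      using integral_diff[OF A_integrable[of v 0 \<beta>] integrable_on_mult_right[OF A_integrable[of v 0 "\<beta> + 1"], of "of_real \<beta>"]] assms
      by (simp only: integral_mult_right)
    finally show ?thesis .
  qed
  ultimately show ?thesis by simp
qed

text \<open>For \<open>z < 1\<close> the singularity at \<open>0\<close> is integrable, so the vertex can be moved into the origin. The
resulting ray, reflected through the origin, lies in the right half plane and carries Euler's integral for
\<open>Gamma (1 - z)\<close>; the reflection formula converts this into \<open>rGamma z\<close>.\<close>

lemma A_zero_base:
  assumes z: "0 < z" "z < 1" and v: "v > 0"
  shows "Im (A z 0 v) / pi = rGamma z"
proof -
  define \<phi> where "\<phi> = \<theta> - pi"
  have phi: "\<bar>\<phi>\<bar> < pi / 2" using theta angles by (auto simp: \<phi>_def)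
  define L where "L r = (of_real r * cis \<theta>) powr of_real (- z) * exp (of_real r * cis \<theta>) * cis \<theta>" for r
  define h where "h r = (sin \<theta>) powr (- z) * exp 1 * norm (complex_of_real r powr (of_real (1 - z) - 1) / of_real (exp (\<eta> * r)))" for r
  define a where "a n r = K z 0 (ray \<theta> (1 / real (Suc n)) r) * cis \<theta>" for n r
  have h: "h integrable_on {0<..}" unfolding h_def
    using absolutely_integrable_Gamma_integral[of "of_real (1 - z)" "\<eta>"] z eta
    by (intro integrable_on_mult_right) (simp add: absolutely_integrable_on_def)
  have a_int: "a n integrable_on {0<..}" for n
    unfolding a_def by (rule A_integrable) (use z in auto)
  have a_bound: "norm (a n r) \<le> h r" if "r \<in> {0<..}" for n r
  proof -
    let ?s = "ray \<theta> (1 / real (Suc n)) r"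
    have r: "r > 0" using that by simp
    have s: "?s \<noteq> 0" using r by (intro ray_nonzero) auto
    have "norm ?s powr (- z) \<le> (r * sin \<theta>) powr (- z)"
      using ray_norm_bounds(2)[of "1 / real (Suc n)" r \<theta>] angles r z sin_theta by (intro powr_mono2') auto
    moreover have "exp (Re ?s) \<le> exp (1 - \<eta> * r)" by (simp add: \<eta>_def mult.commute)
    ultimately have "norm (a n r) \<le> (r * sin \<theta>) powr (- z) * exp (1 - \<eta> * r)"
      using s by (simp add: a_def K_zero norm_mult norm_cpowr_real mult_mono del: of_real_minus Re_ray)
    also have "\<dots> = h r" using r sin_theta
      by (simp add: h_def norm_divide norm_cpowr_real powr_mult exp_diff exp_minus field_simps del: of_real_minus)
         (simp add: norm_cpowr_real flip: of_real_minus)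
    finally show ?thesis .
  qed
  have a_lim: "(\<lambda>n. a n r) \<longlonglongrightarrow> L r" if "r \<in> {0<..}" for r
  proof -
    have nz: "of_real r * cis \<theta> \<notin> \<real>\<^sub>\<le>\<^sub>0"
    proof -
      have "Im (of_real r * cis \<theta>) > 0" using that sin_theta by simp
      then show ?thesis by (auto simp: complex_nonpos_Reals_iff)
    qed
    have "(\<lambda>n. 1 / real (Suc n)) \<longlonglongrightarrow> 0" using LIMSEQ_inverse_real_of_nat by (simp add: inverse_eq_divide)
    from tendsto_add[OF tendsto_of_real[OF this] tendsto_const[of "of_real r * cis \<theta>"]]
    have lim: "(\<lambda>n. ray \<theta> (1 / real (Suc n)) r) \<longlonglongrightarrow> of_real r * cis \<theta>"
      by (simp only: ray_def of_real_0 add_0)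
    have "(\<lambda>n. ray \<theta> (1 / real (Suc n)) r powr of_real (- z) * exp (ray \<theta> (1 / real (Suc n)) r) * cis \<theta>) \<longlonglongrightarrow> L r"
      unfolding L_def by (intro tendsto_mult tendsto_powr_complex tendsto_exp lim tendsto_const nz)
    moreover have "a n r = ray \<theta> (1 / real (Suc n)) r powr of_real (- z) * exp (ray \<theta> (1 / real (Suc n)) r) * cis \<theta>" for n
    proof -
      have "ray \<theta> (1 / real (Suc n)) r \<noteq> 0" using that by (intro ray_nonzero) auto
      then show ?thesis by (simp add: a_def K_zero)
    qed
    ultimately show ?thesis by simp
  qed
  have "(\<lambda>n. integral {0<..} (a n)) \<longlonglongrightarrow> integral {0<..} L"
    by (rule dominated_convergence(2)[OF a_int h a_bound a_lim])
  then have "(\<lambda>n. Im (A z 0 (1 / real (Suc n)))) \<longlonglongrightarrow> Im (integral {0<..} L)"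
    unfolding A_def ray_integral_def a_def by (rule tendsto_Im)
  moreover have "Im (A z 0 (1 / real (Suc n))) = Im (A z 0 v)" for n
  proof (cases "1 / real (Suc n) \<le> v")
    case True then show ?thesis by (intro A_shift) (use z in auto)
  next
    case False then show ?thesis by (intro A_shift[symmetric]) (use z v in auto)
  qed
  ultimately have 1: "Im (A z 0 v) = Im (integral {0<..} L)" by (simp add: LIMSEQ_const_iff)
  have "L r = - cis (- (pi * z)) * ((of_real r * cis \<phi>) powr of_real ((1 - z) - 1) * exp (- (of_real r * cis \<phi>)) * cis \<phi>)"
    if "r \<in> {0<..}" for r
  proof -
    have cis: "cis \<theta> = - cis \<phi>" by (simp add: \<phi>_def complex_eq_iff)
    have rp: "r > 0" using that by simp
    have Arg: "Arg (of_real r * cis \<theta>) = \<theta>" "Arg (of_real r * cis \<phi>) = \<phi>"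
      using rp angles theta by (auto intro!: cis_Arg_unique simp: Arg_times_of_real2 \<phi>_def sgn_mult sgn_div_norm)
    have n: "norm (complex_of_real r * cis \<theta>) = r" "norm (complex_of_real r * cis \<phi>) = r" using rp by (auto simp: norm_mult)
    have "(of_real r * cis \<theta>) powr of_real (- z) = cis (- (pi * z)) * (of_real r * cis \<phi>) powr of_real (- z)"
    proof -
      have nz: "complex_of_real r * cis \<theta> \<noteq> 0" "complex_of_real r * cis \<phi> \<noteq> 0" using rp by auto
      have e: "cis (- z * \<theta>) = cis (- (pi * z)) * cis (- z * \<phi>)" by (simp add: cis_mult \<phi>_def algebra_simps)
      show ?thesis unfolding cpowr_eq_norm_cis[OF nz(1)] cpowr_eq_norm_cis[OF nz(2)] Arg n e
        by (simp only: mult_ac)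
    qed
    then show ?thesis unfolding L_def by (simp add: cis)
  qed
  then have "integral {0<..} L = integral {0<..} (\<lambda>r. - cis (- (pi * z)) *
      ((of_real r * cis \<phi>) powr of_real ((1 - z) - 1) * exp (- (of_real r * cis \<phi>)) * cis \<phi>))"
    by (intro integral_cong)
  also have "\<dots> = - cis (- (pi * z)) * of_real (Gamma (1 - z))"
    by (subst integral_mult_right, subst rotated_Gamma_integral) (use phi z in auto)
  finally have "integral {0<..} L = - cis (- (pi * z)) * of_real (Gamma (1 - z))" .
  then have "Im (A z 0 v) = sin (pi * z) * Gamma (1 - z)" using 1 by simp
  moreover have "rGamma z * rGamma (1 - z) = sin (pi * z) / pi"
  proof -
    have "complex_of_real (rGamma z * rGamma (1 - z)) = rGamma (of_real z) * rGamma (1 - of_real z)"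
      by (simp only: of_real_mult rGamma_complex_of_real[symmetric] of_real_diff of_real_1)
    also have "\<dots> = of_real (sin (pi * z) / pi)"
      unfolding rGamma_reflection_complex by (simp only: sin_of_real of_real_mult[symmetric] of_real_divide[symmetric])
    finally have "complex_of_real (rGamma z * rGamma (1 - z)) = of_real (sin (pi * z) / pi)" .
    then show ?thesis using of_real_eq_iff by blast
  qed
  moreover have "rGamma (1 - z) \<noteq> 0" "Gamma (1 - z) = inverse (rGamma (1 - z))"
    using z Gamma_real_pos[of "1 - z"] by (auto simp: Gamma_def)
  ultimately have "rGamma (1 - z) * Im (A z 0 v) = rGamma (1 - z) * (pi * rGamma z)" by (simp add: field_simps)
  then have "Im (A z 0 v) = pi * rGamma z" using \<open>rGamma (1 - z) \<noteq> 0\<close> by (metis mult_left_cancel)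
  then show ?thesis by simp
qed

text \<open>At \<open>z = 1\<close> the vertex cannot be moved into the origin, but the integral over a fixed ray is continuous
in the parameter.\<close>

lemma A_zero_at_one: "Im (A 1 0 1) / pi = rGamma 1"
proof -
  define b where "b n = 1 - 1 / real (Suc (Suc n))" for n
  have b: "0 < b n" "b n < 1" for n by (auto simp: b_def field_simps)
  have blim: "b \<longlonglongrightarrow> 1"
    unfolding b_def by real_asymp
  have "(\<lambda>n. integral {0<..} (\<lambda>r. K (b n) 0 (ray \<theta> 1 r) * cis \<theta>)) \<longlonglongrightarrow> integral {0<..} (\<lambda>r. K 1 0 (ray \<theta> 1 r) * cis \<theta>)"
  proof (rule dominated_convergence(2)[OF A_integrable exp_decay_integrable[OF eta, of "(sin \<theta>) powr (- 1) * exp 1 / c"]])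
    fix n and r :: real assume r: "r \<in> {0<..}"
    have "norm (K (b n) 0 (ray \<theta> 1 r) * cis \<theta>) \<le> (1 * sin \<theta>) powr (- b n) * exp 1 / c * exp (- \<eta> * r)"
      using K_ray_bound_uniform[of 1 r 0 "b n"] b[of n] r by (simp add: norm_mult)
    also have "\<dots> \<le> (sin \<theta>) powr (- 1) * exp 1 / c * exp (- \<eta> * r)"
    proof -
      have "sin \<theta> powr (- b n) \<le> sin \<theta> powr (- 1)"
        by (rule powr_mono') (use b[of n] sin_theta in auto)
      then show ?thesis using c_pos by (intro mult_right_mono divide_right_mono) auto
    qed
    finally show "norm (K (b n) 0 (ray \<theta> 1 r) * cis \<theta>) \<le> (sin \<theta>) powr (- 1) * exp 1 / c * exp (- \<eta> * r)" .
  next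
    fix r :: real assume r: "r \<in> {0<..}"
    have s: "ray \<theta> 1 r \<noteq> 0" "ray \<theta> 1 r \<notin> \<real>\<^sub>\<le>\<^sub>0"
      using half_plane_Arg[OF ray_in_half_plane[of 1 r \<theta> \<omega>]] angles r by auto
    have "(\<lambda>n. ray \<theta> 1 r powr of_real (- b n) * exp (ray \<theta> 1 r) * cis \<theta>)
       \<longlonglongrightarrow> ray \<theta> 1 r powr of_real (- 1) * exp (ray \<theta> 1 r) * cis \<theta>"
      by (intro tendsto_mult tendsto_powr_complex tendsto_const s tendsto_of_real tendsto_minus blim)
    then show "(\<lambda>n. K (b n) 0 (ray \<theta> 1 r) * cis \<theta>) \<longlonglongrightarrow> K 1 0 (ray \<theta> 1 r) * cis \<theta>"
      using s by (simp add: K_zero)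
  qed (use b less_imp_le in auto)
  then have "(\<lambda>n. Im (A (b n) 0 1) / pi) \<longlonglongrightarrow> Im (A 1 0 1) / pi"
    unfolding A_def ray_integral_def by (intro tendsto_divide tendsto_Im tendsto_const) auto
  moreover have "Im (A (b n) 0 1) / pi = rGamma (b n)" for n using A_zero_base b by simp
  ultimately have "(\<lambda>n. rGamma (b n)) \<longlonglongrightarrow> Im (A 1 0 1) / pi" by (simp only:)
  moreover have "(\<lambda>n. rGamma (b n)) \<longlonglongrightarrow> rGamma 1"
    by (rule isCont_tendsto_compose[OF _ blim]) (auto intro!: continuous_intros)
  ultimately show ?thesis by (rule LIMSEQ_unique)
qed

text \<open>Hankel's formula. The functional equations of both sides reduce it to \<open>0 < \<beta> \<le> 1\<close>.\<close>

lemma A_zero_eq_rGamma: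
  assumes "0 < \<beta>" "0 < v"
  shows "Im (A \<beta> 0 v) / pi = rGamma \<beta>"
proof -
  have *: "Im (A z 0 v) / pi = rGamma z" if "0 < z" "z \<le> 1" for z
  proof (cases "z < 1")
    case True then show ?thesis using A_zero_base assms that by simp
  next
    case False
    then have "z = 1" using that by simp
    moreover have "Im (A 1 0 v) = Im (A 1 0 1)"
    proof (cases "v \<le> 1")
      case True then show ?thesis by (intro A_shift) (use assms in auto)
    next
      case False then show ?thesis by (intro A_shift[symmetric]) (use assms in auto)
    qed
    ultimately show ?thesis using A_zero_at_one by simp
  qed
  have "Im (A (z + real n) 0 v) / pi = rGamma (z + real n)" if "0 < z" "z \<le> 1" for z n
  proof (induction n)
    case (Suc n)
    define w where "w = z + real n"
    have w: "w > 0" using that by (simp add: w_def)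
    have "w * (Im (A (w + 1) 0 v) / pi) = w * rGamma (w + 1)"
      using A_zero_step[of v w] assms w Suc rGamma_plus1[of w] by (simp add: w_def)
    then have "Im (A (w + 1) 0 v) / pi = rGamma (w + 1)" using w by (metis less_irrefl mult_left_cancel)
    then show ?case by (simp add: w_def add_ac)
  qed (use * that in auto)
  from this[of "\<beta> - of_int (\<lceil>\<beta>\<rceil> - 1)" "nat (\<lceil>\<beta>\<rceil> - 1)"]
  have "Im (A (\<beta> - of_int (\<lceil>\<beta>\<rceil> - 1) + real (nat (\<lceil>\<beta>\<rceil> - 1))) 0 v) / pi = rGamma (\<beta> - of_int (\<lceil>\<beta>\<rceil> - 1) + real (nat (\<lceil>\<beta>\<rceil> - 1)))"
    using ceiling_correct[of \<beta>] by simp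
  moreover have "real (nat (\<lceil>\<beta>\<rceil> - 1)) = of_int (\<lceil>\<beta>\<rceil> - 1)" using assms by simp
  ultimately show ?thesis by simp
qed

text \<open>Applying \<open>A_recurrence\<close> \<open>N\<close> times splits off the first \<open>N\<close> terms of the power series, by Hankel's formula, and
leaves \<open>(- x) ^ N * Im (A (\<alpha> * N + \<beta>) x v) / pi\<close>. This remainder is of order \<open>(x / (v sin \<theta>) powr \<alpha>) ^ N\<close>,
hence tends to \<open>0\<close> if the vertex \<open>v\<close> is far enough to the right.\<close>

lemma mittag_leffler_sums_contour:
  assumes "0 < \<beta>" "0 \<le> x"
  shows "(\<lambda>n. (- x) ^ n / Gamma (\<alpha> * real n + \<beta>)) sums (Im (A \<beta> x 1) / pi)"
proof -
  \<comment> \<open>With this vertex the remainder is of order \<open>(x / (x + 1)) ^ N\<close>.\<close>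
  define v where "v = (x + 1) powr (1 / \<alpha>) / sin \<theta>"
  have vs: "v * sin \<theta> = (x + 1) powr (1 / \<alpha>)" using sin_theta by (simp add: v_def)
  have "(x + 1) powr (1 / \<alpha>) \<ge> 1" using assms alpha by (intro ge_one_powr_ge_zero) auto
  then have "sin \<theta> \<le> (x + 1) powr (1 / \<alpha>)" using sin_theta by linarith
  then have v1: "1 \<le> v" using sin_theta unfolding v_def by (simp add: le_divide_eq)
  have F: "Im (A \<beta> x v) / pi = (\<Sum>n<N. (- x) ^ n / Gamma (\<alpha> * real n + \<beta>)) + (- x) ^ N * (Im (A (\<alpha> * real N + \<beta>) x v) / pi)" for N
  proof (induction N)
    case (Suc N)
    have pos: "\<alpha> * real N + \<beta> > 0" using assms alpha by (simp add: add_nonneg_pos)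
    have "Im (A (\<alpha> * real N + \<beta>) x v) / pi = Im (A (\<alpha> * real N + \<beta>) 0 v) / pi - x * (Im (A (\<alpha> * real N + \<beta> + \<alpha>) x v) / pi)"
      using A_recurrence[of v x "\<alpha> * real N + \<beta>"] pos v1 assms by (simp add: diff_divide_distrib)
    also have "Im (A (\<alpha> * real N + \<beta>) 0 v) / pi = 1 / Gamma (\<alpha> * real N + \<beta>)"
      using A_zero_eq_rGamma[of "\<alpha> * real N + \<beta>" v] pos v1 by (simp add: rGamma_inverse_Gamma inverse_eq_divide)
    also have "\<alpha> * real N + \<beta> + \<alpha> = \<alpha> * real (Suc N) + \<beta>" by (simp add: algebra_simps)
    finally have step: "Im (A (\<alpha> * real N + \<beta>) x v) / pi = 1 / Gamma (\<alpha> * real N + \<beta>) - x * (Im (A (\<alpha> * real (Suc N) + \<beta>) x v) / pi)" .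
    show ?case unfolding Suc.IH step sum.lessThan_Suc power_Suc by (simp only: algebra_simps) simp
  qed simp
  define B where "B = (v * sin \<theta>) powr (- \<beta>) * exp v / c / \<eta> / pi"
  have "(\<lambda>N. (- x) ^ N * (Im (A (\<alpha> * real N + \<beta>) x v) / pi)) \<longlonglongrightarrow> 0"
  proof (rule Lim_null_comparison[OF eventuallyI])
    fix N
    have pos: "\<alpha> * real N + \<beta> > 0" using assms alpha by (simp add: add_nonneg_pos)
    have "\<bar>Im (A (\<alpha> * real N + \<beta>) x v)\<bar> \<le> (v * sin \<theta>) powr (- (\<alpha> * real N + \<beta>)) * exp v / c / \<eta>"
      using A_bound[of v x "\<alpha> * real N + \<beta>"] abs_Im_le_cmod pos v1 assms by (meson less_imp_le less_le_trans order_trans zero_less_one)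
    also have "(v * sin \<theta>) powr (- (\<alpha> * real N + \<beta>)) = (v * sin \<theta>) powr (- \<beta>) * (1 / (x + 1)) ^ N"
    proof -
      have "(v * sin \<theta>) powr (- (\<alpha> * real N + \<beta>)) = (v * sin \<theta>) powr (- \<beta>) * (v * sin \<theta>) powr (- (\<alpha> * real N))"
        by (simp add: algebra_simps flip: powr_add)
      also have "(v * sin \<theta>) powr (- (\<alpha> * real N)) = (1 / (x + 1)) ^ N"
        unfolding vs using assms alpha by (simp add: powr_powr powr_minus powr_realpow inverse_eq_divide power_one_over)
      finally show ?thesis .
    qed
    finally have "\<bar>Im (A (\<alpha> * real N + \<beta>) x v)\<bar> / pi \<le> B * (1 / (x + 1)) ^ N"
      using divide_right_mono[of _ _ pi] by (fastforce simp: B_def mult_ac)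
    then have "x ^ N * (\<bar>Im (A (\<alpha> * real N + \<beta>) x v)\<bar> / pi) \<le> x ^ N * (B * (1 / (x + 1)) ^ N)"
      by (rule mult_left_mono) (use assms in auto)
    also have "\<dots> = B * (x / (x + 1)) ^ N" by (simp add: power_divide)
    finally show "norm ((- x) ^ N * (Im (A (\<alpha> * real N + \<beta>) x v) / pi)) \<le> B * (x / (x + 1)) ^ N"
      using assms by (simp add: abs_mult power_abs)
  next
    show "(\<lambda>N. B * (x / (x + 1)) ^ N) \<longlonglongrightarrow> 0"
      using tendsto_mult[OF tendsto_const LIMSEQ_realpow_zero[of "x / (x + 1)"]] assms by fastforce
  qed
  note * = tendsto_diff[OF tendsto_const[of "Im (A \<beta> x v) / pi"] this]
  have "(\<lambda>N. \<Sum>n<N. (- x) ^ n / Gamma (\<alpha> * real n + \<beta>)) \<longlonglongrightarrow> Im (A \<beta> x v) / pi"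
  proof -
    have "(\<Sum>n<N. (- x) ^ n / Gamma (\<alpha> * real n + \<beta>)) = Im (A \<beta> x v) / pi - (- x) ^ N * (Im (A (\<alpha> * real N + \<beta>) x v) / pi)" for N
      using F[of N] by linarith
    then show ?thesis using * by (simp only: diff_zero)
  qed
  moreover have "Im (A \<beta> x v) = Im (A \<beta> x 1)" using A_shift[of 1 v x \<beta>] v1 assms by simp
  ultimately show ?thesis by (simp add: sums_def)
qed

text \<open>Along the ray the modulus of \<open>s\<close> is bounded below, so the denominator of \<open>K \<beta> x s\<close> is at least a multiple
of \<open>1 + x\<close>; the powers of \<open>s\<close> in the numerator are absorbed by a part of the exponential decay.\<close>

lemma A_decay:
  assumes "0 < \<beta>"
  shows "\<exists>C>0. \<forall>x\<ge>0. norm (A \<beta> x 1) \<le> C / (1 + x)"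
proof -
  \<comment> \<open>From \<open>(1 + r)\<^sup>2 \<le> exp (2 * d * r) / d\<^sup>2\<close>: this choice of \<open>d\<close> spends half of the exponential decay.\<close>
  define d where "d = \<eta> / 4"
  have d: "0 < d" "d \<le> 1" using eta eta_le by (auto simp: d_def)
  define C where "C = (1 / d)\<^sup>2 * (sin \<theta>) powr (- \<beta>) * exp 1 / (c * (sin \<theta>) powr \<alpha>)"
  have C: "C > 0" using d c_pos sin_theta by (simp add: C_def)
  have "norm (A \<beta> x 1) \<le> C / (1 + x) / (\<eta> / 2)" if x: "x \<ge> 0" for x
    unfolding A_def
  proof (rule ray_integral_props(2)[OF angles(1-3) _ zero_less_one K_holomorphic[OF that]])
    fix r :: real assume r: "r > 0"
    define n where "n = norm (ray \<theta> 1 r)"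
    have n: "sin \<theta> \<le> n" "n \<le> 1 + r" "0 < n" using ray_norm_bounds[of 1 r \<theta>] angles r sin_theta by (auto simp: n_def)
    have s1: "(sin \<theta>) powr \<alpha> \<le> 1" using sin_theta alpha by (intro powr_le1) auto
    have sp: "(sin \<theta>) powr \<alpha> > 0" using sin_theta by simp
    have den: "(sin \<theta>) powr \<alpha> * (1 + x) \<le> n powr \<alpha> + x"
    proof -
      have "(sin \<theta>) powr \<alpha> \<le> n powr \<alpha>" using n sin_theta alpha by (intro powr_mono2) auto
      moreover have "(sin \<theta>) powr \<alpha> * x \<le> 1 * x" by (rule mult_right_mono[OF s1 x])
      ultimately show ?thesis by (simp add: algebra_simps)
    qed
    have "1 + r \<le> (1 / d) * (1 + d * r)" using d by (simp add: field_simps)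
    also have "\<dots> \<le> (1 / d) * exp (d * r)" using d by (intro mult_left_mono) auto
    finally have "(1 + r)\<^sup>2 \<le> ((1 / d) * exp (d * r))\<^sup>2" using r by (intro power_mono) auto
    also have "(exp (d * r))\<^sup>2 = exp (\<eta> / 2 * r)" by (simp add: power2_eq_square d_def flip: exp_add)
    then have "((1 / d) * exp (d * r))\<^sup>2 = (1 / d)\<^sup>2 * exp (\<eta> / 2 * r)" by (simp only: power_mult_distrib)
    finally have sq: "(1 + r)\<^sup>2 \<le> (1 / d)\<^sup>2 * exp (\<eta> / 2 * r)" .
    have "n powr (\<alpha> - \<beta>) = n powr (- \<beta>) * n powr \<alpha>" by (simp flip: powr_add)
    also have "\<dots> \<le> (sin \<theta>) powr (- \<beta>) * (1 + r)\<^sup>2"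
    proof (rule mult_mono)
      show "n powr (- \<beta>) \<le> (sin \<theta>) powr (- \<beta>)" using n sin_theta assms by (intro powr_mono2') auto
      have "n powr \<alpha> \<le> (1 + r) powr \<alpha>" using n alpha by (intro powr_mono2) auto
      also have "\<dots> \<le> (1 + r) powr 2" using r alpha by (intro powr_mono) auto
      finally show "n powr \<alpha> \<le> (1 + r)\<^sup>2" using r by (simp add: powr_numeral)
    qed auto
    also have "\<dots> \<le> (sin \<theta>) powr (- \<beta>) * ((1 / d)\<^sup>2 * exp (\<eta> / 2 * r))" using sq by (intro mult_left_mono) auto
    finally have num: "n powr (\<alpha> - \<beta>) \<le> (sin \<theta>) powr (- \<beta>) * ((1 / d)\<^sup>2 * exp (\<eta> / 2 * r))" .
    have "norm (K \<beta> x (ray \<theta> 1 r)) \<le> n powr (\<alpha> - \<beta>) * exp (1 - \<eta> * r) / (c * (n powr \<alpha> + x))"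
      unfolding n_def by (rule K_ray_bound) (use r x in auto)
    also have "\<dots> \<le> (sin \<theta>) powr (- \<beta>) * ((1 / d)\<^sup>2 * exp (\<eta> / 2 * r)) * exp (1 - \<eta> * r) / (c * ((sin \<theta>) powr \<alpha> * (1 + x)))"
      using num den c_pos sp x d by (intro frac_le mult_mono mult_pos_pos) auto
    also have "\<dots> = C / (1 + x) * exp (- (\<eta> / 2) * r)"
    proof -
      have "exp (\<eta> / 2 * r) * exp (1 - \<eta> * r) = exp 1 * exp (- (\<eta> / 2) * r)"
        by (simp add: field_simps flip: exp_add)
      then have "(sin \<theta>) powr (- \<beta>) * ((1 / d)\<^sup>2 * exp (\<eta> / 2 * r)) * exp (1 - \<eta> * r)
         = (sin \<theta>) powr (- \<beta>) * (1 / d)\<^sup>2 * (exp 1 * exp (- (\<eta> / 2) * r))" by (simp add: mult.assoc)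
      then show ?thesis by (simp add: C_def mult_ac)
    qed
    finally show "norm (K \<beta> x (ray \<theta> 1 r)) \<le> C / (1 + x) * exp (- (\<eta> / 2) * r)" .
  qed (use eta in auto)
  then have "\<forall>x\<ge>0. norm (A \<beta> x 1) \<le> (2 * C / \<eta>) / (1 + x)" by (simp add: mult_ac)
  moreover have "2 * C / \<eta> > 0" using C eta by simp
  ultimately show ?thesis by blast
qed

end

lemma ml_contour_exists:
  assumes "1 < \<alpha>" "\<alpha> < 2"
  obtains \<theta> where "ml_contour \<alpha> \<theta>"
proof -
  have "pi / 2 < pi / \<alpha>" using assms pi_gt_zero by (intro divide_strict_left_mono) auto
  then have "ml_contour \<alpha> ((pi / 2 + pi / \<alpha>) / 2)" using assms by unfold_locales (auto simp: field_simps)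
  then show ?thesis by (rule that)
qed

text \<open>The contour representation gives convergence of the power series on the whole negative axis, hence
absolute convergence everywhere.\<close>

lemma mittag_leffler_summable:
  assumes "1 < \<alpha>" "\<alpha> < 2" "0 < \<beta>"
  shows "summable (\<lambda>n. norm (z ^ n / Gamma (\<alpha> * real n + \<beta>)))"
proof -
  obtain \<theta> where "ml_contour \<alpha> \<theta>" using ml_contour_exists assms by blast
  then interpret ml_contour \<alpha> \<theta> .
  have "summable (\<lambda>n. (1 / Gamma (\<alpha> * real n + \<beta>)) * (- (\<bar>z\<bar> + 1)) ^ n)"
    using mittag_leffler_sums_contour[of \<beta> "\<bar>z\<bar> + 1"] assms by (simp add: sums_iff)
  then have "summable (\<lambda>n. norm ((1 / Gamma (\<alpha> * real n + \<beta>)) * z ^ n))"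
    by (rule powser_insidea) auto
  then show ?thesis by simp
qed

lemma mittag_leffler_decay:
  assumes "1 < \<alpha>" "\<alpha> < 2" "0 < \<beta>"
  shows "\<exists>C>0. \<forall>x\<ge>0. \<bar>mittag_leffler \<alpha> \<beta> (- x)\<bar> \<le> C / (1 + x)"
proof -
  obtain \<theta> where "ml_contour \<alpha> \<theta>" using ml_contour_exists assms by blast
  then interpret ml_contour \<alpha> \<theta> .
  obtain C where C: "C > 0" "\<And>x. x \<ge> 0 \<Longrightarrow> norm (A \<beta> x 1) \<le> C / (1 + x)" using A_decay[OF assms(3)] by blast
  have "\<bar>mittag_leffler \<alpha> \<beta> (- x)\<bar> \<le> C / (1 + x)" if "x \<ge> 0" for x
  proof -
    have "mittag_leffler \<alpha> \<beta> (- x) = Im (A \<beta> x 1) / pi"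
      using mittag_leffler_sums_contour[OF assms(3) that] by (simp add: mittag_leffler_def sums_iff)
    moreover have "\<bar>Im (A \<beta> x 1)\<bar> / pi \<le> \<bar>Im (A \<beta> x 1)\<bar> / 1"
      using pi_ge_two by (intro divide_left_mono) auto
    ultimately show ?thesis using C(2)[OF that] abs_Im_le_cmod[of "A \<beta> x 1"] by simp
  qed
  then show ?thesis using C(1) by blast
qed

section \<open>Convolution on the half line\<close>

lemma has_integral_nonneg_lebesgue_on:
  fixes f :: "real \<Rightarrow> real"
  assumes "(f has_integral I) S" "S \<in> sets lebesgue" "\<And>x. x \<in> S \<Longrightarrow> 0 \<le> f x"
  shows "integrable (lebesgue_on S) f" "(\<integral>x. f x \<partial>lebesgue_on S) = I"
proof -
  have "f absolutely_integrable_on S"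
    using assms by (intro nonnegative_absolutely_integrable_1) auto
  then show i: "integrable (lebesgue_on S) f"
    using assms(2) by (simp add: set_integrable_def integrable_restrict_space)
  show "(\<integral>x. f x \<partial>lebesgue_on S) = I"
    using lebesgue_integral_eq_integral[OF i assms(2)] assms(1) by (simp add: integral_unique)
qed

definition convolve :: "(real \<Rightarrow> real) \<Rightarrow> (real \<Rightarrow> real) \<Rightarrow> real \<Rightarrow> real" where
  "convolve a c t = (\<integral>\<tau>. a (t - \<tau>) * c \<tau> \<partial>lebesgue_on {0<..<t})"

lemma convolve_cong:
  assumes "\<And>s. 0 < s \<Longrightarrow> s < t \<Longrightarrow> a s = a' s" "\<And>s. 0 < s \<Longrightarrow> s < t \<Longrightarrow> c s = c' s"
  shows "convolve a c t = convolve a' c' t"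
  unfolding convolve_def by (intro Bochner_Integration.integral_cong) (auto simp: assms)

lemma integral_initial_interval:
  fixes f :: "real \<Rightarrow> 'b::{banach, second_countable_topology}"
  assumes "s \<le> t"
  shows "(\<integral>r. f r \<partial>lebesgue_on {0<..<s}) = (\<integral>r. (if r < s then f r else 0) \<partial>lebesgue_on {0<..<t})"
  using assms by (simp add: integral_restrict_space)
    (intro Bochner_Integration.integral_cong, auto simp: indicator_def)

lemma integrable_initial_interval:
  fixes f :: "real \<Rightarrow> 'b::{banach, second_countable_topology}"
  assumes "integrable (lebesgue_on {0<..<t}) f" "s \<le> t"
  shows "integrable (lebesgue_on {0<..<s}) f"
proof -
  have "integrable lebesgue (\<lambda>x. indicator {0<..<s} x *\<^sub>R (indicator {0<..<t} x *\<^sub>R f x))"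
    by (rule integrable_mult_indicator) (use assms(1) in \<open>auto simp: integrable_restrict_space\<close>)
  moreover have "indicator {0<..<s} x *\<^sub>R (indicator {0<..<t} x *\<^sub>R f x) = indicator {0<..<s} x *\<^sub>R f x" for x
    using assms(2) by (auto simp: indicator_def)
  ultimately have "integrable lebesgue (\<lambda>x. indicator {0<..<s} x *\<^sub>R f x)" by (simp only:)
  then show ?thesis by (simp add: integrable_restrict_space)
qed

lemma borel_measurable_lebesgue_on_borel:
  "f \<in> borel_measurable borel \<Longrightarrow> f \<in> borel_measurable (lebesgue_on S)"
  by (intro measurable_restrict_space1 measurable_completion) simp

lemma ident_measurable_lebesgue_on [measurable]: "(\<lambda>x. x) \<in> borel_measurable (lebesgue_on S)"
  by (rule borel_measurable_lebesgue_on_borel) simp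

lemma lebesgue_on_lborel_integral:
  fixes f :: "real \<Rightarrow> 'b::{banach, second_countable_topology}"
  assumes [measurable]: "f \<in> borel_measurable borel"
  shows "(\<integral>x. f x \<partial>lebesgue_on {0<..<t}) = (\<integral>x. indicator {0<..<t} x *\<^sub>R f x \<partial>lborel)"
    and "integrable (lebesgue_on {0<..<t}) f \<longleftrightarrow> integrable lborel (\<lambda>x. indicator {0<..<t} x *\<^sub>R f x)"
  by (simp_all add: integral_restrict_space integrable_restrict_space integral_completion integrable_completion)

lemma integral_translate:
  fixes h :: "real \<Rightarrow> 'b::{banach, second_countable_topology}"
  assumes h [measurable]: "h \<in> borel_measurable borel" and r: "0 \<le> r"
  shows "(\<integral>s. (if r < s then h (s - r) else 0) \<partial>lebesgue_on {0<..<t}) = (\<integral>s. h s \<partial>lebesgue_on {0<..<t - r})"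
proof -
  have "(\<integral>s. (if r < s then h (s - r) else 0) \<partial>lebesgue_on {0<..<t})
      = (\<integral>s. indicator {0<..<t} s *\<^sub>R (if r < s then h (s - r) else 0) \<partial>lborel)"
    by (rule lebesgue_on_lborel_integral) measurable
  also have "\<dots> = (\<integral>s. indicator {0<..<t} (r + 1 * s) *\<^sub>R (if r < r + 1 * s then h (r + 1 * s - r) else 0) \<partial>lborel)"
    by (subst lborel_integral_real_affine[of 1 _ r]) simp_all
  also have "\<dots> = (\<integral>s. indicator {0<..<t - r} s *\<^sub>R h s \<partial>lborel)"
    using r by (intro Bochner_Integration.integral_cong) (auto simp: indicator_def)
  finally show ?thesis by (simp add: lebesgue_on_lborel_integral)
qed

lemma integral_reflect:
  fixes h :: "real \<Rightarrow> 'b::{banach, second_countable_topology}"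
  assumes h [measurable]: "h \<in> borel_measurable borel"
  shows "(\<integral>s. h (t - s) \<partial>lebesgue_on {0<..<t}) = (\<integral>s. h s \<partial>lebesgue_on {0<..<t})"
proof -
  have "(\<integral>s. h s \<partial>lebesgue_on {0<..<t}) = (\<integral>s. indicator {0<..<t} (t + (- 1) * s) *\<^sub>R h (t + (- 1) * s) \<partial>lborel)"
    using lborel_integral_real_affine[of "- 1" "\<lambda>s. indicator {0<..<t} s *\<^sub>R h s" t]
    by (simp add: lebesgue_on_lborel_integral)
  also have "\<dots> = (\<integral>s. indicator {0<..<t} s *\<^sub>R h (t - s) \<partial>lborel)"
    by (intro Bochner_Integration.integral_cong) (auto simp: indicator_def)
  finally show ?thesis by (simp add: lebesgue_on_lborel_integral)
qed

lemma integrable_reflect: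
  fixes h :: "real \<Rightarrow> 'b::{banach, second_countable_topology}"
  assumes h [measurable]: "h \<in> borel_measurable borel" and i: "integrable (lebesgue_on {0<..<t}) h"
  shows "integrable (lebesgue_on {0<..<t}) (\<lambda>s. h (t - s))"
proof -
  have "integrable lborel (\<lambda>s. indicator {0<..<t} (t + (- 1) * s) *\<^sub>R h (t + (- 1) * s))"
    using i by (intro lborel_integrable_real_affine) (simp_all add: lebesgue_on_lborel_integral)
  then have "integrable lborel (\<lambda>s. indicator {0<..<t} s *\<^sub>R h (t - s))"
    by (rule Bochner_Integration.integrable_cong[THEN iffD1, rotated -1]) (auto simp: indicator_def)
  then show ?thesis by (simp add: lebesgue_on_lborel_integral)
qed

lemma integrable_translate:
  fixes h :: "real \<Rightarrow> 'b::{banach, second_countable_topology}"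
  assumes h [measurable]: "h \<in> borel_measurable borel" and i: "integrable (lebesgue_on {0<..<t}) h" and r: "0 \<le> r"
  shows "integrable (lebesgue_on {0<..<t}) (\<lambda>s. if r < s then h (s - r) else 0)"
proof -
  have "integrable (lebesgue_on {0<..<t - r}) h" by (rule integrable_initial_interval[OF i]) (use r in simp)
  then have "integrable lborel (\<lambda>s. indicator {0<..<t - r} (- r + 1 * s) *\<^sub>R h (- r + 1 * s))"
    by (intro lborel_integrable_real_affine) (simp_all add: lebesgue_on_lborel_integral)
  then have "integrable lborel (\<lambda>s. indicator {0<..<t} s *\<^sub>R (if r < s then h (s - r) else 0))"
    by (rule Bochner_Integration.integrable_cong[THEN iffD1, rotated -1]) (use r in \<open>auto simp: indicator_def\<close>)
  then show ?thesis by (subst lebesgue_on_lborel_integral) measurable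
qed

lemma convolve_commute:
  assumes [measurable]: "a \<in> borel_measurable borel" "c \<in> borel_measurable borel"
  shows "convolve a c t = convolve c a t"
  unfolding convolve_def using integral_reflect[of "\<lambda>s. a s * c (t - s)" t]
  by (simp add: mult.commute)

lemma finite_measure_interval: "finite_measure (lebesgue_on {0<..<t::real})"
  by (rule finite_measure_lebesgue_on) simp

lemma pair_sigma_finite_interval: "pair_sigma_finite (lebesgue_on {0<..<s::real}) (lebesgue_on {0<..<t::real})"
  by (intro pair_sigma_finite.intro finite_measure.axioms(1) finite_measure_interval)

lemma integrable_bounded_mult:
  fixes f g :: "real \<Rightarrow> real"
  assumes f: "integrable (lebesgue_on {0<..<t}) f"
    and g: "g \<in> borel_measurable (lebesgue_on {0<..<t})" "\<And>x. 0 < x \<Longrightarrow> x < t \<Longrightarrow> \<bar>g x\<bar> \<le> C"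
  shows "integrable (lebesgue_on {0<..<t}) (\<lambda>x. f x * g x)"
proof (rule Bochner_Integration.integrable_bound[OF integrable_mult_right[OF f, of C]])
  show "(\<lambda>x. f x * g x) \<in> borel_measurable (lebesgue_on {0<..<t})"
    using f g by auto
  show "AE x in lebesgue_on {0<..<t}. norm (f x * g x) \<le> norm (C * f x)"
    by (rule AE_I2) (auto simp: abs_mult mult.commute[of "\<bar>f _\<bar>"] intro!: mult_right_mono order_trans[OF g(2)])
qed

context
  fixes T :: real and a b c :: "real \<Rightarrow> real"
  assumes a [measurable]: "a \<in> borel_measurable borel" and b [measurable]: "b \<in> borel_measurable borel"
    and c [measurable]: "c \<in> borel_measurable (lebesgue_on {0<..<T})"
begin

text \<open>Associativity of the convolution at \<open>T\<close> is Fubini's theorem for this function on the square. The kernels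
are singular at \<open>0\<close> and some sources are only integrable, so its integrability is established
separately according to which of the three factors is bounded.\<close>

definition triangle_integrand :: "real \<times> real \<Rightarrow> real" where
  "triangle_integrand = (\<lambda>(s, r). if r < s then a (T - s) * b (s - r) * c r else 0)"

lemma triangle_integrand_measurable [measurable]:
  "triangle_integrand \<in> borel_measurable (lebesgue_on {0<..<T} \<Otimes>\<^sub>M lebesgue_on {0<..<T})"
  unfolding triangle_integrand_def by measurable

lemma convolve_assoc_of_integrable:
  assumes i: "integrable (lebesgue_on {0<..<T} \<Otimes>\<^sub>M lebesgue_on {0<..<T}) triangle_integrand"
  shows "convolve a (convolve b c) T = convolve (convolve a b) c T"
proof -
  let ?M = "lebesgue_on {0<..<T}"
  interpret pair_sigma_finite ?M ?M by (rule pair_sigma_finite_interval)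
  have "convolve a (convolve b c) T = (\<integral>s. (\<integral>r. triangle_integrand (s, r) \<partial>?M) \<partial>?M)"
    unfolding convolve_def[of a]
  proof (rule Bochner_Integration.integral_cong[OF refl])
    fix s assume "s \<in> space ?M"
    then have s: "0 < s" "s < T" by auto
    have "a (T - s) * convolve b c s = (\<integral>r. a (T - s) * (if r < s then b (s - r) * c r else 0) \<partial>?M)"
      unfolding convolve_def by (subst integral_initial_interval[of s T]) (use s in auto)
    also have "\<dots> = (\<integral>r. triangle_integrand (s, r) \<partial>?M)"
      by (intro Bochner_Integration.integral_cong) (auto simp: triangle_integrand_def)
    finally show "a (T - s) * convolve b c s = (\<integral>r. triangle_integrand (s, r) \<partial>?M)" .
  qed
  also have "\<dots> = (\<integral>r. (\<integral>s. triangle_integrand (s, r) \<partial>?M) \<partial>?M)"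
    using Fubini_integral[of "curry triangle_integrand"] i by (simp add: curry_def)
  also have "\<dots> = convolve (convolve a b) c T"
    unfolding convolve_def[of "convolve a b"]
  proof (rule Bochner_Integration.integral_cong[OF refl])
    fix r assume "r \<in> space ?M"
    then have r: "0 < r" "r < T" by auto
    have "(\<integral>s. triangle_integrand (s, r) \<partial>?M) = (\<integral>s. (if r < s then a (T - r - (s - r)) * b (s - r) else 0) * c r \<partial>?M)"
      by (intro Bochner_Integration.integral_cong) (auto simp: triangle_integrand_def)
    also have "\<dots> = (\<integral>s. (if r < s then a (T - r - (s - r)) * b (s - r) else 0) \<partial>?M) * c r"
      by simp
    also have "(\<integral>s. (if r < s then a (T - r - (s - r)) * b (s - r) else 0) \<partial>?M) = convolve a b (T - r)"
      unfolding convolve_def using integral_translate[of "\<lambda>x. a (T - r - x) * b x" r T] r by simp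
    finally show "(\<integral>s. triangle_integrand (s, r) \<partial>?M) = convolve a b (T - r) * c r" .
  qed
  finally show ?thesis .
qed

lemma triangle_integrable_right_bounded:
  assumes ai: "integrable (lebesgue_on {0<..<T}) a" and bi: "integrable (lebesgue_on {0<..<T}) b"
    and C: "\<And>r. 0 < r \<Longrightarrow> r < T \<Longrightarrow> \<bar>c r\<bar> \<le> C"
  shows "integrable (lebesgue_on {0<..<T} \<Otimes>\<^sub>M lebesgue_on {0<..<T}) triangle_integrand"
proof -
  let ?M = "lebesgue_on {0<..<T}"
  interpret pair_sigma_finite ?M ?M by (rule pair_sigma_finite_interval)
  define B where "B = (\<integral>s. \<bar>b s\<bar> \<partial>?M)"
  have inner: "integrable ?M (\<lambda>r. triangle_integrand (s, r)) \<and> (\<integral>r. norm (triangle_integrand (s, r)) \<partial>?M) \<le> \<bar>a (T - s)\<bar> * (B * C)"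
    if s: "s \<in> space ?M" for s
  proof -
    have sT: "0 < s" "s < T" using s by auto
    have bs: "integrable (lebesgue_on {0<..<s}) (\<lambda>r. \<bar>b r\<bar>)"
      using integrable_initial_interval[OF bi, of s] sT by auto
    then have "integrable (lebesgue_on {0<..<s}) (\<lambda>r. \<bar>b (s - r)\<bar>)"
      by (intro integrable_reflect[where h = "\<lambda>r. \<bar>b r\<bar>"]) auto
    then have bs': "integrable ?M (\<lambda>r. if r < s then \<bar>b (s - r)\<bar> else 0)"
      using sT by (subst (asm) integrable_restrict_space, simp, subst integrable_restrict_space, simp)
        (erule Bochner_Integration.integrable_cong[THEN iffD1, rotated -1], auto simp: indicator_def)
    have bs'': "integrable ?M (\<lambda>r. \<bar>a (T - s)\<bar> * C * (if r < s then \<bar>b (s - r)\<bar> else 0))"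
      using bs' by (rule integrable_mult_right)
    have le: "norm (triangle_integrand (s, r)) \<le> \<bar>a (T - s)\<bar> * C * (if r < s then \<bar>b (s - r)\<bar> else 0)"
      if "r \<in> space ?M" for r
    proof (cases "r < s")
      case True
      have "\<bar>a (T - s)\<bar> * \<bar>b (s - r)\<bar> * \<bar>c r\<bar> \<le> \<bar>a (T - s)\<bar> * \<bar>b (s - r)\<bar> * C"
        using that C[of r] by (intro mult_left_mono) auto
      with True show ?thesis by (simp add: triangle_integrand_def abs_mult mult_ac)
    qed (simp add: triangle_integrand_def)
    have m: "(\<lambda>r. triangle_integrand (s, r)) \<in> borel_measurable ?M"
      using s by measurable
    have i: "integrable ?M (\<lambda>r. triangle_integrand (s, r))"
      by (rule Bochner_Integration.integrable_bound[OF bs'' m]) (rule AE_I2, rule order_trans[OF le], simp_all)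
    have "(\<integral>r. norm (triangle_integrand (s, r)) \<partial>?M) \<le> (\<integral>r. \<bar>a (T - s)\<bar> * C * (if r < s then \<bar>b (s - r)\<bar> else 0) \<partial>?M)"
      using i bs'' le by (intro integral_mono) auto
    also have "\<dots> = \<bar>a (T - s)\<bar> * C * (\<integral>r. \<bar>b r\<bar> \<partial>lebesgue_on {0<..<s})"
      using integral_initial_interval[of s T "\<lambda>r. \<bar>b (s - r)\<bar>"] integral_reflect[of "\<lambda>r. \<bar>b r\<bar>" s] sT by simp
    also have "\<dots> \<le> \<bar>a (T - s)\<bar> * C * B"
    proof (rule mult_left_mono)
      show "(\<integral>r. \<bar>b r\<bar> \<partial>lebesgue_on {0<..<s}) \<le> B"
        unfolding B_def using bi sT by (subst integral_initial_interval[of s T])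
          (auto intro!: integral_mono_AE' )
      show "0 \<le> \<bar>a (T - s)\<bar> * C" using C[of "T / 2"] sT by (auto intro!: mult_nonneg_nonneg)
    qed
    finally show ?thesis using i by (simp add: mult_ac)
  qed
  have "integrable ?M (\<lambda>s. a (T - s))" using ai by (intro integrable_reflect) auto
  then have ar: "integrable ?M (\<lambda>s. \<bar>a (T - s)\<bar> * (B * C))" by auto
  show ?thesis
  proof (rule Fubini_integrable[OF triangle_integrand_measurable])
    show "integrable ?M (\<lambda>s. \<integral>r. norm (triangle_integrand (s, r)) \<partial>?M)"
    proof (rule Bochner_Integration.integrable_bound[OF ar])
      show "(\<lambda>s. \<integral>r. norm (triangle_integrand (s, r)) \<partial>?M) \<in> borel_measurable ?M" by measurable
      show "AE s in ?M. norm (\<integral>r. norm (triangle_integrand (s, r)) \<partial>?M) \<le> norm (\<bar>a (T - s)\<bar> * (B * C))"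
        by (rule AE_I2, subst (1) real_norm_def, subst abs_of_nonneg, rule Bochner_Integration.integral_nonneg, simp,
            rule order_trans[OF conjunct2[OF inner]], simp_all)
    qed
    show "AE s in ?M. integrable ?M (\<lambda>r. triangle_integrand (s, r))"
      by (rule AE_I2) (use inner in blast)
  qed
qed

lemma triangle_integrable_left_bounded:
  assumes A: "\<And>s. 0 < s \<Longrightarrow> s < T \<Longrightarrow> \<bar>a s\<bar> \<le> A" and bi: "integrable (lebesgue_on {0<..<T}) b"
    and ci: "integrable (lebesgue_on {0<..<T}) c"
  shows "integrable (lebesgue_on {0<..<T} \<Otimes>\<^sub>M lebesgue_on {0<..<T}) triangle_integrand"
    and "(\<integral>s. \<integral>r. \<bar>triangle_integrand (s, r)\<bar> \<partial>lebesgue_on {0<..<T} \<partial>lebesgue_on {0<..<T})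
      \<le> A * (\<integral>s. \<bar>b s\<bar> \<partial>lebesgue_on {0<..<T}) * (\<integral>r. \<bar>c r\<bar> \<partial>lebesgue_on {0<..<T})"
proof -
  let ?M = "lebesgue_on {0<..<T}"
  interpret pair_sigma_finite ?M ?M by (rule pair_sigma_finite_interval)
  define B where "B = (\<integral>s. \<bar>b s\<bar> \<partial>?M)"
  have inner: "integrable ?M (\<lambda>s. triangle_integrand (s, r)) \<and> (\<integral>s. norm (triangle_integrand (s, r)) \<partial>?M) \<le> A * B * \<bar>c r\<bar>"
    if r: "r \<in> space ?M" for r
  proof -
    have rT: "0 < r" "r < T" using r by auto
    have bs': "integrable ?M (\<lambda>s. if r < s then \<bar>b (s - r)\<bar> else 0)"
      using bi rT by (intro integrable_translate[where h = "\<lambda>s. \<bar>b s\<bar>"]) auto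
    have bs'': "integrable ?M (\<lambda>s. \<bar>c r\<bar> * A * (if r < s then \<bar>b (s - r)\<bar> else 0))"
      using bs' by (rule integrable_mult_right)
    have le: "norm (triangle_integrand (s, r)) \<le> \<bar>c r\<bar> * A * (if r < s then \<bar>b (s - r)\<bar> else 0)"
      if "s \<in> space ?M" for s
    proof (cases "r < s")
      case True
      have "\<bar>a (T - s)\<bar> * (\<bar>b (s - r)\<bar> * \<bar>c r\<bar>) \<le> A * (\<bar>b (s - r)\<bar> * \<bar>c r\<bar>)"
        using that by (intro mult_right_mono A) auto
      with True show ?thesis by (simp add: triangle_integrand_def abs_mult mult_ac)
    qed (simp add: triangle_integrand_def)
    have m: "(\<lambda>s. triangle_integrand (s, r)) \<in> borel_measurable ?M"
      using r by measurable
    have i: "integrable ?M (\<lambda>s. triangle_integrand (s, r))"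
      by (rule Bochner_Integration.integrable_bound[OF bs'' m]) (rule AE_I2, rule order_trans[OF le], simp_all)
    have A0: "0 \<le> A" using A[of "T / 2"] rT by auto
    have "(\<integral>s. norm (triangle_integrand (s, r)) \<partial>?M) \<le> (\<integral>s. \<bar>c r\<bar> * A * (if r < s then \<bar>b (s - r)\<bar> else 0) \<partial>?M)"
      using i bs'' le by (intro integral_mono) auto
    also have "\<dots> = \<bar>c r\<bar> * A * (\<integral>s. \<bar>b s\<bar> \<partial>lebesgue_on {0<..<T - r})"
      using integral_translate[of "\<lambda>r. \<bar>b r\<bar>" r T] rT by simp
    also have "\<dots> \<le> \<bar>c r\<bar> * A * B"
    proof (rule mult_left_mono)
      show "(\<integral>r. \<bar>b r\<bar> \<partial>lebesgue_on {0<..<T - r}) \<le> B"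
        unfolding B_def using bi rT by (subst integral_initial_interval[of "T - r" T])
          (auto intro!: integral_mono_AE')
      show "0 \<le> \<bar>c r\<bar> * A" using A0 by auto
    qed
    finally show ?thesis using i by (simp add: mult_ac)
  qed
  have cr: "integrable ?M (\<lambda>r. A * B * \<bar>c r\<bar>)" using ci by auto
  have ir: "integrable ?M (\<lambda>r. \<integral>s. norm (triangle_integrand (s, r)) \<partial>?M)"
  proof (rule Bochner_Integration.integrable_bound[OF cr])
    show "(\<lambda>r. \<integral>s. norm (triangle_integrand (s, r)) \<partial>?M) \<in> borel_measurable ?M" by measurable
    show "AE r in ?M. norm (\<integral>s. norm (triangle_integrand (s, r)) \<partial>?M) \<le> norm (A * B * \<bar>c r\<bar>)"
      by (rule AE_I2, subst (1) real_norm_def, subst abs_of_nonneg, rule Bochner_Integration.integral_nonneg, simp,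
            rule order_trans[OF conjunct2[OF inner]], simp_all)
  qed
  have "integrable (?M \<Otimes>\<^sub>M ?M) (\<lambda>(r, s). triangle_integrand (s, r))"
  proof (rule Fubini_integrable)
    show "(\<lambda>(r, s). triangle_integrand (s, r)) \<in> borel_measurable (?M \<Otimes>\<^sub>M ?M)" by measurable
    show "integrable ?M (\<lambda>r. \<integral>s. norm (case (r, s) of (r, s) \<Rightarrow> triangle_integrand (s, r)) \<partial>?M)" using ir by simp
    show "AE r in ?M. integrable ?M (\<lambda>s. case (r, s) of (r, s) \<Rightarrow> triangle_integrand (s, r))"
      by (rule AE_I2) (use inner in simp)
  qed
  then show i: "integrable (?M \<Otimes>\<^sub>M ?M) triangle_integrand"
    using integrable_product_swap[of "\<lambda>(r, s). triangle_integrand (s, r)"] by (simp add: case_prod_beta')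
  have "(\<integral>s. \<integral>r. \<bar>triangle_integrand (s, r)\<bar> \<partial>?M \<partial>?M) = (\<integral>r. \<integral>s. \<bar>triangle_integrand (s, r)\<bar> \<partial>?M \<partial>?M)"
    using Fubini_integral[of "\<lambda>s r. \<bar>triangle_integrand (s, r)\<bar>"] integrable_abs[OF i] by (simp add: case_prod_beta')
  also have "\<dots> \<le> (\<integral>r. A * B * \<bar>c r\<bar> \<partial>?M)"
    using ir inner cr by (intro integral_mono) auto
  finally show "(\<integral>s. \<integral>r. \<bar>triangle_integrand (s, r)\<bar> \<partial>?M \<partial>?M) \<le> A * (\<integral>s. \<bar>b s\<bar> \<partial>?M) * (\<integral>r. \<bar>c r\<bar> \<partial>?M)"
    by (simp add: B_def)
qed

lemma triangle_integrable_middle_bounded: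
  assumes ai: "integrable (lebesgue_on {0<..<T}) a" and B: "\<And>r. 0 < r \<Longrightarrow> r < T \<Longrightarrow> \<bar>b r\<bar> \<le> B"
    and ci: "integrable (lebesgue_on {0<..<T}) c"
  shows "integrable (lebesgue_on {0<..<T} \<Otimes>\<^sub>M lebesgue_on {0<..<T}) triangle_integrand"
proof -
  let ?M = "lebesgue_on {0<..<T}"
  interpret pair_sigma_finite ?M ?M by (rule pair_sigma_finite_interval)
  have inner: "integrable ?M (\<lambda>r. triangle_integrand (s, r)) \<and>
      (\<integral>r. norm (triangle_integrand (s, r)) \<partial>?M) \<le> \<bar>a (T - s)\<bar> * (B * (\<integral>r. \<bar>c r\<bar> \<partial>?M))"
    if s: "s \<in> space ?M" for s
  proof -
    have sT: "0 < s" "s < T" using s by auto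
    have B0: "0 \<le> B" using B[of "T / 2"] sT by auto
    have dom: "integrable ?M (\<lambda>r. \<bar>a (T - s)\<bar> * B * \<bar>c r\<bar>)" using ci by auto
    have le: "norm (triangle_integrand (s, r)) \<le> \<bar>a (T - s)\<bar> * B * \<bar>c r\<bar>" if "r \<in> space ?M" for r
    proof (cases "r < s")
      case True
      have "\<bar>a (T - s)\<bar> * \<bar>b (s - r)\<bar> * \<bar>c r\<bar> \<le> \<bar>a (T - s)\<bar> * B * \<bar>c r\<bar>"
        using that B[of "s - r"] sT True by (intro mult_right_mono mult_left_mono) auto
      with True show ?thesis by (simp add: triangle_integrand_def abs_mult)
    qed (use B0 in \<open>simp add: triangle_integrand_def\<close>)
    have m: "(\<lambda>r. triangle_integrand (s, r)) \<in> borel_measurable ?M" using s by measurable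
    have i: "integrable ?M (\<lambda>r. triangle_integrand (s, r))"
      by (rule Bochner_Integration.integrable_bound[OF dom m]) (rule AE_I2, rule order_trans[OF le], simp_all)
    have "(\<integral>r. norm (triangle_integrand (s, r)) \<partial>?M) \<le> (\<integral>r. \<bar>a (T - s)\<bar> * B * \<bar>c r\<bar> \<partial>?M)"
      using i dom le by (intro integral_mono) auto
    then show ?thesis using i by (simp add: mult.assoc)
  qed
  have "integrable ?M (\<lambda>s. a (T - s))" using ai by (intro integrable_reflect) auto
  then have ar: "integrable ?M (\<lambda>s. \<bar>a (T - s)\<bar> * (B * (\<integral>r. \<bar>c r\<bar> \<partial>?M)))" by auto
  show ?thesis
  proof (rule Fubini_integrable[OF triangle_integrand_measurable])
    show "integrable ?M (\<lambda>s. \<integral>r. norm (triangle_integrand (s, r)) \<partial>?M)"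
    proof (rule Bochner_Integration.integrable_bound[OF ar])
      show "(\<lambda>s. \<integral>r. norm (triangle_integrand (s, r)) \<partial>?M) \<in> borel_measurable ?M" by measurable
      show "AE s in ?M. norm (\<integral>r. norm (triangle_integrand (s, r)) \<partial>?M) \<le> norm (\<bar>a (T - s)\<bar> * (B * (\<integral>r. \<bar>c r\<bar> \<partial>?M)))"
        by (rule AE_I2, subst (1) real_norm_def, subst abs_of_nonneg, rule Bochner_Integration.integral_nonneg, simp,
            rule order_trans[OF conjunct2[OF inner]], simp_all)
    qed
    show "AE s in ?M. integrable ?M (\<lambda>r. triangle_integrand (s, r))"
      by (rule AE_I2) (use inner in blast)
  qed
qed

lemmas convolve_assoc_middle_bounded = convolve_assoc_of_integrable[OF triangle_integrable_middle_bounded]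
lemmas convolve_assoc_right_bounded = convolve_assoc_of_integrable[OF triangle_integrable_right_bounded]
lemmas convolve_assoc_left_bounded = convolve_assoc_of_integrable[OF triangle_integrable_left_bounded(1)]

end

section \<open>Power kernels and Mittag-Leffler kernels\<close>

text \<open>The kernel of the Riemann-Liouville integral of order \<open>\<mu>\<close>.\<close>

definition frac_kernel :: "real \<Rightarrow> real \<Rightarrow> real" where
  "frac_kernel \<mu> t = t powr (\<mu> - 1) / Gamma \<mu>"

definition ml_kernel :: "real \<Rightarrow> real \<Rightarrow> real \<Rightarrow> real \<Rightarrow> real" where
  "ml_kernel \<alpha> \<beta> \<kappa> t = t powr (\<beta> - 1) * mittag_leffler \<alpha> \<beta> (- \<kappa> * t powr \<alpha>)"

lemma frac_kernel_measurable [measurable]: "frac_kernel \<mu> \<in> borel_measurable borel"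
  unfolding frac_kernel_def by measurable

lemma frac_kernel_nonneg: "0 < \<mu> \<Longrightarrow> 0 \<le> frac_kernel \<mu> t"
  unfolding frac_kernel_def using Gamma_real_pos[of \<mu>] by auto

lemma powr_integrable:
  fixes \<mu> t :: real
  assumes "0 < \<mu>" "0 \<le> t"
  shows "integrable (lebesgue_on {0<..<t}) (\<lambda>\<tau>. \<tau> powr (\<mu> - 1))"
    and "(\<integral>\<tau>. \<tau> powr (\<mu> - 1) \<partial>lebesgue_on {0<..<t}) = t powr \<mu> / \<mu>"
proof -
  have "((\<lambda>x. x powr (\<mu> - 1)) has_integral (t powr \<mu> / \<mu>)) {0..t}"
    using has_integral_powr_from_0[of "\<mu> - 1" t] assms by simp
  then have *: "((\<lambda>x. x powr (\<mu> - 1)) has_integral (t powr \<mu> / \<mu>)) {0<..<t}"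
    by (metis has_integral_open_interval box_real(1) cbox_interval)
  note has_integral_nonneg_lebesgue_on[OF *]
  then show "integrable (lebesgue_on {0<..<t}) (\<lambda>\<tau>. \<tau> powr (\<mu> - 1))"
    "(\<integral>\<tau>. \<tau> powr (\<mu> - 1) \<partial>lebesgue_on {0<..<t}) = t powr \<mu> / \<mu>" by auto
qed

lemma frac_kernel_integrable: "0 < \<mu> \<Longrightarrow> 0 \<le> t \<Longrightarrow> integrable (lebesgue_on {0<..<t}) (frac_kernel \<mu>)"
  unfolding frac_kernel_def[abs_def] using powr_integrable(1) by auto

lemma frac_kernel_convolution:
  assumes "0 < \<mu>" "0 < \<nu>" "0 < t"
  shows "integrable (lebesgue_on {0<..<t}) (\<lambda>\<tau>. frac_kernel \<mu> (t - \<tau>) * frac_kernel \<nu> \<tau>)"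
    and "convolve (frac_kernel \<mu>) (frac_kernel \<nu>) t = frac_kernel (\<mu> + \<nu>) t"
proof -
  define f where "f x = x powr (\<nu> - 1) * (1 - x) powr (\<mu> - 1)" for x :: real
  define C where "C = t powr (\<mu> + \<nu> - 2) / (Gamma \<mu> * Gamma \<nu>)"
  have "(f has_integral Beta \<nu> \<mu>) (cbox 0 1)"
    unfolding f_def using has_integral_Beta_real[of \<nu> \<mu>] assms by simp
  from has_integral_affinity[OF this, of "1 / t" 0]
  have "((\<lambda>x. f (1 / t * x)) has_integral t * Beta \<nu> \<mu>) (cbox 0 t)" using assms by simp
  then have "((\<lambda>x. f (1 / t * x)) has_integral t * Beta \<nu> \<mu>) {0<..<t}"
    by (metis has_integral_open_interval box_real(1) cbox_interval)
  then have "((\<lambda>x. C * f (1 / t * x)) has_integral C * (t * Beta \<nu> \<mu>)) {0<..<t}"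
    by (rule has_integral_mult_right)
  moreover have "C * f (1 / t * x) = frac_kernel \<mu> (t - x) * frac_kernel \<nu> x" if "x \<in> {0<..<t}" for x
  proof -
    have x: "0 < x" "x < t" using that by auto
    have "f (1 / t * x) = (x / t) powr (\<nu> - 1) * ((t - x) / t) powr (\<mu> - 1)"
      using x by (simp add: f_def diff_divide_distrib)
    also have "\<dots> = x powr (\<nu> - 1) * (t - x) powr (\<mu> - 1) / (t powr (\<nu> - 1) * t powr (\<mu> - 1))"
      using x by (simp add: powr_divide)
    also have "t powr (\<nu> - 1) * t powr (\<mu> - 1) = t powr (\<mu> + \<nu> - 2)" by (simp add: add_ac flip: powr_add)
    finally show ?thesis using x by (simp add: C_def frac_kernel_def mult_ac)
  qed
  ultimately have *: "((\<lambda>x. frac_kernel \<mu> (t - x) * frac_kernel \<nu> x) has_integral C * (t * Beta \<nu> \<mu>)) {0<..<t}"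
    by (rule has_integral_eq[rotated])
  have I: "C * (t * Beta \<nu> \<mu>) = frac_kernel (\<mu> + \<nu>) t"
  proof -
    have 1: "t * t powr (\<mu> + \<nu> - 2) = t powr (\<mu> + \<nu> - 1)"
    proof -
      have "t powr (1 + (\<mu> + \<nu> - 2)) = t powr 1 * t powr (\<mu> + \<nu> - 2)" by (rule powr_add)
      moreover have "1 + (\<mu> + \<nu> - 2) = \<mu> + \<nu> - 1" by simp
      ultimately show ?thesis using assms(3) by simp
    qed
    have 2: "a / (x * y) * (t * (y * x / z)) = t * a / z" if "x > 0" "y > 0" for a x y z :: real
      using that by (simp add: field_simps)
    have "C * (t * Beta \<nu> \<mu>) = t * t powr (\<mu> + \<nu> - 2) / Gamma (\<nu> + \<mu>)"
      unfolding C_def Beta_def by (rule 2) (use assms in auto)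
    then show ?thesis by (simp only: 1 frac_kernel_def add.commute[of \<nu> \<mu>])
  qed
  note has_integral_nonneg_lebesgue_on[OF *[unfolded I]]
  then show "integrable (lebesgue_on {0<..<t}) (\<lambda>\<tau>. frac_kernel \<mu> (t - \<tau>) * frac_kernel \<nu> \<tau>)"
    "convolve (frac_kernel \<mu>) (frac_kernel \<nu>) t = frac_kernel (\<mu> + \<nu>) t"
    using assms by (auto simp: convolve_def intro!: mult_nonneg_nonneg frac_kernel_nonneg)
qed

context
  fixes \<alpha> :: real
  assumes alpha: "1 < \<alpha>" "\<alpha> < 2"
begin

lemma mittag_leffler_sums:
  "0 < \<beta> \<Longrightarrow> (\<lambda>n. z ^ n / Gamma (\<alpha> * real n + \<beta>)) sums mittag_leffler \<alpha> \<beta> z"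
  unfolding mittag_leffler_def
  by (rule summable_sums, rule summable_norm_cancel, rule mittag_leffler_summable[OF alpha])

lemma mittag_leffler_isCont: "0 < \<beta> \<Longrightarrow> isCont (mittag_leffler \<alpha> \<beta>) z"
proof -
  assume b: "0 < \<beta>"
  have "isCont (\<lambda>x. \<Sum>n. (1 / Gamma (\<alpha> * real n + \<beta>)) * x ^ n) z"
    using summable_norm_cancel[OF mittag_leffler_summable[OF alpha b]]
    by (intro isCont_powser_converges_everywhere) simp
  then show ?thesis unfolding mittag_leffler_def[abs_def] by simp
qed

lemma mittag_leffler_continuous: "0 < \<beta> \<Longrightarrow> continuous_on S (mittag_leffler \<alpha> \<beta>)"
  using mittag_leffler_isCont continuous_at_imp_continuous_on by blast

lemma mittag_leffler_zero: "mittag_leffler \<alpha> \<beta> 0 = 1 / Gamma \<beta>"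
  unfolding mittag_leffler_def by (subst suminf_finite[of "{0}"]) auto

lemma mittag_leffler_measurable: "0 < \<beta> \<Longrightarrow> mittag_leffler \<alpha> \<beta> \<in> borel_measurable borel"
  using mittag_leffler_continuous by (rule borel_measurable_continuous_onI)

lemma ml_kernel_measurable: "0 < \<beta> \<Longrightarrow> ml_kernel \<alpha> \<beta> \<kappa> \<in> borel_measurable borel"
  unfolding ml_kernel_def[abs_def]
  using measurable_compose[OF _ mittag_leffler_measurable, of "\<lambda>t. - \<kappa> * t powr \<alpha>" borel \<beta>] by measurable

lemma ml_kernel_sums:
  assumes "0 < \<beta>" "0 < t"
  shows "(\<lambda>n. (- \<kappa>) ^ n * frac_kernel (\<alpha> * real n + \<beta>) t) sums ml_kernel \<alpha> \<beta> \<kappa> t"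
    and "summable (\<lambda>n. \<bar>\<kappa>\<bar> ^ n * frac_kernel (\<alpha> * real n + \<beta>) t)"
proof -
  have *: "z ^ n * frac_kernel (\<alpha> * real n + \<beta>) t = t powr (\<beta> - 1) * ((z * t powr \<alpha>) ^ n / Gamma (\<alpha> * real n + \<beta>))" for n z
  proof -
    have "t powr (\<alpha> * real n + \<beta> - 1) = t powr (\<beta> - 1) * (t powr \<alpha>) ^ n"
      using assms by (simp add: powr_realpow[symmetric] powr_powr powr_add[symmetric] algebra_simps)
    then show ?thesis by (simp add: frac_kernel_def power_mult_distrib)
  qed
  show "(\<lambda>n. (- \<kappa>) ^ n * frac_kernel (\<alpha> * real n + \<beta>) t) sums ml_kernel \<alpha> \<beta> \<kappa> t"
    unfolding * ml_kernel_def by (intro sums_mult mittag_leffler_sums assms)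
  show "summable (\<lambda>n. \<bar>\<kappa>\<bar> ^ n * frac_kernel (\<alpha> * real n + \<beta>) t)"
    unfolding * by (intro summable_mult summable_norm_cancel[OF mittag_leffler_summable[OF alpha]] assms)
qed

text \<open>The series may be integrated termwise since the integrals of the absolute values of its terms form the
series of a Mittag-Leffler function at a positive argument.\<close>

lemma frac_kernel_ml_kernel_convolution:
  assumes "0 < \<mu>" "0 < \<beta>" "0 < t"
  shows "convolve (frac_kernel \<mu>) (ml_kernel \<alpha> \<beta> \<kappa>) t = ml_kernel \<alpha> (\<beta> + \<mu>) \<kappa> t"
proof -
  let ?M = "lebesgue_on {0<..<t}"
  define f where "f n \<tau> = frac_kernel \<mu> (t - \<tau>) * ((- \<kappa>) ^ n * frac_kernel (\<alpha> * real n + \<beta>) \<tau>)" for n \<tau>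
  have pos: "\<alpha> * real n + \<beta> > 0" for n using alpha assms by (simp add: add_nonneg_pos)
  have f: "f n = (\<lambda>\<tau>. (- \<kappa>) ^ n * (frac_kernel \<mu> (t - \<tau>) * frac_kernel (\<alpha> * real n + \<beta>) \<tau>))" for n
    by (auto simp: f_def)
  have fint: "integrable ?M (f n)" for n
    unfolding f using frac_kernel_convolution(1)[OF assms(1) pos assms(3)] by (rule integrable_mult_right)
  have fI: "(\<integral>\<tau>. f n \<tau> \<partial>?M) = (- \<kappa>) ^ n * frac_kernel (\<alpha> * real n + (\<beta> + \<mu>)) t" for n
    unfolding f using frac_kernel_convolution(2)[OF assms(1) pos assms(3)] by (simp add: convolve_def add_ac)
  have nf: "norm (f n \<tau>) = \<bar>\<kappa>\<bar> ^ n * (frac_kernel \<mu> (t - \<tau>) * frac_kernel (\<alpha> * real n + \<beta>) \<tau>)" for n \<tau>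
    unfolding f using frac_kernel_nonneg[OF assms(1)] frac_kernel_nonneg[OF pos] by (simp add: abs_mult power_abs)
  have nfI: "(\<integral>\<tau>. norm (f n \<tau>) \<partial>?M) = \<bar>\<kappa>\<bar> ^ n * frac_kernel (\<alpha> * real n + (\<beta> + \<mu>)) t" for n
    unfolding nf using frac_kernel_convolution(2)[OF assms(1) pos assms(3)] by (simp add: convolve_def add_ac)
  have ae: "AE \<tau> in ?M. summable (\<lambda>n. norm (f n \<tau>))"
  proof (rule AE_I2)
    fix \<tau> assume "\<tau> \<in> space ?M"
    then have "summable (\<lambda>n. frac_kernel \<mu> (t - \<tau>) * (\<bar>\<kappa>\<bar> ^ n * frac_kernel (\<alpha> * real n + \<beta>) \<tau>))"
      by (intro summable_mult ml_kernel_sums(2)) (use assms in auto)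
    then show "summable (\<lambda>n. norm (f n \<tau>))" unfolding nf by (simp add: mult_ac)
  qed
  have sum: "summable (\<lambda>n. \<integral>\<tau>. norm (f n \<tau>) \<partial>?M)"
    unfolding nfI by (rule ml_kernel_sums(2)) (use assms in auto)
  have "(\<lambda>n. \<integral>\<tau>. f n \<tau> \<partial>?M) sums (\<integral>\<tau>. (\<Sum>n. f n \<tau>) \<partial>?M)"
    by (rule sums_integral[OF fint ae sum])
  moreover have "(\<integral>\<tau>. (\<Sum>n. f n \<tau>) \<partial>?M) = convolve (frac_kernel \<mu>) (ml_kernel \<alpha> \<beta> \<kappa>) t"
    unfolding convolve_def
  proof (rule Bochner_Integration.integral_cong[OF refl])
    fix \<tau> assume "\<tau> \<in> space ?M"
    then have "(\<lambda>n. f n \<tau>) sums (frac_kernel \<mu> (t - \<tau>) * ml_kernel \<alpha> \<beta> \<kappa> \<tau>)"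
      unfolding f_def by (intro sums_mult ml_kernel_sums(1)) (use assms in auto)
    then show "(\<Sum>n. f n \<tau>) = frac_kernel \<mu> (t - \<tau>) * ml_kernel \<alpha> \<beta> \<kappa> \<tau>" by (simp add: sums_iff)
  qed
  moreover have "(\<lambda>n. \<integral>\<tau>. f n \<tau> \<partial>?M) sums ml_kernel \<alpha> (\<beta> + \<mu>) \<kappa> t"
    unfolding fI by (rule ml_kernel_sums(1)) (use assms in auto)
  ultimately show ?thesis using sums_unique2 by metis
qed

lemma ml_kernel_recurrence:
  assumes "0 < \<beta>" "0 < t"
  shows "\<kappa> * ml_kernel \<alpha> (\<beta> + \<alpha>) \<kappa> t = frac_kernel \<beta> t - ml_kernel \<alpha> \<beta> \<kappa> t"
proof -
  have "(\<lambda>n. (- \<kappa>) ^ Suc n * frac_kernel (\<alpha> * real (Suc n) + \<beta>) t) sums (ml_kernel \<alpha> \<beta> \<kappa> t - frac_kernel \<beta> t)"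
    using ml_kernel_sums(1)[OF assms, of \<kappa>] by (subst sums_Suc_iff) simp
  moreover have "(\<lambda>n. - \<kappa> * ((- \<kappa>) ^ n * frac_kernel (\<alpha> * real n + (\<beta> + \<alpha>)) t)) sums (- \<kappa> * ml_kernel \<alpha> (\<beta> + \<alpha>) \<kappa> t)"
    by (intro sums_mult ml_kernel_sums(1)) (use assms alpha in auto)
  then have "(\<lambda>n. (- \<kappa>) ^ Suc n * frac_kernel (\<alpha> * real (Suc n) + \<beta>) t) sums (- \<kappa> * ml_kernel \<alpha> (\<beta> + \<alpha>) \<kappa> t)"
    by (simp add: algebra_simps)
  ultimately have "ml_kernel \<alpha> \<beta> \<kappa> t - frac_kernel \<beta> t = - \<kappa> * ml_kernel \<alpha> (\<beta> + \<alpha>) \<kappa> t" by (rule sums_unique2)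
  then show ?thesis by linarith
qed

text \<open>In terms of \<open>x = \<kappa> * t powr \<alpha>\<close> the claim is that \<open>x powr s\<close> times the Mittag-Leffler function at \<open>- x\<close> is
bounded, and \<open>x powr s \<le> 1 + x\<close>.\<close>

lemma ml_kernel_bound:
  assumes "0 < \<beta>"
  obtains B where "B > 0"
    "\<And>\<kappa> t s. 0 < \<kappa> \<Longrightarrow> 0 < t \<Longrightarrow> 0 \<le> s \<Longrightarrow> s \<le> 1 \<Longrightarrow>
       \<kappa> powr s * \<bar>ml_kernel \<alpha> \<beta> \<kappa> t\<bar> \<le> B * t powr (\<beta> - 1 - \<alpha> * s)"
proof -
  obtain B where B: "B > 0" "\<And>x. 0 \<le> x \<Longrightarrow> \<bar>mittag_leffler \<alpha> \<beta> (- x)\<bar> \<le> B / (1 + x)"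
    using mittag_leffler_decay[OF alpha assms] by blast
  have "\<kappa> powr s * \<bar>ml_kernel \<alpha> \<beta> \<kappa> t\<bar> \<le> B * t powr (\<beta> - 1 - \<alpha> * s)"
    if *: "0 < \<kappa>" "0 < t" "0 \<le> s" "s \<le> 1" for \<kappa> t s
  proof -
    define x where "x = \<kappa> * t powr \<alpha>"
    have x: "x > 0" using * by (simp add: x_def)
    have "x powr s \<le> 1 + x"
    proof (cases "x \<le> 1")
      case True
      then have "x powr s \<le> 1" using x * by (intro powr_le1) auto
      then show ?thesis using x by linarith
    next
      case False
      then have "x powr s \<le> x powr 1" using * by (intro powr_mono) auto
      then show ?thesis using x by simp
    qed
    then have "x powr s * (B / (1 + x)) \<le> (1 + x) * (B / (1 + x))" using x B(1) by (intro mult_right_mono) auto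
    also have "\<dots> = B" using x by simp
    finally have 1: "x powr s * (B / (1 + x)) \<le> B" .
    have "\<kappa> powr s = x powr s * t powr (- (\<alpha> * s))"
      using * by (simp add: x_def powr_mult powr_powr mult.assoc flip: powr_add)
    then have "\<kappa> powr s * \<bar>ml_kernel \<alpha> \<beta> \<kappa> t\<bar>
      = (t powr (\<beta> - 1) * t powr (- (\<alpha> * s))) * (x powr s * \<bar>mittag_leffler \<alpha> \<beta> (- x)\<bar>)"
      using * by (simp add: ml_kernel_def abs_mult x_def mult_ac)
    also have "\<dots> \<le> (t powr (\<beta> - 1) * t powr (- (\<alpha> * s))) * (x powr s * (B / (1 + x)))"
      using x B(2)[of x] by (intro mult_left_mono) auto
    also have "\<dots> \<le> (t powr (\<beta> - 1) * t powr (- (\<alpha> * s))) * B" using 1 by (intro mult_left_mono) auto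
    also have "t powr (\<beta> - 1) * t powr (- (\<alpha> * s)) = t powr (\<beta> - 1 - \<alpha> * s)" by (simp flip: powr_add)
    finally show ?thesis by (simp add: mult.commute)
  qed
  with B(1) that show thesis by blast
qed

lemma ml_kernel_integrable:
  assumes "0 < \<beta>" "0 < \<kappa>" "0 \<le> t"
  shows "integrable (lebesgue_on {0<..<t}) (ml_kernel \<alpha> \<beta> \<kappa>)"
proof -
  obtain B where B: "\<And>\<kappa> t s. 0 < \<kappa> \<Longrightarrow> 0 < t \<Longrightarrow> 0 \<le> s \<Longrightarrow> s \<le> 1 \<Longrightarrow>
       \<kappa> powr s * \<bar>ml_kernel \<alpha> \<beta> \<kappa> t\<bar> \<le> B * t powr (\<beta> - 1 - \<alpha> * s)"
    using ml_kernel_bound[OF assms(1)] by metis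
  show ?thesis
  proof (rule Bochner_Integration.integrable_bound[OF integrable_mult_right[OF powr_integrable(1)[OF assms(1,3)], of B]])
    show "ml_kernel \<alpha> \<beta> \<kappa> \<in> borel_measurable (lebesgue_on {0<..<t})"
      by (intro borel_measurable_lebesgue_on_borel ml_kernel_measurable assms)
    show "AE x in lebesgue_on {0<..<t}. norm (ml_kernel \<alpha> \<beta> \<kappa> x) \<le> norm (B * x powr (\<beta> - 1))"
      by (rule AE_I2) (use B[of \<kappa> _ 0] assms in \<open>auto intro: order_trans[OF _ abs_ge_self]\<close>)
  qed
qed

end

section \<open>Orthonormal expansions and diagonal operators\<close>

lemma lebesgue_integral_eq_integral_continuous:
  fixes g :: "real \<Rightarrow> real"
  assumes "continuous_on {0..t} g"
  shows "integrable (lebesgue_on {0<..<t}) g" "(\<integral>s. g s \<partial>lebesgue_on {0<..<t}) = integral {0..t} g"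
proof -
  have "g absolutely_integrable_on {0..t}" using absolutely_integrable_continuous_real[OF assms] .
  then have "g absolutely_integrable_on {0<..<t}" by (rule set_integrable_subset) auto
  then show i: "integrable (lebesgue_on {0<..<t}) g"
    by (simp add: set_integrable_def integrable_restrict_space)
  show "(\<integral>s. g s \<partial>lebesgue_on {0<..<t}) = integral {0..t} g"
    using lebesgue_integral_eq_integral[OF i] integral_open_interval_real[of 0 t g] by simp
qed

locale orthonormal_basis =
  fixes e :: "nat \<Rightarrow> 'h::{real_inner,banach,second_countable_topology}"
  assumes ortho: "inner (e i) (e j) = (if i = j then 1 else 0)"
    and total: "closure (span (range e)) = UNIV"
begin

definition proj :: "nat \<Rightarrow> 'h \<Rightarrow> 'h" where
  "proj N h = (\<Sum>n<N. inner h (e n) *\<^sub>R e n)"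

lemma inner_sum_basis:
  assumes "finite S"
  shows "inner (\<Sum>n\<in>S. c n *\<^sub>R e n) (e k) = (if k \<in> S then c k else 0)"
proof -
  have "inner (\<Sum>n\<in>S. c n *\<^sub>R e n) (e k) = (\<Sum>n\<in>S. if n = k then c n else 0)"
    unfolding inner_sum_left by (intro sum.cong) (simp_all add: ortho)
  then show ?thesis using assms by simp
qed

lemma norm_sum_basis:
  assumes "finite S"
  shows "(norm (\<Sum>n\<in>S. c n *\<^sub>R e n))\<^sup>2 = (\<Sum>n\<in>S. (c n)\<^sup>2)"
proof -
  have "(norm (\<Sum>n\<in>S. c n *\<^sub>R e n))\<^sup>2 = inner (\<Sum>n\<in>S. c n *\<^sub>R e n) (\<Sum>n\<in>S. c n *\<^sub>R e n)"
    by (simp add: power2_norm_eq_inner)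
  also have "\<dots> = (\<Sum>k\<in>S. c k * inner (\<Sum>n\<in>S. c n *\<^sub>R e n) (e k))"
    by (subst inner_sum_right) simp
  also have "\<dots> = (\<Sum>k\<in>S. c k * c k)"
    by (intro sum.cong) (simp_all add: inner_sum_basis[OF assms])
  finally show ?thesis by (simp add: power2_eq_square)
qed

lemma proj_diff: "proj N (x - y) = proj N x - proj N y"
  by (simp add: proj_def inner_diff_left scaleR_left_diff_distrib sum_subtractf)

lemma inner_proj: "inner (proj N h) (e k) = (if k < N then inner h (e k) else 0)"
  unfolding proj_def by (subst inner_sum_basis) auto

lemma norm_proj_le: "norm (proj N h) \<le> norm h"
proof -
  have "inner h (proj N h) = (\<Sum>n<N. (inner h (e n))\<^sup>2)"
    by (simp add: proj_def inner_sum_right power2_eq_square)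
  also have "\<dots> = (norm (proj N h))\<^sup>2"
    unfolding proj_def by (subst norm_sum_basis) auto
  finally have "norm (proj N h) * norm (proj N h) \<le> norm h * norm (proj N h)"
    using norm_cauchy_schwarz[of h "proj N h"] by (simp add: power2_eq_square)
  then show ?thesis by (cases "norm (proj N h) = 0") auto
qed

lemma span_eventually_proj:
  assumes "y \<in> span (range e)"
  shows "\<exists>N. \<forall>N'\<ge>N. proj N' y = y"
  using assms
proof (induction rule: span_induct_alt)
  case base
  show ?case by (simp add: proj_def)
next
  case (step c x y)
  then obtain k N where k: "x = e k" and N: "\<And>N'. N' \<ge> N \<Longrightarrow> proj N' y = y" by auto
  have "proj N' (c *\<^sub>R x + y) = c *\<^sub>R x + y" if "N' \<ge> max N (Suc k)" for N'
  proof -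
    have "proj N' (c *\<^sub>R x + y) = c *\<^sub>R proj N' x + proj N' y"
      by (simp add: proj_def inner_add_left scaleR_left_distrib sum.distrib scaleR_sum_right)
    moreover have "proj N' x = x"
      using that by (simp add: proj_def k ortho if_distrib[of "\<lambda>r. r *\<^sub>R _"] cong: if_cong)
    ultimately show ?thesis using N[of N'] that by simp
  qed
  then show ?case by blast
qed

lemma proj_tendsto: "(\<lambda>N. proj N h) \<longlonglongrightarrow> h"
proof (rule LIMSEQ_I)
  fix r :: real assume r: "r > 0"
  have "h \<in> closure (span (range e))" by (simp add: total)
  then obtain y where y: "y \<in> span (range e)" "dist y h < r / 2"
    using r closure_approachable by (metis half_gt_zero)
  obtain N where N: "\<And>N'. N' \<ge> N \<Longrightarrow> proj N' y = y" using span_eventually_proj[OF y(1)] by blast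
  have "norm (proj N' h - h) < r" if "N' \<ge> N" for N'
  proof -
    have "proj N' h - h = proj N' (h - y) + (y - h)" using N[OF that] by (simp add: proj_diff)
    then have "norm (proj N' h - h) \<le> norm (h - y) + norm (y - h)"
      using norm_triangle_ineq[of "proj N' (h - y)" "y - h"] norm_proj_le[of N' "h - y"] by (simp only:)
    then show ?thesis using y(2) by (simp add: dist_norm norm_minus_commute)
  qed
  then show "\<exists>no. \<forall>n\<ge>no. norm (proj n h - h) < r" by blast
qed

lemma expansion: "(\<lambda>n. inner h (e n) *\<^sub>R e n) sums h"
  using proj_tendsto[of h] by (simp add: sums_def proj_def)

lemma inner_sums: "(\<lambda>n. inner x (e n) * inner y (e n)) sums inner x y"
  using bounded_linear.sums[OF bounded_linear_inner_left expansion[of x], of y]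
  by (simp add: inner_commute)

lemma parseval: "(\<lambda>n. (inner h (e n))\<^sup>2) sums (norm h)\<^sup>2"
  using inner_sums[of h h] by (simp add: power2_norm_eq_inner flip: power2_eq_square)

lemma basis_eqI: "(\<And>n. inner x (e n) = inner y (e n)) \<Longrightarrow> x = y"
  using expansion[of x] expansion[of y] sums_unique2 by simp

lemma norm_le_of_coefficients:
  assumes "\<And>n. \<bar>inner x (e n)\<bar> \<le> K * \<bar>inner y (e n)\<bar>" "0 \<le> K"
  shows "norm x \<le> K * norm y"
proof -
  have "(norm x)\<^sup>2 \<le> (K * norm y)\<^sup>2"
    unfolding power_mult_distrib
  proof (rule sums_le[OF _ parseval sums_mult[OF parseval]])
    show "(inner x (e n))\<^sup>2 \<le> K\<^sup>2 * (inner y (e n))\<^sup>2" for n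
      using power_mono[OF assms(1)[of n], of 2] by (simp add: power_mult_distrib)
  qed
  then show ?thesis using assms(2) by (simp add: power2_le_iff_abs_le)
qed

definition of_coefficients :: "(nat \<Rightarrow> real) \<Rightarrow> 'h" where
  "of_coefficients c = (\<Sum>n. c n *\<^sub>R e n)"

lemma of_coefficients_sums:
  assumes "summable (\<lambda>n. (c n)\<^sup>2)"
  shows "(\<lambda>n. c n *\<^sub>R e n) sums of_coefficients c"
proof -
  have "summable (\<lambda>n. c n *\<^sub>R e n)"
    unfolding summable_Cauchy
  proof (intro allI impI)
    fix r :: real assume r: "r > 0"
    then obtain N where N: "\<And>m n. m \<ge> N \<Longrightarrow> norm (\<Sum>i=m..<n. (c i)\<^sup>2) < r\<^sup>2"
      using assms unfolding summable_Cauchy by (meson zero_less_power)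
    have "norm (\<Sum>i=m..<n. c i *\<^sub>R e i) < r" if "m \<ge> N" for m n
    proof -
      have "(norm (\<Sum>i=m..<n. c i *\<^sub>R e i))\<^sup>2 < r\<^sup>2"
        using N[OF that, of n] by (subst norm_sum_basis) auto
      then show ?thesis using r by (simp add: power2_less_imp_less)
    qed
    then show "\<exists>N. \<forall>m\<ge>N. \<forall>n. norm (\<Sum>i=m..<n. c i *\<^sub>R e i) < r" by blast
  qed
  then show ?thesis unfolding of_coefficients_def by (rule summable_sums)
qed

lemma inner_of_coefficients:
  assumes "summable (\<lambda>n. (c n)\<^sup>2)"
  shows "inner (of_coefficients c) (e k) = c k"
proof -
  have "(\<lambda>n. inner (c n *\<^sub>R e n) (e k)) sums inner (of_coefficients c) (e k)"
    by (rule bounded_linear.sums[OF bounded_linear_inner_left of_coefficients_sums[OF assms]])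
  moreover have "(\<lambda>n. inner (c n *\<^sub>R e n) (e k)) sums c k"
    using sums_If_finite_set[of "{k}" c] by (simp add: ortho if_distrib[of "(*) _"] cong: if_cong)
  ultimately show ?thesis by (rule sums_unique2)
qed

definition diag :: "(nat \<Rightarrow> real) \<Rightarrow> 'h \<Rightarrow> 'h" where
  "diag m h = of_coefficients (\<lambda>n. m n * inner h (e n))"

lemma diag_summable:
  assumes "\<And>n. \<bar>m n\<bar> \<le> K"
  shows "summable (\<lambda>n. (m n * inner h (e n))\<^sup>2)"
proof (rule summable_comparison_test')
  show "summable (\<lambda>n. K\<^sup>2 * (inner h (e n))\<^sup>2)" using parseval by (intro summable_mult sums_summable)
  show "norm ((m n * inner h (e n))\<^sup>2) \<le> K\<^sup>2 * (inner h (e n))\<^sup>2" if "n \<ge> 0" for n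
    using power_mono[OF assms[of n], of 2] by (simp add: power_mult_distrib mult_right_mono)
qed

lemma inner_diag: "(\<And>n. \<bar>m n\<bar> \<le> K) \<Longrightarrow> inner (diag m h) (e k) = m k * inner h (e k)"
  unfolding diag_def by (rule inner_of_coefficients[OF diag_summable])

lemma diag_sums: "(\<And>n. \<bar>m n\<bar> \<le> K) \<Longrightarrow> (\<lambda>n. (m n * inner h (e n)) *\<^sub>R e n) sums diag m h"
  unfolding diag_def by (rule of_coefficients_sums[OF diag_summable])

lemma norm_diag_le:
  assumes "\<And>n. \<bar>m n\<bar> \<le> K"
  shows "norm (diag m h) \<le> K * norm h"
proof (rule norm_le_of_coefficients)
  show "0 \<le> K" using assms[of 0] by linarith
  show "\<bar>inner (diag m h) (e n)\<bar> \<le> K * \<bar>inner h (e n)\<bar>" for n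
    unfolding inner_diag[OF assms] abs_mult by (intro mult_right_mono assms) auto
qed

lemma diag_diff: "(\<And>n. \<bar>m n\<bar> \<le> K) \<Longrightarrow> diag m (x - y) = diag m x - diag m y"
  by (rule basis_eqI) (simp add: inner_diff_left inner_diag[where K = K] right_diff_distrib)

lemma diag_tail:
  assumes "\<And>n. \<bar>m n\<bar> \<le> K"
  shows "norm (diag m h - (\<Sum>n<N. (m n * inner h (e n)) *\<^sub>R e n)) \<le> K * norm (h - proj N h)"
proof (rule norm_le_of_coefficients)
  show "0 \<le> K" using assms[of 0] by linarith
  fix k
  have "inner (diag m h - (\<Sum>n<N. (m n * inner h (e n)) *\<^sub>R e n)) (e k) = (if k < N then 0 else m k * inner h (e k))"
    unfolding inner_diff_left inner_diag[OF assms] by (subst inner_sum_basis) auto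
  moreover have "inner (h - proj N h) (e k) = (if k < N then 0 else inner h (e k))"
    by (simp add: inner_diff_left inner_proj)
  ultimately show "\<bar>inner (diag m h - (\<Sum>n<N. (m n * inner h (e n)) *\<^sub>R e n)) (e k)\<bar> \<le> K * \<bar>inner (h - proj N h) (e k)\<bar>"
    using assms[of k] by (simp add: abs_mult mult_right_mono)
qed

text \<open>The tail of the series is at most \<open>K\<close> times the tail of the expansion of \<open>h\<close>, so the partial sums converge
uniformly in \<open>t\<close>.\<close>

lemma diag_continuous_on:
  assumes "\<And>n. continuous_on S (\<lambda>t. m t n)" "\<And>t n. t \<in> S \<Longrightarrow> \<bar>m t n\<bar> \<le> K"
  shows "continuous_on S (\<lambda>t. diag (m t) h)"
proof (rule uniform_limit_theorem)
  show "\<forall>\<^sub>F N in sequentially. continuous_on S (\<lambda>t. \<Sum>n<N. (m t n * inner h (e n)) *\<^sub>R e n)"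
    by (intro always_eventually allI continuous_intros assms)
  show "uniform_limit S (\<lambda>N t. \<Sum>n<N. (m t n * inner h (e n)) *\<^sub>R e n) (\<lambda>t. diag (m t) h) sequentially"
  proof (rule uniform_limitI)
    fix r :: real assume r: "r > 0"
    have "(\<lambda>N. K * norm (h - proj N h)) \<longlonglongrightarrow> K * norm (h - h)"
      by (intro tendsto_intros proj_tendsto)
    then have "\<forall>\<^sub>F N in sequentially. K * norm (h - proj N h) < r"
      using r by (intro order_tendstoD(2)) auto
    then show "\<forall>\<^sub>F N in sequentially. \<forall>t\<in>S. dist (\<Sum>n<N. (m t n * inner h (e n)) *\<^sub>R e n) (diag (m t) h) < r"
    proof eventually_elim
      case (elim N)
      show ?case
      proof
        fix t assume "t \<in> S"
        then show "dist (\<Sum>n<N. (m t n * inner h (e n)) *\<^sub>R e n) (diag (m t) h) < r"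
          using diag_tail[of "m t" K h N] assms(2)[of t] elim by (simp add: dist_norm norm_minus_commute)
      qed
    qed
  qed
qed simp

lemma diag_measurable:
  assumes "\<And>n. (\<lambda>x. m x n) \<in> borel_measurable M" "f \<in> borel_measurable M"
    and "\<And>x n. x \<in> space M \<Longrightarrow> \<bar>m x n\<bar> \<le> K x"
  shows "(\<lambda>x. diag (m x) (f x)) \<in> borel_measurable M"
proof (rule borel_measurable_LIMSEQ_metric)
  show "(\<lambda>x. \<Sum>n<N. (m x n * inner (f x) (e n)) *\<^sub>R e n) \<in> borel_measurable M" for N
    using assms(1,2) by measurable
  show "(\<lambda>N. \<Sum>n<N. (m x n * inner (f x) (e n)) *\<^sub>R e n) \<longlonglongrightarrow> diag (m x) (f x)" if "x \<in> space M" for x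
    using diag_sums[of "m x" "K x" "f x"] assms(3)[OF that] by (simp add: sums_def)
qed

text \<open>For continuous \<open>v\<close> the coefficients determine \<open>U\<close> as \<open>U 0\<close> plus the integral of \<open>v\<close>, so derivatives can be
computed coefficient by coefficient.\<close>

lemma primitive_has_vector_derivative:
  assumes v: "continuous_on {0..T} v"
    and U: "\<And>t n. 0 \<le> t \<Longrightarrow> t \<le> T \<Longrightarrow>
      inner (U t) (e n) = inner (U 0) (e n) + (\<integral>s. inner (v s) (e n) \<partial>lebesgue_on {0<..<t})"
    and t: "t \<in> {0..T}"
  shows "(U has_vector_derivative v t) (at t within {0..T})"
proof -
  have eq: "U t = U 0 + integral {0..t} v" if "t \<in> {0..T}" for t
  proof (rule basis_eqI)
    fix n
    have c: "continuous_on {0..t} v" using v that by (auto intro: continuous_on_subset)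
    have "inner (integral {0..t} v) (e n) = integral {0..t} (\<lambda>s. inner (v s) (e n))"
      using integral_linear[OF integrable_continuous_real[OF c] bounded_linear_inner_left[of "e n"]]
      by (simp add: o_def)
    also have "\<dots> = (\<integral>s. inner (v s) (e n) \<partial>lebesgue_on {0<..<t})"
      by (rule lebesgue_integral_eq_integral_continuous(2)[symmetric]) (intro continuous_intros c)
    finally show "inner (U t) (e n) = inner (U 0 + integral {0..t} v) (e n)"
      using U[of t n] that by (simp add: inner_add_left)
  qed
  have "((\<lambda>t. U 0 + integral {0..t} v) has_vector_derivative 0 + v t) (at t within {0..T})"
    by (intro has_vector_derivative_add has_vector_derivative_const integral_has_vector_derivative v t)
  then show ?thesis by (subst (asm) add_0) (rule has_vector_derivative_transform[OF t eq])
qed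

section \<open>Convolution with a family of diagonal operators\<close>

text \<open>In the form \<open>U t = \<integral>\<tau>. diag (m \<tau>) (f (t - \<tau>))\<close>, with \<open>f\<close> extended by zero, the time \<open>t\<close> enters only
through the continuous function \<open>f\<close>, and dominated convergence applies however singular the multipliers are
at \<open>0\<close>.\<close>

lemma diag_convolution_continuous:
  fixes m :: "real \<Rightarrow> nat \<Rightarrow> real" and f :: "real \<Rightarrow> 'h"
  assumes m [measurable]: "\<And>n. (\<lambda>\<tau>. m \<tau> n) \<in> borel_measurable borel"
    and k: "integrable (lebesgue_on {0<..<T}) k" "\<And>\<tau> n. 0 < \<tau> \<Longrightarrow> \<tau> < T \<Longrightarrow> \<bar>m \<tau> n\<bar> \<le> k \<tau>"
    and f: "continuous_on {0..T} f"
  obtains U where "continuous_on {0..T} U"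
    "\<And>t n. 0 \<le> t \<Longrightarrow> t \<le> T \<Longrightarrow> inner (U t) (e n) = convolve (\<lambda>\<tau>. m \<tau> n) (\<lambda>\<tau>. inner (f \<tau>) (e n)) t"
proof -
  let ?M = "lebesgue_on {0<..<T}"
  define g where "g s = (if s \<in> {0<..T} then f s else 0)" for s
  have g [measurable]: "g \<in> borel_measurable borel"
    unfolding g_def
    by (rule borel_measurable_continuous_on_if) (auto intro: continuous_on_subset[OF f])
  have "compact (f ` {0..T})" using f by (intro compact_continuous_image) auto
  then obtain C where C: "\<And>s. s \<in> {0..T} \<Longrightarrow> norm (f s) \<le> C"
    using compact_imp_bounded bounded_iff by (metis imageI)
  have gC: "norm (g s) \<le> \<bar>C\<bar>" for s using C[of s] by (auto simp: g_def)
  define \<psi> where "\<psi> t \<tau> = diag (m \<tau>) (g (t - \<tau>))" for t \<tau>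
  \<comment> \<open>The integral extends over all of \<open>{0<..<T}\<close>; the extension of \<open>f\<close> by zero removes \<open>\<tau> > t\<close>.\<close>
  define U where "U t = (\<integral>\<tau>. \<psi> t \<tau> \<partial>?M)" for t
  have psi_m: "\<psi> t \<in> borel_measurable ?M" for t
    unfolding \<psi>_def
    by (rule diag_measurable[where K = k]) (use k(2) in \<open>auto intro!: borel_measurable_lebesgue_on_borel\<close>)
  have psi_le: "norm (\<psi> t \<tau>) \<le> k \<tau> * \<bar>C\<bar>" if "0 < \<tau>" "\<tau> < T" for t \<tau>
  proof -
    have "norm (\<psi> t \<tau>) \<le> k \<tau> * norm (g (t - \<tau>))" unfolding \<psi>_def by (rule norm_diag_le) (use k(2) that in auto)
    also have "\<dots> \<le> k \<tau> * \<bar>C\<bar>" using k(2)[OF that, of 0] gC by (intro mult_left_mono) auto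
    finally show ?thesis .
  qed
  have kC: "integrable ?M (\<lambda>\<tau>. k \<tau> * \<bar>C\<bar>)" using k(1) by auto
  have psi_i: "integrable ?M (\<psi> t)" for t
    by (rule Bochner_Integration.integrable_bound[OF kC psi_m]) (rule AE_I2, rule order_trans[OF psi_le], simp_all)
  have "continuous_on {0..T} U"
    unfolding continuous_on_sequentially
  proof (intro allI ballI impI, elim conjE)
    fix x :: "nat \<Rightarrow> real" and t assume t: "t \<in> {0..T}" and x: "\<forall>i. x i \<in> {0..T}" "x \<longlonglongrightarrow> t"
    have ptw: "(\<lambda>i. \<psi> (x i) \<tau>) \<longlonglongrightarrow> \<psi> t \<tau>" if \<tau>: "0 < \<tau>" "\<tau> < T" "\<tau> \<noteq> t" for \<tau>
    proof -
      have "(\<lambda>i. g (x i - \<tau>)) \<longlonglongrightarrow> g (t - \<tau>)"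
      proof (cases "\<tau> < t")
        case True
        have ev: "\<forall>\<^sub>F i in sequentially. x i > \<tau>" using order_tendstoD(1)[OF x(2) True] .
        have in_T: "x i - \<tau> \<in> {0..T}" if "x i > \<tau>" for i using x(1)[rule_format, of i] that \<tau> by auto
        have "(\<lambda>i. f (x i - \<tau>)) \<longlonglongrightarrow> f (t - \<tau>)"
        proof (rule continuous_on_tendsto_compose[OF f])
          show "(\<lambda>i. x i - \<tau>) \<longlonglongrightarrow> t - \<tau>" by (intro tendsto_intros x)
          show "t - \<tau> \<in> {0..T}" using True t \<tau> by simp
          show "\<forall>\<^sub>F i in sequentially. x i - \<tau> \<in> {0..T}" using ev by eventually_elim (rule in_T)
        qed
        moreover have "\<forall>\<^sub>F i in sequentially. f (x i - \<tau>) = g (x i - \<tau>)"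
          using ev by eventually_elim (use in_T in \<open>auto simp: g_def\<close>)
        ultimately have "(\<lambda>i. g (x i - \<tau>)) \<longlonglongrightarrow> f (t - \<tau>)" by (rule Lim_transform_eventually)
        moreover have "g (t - \<tau>) = f (t - \<tau>)" using True t \<tau> by (simp add: g_def)
        ultimately show ?thesis by simp
      next
        case False
        then have "t < \<tau>" using \<tau> by simp
        then have "\<forall>\<^sub>F i in sequentially. x i < \<tau>" using order_tendstoD(2)[OF x(2)] by blast
        then have "\<forall>\<^sub>F i in sequentially. g (x i - \<tau>) = g (t - \<tau>)"
          by eventually_elim (use \<open>t < \<tau>\<close> in \<open>auto simp: g_def\<close>)
        then show ?thesis by (rule tendsto_eventually)
      qed
      then have "(\<lambda>i. k \<tau> * norm (g (x i - \<tau>) - g (t - \<tau>))) \<longlonglongrightarrow> k \<tau> * norm (g (t - \<tau>) - g (t - \<tau>))"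
        by (intro tendsto_intros)
      moreover have "norm (\<psi> (x i) \<tau> - \<psi> t \<tau>) \<le> k \<tau> * norm (g (x i - \<tau>) - g (t - \<tau>))" for i
        unfolding \<psi>_def using k(2)[OF \<tau>(1,2)]
        by (subst diag_diff[symmetric, where K = "k \<tau>"]) (auto intro!: norm_diag_le)
      ultimately have "(\<lambda>i. \<psi> (x i) \<tau> - \<psi> t \<tau>) \<longlonglongrightarrow> 0"
        by (intro Lim_null_comparison[OF eventuallyI[of "\<lambda>i. norm (\<psi> (x i) \<tau> - \<psi> t \<tau>) \<le> k \<tau> * norm (g (x i - \<tau>) - g (t - \<tau>))"]]) simp_all
      then show ?thesis by (rule LIM_zero_cancel)
    qed
    have ae: "AE \<tau> in ?M. \<tau> \<noteq> t"
      by (subst AE_restrict_space_iff) (use AE_completion[OF AE_lborel_singleton[of t]] in auto)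
    show "(U \<circ> x) \<longlonglongrightarrow> U t"
      unfolding o_def U_def
    proof (rule integral_dominated_convergence[OF psi_m psi_m kC])
      show "AE \<tau> in ?M. (\<lambda>i. \<psi> (x i) \<tau>) \<longlonglongrightarrow> \<psi> t \<tau>"
        using ae AE_space by eventually_elim (use ptw in auto)
      show "AE \<tau> in ?M. norm (\<psi> (x i) \<tau>) \<le> k \<tau> * \<bar>C\<bar>" for i
        by (rule AE_I2) (use psi_le in auto)
    qed
  qed
  moreover have "inner (U t) (e n) = convolve (\<lambda>\<tau>. m \<tau> n) (\<lambda>\<tau>. inner (f \<tau>) (e n)) t"
    if t: "0 \<le> t" "t \<le> T" for t n
  proof -
    have "inner (U t) (e n) = (\<integral>\<tau>. inner (\<psi> t \<tau>) (e n) \<partial>?M)"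
      unfolding U_def using psi_i[of t] by (simp add: integral_inner_left)
    also have "\<dots> = (\<integral>\<tau>. (if \<tau> < t then m \<tau> n * inner (g (t - \<tau>)) (e n) else 0) \<partial>?M)"
    proof (rule Bochner_Integration.integral_cong[OF refl])
      fix \<tau> assume "\<tau> \<in> space ?M"
      then have "inner (\<psi> t \<tau>) (e n) = m \<tau> n * inner (g (t - \<tau>)) (e n)"
        unfolding \<psi>_def by (intro inner_diag[where K = "k \<tau>"] k(2)) auto
      then show "inner (\<psi> t \<tau>) (e n) = (if \<tau> < t then m \<tau> n * inner (g (t - \<tau>)) (e n) else 0)"
        by (auto simp: g_def)
    qed
    also have "\<dots> = (\<integral>\<tau>. m \<tau> n * inner (g (t - \<tau>)) (e n) \<partial>lebesgue_on {0<..<t})"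
      by (rule integral_initial_interval[symmetric]) (rule t)
    also have "\<dots> = (\<integral>\<tau>. m (t - \<tau>) n * inner (g \<tau>) (e n) \<partial>lebesgue_on {0<..<t})"
      using integral_reflect[of "\<lambda>\<tau>. m (t - \<tau>) n * inner (g \<tau>) (e n)" t] by simp
    also have "\<dots> = convolve (\<lambda>\<tau>. m \<tau> n) (\<lambda>\<tau>. inner (f \<tau>) (e n)) t"
      unfolding convolve_def by (intro Bochner_Integration.integral_cong) (use t in \<open>auto simp: g_def\<close>)
    finally show ?thesis .
  qed
  ultimately show thesis by (rule that)
qed

lemma diag_convolution_bounded:
  fixes m :: "real \<Rightarrow> nat \<Rightarrow> real" and f :: "real \<Rightarrow> 'h"
  assumes m [measurable]: "\<And>n. (\<lambda>\<tau>. m \<tau> n) \<in> borel_measurable borel"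
    and K: "\<And>\<tau> n. 0 < \<tau> \<Longrightarrow> \<tau> < t \<Longrightarrow> \<bar>m \<tau> n\<bar> \<le> K" "0 \<le> K"
    and f: "integrable (lebesgue_on {0<..<t}) f"
  obtains U where "\<And>n. inner U (e n) = convolve (\<lambda>\<tau>. m \<tau> n) (\<lambda>\<tau>. inner (f \<tau>) (e n)) t"
    "norm U \<le> K * (\<integral>\<tau>. norm (f \<tau>) \<partial>lebesgue_on {0<..<t})"
proof -
  let ?M = "lebesgue_on {0<..<t}"
  define \<psi> where "\<psi> \<tau> = diag (m (t - \<tau>)) (f \<tau>)" for \<tau>
  have psi_m: "\<psi> \<in> borel_measurable ?M"
    unfolding \<psi>_def
    by (rule diag_measurable[where K = "\<lambda>_. K"]) (use K(1) f in \<open>auto intro!: borel_measurable_lebesgue_on_borel\<close>)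
  have psi_le: "norm (\<psi> \<tau>) \<le> K * norm (f \<tau>)" if "\<tau> \<in> space ?M" for \<tau>
    unfolding \<psi>_def by (rule norm_diag_le) (use K(1) that in auto)
  have Kf: "integrable ?M (\<lambda>\<tau>. K * norm (f \<tau>))" using f by auto
  have psi_i: "integrable ?M \<psi>"
    by (rule Bochner_Integration.integrable_bound[OF Kf psi_m]) (rule AE_I2, rule order_trans[OF psi_le], simp_all)
  have "inner (\<integral>\<tau>. \<psi> \<tau> \<partial>?M) (e n) = convolve (\<lambda>\<tau>. m \<tau> n) (\<lambda>\<tau>. inner (f \<tau>) (e n)) t" for n
  proof -
    have "inner (\<integral>\<tau>. \<psi> \<tau> \<partial>?M) (e n) = (\<integral>\<tau>. inner (\<psi> \<tau>) (e n) \<partial>?M)"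
      using psi_i by (simp add: integral_inner_left)
    also have "\<dots> = convolve (\<lambda>\<tau>. m \<tau> n) (\<lambda>\<tau>. inner (f \<tau>) (e n)) t"
      unfolding convolve_def \<psi>_def
      by (intro Bochner_Integration.integral_cong refl inner_diag[where K = K]) (use K(1) in auto)
    finally show ?thesis .
  qed
  moreover have "norm (\<integral>\<tau>. \<psi> \<tau> \<partial>?M) \<le> K * (\<integral>\<tau>. norm (f \<tau>) \<partial>?M)"
  proof -
    have "norm (\<integral>\<tau>. \<psi> \<tau> \<partial>?M) \<le> (\<integral>\<tau>. norm (\<psi> \<tau>) \<partial>?M)" by (rule integral_norm_bound)
    also have "\<dots> \<le> (\<integral>\<tau>. K * norm (f \<tau>) \<partial>?M)" using psi_i Kf psi_le by (intro integral_mono) auto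
    finally show ?thesis by simp
  qed
  ultimately show thesis by (rule that)
qed

text \<open>Young's inequality for an operator-valued kernel. When both factors are merely integrable, the
convolution exists only for almost every \<open>t\<close>.\<close>

lemma diag_convolution_integrable:
  fixes m :: "real \<Rightarrow> nat \<Rightarrow> real" and f :: "real \<Rightarrow> 'h"
  assumes m [measurable]: "\<And>n. (\<lambda>\<tau>. m \<tau> n) \<in> borel_measurable borel"
    and k [measurable]: "k \<in> borel_measurable borel"
    and ki: "integrable (lebesgue_on {0<..<T}) k" and km: "\<And>\<tau> n. 0 < \<tau> \<Longrightarrow> \<tau> < T \<Longrightarrow> \<bar>m \<tau> n\<bar> \<le> k \<tau>"
    and f: "integrable (lebesgue_on {0<..<T}) f"
  obtains w where "integrable (lebesgue_on {0<..<T}) w"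
    "AE t in lebesgue_on {0<..<T}. \<forall>n. inner (w t) (e n) = convolve (\<lambda>\<tau>. m \<tau> n) (\<lambda>\<tau>. inner (f \<tau>) (e n)) t"
    "(\<integral>t. norm (w t) \<partial>lebesgue_on {0<..<T}) \<le> (\<integral>\<tau>. \<bar>k \<tau>\<bar> \<partial>lebesgue_on {0<..<T}) * (\<integral>\<tau>. norm (f \<tau>) \<partial>lebesgue_on {0<..<T})"
proof -
  let ?M = "lebesgue_on {0<..<T}"
  interpret pair_sigma_finite ?M ?M by (rule pair_sigma_finite_interval)
  have fm [measurable]: "f \<in> borel_measurable ?M" using f by auto
  define \<mu> where "\<mu> x n = (if snd x < fst x then m (fst x - snd x) n else 0)" for x :: "real \<times> real" and n
  define \<psi> where "\<psi> x = diag (\<mu> x) (f (snd x))" for x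
  define \<Delta> where "\<Delta> = triangle_integrand T (\<lambda>_. 1) k (\<lambda>r. norm (f r))"
  have \<mu>_le: "\<bar>\<mu> x n\<bar> \<le> (if snd x < fst x then k (fst x - snd x) else 0)" if "x \<in> space (?M \<Otimes>\<^sub>M ?M)" for x n
    using that km[of "fst x - snd x" n] by (auto simp: \<mu>_def space_pair_measure)
  have psi_m: "\<psi> \<in> borel_measurable (?M \<Otimes>\<^sub>M ?M)"
    unfolding \<psi>_def
  proof (rule diag_measurable[OF _ _ \<mu>_le])
    show "(\<lambda>x. \<mu> x n) \<in> borel_measurable (?M \<Otimes>\<^sub>M ?M)" for n
      unfolding \<mu>_def by measurable
  qed measurable
  have psi_le: "norm (\<psi> x) \<le> \<bar>\<Delta> x\<bar>" if "x \<in> space (?M \<Otimes>\<^sub>M ?M)" for x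
  proof -
    have "norm (\<psi> x) \<le> (if snd x < fst x then k (fst x - snd x) else 0) * norm (f (snd x))"
      unfolding \<psi>_def by (rule norm_diag_le) (use \<mu>_le[OF that] in auto)
    also have "\<dots> = \<Delta> x" by (cases x) (simp add: \<Delta>_def triangle_integrand_def[of "\<lambda>_. 1" k "\<lambda>r. norm (f r)" T])
    finally show ?thesis by simp
  qed
  have \<Delta>i: "integrable (?M \<Otimes>\<^sub>M ?M) \<Delta>"
    unfolding \<Delta>_def by (rule triangle_integrable_left_bounded(1)[where A = 1]) (use ki f in auto)
  have psi_i: "integrable (?M \<Otimes>\<^sub>M ?M) \<psi>"
    by (rule Bochner_Integration.integrable_bound[OF \<Delta>i psi_m]) (rule AE_I2, use psi_le in auto)
  define w where "w t = (\<integral>\<tau>. \<psi> (t, \<tau>) \<partial>?M)" for t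
  have wi: "integrable ?M w" unfolding w_def by (rule integrable_fst'[OF psi_i])
  moreover have "AE t in ?M. \<forall>n. inner (w t) (e n) = convolve (\<lambda>\<tau>. m \<tau> n) (\<lambda>\<tau>. inner (f \<tau>) (e n)) t"
    using AE_integrable_fst'[OF psi_i] AE_space
  proof eventually_elim
    case (elim t)
    then have t: "0 < t" "t < T" by auto
    show ?case
    proof
      fix n
      have "inner (w t) (e n) = (\<integral>\<tau>. inner (\<psi> (t, \<tau>)) (e n) \<partial>?M)"
        unfolding w_def using elim(1) by (simp add: integral_inner_left)
      also have "\<dots> = (\<integral>\<tau>. (if \<tau> < t then m (t - \<tau>) n * inner (f \<tau>) (e n) else 0) \<partial>?M)"
      proof (rule Bochner_Integration.integral_cong[OF refl])
        fix \<tau> assume "\<tau> \<in> space ?M"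
        then have "(t, \<tau>) \<in> space (?M \<Otimes>\<^sub>M ?M)" using t by (simp add: space_pair_measure)
        then have "inner (\<psi> (t, \<tau>)) (e n) = \<mu> (t, \<tau>) n * inner (f \<tau>) (e n)"
          unfolding \<psi>_def snd_conv by (intro inner_diag[OF \<mu>_le])
        then show "inner (\<psi> (t, \<tau>)) (e n) = (if \<tau> < t then m (t - \<tau>) n * inner (f \<tau>) (e n) else 0)"
          by (simp add: \<mu>_def)
      qed
      also have "\<dots> = convolve (\<lambda>\<tau>. m \<tau> n) (\<lambda>\<tau>. inner (f \<tau>) (e n)) t"
        unfolding convolve_def by (rule integral_initial_interval[symmetric]) (use t in simp)
      finally show "inner (w t) (e n) = convolve (\<lambda>\<tau>. m \<tau> n) (\<lambda>\<tau>. inner (f \<tau>) (e n)) t" .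
    qed
  qed
  moreover have "(\<integral>t. norm (w t) \<partial>?M) \<le> (\<integral>\<tau>. \<bar>k \<tau>\<bar> \<partial>?M) * (\<integral>\<tau>. norm (f \<tau>) \<partial>?M)"
  proof -
    have "(\<integral>t. norm (w t) \<partial>?M) \<le> (\<integral>t. (\<integral>\<tau>. \<bar>\<Delta> (t, \<tau>)\<bar> \<partial>?M) \<partial>?M)"
    proof (rule integral_mono_AE)
      show "integrable ?M (\<lambda>t. \<integral>\<tau>. \<bar>\<Delta> (t, \<tau>)\<bar> \<partial>?M)"
        using integrable_fst'[OF integrable_abs[OF \<Delta>i]] by simp
      show "AE t in ?M. norm (w t) \<le> (\<integral>\<tau>. \<bar>\<Delta> (t, \<tau>)\<bar> \<partial>?M)"
        using AE_integrable_fst'[OF psi_i] AE_integrable_fst'[OF \<Delta>i] AE_space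
      proof eventually_elim
        case (elim t)
        have "norm (w t) \<le> (\<integral>\<tau>. norm (\<psi> (t, \<tau>)) \<partial>?M)" unfolding w_def by (rule integral_norm_bound)
        also have "\<dots> \<le> (\<integral>\<tau>. \<bar>\<Delta> (t, \<tau>)\<bar> \<partial>?M)"
          using elim psi_le by (intro integral_mono) (auto simp: space_pair_measure)
        finally show ?case .
      qed
    qed (use wi in auto)
    also have "\<dots> \<le> 1 * (\<integral>\<tau>. \<bar>k \<tau>\<bar> \<partial>?M) * (\<integral>\<tau>. \<bar>norm (f \<tau>)\<bar> \<partial>?M)"
      unfolding \<Delta>_def by (rule triangle_integrable_left_bounded(2)) (use ki f in auto)
    finally show ?thesis by simp
  qed
  ultimately show thesis by (rule that)
qed

end

section \<open>Sobolev functions of time\<close>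

text \<open>A continuously differentiable transition from \<open>0\<close> to \<open>1\<close>, pieced together from parabolas; differences of
rescaled translates are test functions that approximate the indicator of an interval.\<close>

definition ramp :: "real \<Rightarrow> real" where
  "ramp x = 2 * (max 0 x)\<^sup>2 - 4 * (max 0 (x - 1 / 2))\<^sup>2 + 2 * (max 0 (x - 1))\<^sup>2"

definition ramp' :: "real \<Rightarrow> real" where
  "ramp' x = 4 * max 0 x - 8 * max 0 (x - 1 / 2) + 4 * max 0 (x - 1)"

lemma DERIV_max_zero_square: "((\<lambda>x. (max 0 x)\<^sup>2) has_real_derivative 2 * max 0 x) (at x)" for x :: real
proof -
  consider "x > 0" | "x < 0" | "x = 0" by linarith
  then show ?thesis
  proof cases
    case 1
    have "((\<lambda>x. x\<^sup>2) has_real_derivative 2 * max 0 x) (at x)" using 1 by (auto intro!: derivative_eq_intros)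
    then show ?thesis
      by (rule has_field_derivative_transform_within_open[of _ _ _ "{0<..}"]) (use 1 in auto)
  next
    case 2
    have "((\<lambda>x. 0) has_real_derivative 2 * max 0 x) (at x)" using 2 by auto
    then show ?thesis
      by (rule has_field_derivative_transform_within_open[of _ _ _ "{..<0}"]) (use 2 in auto)
  next
    case 3
    have "(\<lambda>h. ((max 0 (0 + h))\<^sup>2 - (max 0 0)\<^sup>2) / h) \<midarrow>0\<rightarrow> (0::real)"
    proof (rule Lim_null_comparison[OF always_eventually])
      show "\<forall>h::real. norm (((max 0 (0 + h))\<^sup>2 - (max 0 0)\<^sup>2) / h) \<le> \<bar>h\<bar>"
        by (auto simp: max_def power2_eq_square)
      show "(\<lambda>h::real. \<bar>h\<bar>) \<midarrow>0\<rightarrow> 0" by (rule tendsto_rabs_zero) (rule tendsto_ident_at)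
    qed
    then show ?thesis using 3 by (simp add: DERIV_def)
  qed
qed

lemma ramp_DERIV: "(ramp has_real_derivative ramp' x) (at x)"
proof -
  have D: "((\<lambda>x. (max 0 (x - c))\<^sup>2) has_real_derivative 2 * max 0 (x - c)) (at x)" for c
  proof -
    have "((\<lambda>x. x - c) has_real_derivative 1) (at x)" by (auto intro!: derivative_eq_intros)
    from DERIV_chain2[OF DERIV_max_zero_square this] show ?thesis by simp
  qed
  have "((\<lambda>x. 2 * (max 0 (x - 0))\<^sup>2 - 4 * (max 0 (x - 1 / 2))\<^sup>2 + 2 * (max 0 (x - 1))\<^sup>2) has_real_derivative
      2 * (2 * max 0 (x - 0)) - 4 * (2 * max 0 (x - 1 / 2)) + 2 * (2 * max 0 (x - 1))) (at x)"
    by (intro DERIV_add DERIV_diff DERIV_cmult D)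
  then show ?thesis unfolding ramp_def[abs_def] ramp'_def by simp
qed

lemma ramp'_continuous: "continuous_on S ramp'"
  unfolding ramp'_def[abs_def] by (intro continuous_intros)

lemma ramp'_nonneg: "0 \<le> ramp' x" and ramp'_support: "x \<le> 0 \<or> 1 \<le> x \<Longrightarrow> ramp' x = 0"
  unfolding ramp'_def by (auto simp: max_def)

lemma ramp_values: "x \<le> 0 \<Longrightarrow> ramp x = 0" "1 \<le> x \<Longrightarrow> ramp x = 1"
  unfolding ramp_def by (auto simp: max_def power2_eq_square algebra_simps)

lemma ramp_bounds: "0 \<le> ramp x" "ramp x \<le> 1"
proof -
  have m: "mono ramp"
    by (rule DERIV_nonneg_imp_nondecreasing[THEN monoI, rotated])
      (use ramp_DERIV ramp'_nonneg in blast)+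
  show "0 \<le> ramp x" using monoD[OF m, of "min x 0" x] ramp_values(1)[of "min x 0"] by simp
  show "ramp x \<le> 1" using monoD[OF m, of x "max x 1"] ramp_values(2)[of "max x 1"] by simp
qed

lemma integrable_bounded_scaleR:
  fixes f :: "real \<Rightarrow> 'b::{banach, second_countable_topology}" and g :: "real \<Rightarrow> real"
  assumes f: "integrable (lebesgue_on {0<..<t}) f"
    and g: "g \<in> borel_measurable (lebesgue_on {0<..<t})" "\<And>x. 0 < x \<Longrightarrow> x < t \<Longrightarrow> \<bar>g x\<bar> \<le> C"
  shows "integrable (lebesgue_on {0<..<t}) (\<lambda>x. g x *\<^sub>R f x)"
proof (rule Bochner_Integration.integrable_bound[OF integrable_mult_right[OF integrable_norm[OF f], of C]])
  show "(\<lambda>x. g x *\<^sub>R f x) \<in> borel_measurable (lebesgue_on {0<..<t})" using f g by auto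
  show "AE x in lebesgue_on {0<..<t}. norm (g x *\<^sub>R f x) \<le> norm (C * norm (f x))"
    by (rule AE_I2) (auto simp: abs_mult intro!: mult_right_mono order_trans[OF g(2)])
qed

lemma continuous_on_lebesgue_integrable:
  fixes f :: "real \<Rightarrow> 'b::{banach, second_countable_topology}"
  assumes "continuous_on {0..t} f"
  shows "integrable (lebesgue_on {0<..<t}) f"
proof -
  have "set_integrable lborel {0..t} f" using borel_integrable_atLeastAtMost'[OF assms] .
  then have "set_integrable lborel {0<..<t} f" by (rule set_integrable_subset) auto
  then have "integrable lebesgue (\<lambda>x. indicator {0<..<t} x *\<^sub>R f x)"
    unfolding set_integrable_def by (subst integrable_completion) auto
  then show ?thesis by (simp add: integrable_restrict_space)
qed

lemma AE_neq_lebesgue_on: "AE x in lebesgue_on {0<..<t::real}. x \<noteq> c"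
  by (subst AE_restrict_space_iff) (use AE_completion[OF AE_lborel_singleton[of c]] in auto)

lemma ramp_average:
  fixes f :: "real \<Rightarrow> 'b::{banach, second_countable_topology}"
  assumes f: "continuous_on {0..T} f" and a: "0 < a" "0 < d" "a + d < T"
    and \<epsilon>: "\<And>t. a \<le> t \<Longrightarrow> t \<le> a + d \<Longrightarrow> norm (f t - f a) \<le> \<epsilon>"
  shows "norm ((\<integral>t. (ramp' ((t - a) / d) / d) *\<^sub>R f t \<partial>lebesgue_on {0<..<T}) - f a) \<le> \<epsilon>"
proof -
  let ?M = "lebesgue_on {0<..<T}"
  define \<rho> where "\<rho> t = ramp' ((t - a) / d) / d" for t
  have "(\<rho> has_integral (ramp ((T - a) / d) - ramp ((0 - a) / d))) {0..T}"
  proof (rule fundamental_theorem_of_calculus)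
    show "((\<lambda>t. ramp ((t - a) / d)) has_vector_derivative \<rho> t) (at t within {0..T})" for t
    proof -
      have "((\<lambda>t. ramp ((t - a) / d)) has_real_derivative ramp' ((t - a) / d) * (1 / d)) (at t)"
        by (rule DERIV_chain2[OF ramp_DERIV]) (use a in \<open>auto intro!: derivative_eq_intros\<close>)
      then show ?thesis
        by (simp add: \<rho>_def has_real_derivative_iff_has_vector_derivative has_vector_derivative_at_within)
    qed
  qed (use a in auto)
  moreover have "ramp ((T - a) / d) = 1" "ramp ((0 - a) / d) = 0"
    using a by (auto intro!: ramp_values simp: field_simps)
  ultimately have "(\<rho> has_integral 1) {0..T}" by simp
  then have "(\<rho> has_integral 1) {0<..<T}" by (metis has_integral_open_interval box_real(1) cbox_interval)
  then have \<rho>: "integrable ?M \<rho>" "(\<integral>t. \<rho> t \<partial>?M) = 1"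
    using has_integral_nonneg_lebesgue_on[of \<rho> 1 "{0<..<T}"] ramp'_nonneg a by (auto simp: \<rho>_def)
  have \<rho>0: "0 \<le> \<rho> t" for t using ramp'_nonneg a by (simp add: \<rho>_def)
  have cont_\<rho>: "continuous_on {0..T} \<rho>" unfolding \<rho>_def
    by (intro continuous_intros continuous_on_compose2[OF ramp'_continuous[of UNIV]]) (use a in auto)
  have i1: "integrable ?M (\<lambda>t. \<rho> t *\<^sub>R f t)"
    by (rule continuous_on_lebesgue_integrable) (intro continuous_intros f cont_\<rho>)
  have i2: "integrable ?M (\<lambda>t. \<rho> t *\<^sub>R f a)" using \<rho>(1) by auto
  have "(\<integral>t. \<rho> t *\<^sub>R f t \<partial>?M) - f a = (\<integral>t. \<rho> t *\<^sub>R f t - \<rho> t *\<^sub>R f a \<partial>?M)"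
    using i1 i2 \<rho> by (simp add: Bochner_Integration.integral_diff)
  also have "norm \<dots> \<le> (\<integral>t. norm (\<rho> t *\<^sub>R f t - \<rho> t *\<^sub>R f a) \<partial>?M)" by (rule integral_norm_bound)
  also have "\<dots> \<le> (\<integral>t. \<rho> t * \<epsilon> \<partial>?M)"
  proof (rule integral_mono)
    fix t
    show "norm (\<rho> t *\<^sub>R f t - \<rho> t *\<^sub>R f a) \<le> \<rho> t * \<epsilon>"
    proof (cases "a \<le> t \<and> t \<le> a + d")
      case True
      then show ?thesis using \<epsilon>[of t] \<rho>0[of t] by (simp add: mult_left_mono flip: scaleR_diff_right)
    next
      case False
      then have "\<rho> t = 0" using a by (auto simp: \<rho>_def field_simps intro!: ramp'_support)
      then show ?thesis by simp
    qed
  qed (use i1 i2 \<rho> in auto)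
  also have "\<dots> = \<epsilon>" using \<rho> by simp
  finally show ?thesis by (simp add: \<rho>_def)
qed

lemma ramp_average_limit:
  fixes f :: "real \<Rightarrow> 'b::{banach, second_countable_topology}"
  assumes f: "continuous_on {0..T} f" and a: "0 < a" "a < T"
    and d: "d \<longlonglongrightarrow> 0" "\<And>k. 0 < d k" "\<And>k. a + d k < T"
  shows "(\<lambda>k. \<integral>t. (ramp' ((t - a) / d k) / d k) *\<^sub>R f t \<partial>lebesgue_on {0<..<T}) \<longlonglongrightarrow> f a"
proof (rule LIMSEQ_I)
  fix r :: real assume r: "r > 0"
  obtain s where s: "s > 0" "\<And>t. t \<in> {0..T} \<Longrightarrow> dist t a < s \<Longrightarrow> dist (f t) (f a) < r / 2"
    using f a r unfolding continuous_on_iff by (metis atLeastAtMost_iff half_gt_zero less_imp_le)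
  obtain N where N: "\<And>k. k \<ge> N \<Longrightarrow> d k < s"
    using order_tendstoD(2)[OF d(1) s(1)] by (auto simp: eventually_sequentially)
  have "norm ((\<integral>t. (ramp' ((t - a) / d k) / d k) *\<^sub>R f t \<partial>lebesgue_on {0<..<T}) - f a) \<le> r / 2" if "k \<ge> N" for k
  proof (rule ramp_average[OF f a(1) d(2) d(3)])
    fix t assume t: "a \<le> t" "t \<le> a + d k"
    then have "dist (f t) (f a) < r / 2" using N[OF that] d(3)[of k] a by (intro s) (auto simp: dist_real_def)
    then show "norm (f t - f a) \<le> r / 2" by (simp add: dist_norm)
  qed
  moreover have "r / 2 < r" using r by simp
  ultimately show "\<exists>no. \<forall>k\<ge>no. norm ((\<integral>t. (ramp' ((t - a) / d k) / d k) *\<^sub>R f t \<partial>lebesgue_on {0<..<T}) - f a) < r"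
    using order_le_less_trans by blast
qed

text \<open>Test functions with steeper and steeper flanks at \<open>a\<close> and \<open>b\<close>: their derivatives average \<open>f\<close> over
shrinking intervals at these two points, while the functions themselves tend to the indicator.\<close>

lemma weak_derivative_increment:
  fixes f f' :: "real \<Rightarrow> 'b::{banach, second_countable_topology}"
  assumes w: "weak_derivative T f f'" and f: "continuous_on {0..T} f"
    and f': "integrable (lebesgue_on {0<..<T}) f'" and ab: "0 < a" "a < b" "b < T"
  shows "f b - f a = (\<integral>s. indicator {a<..<b} s *\<^sub>R f' s \<partial>lebesgue_on {0<..<T})"
proof -
  let ?M = "lebesgue_on {0<..<T}"
  define d where "d k = (T - b) / real (k + 2)" for k
  have d: "d \<longlonglongrightarrow> 0" "\<And>k. 0 < d k" "\<And>k. b + d k < T"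
  proof -
    show "d \<longlonglongrightarrow> 0" unfolding d_def by real_asymp
    show "0 < d k" for k using ab by (simp add: d_def)
    have "(T - b) / real (k + 2) < (T - b) / 1" for k using ab by (intro divide_strict_left_mono) auto
    then show "b + d k < T" for k by (simp add: d_def algebra_simps)
  qed
  have ad: "a + d k < T" for k using d(3)[of k] ab by linarith
  define \<psi> where "\<psi> k t = ramp ((t - a) / d k) - ramp ((t - b) / d k)" for k t
  define \<psi>' where "\<psi>' k t = ramp' ((t - a) / d k) / d k - ramp' ((t - b) / d k) / d k" for k t
  have test: "test_function T (\<psi> k) (\<psi>' k)" for k
    unfolding test_function_def
  proof (intro conjI allI)
    fix t
    have "((\<lambda>t. ramp ((t - c) / d k)) has_real_derivative ramp' ((t - c) / d k) * (1 / d k)) (at t)" for c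
      by (rule DERIV_chain2[OF ramp_DERIV]) (use d(2)[of k] in \<open>auto intro!: derivative_eq_intros\<close>)
    from DERIV_diff[OF this this] show "(\<psi> k has_real_derivative \<psi>' k t) (at t)"
      unfolding \<psi>_def[abs_def] \<psi>'_def by simp
  next
    show "continuous_on UNIV (\<psi>' k)" unfolding \<psi>'_def
      by (intro continuous_intros continuous_on_compose2[OF ramp'_continuous[of UNIV]]) (use d(2)[of k] in auto)
    have "\<psi> k t = 0" if "t \<notin> {a..b + d k}" for t
    proof (cases "t < a")
      case True
      then have "ramp ((t - a) / d k) = 0" "ramp ((t - b) / d k) = 0"
        using ab d(2)[of k] by (auto intro!: ramp_values simp: field_simps)
      then show ?thesis by (simp add: \<psi>_def)
    next
      case False
      then have "ramp ((t - a) / d k) = 1" "ramp ((t - b) / d k) = 1"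
        using ab d(2)[of k] that by (auto intro!: ramp_values simp: field_simps)
      then show ?thesis by (simp add: \<psi>_def)
    qed
    then show "\<exists>a b. 0 < a \<and> b < T \<and> (\<forall>t. t \<notin> {a..b} \<longrightarrow> \<psi> k t = 0)"
      using ab d(3)[of k] by blast
  qed
  have "(\<integral>t. \<psi>' k t *\<^sub>R f t \<partial>?M) = - (\<integral>t. \<psi> k t *\<^sub>R f' t \<partial>?M)" for k
    using w test[of k] unfolding weak_derivative_def by blast
  moreover have "(\<lambda>k. \<integral>t. \<psi>' k t *\<^sub>R f t \<partial>?M) \<longlonglongrightarrow> f a - f b"
  proof -
    have ci: "integrable ?M (\<lambda>t. (ramp' ((t - c) / d k) / d k) *\<^sub>R f t)" for c k
      by (rule continuous_on_lebesgue_integrable)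
        (intro continuous_intros f continuous_on_compose2[OF ramp'_continuous[of UNIV]], use d(2)[of k] in auto)
    have "(\<lambda>k. (\<integral>t. (ramp' ((t - a) / d k) / d k) *\<^sub>R f t \<partial>?M) - (\<integral>t. (ramp' ((t - b) / d k) / d k) *\<^sub>R f t \<partial>?M)) \<longlonglongrightarrow> f a - f b"
      by (intro tendsto_diff ramp_average_limit[OF f] d ad) (use ab in auto)
    then show ?thesis unfolding \<psi>'_def scaleR_left_diff_distrib
      by (simp only: Bochner_Integration.integral_diff[OF ci ci])
  qed
  moreover have "(\<lambda>k. \<integral>t. \<psi> k t *\<^sub>R f' t \<partial>?M) \<longlonglongrightarrow> (\<integral>s. indicator {a<..<b} s *\<^sub>R f' s \<partial>?M)"
  proof (rule integral_dominated_convergence)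
    show "integrable ?M (\<lambda>t. norm (f' t))" using f' by auto
    show "(\<lambda>s. indicator {a<..<b} s *\<^sub>R f' s) \<in> borel_measurable ?M"
      using f' by (auto intro!: borel_measurable_scaleR borel_measurable_lebesgue_on_borel)
    have "isCont (\<psi> k) t" for k t using test[of k] unfolding test_function_def by (blast intro: DERIV_isCont)
    then have "\<psi> k \<in> borel_measurable borel" for k
      by (intro borel_measurable_continuous_onI continuous_at_imp_continuous_on) auto
    then show "(\<lambda>t. \<psi> k t *\<^sub>R f' t) \<in> borel_measurable ?M" for k
      using f' by (auto intro!: borel_measurable_scaleR borel_measurable_lebesgue_on_borel)
    have "\<bar>\<psi> k t\<bar> \<le> 1" for k t
      using ramp_bounds[of "(t - a) / d k"] ramp_bounds[of "(t - b) / d k"] by (simp add: \<psi>_def)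
    then show "AE t in ?M. norm (\<psi> k t *\<^sub>R f' t) \<le> norm (f' t)" for k
      by (intro AE_I2) (simp add: mult_left_le_one_le)
    show "AE t in ?M. (\<lambda>k. \<psi> k t *\<^sub>R f' t) \<longlonglongrightarrow> indicator {a<..<b} t *\<^sub>R f' t"
      using AE_neq_lebesgue_on[where t = T and c = b] AE_neq_lebesgue_on[where t = T and c = a]
    proof eventually_elim
      case (elim t)
      have one: "\<forall>\<^sub>F k in sequentially. ramp ((t - c) / d k) = (if c < t then 1 else 0)" for c
      proof (cases "c < t")
        case True
        have "\<forall>\<^sub>F k in sequentially. d k < t - c" using True by (intro order_tendstoD(2)[OF d(1)]) simp
        then show ?thesis
          by eventually_elim (use True d(2) in \<open>auto intro!: ramp_values(2) simp: le_divide_eq less_imp_le\<close>)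
      next
        case False
        then have "ramp ((t - c) / d k) = 0" for k using d(2)[of k] by (intro ramp_values(1)) (simp add: divide_le_0_iff)
        then show ?thesis using False by simp
      qed
      have "\<forall>\<^sub>F k in sequentially. \<psi> k t *\<^sub>R f' t = indicator {a<..<b} t *\<^sub>R f' t"
        using one[of a] one[of b] by eventually_elim (use elim ab in \<open>auto simp: \<psi>_def\<close>)
      then show ?case by (rule tendsto_eventually)
    qed
  qed
  ultimately have "(\<lambda>k. - (\<integral>t. \<psi> k t *\<^sub>R f' t \<partial>?M)) \<longlonglongrightarrow> f a - f b"
    "(\<lambda>k. - (\<integral>t. \<psi> k t *\<^sub>R f' t \<partial>?M)) \<longlonglongrightarrow> - (\<integral>s. indicator {a<..<b} s *\<^sub>R f' s \<partial>?M)"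
    by (simp_all only: tendsto_minus)
  then have "f a - f b = - (\<integral>s. indicator {a<..<b} s *\<^sub>R f' s \<partial>?M)"
    by (rule LIMSEQ_unique)
  then show ?thesis by (metis minus_diff_eq minus_minus)
qed

lemma weak_derivative_primitive:
  fixes f f' :: "real \<Rightarrow> 'b::{banach, second_countable_topology}"
  assumes w: "weak_derivative T f f'" and f: "continuous_on {0..T} f"
    and f': "integrable (lebesgue_on {0<..<T}) f'" and t: "0 \<le> t" "t \<le> T"
  shows "f t = f 0 + (\<integral>s. f' s \<partial>lebesgue_on {0<..<t})"
proof (cases "t = 0")
  case False
  let ?M = "lebesgue_on {0<..<T}"
  have tp: "t > 0" using False t by simp
  define a where "a k = t / real (k + 3)" for k
  have a0: "0 < a k" "a k < t / 2" for k
  proof -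
    show "0 < a k" using tp by (simp add: a_def)
    show "a k < t / 2" unfolding a_def by (rule divide_strict_left_mono) (use tp in auto)
  qed
  have alim: "a \<longlonglongrightarrow> 0" unfolding a_def by real_asymp
  have "f (t - a k) - f (a k) = (\<integral>s. indicator {a k<..<t - a k} s *\<^sub>R f' s \<partial>?M)" for k
    by (rule weak_derivative_increment[OF w f f']) (use a0[of k] t in auto)
  moreover have "(\<lambda>k. f (t - a k) - f (a k)) \<longlonglongrightarrow> f (t - 0) - f 0"
    by (intro tendsto_diff continuous_on_tendsto_compose[OF f] tendsto_intros alim always_eventually allI)
      (use a0 t in \<open>auto intro: less_imp_le, (smt (verit, best) field_sum_of_halves)+\<close>)
  moreover have "(\<lambda>k. \<integral>s. indicator {a k<..<t - a k} s *\<^sub>R f' s \<partial>?M) \<longlonglongrightarrow> (\<integral>s. (if s < t then f' s else 0) \<partial>?M)"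
  proof (rule integral_dominated_convergence)
    show "integrable ?M (\<lambda>t. norm (f' t))" using f' by auto
    have [measurable]: "f' \<in> borel_measurable ?M" using f' by auto
    show "(\<lambda>s. if s < t then f' s else 0) \<in> borel_measurable ?M" by measurable
    show "(\<lambda>s. indicator {a k<..<t - a k} s *\<^sub>R f' s) \<in> borel_measurable ?M" for k
      by (auto intro!: borel_measurable_scaleR borel_measurable_lebesgue_on_borel)
    show "AE s in ?M. norm (indicator {a k<..<t - a k} s *\<^sub>R f' s) \<le> norm (f' s)" for k
      by (intro AE_I2) (simp add: indicator_def)
    show "AE s in ?M. (\<lambda>k. indicator {a k<..<t - a k} s *\<^sub>R f' s) \<longlonglongrightarrow> (if s < t then f' s else 0)"
    proof (rule AE_I2)
      fix s assume "s \<in> space ?M"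
      then have s: "0 < s" by simp
      show "(\<lambda>k. indicator {a k<..<t - a k} s *\<^sub>R f' s) \<longlonglongrightarrow> (if s < t then f' s else 0)"
      proof (cases "s < t")
        case True
        have "\<forall>\<^sub>F k in sequentially. a k < min s (t - s)" by (rule order_tendstoD(2)[OF alim]) (use s True in simp)
        then have "\<forall>\<^sub>F k in sequentially. indicator {a k<..<t - a k} s *\<^sub>R f' s = f' s"
          by eventually_elim auto
        then show ?thesis using True by (simp add: tendsto_eventually)
      next
        case False
        then have "indicator {a k<..<t - a k} s = (0::real)" for k using a0[of k] by auto
        then show ?thesis using False by simp
      qed
    qed
  qed
  ultimately have "f t - f 0 = (\<integral>s. (if s < t then f' s else 0) \<partial>?M)"
    by (simp only: diff_zero) (rule LIMSEQ_unique)
  also have "\<dots> = (\<integral>s. f' s \<partial>lebesgue_on {0<..<t})" by (rule integral_initial_interval[symmetric]) (rule t)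
  finally show ?thesis by (simp add: algebra_simps)
qed (simp add: integral_restrict_space)

lemma conjugate_exponents:
  fixes q :: ennreal
  assumes "1 \<le> p" "1 / ennreal p + 1 / q = 1"
  shows "(q = \<infinity> \<and> p = 1) \<or> (q \<noteq> \<infinity> \<and> 1 < p \<and> 1 < enn2real q \<and> 1 / p + 1 / enn2real q = 1)"
proof -
  have p: "1 / ennreal p = ennreal (1 / p)" using assms(1) divide_ennreal[of 1 p] by simp
  show ?thesis
  proof (cases q)
    case (real r)
    show ?thesis
    proof (cases "r = 0")
      case True
      then have "1 / q = \<infinity>" using real by (simp add: ennreal_divide_eq_top_iff)
      then show ?thesis using assms(2) by simp
    next
      case False
      then have r: "r > 0" using real by simp
      then have "1 / q = ennreal (1 / r)" using real divide_ennreal[of 1 r] by simp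
      then have "ennreal (1 / p + 1 / r) = ennreal 1"
        using assms p r by (simp add: ennreal_plus)
      then have eq: "1 / p + 1 / r = 1" using assms r by (subst (asm) ennreal_inj) auto
      moreover have "1 / r > 0" "1 / p > 0" using r assms by auto
      ultimately have "1 / p < 1" "1 / r < 1" by linarith+
      then have "1 < p" "1 < r" using assms r by (auto simp: divide_less_eq)
      then show ?thesis using eq real r by simp
    qed
  next
    case top
    then have "1 / q = 0" by simp
    then have "ennreal (1 / p) = ennreal 1" using assms p by simp
    then have "1 / p = 1" using assms by (subst (asm) ennreal_inj) auto
    then show ?thesis using top by simp
  qed
qed

text \<open>Hoelder's inequality against the constant \<open>1\<close>. It is derived from Young's inequality after division by a
number \<open>N\<close> greater than the norm of \<open>f\<close>; letting \<open>N\<close> decrease to the norm includes the case of norm \<open>0\<close>.\<close>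

lemma Lq_integral_bound:
  fixes f :: "real \<Rightarrow> 'b::{banach, second_countable_topology}"
  assumes p: "1 \<le> p" "1 / ennreal p + 1 / q = 1" and f: "f \<in> Lq_space q (lebesgue_on {0<..<T})"
  shows "integrable (lebesgue_on {0<..<T}) f"
    and "0 \<le> t \<Longrightarrow> t \<le> T \<Longrightarrow>
      (\<integral>s. norm (f s) \<partial>lebesgue_on {0<..<t}) \<le> t powr (1 / p) * Lq_norm q (lebesgue_on {0<..<T}) f"
proof -
  let ?M = "lebesgue_on {0<..<T}"
  interpret finite_measure ?M by (rule finite_measure_interval)
  have fm: "f \<in> borel_measurable ?M" using f by (simp add: Lq_space_def)
  have one: "(\<integral>s. c \<partial>lebesgue_on {0<..<t}) = t * c" if "0 \<le> t" for t c :: real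
    using that by (simp add: measure_restrict_space)
  have "integrable ?M f \<and> (0 \<le> t \<longrightarrow> t \<le> T \<longrightarrow>
      (\<integral>s. norm (f s) \<partial>lebesgue_on {0<..<t}) \<le> t powr (1 / p) * Lq_norm q ?M f)" for t
    using conjugate_exponents[OF p]
  proof (elim disjE conjE)
    assume q: "q = \<infinity>" "p = 1"
    define E where "E = esssup ?M (\<lambda>x. ereal (norm (f x)))"
    have E: "E < \<infinity>" using f q by (simp add: Lq_space_def E_def)
    have L: "Lq_norm q ?M f = real_of_ereal E" using q by (simp add: Lq_norm_def E_def)
    have ae: "AE x in ?M. norm (f x) \<le> real_of_ereal E"
      using esssup_AE[of "\<lambda>x. ereal (norm (f x))" ?M]
    proof eventually_elim
      case (elim x)
      then show ?case using E unfolding E_def[symmetric] by (cases E) auto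
    qed
    have i: "integrable ?M f"
      by (rule integrable_const_bound[OF ae fm])
    have "(\<integral>s. norm (f s) \<partial>lebesgue_on {0<..<t}) \<le> t powr (1 / p) * Lq_norm q ?M f" if t: "0 \<le> t" "t \<le> T"
    proof -
      have "AE x in lebesgue_on {0<..<t}. norm (f x) \<le> real_of_ereal E"
        using ae t by (auto simp: AE_restrict_space_iff)
      then have "(\<integral>s. norm (f s) \<partial>lebesgue_on {0<..<t}) \<le> (\<integral>s. real_of_ereal E \<partial>lebesgue_on {0<..<t})"
        using integrable_initial_interval[OF i t(2)] finite_measure.integrable_const[OF finite_measure_interval]
        by (intro integral_mono_AE) auto
      then have "(\<integral>s. norm (f s) \<partial>lebesgue_on {0<..<t}) \<le> t * real_of_ereal E" unfolding one[OF t(1)] .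
      then show ?thesis using t unfolding L q(2) by simp
    qed
    with i show ?thesis by blast
  next
    assume q: "q \<noteq> \<infinity>" "1 < p" "1 < enn2real q" "1 / p + 1 / enn2real q = 1"
    define r where "r = enn2real q"
    have r: "1 < r" "1 / r + 1 / p = 1" using q by (auto simp: r_def)
    define J where "J = (\<integral>x. norm (f x) powr r \<partial>?M)"
    have Ji: "integrable ?M (\<lambda>x. norm (f x) powr r)" using f q by (simp add: Lq_space_def r_def)
    have J0: "0 \<le> J" unfolding J_def by (rule Bochner_Integration.integral_nonneg) simp
    have L: "Lq_norm q ?M f = J powr (1 / r)" using q by (simp add: Lq_norm_def J_def r_def)
    have i: "integrable ?M f"
    proof (rule Bochner_Integration.integrable_bound[OF _ fm])
      show "integrable ?M (\<lambda>x. norm (f x) powr r / r + 1 / p)" using Ji by auto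
      have "norm (f x) \<le> norm (f x) powr r / r + 1 / p" for x
        using Youngs_inequality[of r p "norm (f x)" 1] r q by simp
      then show "AE x in ?M. norm (f x) \<le> norm (norm (f x) powr r / r + 1 / p)"
        by (intro AE_I2) (auto intro: order_trans[OF _ abs_ge_self])
    qed
    have "(\<integral>s. norm (f s) \<partial>lebesgue_on {0<..<t}) \<le> t powr (1 / p) * Lq_norm q ?M f" if t: "0 \<le> t" "t \<le> T"
    proof (cases "t = 0")
      case True
      then show ?thesis by (simp add: integral_restrict_space)
    next
      case False
      then have t0: "t > 0" using t by simp
      let ?N = "lebesgue_on {0<..<t}"
      have iN: "integrable ?N f" "integrable ?N (\<lambda>x. norm (f x) powr r)"
        using integrable_initial_interval[OF i t(2)] integrable_initial_interval[OF Ji t(2)] by auto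
      have JN: "(\<integral>x. norm (f x) powr r \<partial>?N) \<le> J"
        unfolding J_def by (subst integral_initial_interval[OF t(2)]) (rule integral_mono_AE', use Ji in auto)
      have "(\<integral>s. norm (f s) \<partial>?N) \<le> t powr (1 / p) * N" if N: "N > J powr (1 / r)" for N
      proof -
        have N0: "N > 0" using N by (smt (verit) powr_ge_zero)
        have JNr: "J \<le> N powr r"
        proof -
          have "J = (J powr (1 / r)) powr r" using J0 r by (simp add: powr_powr)
          also have "\<dots> \<le> N powr r" using N r by (intro powr_mono2) auto
          finally show ?thesis .
        qed
        have pt: "norm (f s) \<le> N * t powr (1 / p) * ((norm (f s) powr r / N powr r) / r + (1 / t) / p)" for s
        proof -
          have "(norm (f s) / N) * t powr (- (1 / p)) \<le> (norm (f s) / N) powr r / r + (t powr (- (1 / p))) powr p / p"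
            using r q N0 by (intro Youngs_inequality) auto
          also have "(norm (f s) / N) powr r = norm (f s) powr r / N powr r" using N0 by (simp add: powr_divide)
          also have "(t powr (- (1 / p))) powr p = 1 / t" unfolding powr_powr using q t0 by (simp add: powr_minus_divide)
          finally have "(norm (f s) / N) * t powr (- (1 / p)) \<le> (norm (f s) powr r / N powr r) / r + (1 / t) / p" .
          then have "N * t powr (1 / p) * ((norm (f s) / N) * t powr (- (1 / p))) \<le> N * t powr (1 / p) * ((norm (f s) powr r / N powr r) / r + (1 / t) / p)"
            using N0 by (intro mult_left_mono) auto
          moreover have "N * t powr (1 / p) * ((norm (f s) / N) * t powr (- (1 / p))) = norm (f s)"
            using N0 t0 by (simp add: powr_minus field_simps)
          ultimately show ?thesis by simp
        qed
        have iR: "integrable ?N (\<lambda>s. (norm (f s) powr r / N powr r) / r + (1 / t) / p)"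
          by (rule Bochner_Integration.integrable_add, rule integrable_divide, rule integrable_divide, rule iN(2))
            (rule finite_measure.integrable_const[OF finite_measure_interval])
        have "(\<integral>s. norm (f s) \<partial>?N) \<le> (\<integral>s. N * t powr (1 / p) * ((norm (f s) powr r / N powr r) / r + (1 / t) / p) \<partial>?N)"
          using iN iR pt by (intro integral_mono) auto
        also have "\<dots> = N * t powr (1 / p) * ((\<integral>s. norm (f s) powr r \<partial>?N) / N powr r / r + t * ((1 / t) / p))"
          unfolding integral_mult_right_zero
            Bochner_Integration.integral_add[OF integrable_divide[OF integrable_divide[OF iN(2)]]
              finite_measure.integrable_const[OF finite_measure_interval]]
            integral_divide_zero one[OF t(1)] by (simp only: times_divide_eq_right)
        also have "\<dots> \<le> N * t powr (1 / p) * (1 / r + 1 / p)"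
        proof (rule mult_left_mono)
          have "(\<integral>s. norm (f s) powr r \<partial>?N) / N powr r \<le> 1" using JN JNr N0 by (simp add: divide_le_eq)
          then have "(\<integral>s. norm (f s) powr r \<partial>?N) / N powr r / r \<le> 1 / r" using r by (intro divide_right_mono) auto
          then show "(\<integral>s. norm (f s) powr r \<partial>?N) / N powr r / r + t * ((1 / t) / p) \<le> 1 / r + 1 / p" using t0 by simp
        qed (use N0 in auto)
        finally show ?thesis using r by (simp add: mult.commute)
      qed
      note * = this
      have "(\<integral>s. norm (f s) \<partial>?N) / t powr (1 / p) \<le> J powr (1 / r)"
      proof (rule dense_ge)
        fix N assume "J powr (1 / r) < N"
        from *[OF this] show "(\<integral>s. norm (f s) \<partial>?N) / t powr (1 / p) \<le> N"
          using t0 by (simp add: divide_le_eq mult.commute)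
      qed
      then show ?thesis using t0 by (simp add: L divide_le_eq mult.commute)
    qed
    with i show ?thesis by blast
  qed
  then show "integrable ?M f" "0 \<le> t \<Longrightarrow> t \<le> T \<Longrightarrow>
      (\<integral>s. norm (f s) \<partial>lebesgue_on {0<..<t}) \<le> t powr (1 / p) * Lq_norm q ?M f" by blast+
qed

lemma Lq_norm_one: "Lq_norm 1 M f = (\<integral>x. norm (f x) \<partial>M)"
  by (simp add: Lq_norm_def)

lemma Lq_space_one: "f \<in> Lq_space 1 M \<longleftrightarrow> integrable M f"
  by (auto simp: Lq_space_def integrable_norm_iff)

context orthonormal_basis
begin

text \<open>Integration by parts for an integrable derivative. Coefficientwise it is an instance of associativity:
\<open>\<integral>t. \<psi>' t * (1 * c) t\<close> is the value at \<open>T\<close> of the convolution of \<open>\<lambda>s. \<psi>' (T - s)\<close> with \<open>1 * c\<close>, where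
\<open>1 * c\<close> denotes the primitive of \<open>c\<close>.\<close>

lemma primitive_sobolev:
  assumes U: "continuous_on {0..T} U" and v: "integrable (lebesgue_on {0<..<T}) v" and T: "0 < T"
    and prim: "\<And>t n. 0 < t \<Longrightarrow> t < T \<Longrightarrow>
      inner (U t) (e n) = inner (U 0) (e n) + (\<integral>s. inner (v s) (e n) \<partial>lebesgue_on {0<..<t})"
  shows "sobolev_W1 1 T U v"
proof -
  let ?M = "lebesgue_on {0<..<T}"
  have Ui: "integrable ?M U" by (rule continuous_on_lebesgue_integrable[OF U])
  have "weak_derivative T U v"
    unfolding weak_derivative_def
  proof (intro allI impI)
    fix \<psi> \<psi>' assume "test_function T \<psi> \<psi>'"
    then obtain a b where der: "\<And>t. (\<psi> has_real_derivative \<psi>' t) (at t)" and cont: "continuous_on UNIV \<psi>'"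
      and ab: "0 < a" "b < T" "\<And>t. t \<notin> {a..b} \<Longrightarrow> \<psi> t = 0"
      unfolding test_function_def by blast
    have ends: "\<psi> 0 = 0" "\<psi> T = 0" using ab by auto
    have \<psi>'m [measurable]: "\<psi>' \<in> borel_measurable borel" using cont by (rule borel_measurable_continuous_onI)
    have \<psi>c: "continuous_on UNIV \<psi>"
      using DERIV_isCont[OF der] by (simp add: continuous_at_imp_continuous_on)
    have \<psi>m [measurable]: "\<psi> \<in> borel_measurable borel" using \<psi>c by (rule borel_measurable_continuous_onI)
    have bnd: "\<exists>C. \<forall>t\<in>{0..T}. \<bar>h t\<bar> \<le> C" if "continuous_on UNIV h" for h :: "real \<Rightarrow> real"
    proof -
      have "compact (h ` {0..T})" by (rule compact_continuous_image[OF continuous_on_subset[OF that]]) auto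
      then obtain C where "\<forall>x\<in>h ` {0..T}. norm x \<le> C" using compact_imp_bounded bounded_iff by blast
      then show ?thesis by auto
    qed
    obtain C C' where C: "\<And>t. t \<in> {0..T} \<Longrightarrow> \<bar>\<psi> t\<bar> \<le> C" "\<And>t. t \<in> {0..T} \<Longrightarrow> \<bar>\<psi>' t\<bar> \<le> C'"
      using bnd[OF \<psi>c] bnd[OF cont] by blast
    have i1: "integrable ?M (\<lambda>t. \<psi>' t *\<^sub>R U t)"
      by (rule integrable_bounded_scaleR[OF Ui, where C = C']) (use C(2) in \<open>auto intro: borel_measurable_lebesgue_on_borel\<close>)
    have i2: "integrable ?M (\<lambda>t. \<psi> t *\<^sub>R v t)"
      by (rule integrable_bounded_scaleR[OF v, where C = C]) (use C(1) in \<open>auto intro: borel_measurable_lebesgue_on_borel\<close>)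
    show "(\<integral>t. \<psi>' t *\<^sub>R U t \<partial>?M) = - (\<integral>t. \<psi> t *\<^sub>R v t \<partial>?M)"
    proof (rule basis_eqI)
      fix n
      define c where "c s = inner (v s) (e n)" for s
      have ci: "integrable ?M c" unfolding c_def using v by auto
      have FTC: "(\<integral>s. \<psi>' (T - s) \<partial>lebesgue_on {0<..<x}) = - \<psi> (T - x)" if x: "0 \<le> x" for x
      proof -
        have "((\<lambda>s. \<psi>' (T - s)) has_integral (- \<psi> (T - x)) - (- \<psi> (T - 0))) {0..x}"
        proof (rule fundamental_theorem_of_calculus[OF x])
          fix s
          have "((\<lambda>s. - \<psi> (T - s)) has_real_derivative \<psi>' (T - s)) (at s)"
          proof -
            have "((\<lambda>s. T - s) has_real_derivative - 1) (at s)" by (auto intro!: derivative_eq_intros)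
            from DERIV_minus[OF DERIV_chain2[OF der this]] show ?thesis by simp
          qed
          then show "((\<lambda>s. - \<psi> (T - s)) has_vector_derivative \<psi>' (T - s)) (at s within {0..x})"
            by (simp add: has_real_derivative_iff_has_vector_derivative has_vector_derivative_at_within)
        qed
        then have "integral {0..x} (\<lambda>s. \<psi>' (T - s)) = - \<psi> (T - x)" using ends by (simp add: integral_unique)
        moreover have "(\<integral>s. \<psi>' (T - s) \<partial>lebesgue_on {0<..<x}) = integral {0..x} (\<lambda>s. \<psi>' (T - s))"
          by (rule lebesgue_integral_eq_integral_continuous(2))
            (intro continuous_intros continuous_on_compose2[OF cont], auto)
        ultimately show ?thesis by simp
      qed
      have "inner (\<integral>t. \<psi>' t *\<^sub>R U t \<partial>?M) (e n) = (\<integral>t. \<psi>' t * inner (U t) (e n) \<partial>?M)"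
        using i1 by (simp flip: integral_inner_left)
      also have "\<dots> = (\<integral>t. \<psi>' t * inner (U 0) (e n) + \<psi>' t * convolve (\<lambda>_. 1) c t \<partial>?M)"
        by (intro Bochner_Integration.integral_cong refl) (auto simp: prim convolve_def c_def algebra_simps)
      also have "\<dots> = (\<integral>t. \<psi>' t \<partial>?M) * inner (U 0) (e n) + (\<integral>t. \<psi>' t * convolve (\<lambda>_. 1) c t \<partial>?M)"
      proof -
        have "integrable ?M (\<lambda>t. \<psi>' t * inner (U t) (e n))"
        proof -
          have "integrable ?M (\<lambda>t. inner (\<psi>' t *\<^sub>R U t) (e n))" by (rule integrable_inner_left) (rule i1)
          then show ?thesis by simp
        qed
        moreover have j: "integrable ?M (\<lambda>t. \<psi>' t * inner (U 0) (e n))"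
          by (rule integrable_mult_left, rule continuous_on_lebesgue_integrable, rule continuous_on_subset[OF cont]) auto
        ultimately have "integrable ?M (\<lambda>t. \<psi>' t * inner (U t) (e n) - \<psi>' t * inner (U 0) (e n))" by (rule Bochner_Integration.integrable_diff)
        then have "integrable ?M (\<lambda>t. \<psi>' t * convolve (\<lambda>_. 1) c t)"
          by (rule Bochner_Integration.integrable_cong[THEN iffD1, OF refl, rotated]) (auto simp: prim convolve_def c_def algebra_simps)
        with j show ?thesis by simp
      qed
      also have "(\<integral>t. \<psi>' t \<partial>?M) = 0"
        using FTC[of T] integral_reflect[of \<psi>' T] ends T by simp
      also have "(\<integral>t. \<psi>' t * convolve (\<lambda>_. 1) c t \<partial>?M) = convolve (\<lambda>s. \<psi>' (T - s)) (convolve (\<lambda>_. 1) c) T"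
        by (simp add: convolve_def[of "\<lambda>s. \<psi>' (T - s)"])
      also have "\<dots> = convolve (convolve (\<lambda>s. \<psi>' (T - s)) (\<lambda>_. 1)) c T"
        by (rule convolve_assoc_left_bounded[where A = C'])
          (use C(2) ci in \<open>auto intro!: finite_measure.integrable_const[OF finite_measure_interval]\<close>)
      also have "\<dots> = (\<integral>r. - \<psi> r * c r \<partial>?M)"
        unfolding convolve_def[of _ c]
      proof (rule Bochner_Integration.integral_cong[OF refl])
        fix r assume "r \<in> space ?M"
        then have "convolve (\<lambda>s. \<psi>' (T - s)) (\<lambda>_. 1) (T - r) = - \<psi> r"
          using FTC[of "T - r"] integral_reflect[of "\<lambda>s. \<psi>' (T - s)" "T - r"] by (simp add: convolve_def)
        then show "convolve (\<lambda>s. \<psi>' (T - s)) (\<lambda>_. 1) (T - r) * c r = - \<psi> r * c r" by simp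
      qed
      also have "\<dots> = inner (- (\<integral>t. \<psi> t *\<^sub>R v t \<partial>?M)) (e n)"
        using i2 by (simp add: c_def flip: integral_inner_left)
      finally show "inner (\<integral>t. \<psi>' t *\<^sub>R U t \<partial>?M) (e n) = inner (- (\<integral>t. \<psi> t *\<^sub>R v t \<partial>?M)) (e n)" by simp
    qed
  qed
  then show ?thesis using Ui v by (simp add: sobolev_W1_def Lq_space_one)
qed

end

section \<open>The scalar Volterra equation\<close>

lemma continuous_on_interval_bounded:
  fixes c :: "real \<Rightarrow> 'b::real_normed_vector"
  assumes "continuous_on {0..T} c"
  obtains C where "\<And>s. 0 \<le> s \<Longrightarrow> s \<le> T \<Longrightarrow> norm (c s) \<le> C"
proof -
  have "compact (c ` {0..T})" using assms by (intro compact_continuous_image) auto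
  then obtain C where "\<forall>x\<in>c ` {0..T}. norm x \<le> C" using compact_imp_bounded bounded_iff by blast
  then show thesis by (intro that[of C]) auto
qed

lemma convolve_integrand_integrable:
  fixes a c :: "real \<Rightarrow> real"
  assumes a: "a \<in> borel_measurable borel" "integrable (lebesgue_on {0<..<t}) a" and c: "continuous_on {0..t} c"
  shows "integrable (lebesgue_on {0<..<t}) (\<lambda>\<tau>. a (t - \<tau>) * c \<tau>)"
proof -
  obtain C where "\<And>s. 0 \<le> s \<Longrightarrow> s \<le> t \<Longrightarrow> norm (c s) \<le> C" using continuous_on_interval_bounded[OF c] by blast
  then show ?thesis
    using continuous_on_lebesgue_integrable[OF c]
    by (intro integrable_bounded_mult[OF integrable_reflect[OF a], where C = C]) auto
qed

lemma convolve_linear: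
  assumes a: "a \<in> borel_measurable borel" "integrable (lebesgue_on {0<..<t}) a"
    and c: "continuous_on {0..t} c" and d: "continuous_on {0..t} d"
  shows "convolve a (\<lambda>s. x * c s + y * d s) t = x * convolve a c t + y * convolve a d t"
proof -
  have "convolve a (\<lambda>s. x * c s + y * d s) t = (\<integral>\<tau>. x * (a (t - \<tau>) * c \<tau>) + y * (a (t - \<tau>) * d \<tau>) \<partial>lebesgue_on {0<..<t})"
    unfolding convolve_def by (intro Bochner_Integration.integral_cong) (auto simp: algebra_simps)
  also have "\<dots> = x * convolve a c t + y * convolve a d t"
    unfolding convolve_def
    using convolve_integrand_integrable[OF a c] convolve_integrand_integrable[OF a d]
    by (subst Bochner_Integration.integral_add) auto
  finally show ?thesis .
qed

lemma convolve_cmult_left: "convolve (\<lambda>s. k * a s) c t = k * convolve a c t"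
  unfolding convolve_def by (simp add: mult.assoc)

lemma convolve_cmult_right: "convolve a (\<lambda>s. k * c s) t = k * convolve a c t"
  unfolding convolve_def by (simp add: mult.left_commute)

lemma convolve_zero [simp]: "convolve a c 0 = 0"
  by (simp add: convolve_def integral_restrict_space)

lemma convolve_assoc_continuous:
  assumes a: "a \<in> borel_measurable borel" "integrable (lebesgue_on {0<..<t}) a"
    and b: "b \<in> borel_measurable borel" "integrable (lebesgue_on {0<..<t}) b"
    and c: "continuous_on {0..t} c"
  shows "convolve a (convolve b c) t = convolve (convolve a b) c t"
proof -
  obtain C where "\<And>s. 0 \<le> s \<Longrightarrow> s \<le> t \<Longrightarrow> norm (c s) \<le> C" using continuous_on_interval_bounded[OF c] by blast
  then show ?thesis
    using continuous_on_lebesgue_integrable[OF c]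
    by (intro convolve_assoc_right_bounded[where C = C] a b) auto
qed

lemma convolve_one: "convolve (\<lambda>_. 1) c t = (\<integral>s. c s \<partial>lebesgue_on {0<..<t})"
  by (simp add: convolve_def)

lemma frac_kernel_one: "0 < t \<Longrightarrow> frac_kernel 1 t = 1"
  by (simp add: frac_kernel_def)

lemma convolve_frac_one: "convolve (frac_kernel 1) c t = (\<integral>s. c s \<partial>lebesgue_on {0<..<t})"
  unfolding convolve_one[symmetric] by (rule convolve_cong) (auto simp: frac_kernel_one)

lemma zero_of_zero_primitive:
  fixes z :: "real \<Rightarrow> real"
  assumes z: "continuous_on {0..T} z" and T: "0 < T"
    and prim: "\<And>t. 0 \<le> t \<Longrightarrow> t \<le> T \<Longrightarrow> (\<integral>s. z s \<partial>lebesgue_on {0<..<t}) = 0"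
    and t: "0 \<le> t" "t \<le> T"
  shows "z t = 0"
proof -
  have "((\<lambda>t. integral {0..t} z) has_vector_derivative z t) (at t within {0..T})"
    by (rule integral_has_vector_derivative) (use z t in auto)
  moreover have "integral {0..s} z = 0" if "s \<in> {0..T}" for s
    using prim[of s] that lebesgue_integral_eq_integral_continuous(2)[OF continuous_on_subset[OF z], of s] by auto
  ultimately have "((\<lambda>t. 0) has_vector_derivative z t) (at t within {0..T})"
    using t by (intro has_vector_derivative_transform[of t "{0..T}" "\<lambda>_. 0" "\<lambda>t. integral {0..t} z"]) auto
  then show ?thesis
    using t T by (intro vector_derivative_unique_within[OF _ _ has_vector_derivative_const, of t "{0..T}"])
      (auto simp: trivial_limit_within islimpt_Icc)
qed

text \<open>The vector-valued statement along a single basis vector.\<close>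

lemma (in orthonormal_basis) convolve_continuous:
  assumes a: "a \<in> borel_measurable borel" "integrable (lebesgue_on {0<..<T}) a" and c: "continuous_on {0..T} c"
  shows "continuous_on {0..T} (convolve a c)"
proof -
  have cc: "continuous_on {0..T} (\<lambda>s. c s *\<^sub>R e 0)" by (intro continuous_intros c)
  obtain U where U: "continuous_on {0..T} U"
    "\<And>t n. 0 \<le> t \<Longrightarrow> t \<le> T \<Longrightarrow> inner (U t) (e n) = convolve (\<lambda>\<tau>. a \<tau>) (\<lambda>\<tau>. inner (c \<tau> *\<^sub>R e 0) (e n)) t"
    by (rule diag_convolution_continuous[of "\<lambda>\<tau> n. a \<tau>" T "\<lambda>\<tau>. \<bar>a \<tau>\<bar>", OF _ _ _ cc]) (use a in auto)
  have "continuous_on {0..T} (\<lambda>t. inner (U t) (e 0))" by (intro continuous_intros U)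
  then show ?thesis by (rule continuous_on_eq) (simp add: U(2) ortho)
qed

locale fractional_evolution =
  fixes V DA :: "'h::{real_inner,banach,second_countable_topology} set"
    and E :: "'h \<Rightarrow> 'h \<Rightarrow> real" and A :: "'h \<Rightarrow> 'h" and e :: "nat \<Rightarrow> 'h" and lam :: "nat \<Rightarrow> real"
    and \<alpha> T :: real
  assumes eigenbasis: "eigenbasis DA A e lam"
    and selfadjoint: "nonneg_selfadjoint DA A"
    and associated: "associated_operator V E DA A e lam"
    and symmetric: "\<And>u v. u \<in> V \<Longrightarrow> v \<in> V \<Longrightarrow> E u v = E v u"
    and alpha: "1 < \<alpha>" "\<alpha> < 2" and T: "0 < T"
begin

sublocale orthonormal_basis e
  using eigenbasis by unfold_locales (auto simp: eigenbasis_def)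

abbreviation \<gamma> where "\<gamma> \<equiv> 1 / \<alpha>"

abbreviation ek :: "real \<Rightarrow> nat \<Rightarrow> real \<Rightarrow> real" where "ek \<beta> n \<equiv> ml_kernel \<alpha> \<beta> (lam n)"

lemma gamma: "1 / 2 < \<gamma>" "\<gamma> < 1" "0 < \<gamma>" "\<alpha> * \<gamma> = 1"
  using alpha by (auto simp: field_simps)

lemma lam_pos: "0 < lam n" and lam_ge: "lam 0 \<le> lam n"
proof -
  have "mono lam" "0 < lam 0" using eigenbasis by (auto simp: eigenbasis_def)
  then show "lam 0 \<le> lam n" by (simp add: monoD)
  with \<open>0 < lam 0\<close> show "0 < lam n" by simp
qed

lemma ek_measurable [measurable]: "0 < \<beta> \<Longrightarrow> ek \<beta> n \<in> borel_measurable borel"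
  by (rule ml_kernel_measurable[OF alpha])

lemma ek_integrable: "0 < \<beta> \<Longrightarrow> 0 \<le> t \<Longrightarrow> integrable (lebesgue_on {0<..<t}) (ek \<beta> n)"
  by (rule ml_kernel_integrable[OF alpha _ lam_pos])

lemma ek_bound:
  assumes "0 < \<beta>"
  obtains B where "B > 0" "\<And>n t s. 0 < t \<Longrightarrow> 0 \<le> s \<Longrightarrow> s \<le> 1 \<Longrightarrow>
    \<bar>lam n powr s * ek \<beta> n t\<bar> \<le> B * t powr (\<beta> - 1 - \<alpha> * s)"
  using ml_kernel_bound[OF alpha assms] lam_pos by (metis abs_mult abs_of_nonneg powr_ge_zero)

lemma frac_ek: "0 < \<mu> \<Longrightarrow> 0 < \<beta> \<Longrightarrow> 0 < t \<Longrightarrow> convolve (frac_kernel \<mu>) (ek \<beta> n) t = ek (\<beta> + \<mu>) n t"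
  by (rule frac_kernel_ml_kernel_convolution[OF alpha])

lemma ek_frac: "0 < \<mu> \<Longrightarrow> 0 < \<beta> \<Longrightarrow> 0 < t \<Longrightarrow> convolve (ek \<beta> n) (frac_kernel \<mu>) t = ek (\<beta> + \<mu>) n t"
  using convolve_commute[of "ek \<beta> n" "frac_kernel \<mu>"] frac_ek by simp

lemma ek_primitive: "0 < \<beta> \<Longrightarrow> 0 < t \<Longrightarrow> (\<integral>s. ek \<beta> n s \<partial>lebesgue_on {0<..<t}) = ek (\<beta> + 1) n t"
  using frac_ek[of 1 \<beta> t n] by (simp add: convolve_frac_one)

lemma ek_recurrence: "0 < \<beta> \<Longrightarrow> 0 < t \<Longrightarrow> lam n * ek (\<beta> + \<alpha>) n t = frac_kernel \<beta> t - ek \<beta> n t"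
  by (rule ml_kernel_recurrence[OF alpha])

text \<open>For \<open>t > 0\<close> this is \<open>ek 1 n t\<close>; at the origin, where \<open>0 powr 0 = 0\<close>, it has the value \<open>1\<close> that makes it
continuous.\<close>

definition E1 :: "nat \<Rightarrow> real \<Rightarrow> real" where
  "E1 n t = mittag_leffler \<alpha> 1 (- lam n * t powr \<alpha>)"

lemma E1_measurable [measurable]: "E1 n \<in> borel_measurable borel"
  unfolding E1_def[abs_def]
  using measurable_compose[OF _ mittag_leffler_measurable[OF alpha], of "\<lambda>t. - lam n * t powr \<alpha>" borel 1] by measurable

lemma E1_eq: "0 < t \<Longrightarrow> E1 n t = ek 1 n t"
  by (simp add: E1_def ml_kernel_def)

lemma E1_zero: "E1 n 0 = 1"
  by (simp add: E1_def mittag_leffler_zero[OF alpha])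

lemma ml_continuous_nonneg: "0 < \<beta> \<Longrightarrow> continuous_on {0..} (\<lambda>t. mittag_leffler \<alpha> \<beta> (- lam n * t powr \<alpha>))"
  using alpha
  by (intro continuous_on_compose2[OF mittag_leffler_continuous[OF alpha, of \<beta> UNIV]] continuous_intros continuous_on_powr') auto

lemma E1_continuous: "continuous_on {0..T} (E1 n)"
  unfolding E1_def[abs_def] by (rule continuous_on_subset[OF ml_continuous_nonneg]) auto

lemma ek_continuous: "1 < \<beta> \<Longrightarrow> continuous_on {0..t} (ek \<beta> n)"
  unfolding ml_kernel_def[abs_def]
  by (rule continuous_on_mult[OF continuous_on_powr' continuous_on_subset[OF ml_continuous_nonneg]])
    (auto intro: continuous_on_id continuous_on_const)

lemma ek_zero: "ek \<beta> n 0 = 0"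
  by (simp add: ml_kernel_def)

definition mild :: "(real \<Rightarrow> 'h) \<Rightarrow> 'h \<Rightarrow> 'h \<Rightarrow> nat \<Rightarrow> real \<Rightarrow> real" where
  "mild f u0 u1 n t = inner u0 (e n) * E1 n t + inner u1 (e n) * ek 2 n t
     + convolve (ek \<alpha> n) (\<lambda>\<tau>. inner (f \<tau>) (e n)) t"

text \<open>The notion that links existence and uniqueness: weak solutions are mild, and mild solutions with
\<open>u0\<close> in \<open>V\<^sub>\<gamma>\<close> and a source of class \<open>W\<^bsup>1,1\<^esup>\<close> are strong.\<close>

definition is_mild :: "(real \<Rightarrow> 'h) \<Rightarrow> 'h \<Rightarrow> 'h \<Rightarrow> (real \<Rightarrow> 'h) \<Rightarrow> bool" where
  "is_mild f u0 u1 u \<longleftrightarrow> (\<forall>t\<in>{0..T}. \<forall>n. inner (u t) (e n) = mild f u0 u1 n t)"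

lemma coefficient_continuous: "continuous_on {0..T} f \<Longrightarrow> t \<le> T \<Longrightarrow> continuous_on {0..t} (\<lambda>s. inner (f s) (e n))"
  by (rule continuous_on_inner[OF continuous_on_subset[of "{0..T}" f] continuous_on_const]) auto

lemma mild_continuous: "continuous_on {0..T} f \<Longrightarrow> continuous_on {0..T} (mild f u0 u1 n)"
  unfolding mild_def[abs_def] using alpha T
  by (intro continuous_intros E1_continuous ek_continuous convolve_continuous ek_measurable ek_integrable) auto

text \<open>Convolution with \<open>g\<^sub>\<alpha>\<close> raises the index of each kernel by \<open>\<alpha>\<close>, and multiplication by the eigenvalue brings
it back down by \<open>ek_recurrence\<close>.\<close>

lemma mild_volterra:
  assumes f: "continuous_on {0..T} f" and t: "0 \<le> t" "t \<le> T"
  shows "mild f u0 u1 n t - inner u0 (e n) - t * inner u1 (e n)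
    = convolve (frac_kernel \<alpha>) (\<lambda>s. inner (f s) (e n) - lam n * mild f u0 u1 n s) t"
proof (cases "t = 0")
  case True
  then show ?thesis by (simp add: mild_def E1_zero ek_zero)
next
  case False
  then have tp: "0 < t" using t by simp
  define c where "c s = inner (f s) (e n)" for s
  have cc: "continuous_on {0..t} c" "continuous_on {0..T} c" unfolding c_def using coefficient_continuous[OF f] t by auto
  have F: "frac_kernel \<alpha> \<in> borel_measurable borel" "integrable (lebesgue_on {0<..<t}) (frac_kernel \<alpha>)"
    using frac_kernel_integrable alpha t by auto
  have K: "ek \<alpha> n \<in> borel_measurable borel" "integrable (lebesgue_on {0<..<t}) (ek \<alpha> n)"
    using ek_integrable alpha t by auto
  have C1: "continuous_on {0..t} (E1 n)" by (rule continuous_on_subset[OF E1_continuous]) (use t in auto)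
  have C2: "continuous_on {0..t} (ek 2 n)" by (rule ek_continuous) simp
  have C3: "continuous_on {0..t} (convolve (ek \<alpha> n) c)" by (rule convolve_continuous[OF K cc(1)])
  have C4: "continuous_on {0..t} (mild f u0 u1 n)" by (rule continuous_on_subset[OF mild_continuous[OF f]]) (use t in auto)
  define x y where "x = inner u0 (e n)" and "y = inner u1 (e n)"
  have C5: "continuous_on {0..t} (\<lambda>s. x * E1 n s + y * ek 2 n s)" by (intro continuous_intros C1 C2)
  have p1: "lam n * convolve (frac_kernel \<alpha>) (E1 n) t = 1 - E1 n t"
  proof -
    have "convolve (frac_kernel \<alpha>) (E1 n) t = convolve (frac_kernel \<alpha>) (ek 1 n) t"
      by (rule convolve_cong) (auto simp: E1_eq)
    then show ?thesis using frac_ek[of \<alpha> 1 t n] ek_recurrence[of 1 t n] alpha tp by (simp add: E1_eq frac_kernel_one)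
  qed
  have p2: "lam n * convolve (frac_kernel \<alpha>) (ek 2 n) t = t - ek 2 n t"
  proof -
    have "frac_kernel 2 t = t" using tp Gamma_fact[of 1, where 'a = real] by (simp add: frac_kernel_def)
    then show ?thesis using frac_ek[of \<alpha> 2 t n] ek_recurrence[of 2 t n] alpha tp by simp
  qed
  have p3: "lam n * convolve (frac_kernel \<alpha>) (convolve (ek \<alpha> n) c) t = convolve (frac_kernel \<alpha>) c t - convolve (ek \<alpha> n) c t"
  proof -
    have "convolve (frac_kernel \<alpha>) (convolve (ek \<alpha> n) c) t = convolve (convolve (frac_kernel \<alpha>) (ek \<alpha> n)) c t"
      by (rule convolve_assoc_continuous[OF F K cc(1)])
    also have "lam n * \<dots> = convolve (\<lambda>s. lam n * convolve (frac_kernel \<alpha>) (ek \<alpha> n) s) c t"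
      by (rule convolve_cmult_left[symmetric])
    also have "\<dots> = convolve (\<lambda>s. frac_kernel \<alpha> s - ek \<alpha> n s) c t"
      using alpha ek_recurrence[of \<alpha> _ n] by (intro convolve_cong) (auto simp: frac_ek)
    also have "\<dots> = convolve (frac_kernel \<alpha>) c t - convolve (ek \<alpha> n) c t"
      unfolding convolve_def left_diff_distrib
      using convolve_integrand_integrable[OF F cc(1)] convolve_integrand_integrable[OF K cc(1)]
      by (rule Bochner_Integration.integral_diff)
    finally show ?thesis .
  qed
  have "convolve (frac_kernel \<alpha>) (mild f u0 u1 n) t
     = convolve (frac_kernel \<alpha>) (\<lambda>s. 1 * (x * E1 n s + y * ek 2 n s) + 1 * convolve (ek \<alpha> n) c s) t"
    by (intro convolve_cong) (simp_all add: mild_def x_def y_def c_def[abs_def])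
  also have "\<dots> = x * convolve (frac_kernel \<alpha>) (E1 n) t + y * convolve (frac_kernel \<alpha>) (ek 2 n) t
     + convolve (frac_kernel \<alpha>) (convolve (ek \<alpha> n) c) t"
    unfolding convolve_linear[OF F C5 C3] convolve_linear[OF F C1 C2] by simp
  finally have m: "lam n * convolve (frac_kernel \<alpha>) (mild f u0 u1 n) t =
     x * (1 - E1 n t) + y * (t - ek 2 n t) + (convolve (frac_kernel \<alpha>) c t - convolve (ek \<alpha> n) c t)"
    by (simp only: p1[symmetric] p2[symmetric] p3[symmetric]) (simp add: algebra_simps)
  have "convolve (frac_kernel \<alpha>) (\<lambda>s. inner (f s) (e n) - lam n * mild f u0 u1 n s) t
    = convolve (frac_kernel \<alpha>) (\<lambda>s. 1 * c s + (- lam n) * mild f u0 u1 n s) t"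
    by (simp add: c_def)
  also have "\<dots> = convolve (frac_kernel \<alpha>) c t - lam n * convolve (frac_kernel \<alpha>) (mild f u0 u1 n) t"
    unfolding convolve_linear[OF F cc(1) C4] by simp
  finally show ?thesis unfolding m by (simp add: mild_def x_def y_def c_def[abs_def] algebra_simps)
qed

text \<open>Convolving the equation with the resolvent kernel \<open>e\<^sub>\<alpha>\<close> yields \<open>e\<^sub>\<alpha> * z = - (g\<^sub>\<alpha> - e\<^sub>\<alpha>) * z\<close>, that is
\<open>g\<^sub>\<alpha> * z = 0\<close>, and the equation itself then says \<open>z = 0\<close>.\<close>

lemma volterra_homogeneous:
  assumes z: "continuous_on {0..T} z"
    and eq: "\<And>t. 0 \<le> t \<Longrightarrow> t \<le> T \<Longrightarrow> z t = - lam n * convolve (frac_kernel \<alpha>) z t"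
    and t: "0 \<le> t" "t \<le> T"
  shows "z t = 0"
proof (cases "t = 0")
  case True
  then show ?thesis using eq[of 0] T by simp
next
  case False
  then have tp: "0 < t" using t by simp
  have zc: "continuous_on {0..t} z" using z t by (auto intro: continuous_on_subset)
  have F: "frac_kernel \<alpha> \<in> borel_measurable borel" "integrable (lebesgue_on {0<..<t}) (frac_kernel \<alpha>)"
    using frac_kernel_integrable alpha t by auto
  have K: "ek \<alpha> n \<in> borel_measurable borel" "integrable (lebesgue_on {0<..<t}) (ek \<alpha> n)"
    using ek_integrable alpha t by auto
  have "convolve (ek \<alpha> n) z t = convolve (ek \<alpha> n) (\<lambda>s. - lam n * convolve (frac_kernel \<alpha>) z s) t"
  proof (rule convolve_cong)
    fix s assume "0 < s" "s < t"
    then show "z s = - lam n * convolve (frac_kernel \<alpha>) z s" by (intro eq) (use t in auto)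
  qed simp
  also have "\<dots> = - lam n * convolve (convolve (ek \<alpha> n) (frac_kernel \<alpha>)) z t"
    unfolding convolve_cmult_right convolve_assoc_continuous[OF K F zc] ..
  also have "\<dots> = - convolve (\<lambda>s. lam n * convolve (ek \<alpha> n) (frac_kernel \<alpha>) s) z t"
    unfolding convolve_cmult_left by simp
  also have "\<dots> = - convolve (\<lambda>s. frac_kernel \<alpha> s - ek \<alpha> n s) z t"
    using alpha ek_recurrence[of \<alpha> _ n]
    by (intro arg_cong[of _ _ uminus] convolve_cong) (auto simp: ek_frac)
  also have "\<dots> = convolve (ek \<alpha> n) z t - convolve (frac_kernel \<alpha>) z t"
    unfolding convolve_def left_diff_distrib
    using convolve_integrand_integrable[OF F zc] convolve_integrand_integrable[OF K zc]
    by (subst Bochner_Integration.integral_diff) auto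
  finally have "convolve (frac_kernel \<alpha>) z t = 0" by simp
  then show ?thesis using eq[OF t] by simp
qed

lemma volterra_unique:
  assumes f: "continuous_on {0..T} f" and y: "continuous_on {0..T} y"
    and eq: "\<And>t. 0 \<le> t \<Longrightarrow> t \<le> T \<Longrightarrow> y t - inner u0 (e n) - t * inner u1 (e n)
      = convolve (frac_kernel \<alpha>) (\<lambda>s. inner (f s) (e n) - lam n * y s) t"
    and t: "0 \<le> t" "t \<le> T"
  shows "y t = mild f u0 u1 n t"
proof -
  let ?m = "mild f u0 u1 n"
  have m: "continuous_on {0..T} ?m" by (rule mild_continuous[OF f])
  have "y t - ?m t = 0"
  proof (rule volterra_homogeneous[OF _ _ t])
    show "continuous_on {0..T} (\<lambda>t. y t - ?m t)" by (intro continuous_intros y m)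
    fix t assume t: "0 \<le> t" "t \<le> T"
    have F: "frac_kernel \<alpha> \<in> borel_measurable borel" "integrable (lebesgue_on {0<..<t}) (frac_kernel \<alpha>)"
      using frac_kernel_integrable alpha t by auto
    have c: "continuous_on {0..t} y" "continuous_on {0..t} ?m" "continuous_on {0..t} (\<lambda>s. inner (f s) (e n))"
      using y m coefficient_continuous[OF f] t by (auto intro: continuous_on_subset)
    have *: "convolve (frac_kernel \<alpha>) (\<lambda>s. inner (f s) (e n) - lam n * g s) t
       = convolve (frac_kernel \<alpha>) (\<lambda>s. inner (f s) (e n)) t - lam n * convolve (frac_kernel \<alpha>) g t"
      if "continuous_on {0..t} g" for g
      using convolve_linear[OF F c(3) that, of 1 "- lam n"] by simp
    have d: "convolve (frac_kernel \<alpha>) (\<lambda>s. y s - ?m s) t = convolve (frac_kernel \<alpha>) y t - convolve (frac_kernel \<alpha>) ?m t"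
      using convolve_linear[OF F c(1,2), of 1 "- 1"] by simp
    show "y t - ?m t = - lam n * convolve (frac_kernel \<alpha>) (\<lambda>s. y s - ?m s) t"
      unfolding d using eq[OF t] mild_volterra[OF f t, of u0 u1 n] *[OF c(1)] *[OF c(2)] by (simp add: algebra_simps)
  qed
  then show ?thesis by simp
qed

end

section \<open>Fractional power spaces and their duals\<close>

context fractional_evolution
begin

abbreviation VS where "VS \<equiv> V_space e lam"
abbreviation VN where "VN \<equiv> V_norm e lam"

text \<open>The fractional power of \<open>A\<close> with exponent \<open>s\<close>.\<close>

definition pow :: "real \<Rightarrow> 'h \<Rightarrow> 'h" where
  "pow s h = of_coefficients (\<lambda>n. lam n powr s * inner h (e n))"

lemma lam_powr_square: "(lam n powr s)\<^sup>2 = lam n powr (2 * s)"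
  unfolding power2_eq_square powr_add[symmetric] by simp

lemma V_space_term: "(inner h (e n))\<^sup>2 * lam n powr (2 * s) = (lam n powr s * inner h (e n))\<^sup>2"
  by (simp add: power_mult_distrib lam_powr_square mult.commute)

lemma V_space_iff: "h \<in> VS s \<longleftrightarrow> summable (\<lambda>n. (lam n powr s * inner h (e n))\<^sup>2)"
  unfolding V_space_def mem_Collect_eq V_space_term ..

lemma inner_pow: "h \<in> VS s \<Longrightarrow> inner (pow s h) (e n) = lam n powr s * inner h (e n)"
  unfolding pow_def V_space_iff by (rule inner_of_coefficients)

lemma V_spaceI:
  assumes "\<And>n. inner x (e n) = lam n powr s * inner h (e n)"
  shows "h \<in> VS s" "pow s h = x" "VN s h = norm x"
proof -
  have "(\<lambda>n. (lam n powr s * inner h (e n))\<^sup>2) sums (norm x)\<^sup>2"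
    using parseval[of x] by (simp add: assms)
  then show V: "h \<in> VS s" and "VN s h = norm x"
    by (auto simp: V_space_iff V_norm_def V_space_term sums_iff)
  show "pow s h = x" by (rule basis_eqI) (simp add: inner_pow[OF V] assms)
qed

lemma V_norm_pow: "h \<in> VS s \<Longrightarrow> VN s h = norm (pow s h)"
  by (rule V_spaceI(3)) (rule inner_pow)

lemma V_basis: "e k \<in> VS s" "pow s (e k) = lam k powr s *\<^sub>R e k"
  by (rule V_spaceI[where x = "lam k powr s *\<^sub>R e k"], simp add: ortho)+

lemma V_add: "v \<in> VS s \<Longrightarrow> w \<in> VS s \<Longrightarrow> v + w \<in> VS s"
  and pow_add: "v \<in> VS s \<Longrightarrow> w \<in> VS s \<Longrightarrow> pow s (v + w) = pow s v + pow s w"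
  by (rule V_spaceI[where x = "pow s v + pow s w"], simp add: inner_add_left inner_pow ring_distribs)+

lemma V_scale: "v \<in> VS s \<Longrightarrow> c *\<^sub>R v \<in> VS s"
  and pow_scale: "v \<in> VS s \<Longrightarrow> pow s (c *\<^sub>R v) = c *\<^sub>R pow s v"
  by (rule V_spaceI[where x = "c *\<^sub>R pow s v"], simp add: inner_pow)+

lemma V_diff: "v \<in> VS s \<Longrightarrow> w \<in> VS s \<Longrightarrow> v - w \<in> VS s"
  and pow_diff: "v \<in> VS s \<Longrightarrow> w \<in> VS s \<Longrightarrow> pow s (v - w) = pow s v - pow s w"
  by (rule V_spaceI[where x = "pow s v - pow s w"], simp add: inner_diff_left inner_pow ring_distribs)+

lemma lam_powr_le: "s \<le> 0 \<Longrightarrow> \<bar>lam n powr s\<bar> \<le> lam 0 powr s"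
  using powr_mono2'[OF _ lam_pos lam_ge] by simp

lemma V_mono:
  assumes "s' \<le> s" "h \<in> VS s"
  shows "h \<in> VS s'" "VN s' h \<le> lam 0 powr (s' - s) * VN s h"
proof -
  let ?x = "diag (\<lambda>n. lam n powr (s' - s)) (pow s h)"
  have b: "\<bar>lam n powr (s' - s)\<bar> \<le> lam 0 powr (s' - s)" for n using assms by (intro lam_powr_le) simp
  have "inner ?x (e n) = lam n powr s' * inner h (e n)" for n
    unfolding inner_diag[OF b] inner_pow[OF assms(2)] by (simp flip: mult.assoc powr_add)
  note * = V_spaceI[OF this]
  show "h \<in> VS s'" by (rule *)
  show "VN s' h \<le> lam 0 powr (s' - s) * VN s h"
    unfolding *(3) V_norm_pow[OF assms(2)] by (rule norm_diag_le[OF b])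
qed

lemma V_space_zero: "h \<in> VS 0" "VN 0 h = norm h"
  by (rule V_spaceI[where x = h], use lam_pos in \<open>simp add: less_imp_neq[symmetric]\<close>)+

lemma norm_le_V_norm: "0 \<le> s \<Longrightarrow> h \<in> VS s \<Longrightarrow> norm h \<le> lam 0 powr (- s) * VN s h"
  using V_mono(2)[of 0 s h] by (simp add: V_space_zero)

lemma inner_pow_eqI:
  assumes v: "v \<in> VS s" and "\<And>n. inner x (e n) * lam n powr s = inner y (e n)"
  shows "inner x (pow s v) = inner y v"
proof -
  have "(\<lambda>n. inner x (e n) * inner (pow s v) (e n)) sums inner x (pow s v)" by (rule inner_sums)
  moreover have "inner x (e n) * inner (pow s v) (e n) = inner y (e n) * inner v (e n)" for n
    using assms(2)[of n] by (simp add: inner_pow[OF v] flip: mult.assoc)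
  ultimately show ?thesis using inner_sums[of y v] sums_unique2 by simp
qed

lemma A_coefficient:
  assumes "w \<in> DA"
  shows "inner (A w) (e n) = lam n * inner w (e n)"
proof -
  have "inner (A w) (e n) = inner w (A (e n))"
    using selfadjoint eigenbasis assms unfolding nonneg_selfadjoint_def eigenbasis_def by blast
  also have "A (e n) = lam n *\<^sub>R e n" using eigenbasis unfolding eigenbasis_def by blast
  finally show ?thesis by simp
qed

text \<open>A self-adjoint operator has no proper symmetric extension, so it suffices to check the symmetry relation
between \<open>u\<close> and \<open>x\<close>, which can be read off from the coefficients.\<close>

lemma DA_intro:
  assumes "\<And>n. inner x (e n) = lam n * inner u (e n)"
  shows "u \<in> DA" "A u = x"
proof -
  have maximal: "y \<in> DA" if "\<And>x. x \<in> DA \<Longrightarrow> inner (A x) y = inner x z" for y z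
    using selfadjoint that unfolding nonneg_selfadjoint_def by blast
  show "u \<in> DA"
  proof (rule maximal)
    fix w assume w: "w \<in> DA"
    have "(\<lambda>n. inner (A w) (e n) * inner u (e n)) sums inner (A w) u" by (rule inner_sums)
    moreover have "(\<lambda>n. inner w (e n) * inner x (e n)) sums inner w x" by (rule inner_sums)
    ultimately show "inner (A w) u = inner w x"
      using sums_unique2 by (simp add: A_coefficient[OF w] assms mult_ac)
  qed
  then show "A u = x" by (intro basis_eqI) (simp add: A_coefficient assms)
qed

text \<open>The operator represents the form only when one argument lies in \<open>DA\<close>; by symmetry this may be the basis
vector.\<close>

lemma form_basis:
  assumes "u \<in> VS \<gamma>"
  shows "E u (e n) = lam n * inner u (e n)"
proof -
  have V: "V = VS (1 / 2)" and Av: "\<And>u v. u \<in> DA \<Longrightarrow> v \<in> V \<Longrightarrow> E u v = inner (A u) v"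
    using associated unfolding associated_operator_def by blast+
  have ev: "e n \<in> DA" "A (e n) = lam n *\<^sub>R e n"
    using eigenbasis unfolding eigenbasis_def by blast+
  have u: "u \<in> V" unfolding V by (rule V_mono(1)[OF _ assms]) (use gamma in simp)
  have "E u (e n) = E (e n) u" using u V_basis V by (intro symmetric) auto
  then show ?thesis using Av[OF ev(1) u] by (simp add: ev(2) inner_commute)
qed

lemma form_DA: "u \<in> DA \<Longrightarrow> v \<in> VS \<gamma> \<Longrightarrow> E u v = inner (A u) v"
  using associated V_mono(1)[of "1 / 2" \<gamma> v] gamma unfolding associated_operator_def by auto

lemma inner_Vdual: "0 \<le> s \<Longrightarrow> inner h \<in> Vdual e lam s"
proof -
  assume s: "0 \<le> s"
  have "\<bar>inner h v\<bar> \<le> norm h * lam 0 powr (- s) * VN s v" if "v \<in> VS s" for v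
  proof -
    have "\<bar>inner h v\<bar> \<le> norm h * norm v" by (rule Cauchy_Schwarz_ineq2)
    also have "\<dots> \<le> norm h * (lam 0 powr (- s) * VN s v)" by (intro mult_left_mono norm_le_V_norm that s) simp
    finally show ?thesis by (simp add: mult.assoc)
  qed
  then show ?thesis unfolding Vdual_def by (auto simp: inner_add_right)
qed

text \<open>The functional on \<open>V\<^sub>s\<close> that would be written \<open>A\<^sup>s x\<close>. By \<open>Vdual_norm_eq\<close> the map \<open>functional s\<close> is an isometry
from the Hilbert space into the dual of \<open>V\<^sub>s\<close>.\<close>

definition functional :: "real \<Rightarrow> 'h \<Rightarrow> 'h \<Rightarrow> real" where
  "functional s x = (\<lambda>v. inner x (pow s v))"

lemma functional_Vdual: "functional s x \<in> Vdual e lam s"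
  unfolding Vdual_def functional_def
  by (auto simp: pow_add pow_scale inner_add_right V_norm_pow Cauchy_Schwarz_ineq2 intro!: exI[of _ "norm x"])

lemma functional_basis: "functional s x (e n) = lam n powr s * inner x (e n)"
  by (simp add: functional_def V_basis)

lemma Vdual_norm_eq:
  assumes "\<And>n. l (e n) = lam n powr s * inner x (e n)"
  shows "Vdual_norm e lam s l = norm x"
proof -
  have "(l (e n))\<^sup>2 * lam n powr (- 2 * s) = (inner x (e n))\<^sup>2" for n
  proof -
    have "(lam n powr s)\<^sup>2 * lam n powr (- 2 * s) = 1"
      using lam_pos[of n] by (simp add: lam_powr_square less_imp_neq[symmetric] flip: powr_add)
    then show ?thesis unfolding assms by (simp add: power_mult_distrib mult_ac)
  qed
  then show ?thesis using parseval[of x] by (simp add: Vdual_norm_def sums_iff)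
qed

lemma Vdual_diff:
  assumes "l1 \<in> Vdual e lam s" "l2 \<in> Vdual e lam s"
  shows "(\<lambda>v. l1 v - l2 v) \<in> Vdual e lam s"
proof -
  obtain K1 K2 where "\<forall>v\<in>VS s. \<bar>l1 v\<bar> \<le> K1 * VN s v" "\<forall>v\<in>VS s. \<bar>l2 v\<bar> \<le> K2 * VN s v"
    using assms unfolding Vdual_def by blast
  then have "\<forall>v\<in>VS s. \<bar>l1 v - l2 v\<bar> \<le> (K1 + K2) * VN s v"
    by (simp add: ring_distribs) (smt (verit))
  then have "\<exists>K. \<forall>v\<in>VS s. \<bar>l1 v - l2 v\<bar> \<le> K * VN s v" by blast
  with assms show ?thesis unfolding Vdual_def mem_Collect_eq by (simp add: algebra_simps)
qed

lemma Vdual_scale: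
  assumes "l \<in> Vdual e lam s"
  shows "(\<lambda>v. l v / c) \<in> Vdual e lam s"
proof -
  obtain K where "\<forall>v\<in>VS s. \<bar>l v\<bar> \<le> K * VN s v" using assms unfolding Vdual_def by blast
  then have "\<forall>v\<in>VS s. \<bar>l v / c\<bar> \<le> (K / \<bar>c\<bar>) * VN s v"
    by (simp add: divide_right_mono)
  then have "\<exists>K. \<forall>v\<in>VS s. \<bar>l v / c\<bar> \<le> K * VN s v" by blast
  with assms show ?thesis unfolding Vdual_def mem_Collect_eq by (simp add: add_divide_distrib)
qed

text \<open>The norm is defined by an infinite sum, which is informative only if the series converges. This follows from
boundedness of \<open>l\<close>, tested on the partial sums of the vector that represents it.\<close>

lemma Vdual_coefficient_bound:
  assumes l: "l \<in> Vdual e lam s"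
  shows "\<bar>l (e n)\<bar> * lam n powr (- s) \<le> Vdual_norm e lam s l"
proof -
  define c where "c n = l (e n) * lam n powr (- s)" for n
  have csq: "(l (e n))\<^sup>2 * lam n powr (- 2 * s) = (c n)\<^sup>2" for n
    using lam_powr_square[of n "- s"] by (simp add: c_def power_mult_distrib)
  obtain K where K: "\<And>v. v \<in> VS s \<Longrightarrow> \<bar>l v\<bar> \<le> K * VN s v"
    and add: "\<And>v w. v \<in> VS s \<Longrightarrow> w \<in> VS s \<Longrightarrow> l (v + w) = l v + l w"
    and sc: "\<And>c v. v \<in> VS s \<Longrightarrow> l (c *\<^sub>R v) = c * l v"
    using l unfolding Vdual_def by blast
  have "summable (\<lambda>n. (c n)\<^sup>2)"
  proof (rule summableI_nonneg_bounded)
    fix N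
    define v where "v N = (\<Sum>n<N. (c n * lam n powr (- s)) *\<^sub>R e n)" for N
    have v: "v N \<in> VS s \<and> l (v N) = (\<Sum>n<N. (c n)\<^sup>2)" for N
    proof (induction N)
      case 0
      have "0 \<in> VS s" using V_scale[OF V_basis(1), of 0 0] by simp
      moreover have "l 0 = 0" using sc[OF V_basis(1), of 0 0] by simp
      ultimately show ?case by (simp add: v_def)
    next
      case (Suc N)
      have "v (Suc N) = v N + (c N * lam N powr (- s)) *\<^sub>R e N" by (simp add: v_def)
      then show ?case using Suc V_basis[where k = N and s = s]
        by (auto simp: add sc V_add V_scale c_def power2_eq_square mult_ac)
    qed
    have "VN s (v N) = norm (\<Sum>n<N. c n *\<^sub>R e n)"
    proof (rule V_spaceI(3))
      show "inner (\<Sum>n<N. c n *\<^sub>R e n) (e k) = lam k powr s * inner (v N) (e k)" for k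
        unfolding v_def using lam_pos[of k]
        by (subst (1 2) inner_sum_basis) (auto simp: powr_minus field_simps)
    qed
    then have "(VN s (v N))\<^sup>2 = (\<Sum>n<N. (c n)\<^sup>2)" by (simp add: norm_sum_basis)
    then have "(VN s (v N))\<^sup>2 \<le> K * VN s (v N)" using K[of "v N"] v[of N] by (simp add: abs_le_iff)
    then have "VN s (v N) * VN s (v N) \<le> K * VN s (v N)" by (simp add: power2_eq_square)
    moreover have nn: "0 \<le> VN s (v N)" using v[of N] by (simp add: V_norm_pow)
    ultimately have "VN s (v N) \<le> \<bar>K\<bar>" by (cases "VN s (v N) = 0") (auto simp: mult_le_cancel_right)
    then have "(VN s (v N))\<^sup>2 \<le> \<bar>K\<bar>\<^sup>2" using nn by (intro power_mono) auto
    then show "(\<Sum>n<N. (c n)\<^sup>2) \<le> \<bar>K\<bar>\<^sup>2" using \<open>(VN s (v N))\<^sup>2 = _\<close> by simp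
  qed simp
  then have "(\<Sum>k\<in>{n}. (c k)\<^sup>2) \<le> (\<Sum>n. (c n)\<^sup>2)" by (rule sum_le_suminf) auto
  then have "sqrt ((c n)\<^sup>2) \<le> sqrt (\<Sum>n. (c n)\<^sup>2)" by (intro real_sqrt_le_mono) simp
  then show ?thesis unfolding Vdual_norm_def csq by (simp add: c_def abs_mult)
qed

text \<open>The expansion of \<open>v\<close> converges to \<open>v\<close> in the norm of \<open>V\<^sub>s\<close>, in which both functionals are continuous.\<close>

lemma Vdual_eqI:
  assumes "l1 \<in> Vdual e lam s" "l2 \<in> Vdual e lam s" and eq: "\<And>n. l1 (e n) = l2 (e n)" and v: "v \<in> VS s"
  shows "l1 v = l2 v"
proof -
  define l where "l v = l1 v - l2 v" for v
  have "l \<in> Vdual e lam s" unfolding l_def by (rule Vdual_diff) fact+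
  then obtain K where K: "\<And>v. v \<in> VS s \<Longrightarrow> \<bar>l v\<bar> \<le> K * VN s v"
    and add: "\<And>v w. v \<in> VS s \<Longrightarrow> w \<in> VS s \<Longrightarrow> l (v + w) = l v + l w"
    and sc: "\<And>c v. v \<in> VS s \<Longrightarrow> l (c *\<^sub>R v) = c * l v"
    unfolding Vdual_def by blast
  have l0: "proj N v \<in> VS s \<and> l (proj N v) = 0" for N
  proof (induction N)
    case 0
    have "0 \<in> VS s" using V_scale[OF V_basis(1), of 0 0] by simp
    moreover have "l 0 = 0" using sc[OF V_basis(1), of 0 0] by simp
    ultimately show ?case by (simp add: proj_def)
  next
    case (Suc N)
    have "proj (Suc N) v = proj N v + inner v (e N) *\<^sub>R e N" by (simp add: proj_def)
    then show ?case using Suc V_basis[where k = N and s = s] eq[of N] by (auto simp: add sc V_add V_scale l_def[of "e N"])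
  qed
  have "\<bar>l v\<bar> \<le> K * norm (pow s v - proj N (pow s v))" for N
  proof -
    have "l (proj N v + (v - proj N v)) = l (proj N v) + l (v - proj N v)"
      using l0 v by (intro add V_diff) auto
    then have "l v = l (v - proj N v)" using l0 by simp
    also have "\<bar>\<dots>\<bar> \<le> K * VN s (v - proj N v)" using l0 v by (intro K V_diff) auto
    also have "VN s (v - proj N v) = norm (pow s v - proj N (pow s v))"
      by (rule V_spaceI(3)) (simp add: inner_diff_left inner_proj inner_pow[OF v])
    finally show ?thesis .
  qed
  moreover have "(\<lambda>N. K * norm (pow s v - proj N (pow s v))) \<longlonglongrightarrow> K * norm (pow s v - pow s v)"
    by (intro tendsto_intros proj_tendsto)
  ultimately have "\<bar>l v\<bar> \<le> K * norm (pow s v - pow s v)"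
    by (intro LIMSEQ_le_const) auto
  then show ?thesis by (simp add: l_def)
qed

text \<open>The isometry \<open>functional s\<close> transports derivatives from the Hilbert space to the dual space.\<close>

lemma Vdual_derivative_functional:
  assumes F: "\<And>t. t \<in> {0..T} \<Longrightarrow> F t \<in> Vdual e lam s"
    and FX: "\<And>t n. t \<in> {0..T} \<Longrightarrow> F t (e n) = lam n powr s * inner (X t) (e n)"
    and X: "\<And>t. t \<in> {0..T} \<Longrightarrow> (X has_vector_derivative X' t) (at t within {0..T})"
  shows "Vdual_derivative e lam s T F (\<lambda>t. functional s (X' t))"
  unfolding Vdual_derivative_def
proof (intro ballI conjI)
  fix t assume t: "t \<in> {0..T}"
  have "((\<lambda>r. norm ((X r - X t) - (r - t) *\<^sub>R X' t) / norm (r - t)) \<longlongrightarrow> 0) (at t within {0..T})"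
    using X[OF t] unfolding has_vector_derivative_def has_derivative_iff_norm by blast
  moreover have "\<forall>\<^sub>F r in at t within {0..T}. norm ((X r - X t) - (r - t) *\<^sub>R X' t) / norm (r - t)
      = Vdual_norm e lam s (\<lambda>v. (F r v - F t v) / (r - t) - functional s (X' t) v)"
    unfolding eventually_at_filter
  proof (intro always_eventually allI impI)
    fix r assume r: "r \<noteq> t" "r \<in> {0..T}"
    have "Vdual_norm e lam s (\<lambda>v. (F r v - F t v) / (r - t) - functional s (X' t) v)
      = norm ((1 / (r - t)) *\<^sub>R ((X r - X t) - (r - t) *\<^sub>R X' t))"
      by (rule Vdual_norm_eq)
        (simp only: FX[OF t] FX[OF r(2)] functional_basis inner_scaleR_left inner_diff_left,
          use r in \<open>simp add: field_simps\<close>)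
    then show "norm ((X r - X t) - (r - t) *\<^sub>R X' t) / norm (r - t)
      = Vdual_norm e lam s (\<lambda>v. (F r v - F t v) / (r - t) - functional s (X' t) v)" by simp
  qed
  ultimately show "((\<lambda>r. Vdual_norm e lam s (\<lambda>v. (F r v - F t v) / (r - t) - functional s (X' t) v)) \<longlongrightarrow> 0) (at t within {0..T})"
    by (rule Lim_transform_eventually)
qed (auto simp: F functional_Vdual)

lemma functional_continuous_into_Vdual:
  assumes d: "continuous_on {0..T} d"
  shows "continuous_into_Vdual e lam s T (\<lambda>t. functional s (d t))"
  unfolding continuous_into_Vdual_def
proof (intro ballI conjI functional_Vdual)
  fix t assume t: "t \<in> {0..T}"
  have "(d \<longlongrightarrow> d t) (at t within {0..T})" using d t by (simp add: continuous_on_def)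
  then have "((\<lambda>r. norm (d r - d t)) \<longlongrightarrow> 0) (at t within {0..T})"
    by (intro tendsto_norm_zero) (simp add: LIM_zero)
  moreover have "Vdual_norm e lam s (\<lambda>v. functional s (d r) v - functional s (d t) v) = norm (d r - d t)" for r
    by (rule Vdual_norm_eq) (simp add: functional_basis inner_diff_left right_diff_distrib)
  ultimately show "((\<lambda>r. Vdual_norm e lam s (\<lambda>v. functional s (d r) v - functional s (d t) v)) \<longlongrightarrow> 0) (at t within {0..T})"
    by simp
qed

lemma Vdual_derivative_coefficient:
  assumes F: "Vdual_derivative e lam s T F F'" and t: "t \<in> {0..T}"
  shows "((\<lambda>t. F t (e n)) has_vector_derivative F' t (e n)) (at t within {0..T})"
proof -
  have FV: "\<And>t. t \<in> {0..T} \<Longrightarrow> F t \<in> Vdual e lam s" "F' t \<in> Vdual e lam s"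
    and lim: "((\<lambda>r. Vdual_norm e lam s (\<lambda>v. (F r v - F t v) / (r - t) - F' t v)) \<longlongrightarrow> 0) (at t within {0..T})"
    using F t unfolding Vdual_derivative_def by auto
  have "((\<lambda>r. (F r (e n) - F t (e n)) / (r - t) - F' t (e n)) \<longlongrightarrow> 0) (at t within {0..T})"
  proof (rule Lim_null_comparison)
    show "\<forall>\<^sub>F r in at t within {0..T}. norm ((F r (e n) - F t (e n)) / (r - t) - F' t (e n))
      \<le> Vdual_norm e lam s (\<lambda>v. (F r v - F t v) / (r - t) - F' t v) * lam n powr s"
      unfolding eventually_at_filter
    proof (intro always_eventually allI impI)
      fix r assume "r \<in> {0..T}"
      then have "(\<lambda>v. (F r v - F t v) / (r - t) - F' t v) \<in> Vdual e lam s"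
        using FV t by (intro Vdual_diff Vdual_scale) auto
      from Vdual_coefficient_bound[OF this, of n] lam_pos[of n]
      show "norm ((F r (e n) - F t (e n)) / (r - t) - F' t (e n))
        \<le> Vdual_norm e lam s (\<lambda>v. (F r v - F t v) / (r - t) - F' t v) * lam n powr s"
        by (simp add: powr_minus field_simps)
    qed
    show "((\<lambda>r. Vdual_norm e lam s (\<lambda>v. (F r v - F t v) / (r - t) - F' t v) * lam n powr s) \<longlongrightarrow> 0) (at t within {0..T})"
      using tendsto_mult_left_zero[OF lim] .
  qed
  then have "((\<lambda>r. (F r (e n) - F t (e n)) / (r - t)) \<longlongrightarrow> F' t (e n)) (at t within {0..T})"
    by (rule LIM_zero_cancel)
  then show ?thesis
    by (simp add: has_field_derivative_iff has_real_derivative_iff_has_vector_derivative[symmetric])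
qed

lemma continuous_into_Vdual_coefficient:
  assumes D: "continuous_into_Vdual e lam s T D"
  shows "continuous_on {0..T} (\<lambda>t. D t (e n))"
  unfolding continuous_on_def
proof
  fix t assume t: "t \<in> {0..T}"
  have DV: "\<And>t. t \<in> {0..T} \<Longrightarrow> D t \<in> Vdual e lam s"
    and lim: "((\<lambda>r. Vdual_norm e lam s (\<lambda>v. D r v - D t v)) \<longlongrightarrow> 0) (at t within {0..T})"
    using D t unfolding continuous_into_Vdual_def by auto
  have "((\<lambda>r. D r (e n) - D t (e n)) \<longlongrightarrow> 0) (at t within {0..T})"
  proof (rule Lim_null_comparison)
    show "\<forall>\<^sub>F r in at t within {0..T}. norm (D r (e n) - D t (e n))
      \<le> Vdual_norm e lam s (\<lambda>v. D r v - D t v) * lam n powr s"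
      unfolding eventually_at_filter
    proof (intro always_eventually allI impI)
      fix r assume "r \<in> {0..T}"
      then have "(\<lambda>v. D r v - D t v) \<in> Vdual e lam s" using DV t by (intro Vdual_diff) auto
      from Vdual_coefficient_bound[OF this, of n] lam_pos[of n]
      show "norm (D r (e n) - D t (e n)) \<le> Vdual_norm e lam s (\<lambda>v. D r v - D t v) * lam n powr s"
        by (simp add: powr_minus field_simps)
    qed
    show "((\<lambda>r. Vdual_norm e lam s (\<lambda>v. D r v - D t v) * lam n powr s) \<longlongrightarrow> 0) (at t within {0..T})"
      using tendsto_mult_left_zero[OF lim] .
  qed
  then show "((\<lambda>r. D r (e n)) \<longlongrightarrow> D t (e n)) (at t within {0..T})" by (rule LIM_zero_cancel)
qed

end

section \<open>Regularity of mild solutions\<close>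

lemma integrable_scaleR_bounded:
  fixes z :: "real \<Rightarrow> 'b::{banach, second_countable_topology}" and g :: "real \<Rightarrow> real"
  assumes g: "integrable (lebesgue_on {0<..<t}) g" and z: "continuous_on {0..t} z"
  shows "integrable (lebesgue_on {0<..<t}) (\<lambda>s. g s *\<^sub>R z s)"
proof -
  obtain C where C: "\<And>s. 0 \<le> s \<Longrightarrow> s \<le> t \<Longrightarrow> norm (z s) \<le> C" using continuous_on_interval_bounded[OF z] by blast
  have zm: "z \<in> borel_measurable (lebesgue_on {0<..<t})" using continuous_on_lebesgue_integrable[OF z] by auto
  show ?thesis
  proof (rule Bochner_Integration.integrable_bound[OF integrable_mult_right[OF integrable_abs[OF g], of C]])
    show "(\<lambda>s. g s *\<^sub>R z s) \<in> borel_measurable (lebesgue_on {0<..<t})" using g zm by auto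
    show "AE s in lebesgue_on {0<..<t}. norm (g s *\<^sub>R z s) \<le> norm (C * \<bar>g s\<bar>)"
    proof (rule AE_I2)
      fix s assume "s \<in> space (lebesgue_on {0<..<t})"
      then have "norm (z s) \<le> \<bar>C\<bar>" using C[of s] by auto
      then show "norm (g s *\<^sub>R z s) \<le> norm (C * \<bar>g s\<bar>)"
        by (simp add: abs_mult mult.commute[of "\<bar>g s\<bar>"] mult_right_mono)
    qed
  qed
qed

lemma primitive_of_derivative:
  fixes F g :: "real \<Rightarrow> real"
  assumes F: "\<And>t. t \<in> {0..T} \<Longrightarrow> (F has_vector_derivative g t) (at t within {0..T})"
    and g: "continuous_on {0..T} g" and t: "0 \<le> t" "t \<le> T"
  shows "F t = F 0 + (\<integral>s. g s \<partial>lebesgue_on {0<..<t})"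
proof -
  have "(g has_integral F t - F 0) {0..t}"
    using t by (intro fundamental_theorem_of_calculus has_vector_derivative_within_subset[OF F]) auto
  moreover have "continuous_on {0..t} g" using g by (rule continuous_on_subset) (use t in auto)
  ultimately show ?thesis using lebesgue_integral_eq_integral_continuous(2)[of t g] by (simp add: integral_unique)
qed

context fractional_evolution
begin

lemma diag_const_continuous:
  assumes m: "\<And>n. \<bar>m n\<bar> \<le> K" and g: "continuous_on S g"
  shows "continuous_on S (\<lambda>t. diag m (g t))"
proof -
  have "bounded_linear (diag m)"
  proof (rule bounded_linear_intro)
    show "diag m (x + y) = diag m x + diag m y" for x y
      by (rule basis_eqI) (simp add: inner_add_left inner_diag[where K = K, OF m] ring_distribs)
    show "diag m (r *\<^sub>R x) = r *\<^sub>R diag m x" for r x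
      by (rule basis_eqI) (simp add: inner_diag[where K = K, OF m])
    show "norm (diag m x) \<le> norm x * K" for x using norm_diag_le[OF m, where h = x] by (simp add: mult.commute)
  qed
  then show ?thesis using g by (rule bounded_linear.continuous_on)
qed

lemma E1_bound: obtains K where "0 < K" "\<And>n t. 0 \<le> t \<Longrightarrow> \<bar>E1 n t\<bar> \<le> K"
proof -
  obtain B where B: "B > 0" "\<And>n t s. 0 < t \<Longrightarrow> 0 \<le> s \<Longrightarrow> s \<le> 1 \<Longrightarrow>
    \<bar>lam n powr s * ek 1 n t\<bar> \<le> B * t powr (1 - 1 - \<alpha> * s)" using ek_bound[of 1] by auto
  have "\<bar>E1 n t\<bar> \<le> max B 1" if "0 \<le> t" for n t
  proof (cases "t = 0")
    case False
    then have "\<bar>E1 n t\<bar> \<le> B" using B(2)[of t 0 n] that lam_pos[of n] by (simp add: E1_eq less_imp_neq[symmetric])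
    then show ?thesis by simp
  qed (simp add: E1_zero)
  then show thesis using that[of "max B 1"] B(1) by auto
qed

lemma lam_powr_split: "lam n powr (1 - s) * lam n powr s = lam n"
  using lam_pos[of n] by (simp flip: powr_add)

text \<open>The exponent \<open>\<gamma>\<close> is critical: as \<open>\<alpha> * \<gamma> = 1\<close>, the multiplier \<open>lam n powr \<gamma> * ek 2 n t\<close> is just bounded
near \<open>t = 0\<close>.\<close>

lemma mild_V_continuous:
  assumes f: "continuous_on {0..T} f" and u0: "u0 \<in> VS \<gamma>" and u: "is_mild f u0 u1 u"
  obtains Y where "continuous_on {0..T} Y"
    "\<And>t n. 0 \<le> t \<Longrightarrow> t \<le> T \<Longrightarrow> inner (Y t) (e n) = lam n powr \<gamma> * inner (u t) (e n)"
proof -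
  obtain K where K: "\<And>n t. 0 \<le> t \<Longrightarrow> \<bar>E1 n t\<bar> \<le> K" by (rule E1_bound) blast
  obtain B2 where B2: "B2 > 0" "\<And>n t s. 0 < t \<Longrightarrow> 0 \<le> s \<Longrightarrow> s \<le> 1 \<Longrightarrow>
    \<bar>lam n powr s * ek 2 n t\<bar> \<le> B2 * t powr (2 - 1 - \<alpha> * s)" using ek_bound[of 2] by auto
  obtain B3 where B3: "B3 > 0" "\<And>n t s. 0 < t \<Longrightarrow> 0 \<le> s \<Longrightarrow> s \<le> 1 \<Longrightarrow>
    \<bar>lam n powr s * ek \<alpha> n t\<bar> \<le> B3 * t powr (\<alpha> - 1 - \<alpha> * s)" using ek_bound[of \<alpha>] alpha by auto
  have b2: "\<bar>lam n powr \<gamma> * ek 2 n t\<bar> \<le> B2" if "0 \<le> t" for n t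
    using B2(2)[of t \<gamma> n] gamma that B2(1) by (cases "t = 0") (auto simp: ek_zero)
  have b3: "\<bar>lam n powr \<gamma> * ek \<alpha> n t\<bar> \<le> B3 * t powr ((\<alpha> - 1) - 1)" if "0 < t" for n t
    using B3(2)[of t \<gamma> n] gamma that by simp
  have i3: "integrable (lebesgue_on {0<..<T}) (\<lambda>t. B3 * t powr ((\<alpha> - 1) - 1))"
    using powr_integrable(1)[of "\<alpha> - 1" T] alpha T by auto
  obtain U where U: "continuous_on {0..T} U"
    "\<And>t n. 0 \<le> t \<Longrightarrow> t \<le> T \<Longrightarrow> inner (U t) (e n) = convolve (\<lambda>\<tau>. lam n powr \<gamma> * ek \<alpha> n \<tau>) (\<lambda>\<tau>. inner (f \<tau>) (e n)) t"
    by (rule diag_convolution_continuous[of "\<lambda>\<tau> n. lam n powr \<gamma> * ek \<alpha> n \<tau>" T "\<lambda>t. B3 * t powr ((\<alpha> - 1) - 1)", OF _ i3 b3 f])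
      (use alpha in auto)
  define Y where "Y t = diag (\<lambda>n. E1 n t) (pow \<gamma> u0) + diag (\<lambda>n. lam n powr \<gamma> * ek 2 n t) u1 + U t" for t
  show thesis
  proof (rule that[of Y])
    show "continuous_on {0..T} Y" unfolding Y_def
      by (intro continuous_on_add U diag_continuous_on[where K = K] diag_continuous_on[where K = B2])
        (use K b2 in \<open>auto intro!: E1_continuous continuous_on_mult ek_continuous\<close>)
    fix t n assume t: "0 \<le> t" "t \<le> T"
    have "inner (Y t) (e n) = E1 n t * (lam n powr \<gamma> * inner u0 (e n)) + lam n powr \<gamma> * ek 2 n t * inner u1 (e n)
       + lam n powr \<gamma> * convolve (ek \<alpha> n) (\<lambda>\<tau>. inner (f \<tau>) (e n)) t"
      unfolding Y_def inner_add_left U(2)[OF t] convolve_cmult_left inner_pow[OF u0, symmetric]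
      using inner_diag[of "\<lambda>n. E1 n t" K] inner_diag[of "\<lambda>n. lam n powr \<gamma> * ek 2 n t" B2] K b2 t by simp
    then show "inner (Y t) (e n) = lam n powr \<gamma> * inner (u t) (e n)"
      using u t by (simp add: is_mild_def mild_def algebra_simps)
  qed
qed

text \<open>Differentiation lowers the index of each kernel by one. In the first term the eigenvalue is split as
\<open>lam n powr (1 - \<gamma>) * lam n powr \<gamma>\<close>, where the second factor goes to \<open>u0\<close> and the first one leaves a
multiplier that is bounded because \<open>\<alpha> - 1 = \<alpha> * (1 - \<gamma>)\<close>.\<close>

lemma mild_C1:
  assumes f: "continuous_on {0..T} f" and u0: "u0 \<in> VS \<gamma>" and u: "is_mild f u0 u1 u"
  obtains v where "continuous_on {0..T} v" "v 0 = u1"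
    "\<And>t. t \<in> {0..T} \<Longrightarrow> (u has_vector_derivative v t) (at t within {0..T})"
    "\<And>t n. 0 \<le> t \<Longrightarrow> t \<le> T \<Longrightarrow> inner (v t) (e n) = - (lam n * ek \<alpha> n t * inner u0 (e n)) + E1 n t * inner u1 (e n)
        + convolve (ek (\<alpha> - 1) n) (\<lambda>\<tau>. inner (f \<tau>) (e n)) t"
proof -
  obtain K where K: "\<And>n t. 0 \<le> t \<Longrightarrow> \<bar>E1 n t\<bar> \<le> K" by (rule E1_bound) blast
  obtain B3 where B3: "B3 > 0" "\<And>n t s. 0 < t \<Longrightarrow> 0 \<le> s \<Longrightarrow> s \<le> 1 \<Longrightarrow>
    \<bar>lam n powr s * ek \<alpha> n t\<bar> \<le> B3 * t powr (\<alpha> - 1 - \<alpha> * s)" using ek_bound[of \<alpha>] alpha by auto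
  obtain B4 where B4: "B4 > 0" "\<And>n t s. 0 < t \<Longrightarrow> 0 \<le> s \<Longrightarrow> s \<le> 1 \<Longrightarrow>
    \<bar>lam n powr s * ek (\<alpha> - 1) n t\<bar> \<le> B4 * t powr (\<alpha> - 1 - 1 - \<alpha> * s)" using ek_bound[of "\<alpha> - 1"] alpha by auto
  define m where "m t n = lam n powr (1 - \<gamma>) * ek \<alpha> n t" for t n
  have b3: "\<bar>m t n\<bar> \<le> B3" if "0 \<le> t" for n t
  proof (cases "t = 0")
    case False
    have "\<alpha> - 1 - \<alpha> * (1 - \<gamma>) = 0" using gamma by (simp add: right_diff_distrib)
    then show ?thesis using B3(2)[of t "1 - \<gamma>" n] gamma False that by (simp add: m_def)
  qed (use B3(1) in \<open>simp add: m_def ek_zero\<close>)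
  have b4: "\<bar>ek (\<alpha> - 1) n t\<bar> \<le> B4 * t powr ((\<alpha> - 1) - 1)" if "0 < t" for n t
    using B4(2)[of t 0 n] that lam_pos[of n] by (simp add: less_imp_neq[symmetric])
  have i4: "integrable (lebesgue_on {0<..<T}) (\<lambda>t. B4 * t powr ((\<alpha> - 1) - 1))"
    using powr_integrable(1)[of "\<alpha> - 1" T] alpha T by auto
  obtain v3 where v3: "continuous_on {0..T} v3"
    "\<And>t n. 0 \<le> t \<Longrightarrow> t \<le> T \<Longrightarrow> inner (v3 t) (e n) = convolve (\<lambda>\<tau>. ek (\<alpha> - 1) n \<tau>) (\<lambda>\<tau>. inner (f \<tau>) (e n)) t"
    by (rule diag_convolution_continuous[of "\<lambda>\<tau> n. ek (\<alpha> - 1) n \<tau>" T "\<lambda>t. B4 * t powr ((\<alpha> - 1) - 1)", OF _ i4 b4 f])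
      (use alpha in auto)
  define v1 where "v1 t = diag (m t) (pow \<gamma> u0)" for t
  define v2 where "v2 t = diag (\<lambda>n. E1 n t) u1" for t
  have v1: "continuous_on {0..T} v1" unfolding v1_def
    by (rule diag_continuous_on[where K = B3])
      (use alpha b3 in \<open>auto simp: m_def intro!: continuous_on_mult ek_continuous\<close>)
  have v2: "continuous_on {0..T} v2" unfolding v2_def
    by (rule diag_continuous_on[where K = K]) (use K in \<open>auto intro!: E1_continuous\<close>)
  have v1c: "inner (v1 t) (e n) = lam n * ek \<alpha> n t * inner u0 (e n)" if "0 \<le> t" for t n
  proof -
    have "inner (v1 t) (e n) = m t n * (lam n powr \<gamma> * inner u0 (e n))"
      unfolding v1_def inner_pow[OF u0, symmetric] by (rule inner_diag[OF b3[OF that]])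
    also have "\<dots> = (lam n powr (1 - \<gamma>) * lam n powr \<gamma>) * ek \<alpha> n t * inner u0 (e n)"
      by (simp add: m_def)
    finally show ?thesis unfolding lam_powr_split .
  qed
  have v2c: "inner (v2 t) (e n) = E1 n t * inner u1 (e n)" if "0 \<le> t" for t n
    unfolding v2_def by (rule inner_diag[OF K[OF that]])
  define v where "v t = - v1 t + v2 t + v3 t" for t
  have vc: "continuous_on {0..T} v" unfolding v_def by (intro continuous_intros v1 v2 v3)
  have coef: "inner (v t) (e n) = - (lam n * ek \<alpha> n t * inner u0 (e n)) + E1 n t * inner u1 (e n)
        + convolve (ek (\<alpha> - 1) n) (\<lambda>\<tau>. inner (f \<tau>) (e n)) t" if "0 \<le> t" "t \<le> T" for t n
    using that by (simp add: v_def inner_add_left inner_diff_left v1c v2c v3)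
  have prim: "inner (u t) (e n) = inner (u 0) (e n) + (\<integral>s. inner (v s) (e n) \<partial>lebesgue_on {0<..<t})"
    if t: "0 \<le> t" "t \<le> T" for t n
  proof (cases "t = 0")
    case False
    then have tp: "0 < t" using t by simp
    let ?M = "lebesgue_on {0<..<t}"
    define c where "c s = inner (f s) (e n)" for s
    have cc: "continuous_on {0..t} c" unfolding c_def using coefficient_continuous[OF f] t by auto
    have i: "integrable ?M (\<lambda>s. inner (w s) (e n))" if "continuous_on {0..T} w" for w
      by (intro integrable_inner_left continuous_on_lebesgue_integrable continuous_on_subset[OF that]) (use t in auto)
    have I1: "(\<integral>s. inner (v1 s) (e n) \<partial>?M) = inner u0 (e n) * (1 - E1 n t)"
    proof -
      have "(\<integral>s. inner (v1 s) (e n) \<partial>?M) = (\<integral>s. (lam n * inner u0 (e n)) * ek \<alpha> n s \<partial>?M)"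
        by (intro Bochner_Integration.integral_cong) (auto simp: v1c)
      also have "\<dots> = inner u0 (e n) * (lam n * ek (1 + \<alpha>) n t)"
        using ek_primitive[of \<alpha> t n] alpha tp by (simp add: add.commute)
      also have "lam n * ek (1 + \<alpha>) n t = 1 - E1 n t"
        using ek_recurrence[of 1 t n] tp by (simp add: frac_kernel_one E1_eq)
      finally show ?thesis .
    qed
    have I2: "(\<integral>s. inner (v2 s) (e n) \<partial>?M) = inner u1 (e n) * ek 2 n t"
    proof -
      have "(\<integral>s. inner (v2 s) (e n) \<partial>?M) = (\<integral>s. inner u1 (e n) * ek 1 n s \<partial>?M)"
        by (intro Bochner_Integration.integral_cong) (auto simp: v2c E1_eq)
      then show ?thesis using ek_primitive[of 1 t n] tp by simp
    qed
    have I3: "(\<integral>s. inner (v3 s) (e n) \<partial>?M) = convolve (ek \<alpha> n) c t"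
    proof -
      have "(\<integral>s. inner (v3 s) (e n) \<partial>?M) = convolve (frac_kernel 1) (convolve (ek (\<alpha> - 1) n) c) t"
        unfolding convolve_frac_one c_def by (intro Bochner_Integration.integral_cong) (use t in \<open>auto simp: v3\<close>)
      also have "\<dots> = convolve (convolve (frac_kernel 1) (ek (\<alpha> - 1) n)) c t"
        by (rule convolve_assoc_continuous) (use alpha t frac_kernel_integrable ek_integrable cc in auto)
      also have "\<dots> = convolve (ek \<alpha> n) c t"
        using alpha by (intro convolve_cong) (auto simp: frac_ek)
      finally show ?thesis .
    qed
    have "(\<integral>s. inner (v s) (e n) \<partial>?M) = (\<integral>s. - inner (v1 s) (e n) + inner (v2 s) (e n) + inner (v3 s) (e n) \<partial>?M)"
      by (simp add: v_def inner_add_left inner_diff_left)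
    also have "\<dots> = - (\<integral>s. inner (v1 s) (e n) \<partial>?M) + (\<integral>s. inner (v2 s) (e n) \<partial>?M) + (\<integral>s. inner (v3 s) (e n) \<partial>?M)"
      using i[OF v1] i[OF v2] i[OF v3(1)] by simp
    also have "\<dots> = mild f u0 u1 n t - inner u0 (e n)"
      unfolding I1 I2 I3 by (simp add: mild_def c_def[abs_def] algebra_simps)
    also have "\<dots> = inner (u t) (e n) - inner (u 0) (e n)"
      using u t T by (simp add: is_mild_def mild_def[of f u0 u1 n 0] E1_zero ek_zero)
    finally show ?thesis by simp
  qed (simp add: integral_restrict_space)
  show thesis
  proof (rule that[OF vc _ _ coef])
    show "v 0 = u1"
      by (rule basis_eqI) (use T in \<open>simp add: coef ek_zero E1_zero\<close>)
    show "(u has_vector_derivative v t) (at t within {0..T})" if "t \<in> {0..T}" for t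
      by (rule primitive_has_vector_derivative[OF vc prim that])
  qed
qed

lemma interval_islimpt: "t \<in> {0..T} \<Longrightarrow> at t within {0..T} \<noteq> bot"
  using T by (auto simp: trivial_limit_within islimpt_Icc)

lemma dt_eq: "t \<in> {0..T} \<Longrightarrow> (u has_vector_derivative v) (at t within {0..T}) \<Longrightarrow> dt T u t = v"
  unfolding dt_def by (rule vector_derivative_within[OF interval_islimpt])

lemma C1_continuous: "C1_on T u \<Longrightarrow> continuous_on {0..T} u"
  unfolding C1_on_def continuous_on_eq_continuous_within by (blast intro: has_vector_derivative_continuous)

lemma is_mild_zero: "is_mild f u0 u1 u \<Longrightarrow> u 0 = u0"
  using T by (intro basis_eqI) (simp add: is_mild_def mild_def E1_zero ek_zero)

lemma caputo_integral_coefficient: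
  assumes u: "continuous_on {0..T} u" and t: "0 \<le> t" "t \<le> T"
  shows "inner (caputo_integral \<alpha> T u t) (e n)
    = convolve (frac_kernel (2 - \<alpha>)) (\<lambda>s. inner (u s) (e n) - inner (u 0) (e n) - s * inner (dt T u 0) (e n)) t"
proof -
  let ?M = "lebesgue_on {0<..<t}"
  define z where "z s = u s - u 0 - s *\<^sub>R dt T u 0" for s
  have zc: "continuous_on {0..t} z" unfolding z_def
    using continuous_on_subset[OF u] t by (intro continuous_intros) auto
  have "integrable ?M (\<lambda>s. (s powr ((2 - \<alpha>) - 1)))" by (rule powr_integrable(1)) (use alpha t in auto)
  then have "integrable ?M (\<lambda>s. (t - s) powr ((2 - \<alpha>) - 1))" by (intro integrable_reflect[where h = "\<lambda>s. s powr ((2 - \<alpha>) - 1)"]) auto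
  then have i: "integrable ?M (\<lambda>s. (t - s) powr (1 - \<alpha>) *\<^sub>R z s)"
    by (intro integrable_scaleR_bounded[OF _ zc]) simp
  have "inner (caputo_integral \<alpha> T u t) (e n) = (1 / Gamma (2 - \<alpha>)) * (\<integral>s. inner ((t - s) powr (1 - \<alpha>) *\<^sub>R z s) (e n) \<partial>?M)"
  proof -
    have "inner (\<integral>s. (t - s) powr (1 - \<alpha>) *\<^sub>R z s \<partial>?M) (e n) = (\<integral>s. inner ((t - s) powr (1 - \<alpha>) *\<^sub>R z s) (e n) \<partial>?M)"
      by (rule integral_inner_left[symmetric]) (rule i)
    then show ?thesis unfolding caputo_integral_def z_def[symmetric] inner_scaleR_left by (simp only:)
  qed
  also have "\<dots> = (\<integral>s. (1 / Gamma (2 - \<alpha>)) * inner ((t - s) powr (1 - \<alpha>) *\<^sub>R z s) (e n) \<partial>?M)" by simp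
  also have "\<dots> = convolve (frac_kernel (2 - \<alpha>)) (\<lambda>s. inner (u s) (e n) - inner (u 0) (e n) - s * inner (dt T u 0) (e n)) t"
    unfolding convolve_def by (intro Bochner_Integration.integral_cong) (auto simp: frac_kernel_def z_def inner_diff_left)
  finally show ?thesis .
qed

text \<open>By the Volterra equation, the coefficients of the fractional integral are twofold primitives of
those of \<open>f - A u\<close>. The latter is only a functional, but \<open>A\<^bsup>-\<gamma>\<^esup> (f - A u)\<close> is a continuous function \<open>d\<close> with
values in the Hilbert space, and its primitives represent the two derivatives.\<close>

lemma mild_caputo:
  assumes f: "continuous_on {0..T} f" and u0: "u0 \<in> VS \<gamma>" and u: "is_mild f u0 u1 u"
  obtains d where "continuous_on {0..T} d"
    "\<And>t n. 0 \<le> t \<Longrightarrow> t \<le> T \<Longrightarrow> inner (d t) (e n) * lam n powr \<gamma> = inner (f t) (e n) - lam n * inner (u t) (e n)"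
    "has_caputo_derivative e lam \<gamma> \<alpha> T u (\<lambda>t. functional \<gamma> (d t))"
proof -
  obtain Y where Y: "continuous_on {0..T} Y"
    "\<And>t n. 0 \<le> t \<Longrightarrow> t \<le> T \<Longrightarrow> inner (Y t) (e n) = lam n powr \<gamma> * inner (u t) (e n)"
    using mild_V_continuous[OF f u0 u] by blast
  obtain v where v: "continuous_on {0..T} v" "v 0 = u1"
    "\<And>t. t \<in> {0..T} \<Longrightarrow> (u has_vector_derivative v t) (at t within {0..T})"
    using mild_C1[OF f u0 u] by metis
  have uc: "continuous_on {0..T} u" using v(1,3) by (intro C1_continuous) (auto simp: C1_on_def)
  have u0': "u 0 = u0" "dt T u 0 = u1" using is_mild_zero[OF u] dt_eq[OF _ v(3), of 0] v(2) T by auto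
  have b1: "\<bar>lam n powr (- \<gamma>)\<bar> \<le> lam 0 powr (- \<gamma>)" for n by (rule lam_powr_le) (use gamma in auto)
  \<comment> \<open>\<open>A powr (- \<gamma>)\<close> applied to \<open>A u\<close> is \<open>A powr (1 - 2 * \<gamma>)\<close> applied to \<open>Y = A powr \<gamma> u\<close>, and \<open>1 - 2 * \<gamma> < 0\<close>.\<close>
  have b2: "\<bar>lam n powr (1 - 2 * \<gamma>)\<bar> \<le> lam 0 powr (1 - 2 * \<gamma>)" for n by (rule lam_powr_le) (use gamma in auto)
  define d where "d t = diag (\<lambda>n. lam n powr (- \<gamma>)) (f t) - diag (\<lambda>n. lam n powr (1 - 2 * \<gamma>)) (Y t)" for t
  have dc: "continuous_on {0..T} d" unfolding d_def
    by (intro continuous_on_diff diag_const_continuous[OF b1 f] diag_const_continuous[OF b2 Y(1)])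
  define c where "c n s = inner (f s) (e n) - lam n * inner (u s) (e n)" for n s
  have dn: "inner (d t) (e n) = lam n powr (- \<gamma>) * c n t" if "0 \<le> t" "t \<le> T" for t n
  proof -
    have "lam n powr (1 - 2 * \<gamma>) * lam n powr \<gamma> = lam n powr (- \<gamma>) * lam n"
    proof -
      have "lam n powr (- \<gamma>) * lam n powr 1 = lam n powr (1 - 2 * \<gamma>) * lam n powr \<gamma>"
        unfolding powr_add[symmetric] by simp
      then show ?thesis using lam_pos[of n] by (simp add: abs_of_pos)
    qed
    then show ?thesis
      unfolding d_def inner_diff_left inner_diag[OF b1] inner_diag[OF b2] Y(2)[OF that]
      by (simp add: c_def right_diff_distrib flip: mult.assoc)
  qed
  have lam1: "lam n powr \<gamma> * lam n powr (- \<gamma>) = 1" for n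
    using lam_pos[of n] by (simp add: less_imp_neq[symmetric] flip: powr_add)
  have dn': "inner (d t) (e n) * lam n powr \<gamma> = inner (f t) (e n) - lam n * inner (u t) (e n)" if "0 \<le> t" "t \<le> T" for t n
    unfolding dn[OF that] using lam1[of n] by (simp add: c_def mult_ac)
  define w where "w t = integral {0..t} d" for t
  have wd: "(w has_vector_derivative d t) (at t within {0..T})" if "t \<in> {0..T}" for t
    unfolding w_def by (rule integral_has_vector_derivative[OF dc that])
  then have wc: "continuous_on {0..T} w"
    unfolding continuous_on_eq_continuous_within by (blast intro: has_vector_derivative_continuous)
  define j where "j t = integral {0..t} w" for t
  have jd: "(j has_vector_derivative w t) (at t within {0..T})" if "t \<in> {0..T}" for t
    unfolding j_def by (rule integral_has_vector_derivative[OF wc that])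
  have intc: "inner (integral {0..t} g) (e n) = (\<integral>s. inner (g s) (e n) \<partial>lebesgue_on {0<..<t})"
    if g: "continuous_on {0..T} g" and t: "0 \<le> t" "t \<le> T" for g t n
  proof -
    have gc: "continuous_on {0..t} g" using g by (rule continuous_on_subset) (use t in auto)
    have "inner (integral {0..t} g) (e n) = integral {0..t} (\<lambda>s. inner (g s) (e n))"
      using integral_linear[OF integrable_continuous_real[OF gc] bounded_linear_inner_left[of "e n"]] by (simp add: o_def)
    also have "\<dots> = (\<integral>s. inner (g s) (e n) \<partial>lebesgue_on {0<..<t})"
      by (rule lebesgue_integral_eq_integral_continuous(2)[symmetric]) (intro continuous_intros gc)
    finally show ?thesis .
  qed
  have cc: "continuous_on {0..t} (c n)" if "t \<le> T" for n t
    unfolding c_def by (rule continuous_on_diff[OF coefficient_continuous[OF f that] continuous_on_mult[OF continuous_on_const coefficient_continuous[OF uc that]]])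
  have jn: "inner (caputo_integral \<alpha> T u t) (e n) = lam n powr \<gamma> * inner (j t) (e n)" if t: "0 \<le> t" "t \<le> T" for t n
  proof -
    have F: "frac_kernel \<mu> \<in> borel_measurable borel" "0 < \<mu> \<Longrightarrow> integrable (lebesgue_on {0<..<t}) (frac_kernel \<mu>)" for \<mu>
      using frac_kernel_integrable t by auto
    have "inner (caputo_integral \<alpha> T u t) (e n) = convolve (frac_kernel (2 - \<alpha>)) (\<lambda>s. inner (u s) (e n) - inner (u 0) (e n) - s * inner (dt T u 0) (e n)) t"
      by (rule caputo_integral_coefficient[OF uc t])
    also have "\<dots> = convolve (frac_kernel (2 - \<alpha>)) (convolve (frac_kernel \<alpha>) (c n)) t"
    proof (rule convolve_cong)
      fix s assume s: "0 < s" "s < t"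
      have "inner (u s) (e n) - inner (u 0) (e n) - s * inner (dt T u 0) (e n) = mild f u0 u1 n s - inner u0 (e n) - s * inner u1 (e n)"
        using u s t by (simp add: u0' is_mild_def)
      also have "\<dots> = convolve (frac_kernel \<alpha>) (\<lambda>s. inner (f s) (e n) - lam n * mild f u0 u1 n s) s"
        by (rule mild_volterra[OF f]) (use s t in auto)
      also have "\<dots> = convolve (frac_kernel \<alpha>) (c n) s"
        by (rule convolve_cong) (use u s t in \<open>auto simp: c_def is_mild_def\<close>)
      finally show "inner (u s) (e n) - inner (u 0) (e n) - s * inner (dt T u 0) (e n) = convolve (frac_kernel \<alpha>) (c n) s" .
    qed simp
    also have "\<dots> = convolve (convolve (frac_kernel (2 - \<alpha>)) (frac_kernel \<alpha>)) (c n) t"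
      by (rule convolve_assoc_continuous) (use F alpha cc t in auto)
    also have "\<dots> = convolve (convolve (frac_kernel 1) (frac_kernel 1)) (c n) t"
      by (rule convolve_cong) (use alpha in \<open>auto simp: frac_kernel_convolution\<close>)
    also have "\<dots> = convolve (frac_kernel 1) (convolve (frac_kernel 1) (c n)) t"
      by (rule convolve_assoc_continuous[symmetric]) (use F cc t in auto)
    also have "\<dots> = (\<integral>s. lam n powr \<gamma> * inner (w s) (e n) \<partial>lebesgue_on {0<..<t})"
      unfolding convolve_frac_one
    proof (rule Bochner_Integration.integral_cong[OF refl])
      fix s assume "s \<in> space (lebesgue_on {0<..<t})"
      then have s: "0 \<le> s" "s \<le> T" using t by auto
      have "lam n powr \<gamma> * inner (w s) (e n) = (\<integral>r. lam n powr \<gamma> * inner (d r) (e n) \<partial>lebesgue_on {0<..<s})"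
        unfolding w_def intc[OF dc s] by simp
      also have "\<dots> = (\<integral>r. c n r \<partial>lebesgue_on {0<..<s})"
        by (intro Bochner_Integration.integral_cong) (use s dn' in \<open>auto simp: c_def mult.commute\<close>)
      finally show "(\<integral>r. c n r \<partial>lebesgue_on {0<..<s}) = lam n powr \<gamma> * inner (w s) (e n)" ..
    qed
    also have "\<dots> = lam n powr \<gamma> * inner (j t) (e n)" unfolding j_def intc[OF wc t] by simp
    finally show ?thesis .
  qed
  have "has_caputo_derivative e lam \<gamma> \<alpha> T u (\<lambda>t. functional \<gamma> (d t))"
    unfolding has_caputo_derivative_def
  proof (intro exI conjI)
    show "Vdual_derivative e lam \<gamma> T (\<lambda>t v. inner (caputo_integral \<alpha> T u t) v) (\<lambda>t. functional \<gamma> (w t))"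
      by (rule Vdual_derivative_functional[where X = j]) (use inner_Vdual gamma jn jd in auto)
    show "Vdual_derivative e lam \<gamma> T (\<lambda>t. functional \<gamma> (w t)) (\<lambda>t. functional \<gamma> (d t))"
      by (rule Vdual_derivative_functional[where X = w]) (use functional_Vdual functional_basis wd in auto)
  qed
  with dc dn' show thesis by (rule that)
qed

lemma caputo_derivative_unique:
  assumes "has_caputo_derivative e lam s \<alpha> T u D" "has_caputo_derivative e lam s \<alpha> T u D'"
    and t: "t \<in> {0..T}" and v: "v \<in> VS s"
  shows "D t v = D' t v"
proof -
  obtain W where W: "Vdual_derivative e lam s T (\<lambda>t v. inner (caputo_integral \<alpha> T u t) v) W" "Vdual_derivative e lam s T W D"
    using assms(1) unfolding has_caputo_derivative_def by blast
  obtain W' where W': "Vdual_derivative e lam s T (\<lambda>t v. inner (caputo_integral \<alpha> T u t) v) W'" "Vdual_derivative e lam s T W' D'"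
    using assms(2) unfolding has_caputo_derivative_def by blast
  have WW: "W r (e n) = W' r (e n)" if "r \<in> {0..T}" for r n
    using vector_derivative_unique_within[OF interval_islimpt[OF that]
        Vdual_derivative_coefficient[OF W(1) that] Vdual_derivative_coefficient[OF W'(1) that]] .
  have DD: "D t (e n) = D' t (e n)" for n
  proof (rule vector_derivative_unique_within[OF interval_islimpt[OF t] Vdual_derivative_coefficient[OF W(2) t]])
    show "((\<lambda>r. W r (e n)) has_vector_derivative D' t (e n)) (at t within {0..T})"
      by (rule has_vector_derivative_transform[OF t WW Vdual_derivative_coefficient[OF W'(2) t]])
  qed
  show ?thesis
    by (rule Vdual_eqI[where ?l1.0 = "D t" and ?l2.0 = "D' t", OF _ _ DD v]) (use W(2) W'(2) t in \<open>auto simp: Vdual_derivative_def\<close>)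
qed

end

section \<open>Weak solutions are mild\<close>

context fractional_evolution
begin

text \<open>For each \<open>n\<close> the coefficient \<open>J\<close> of the fractional integral is twice differentiable, and by the equation its second
derivative is almost everywhere the coefficient \<open>c\<close> of \<open>f - A w\<close>. Hence \<open>J = g\<^sub>2 * c\<close>, which is \<open>g\<^bsub>2-\<alpha>\<^esub> * (g\<^sub>\<alpha> * c)\<close>. Since also
\<open>J = g\<^bsub>2-\<alpha>\<^esub> * z\<close>, the difference \<open>y = z - g\<^sub>\<alpha> * c\<close> is annihilated by \<open>g\<^bsub>2-\<alpha>\<^esub>\<close>, hence by
\<open>g\<^bsub>\<alpha>-1\<^esub> * g\<^bsub>2-\<alpha>\<^esub> = 1\<close>, and vanishes. This is the Volterra equation.\<close>

lemma weak_solution_is_mild: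
  assumes f: "continuous_on {0..T} f" and w: "weak_solution e lam E \<alpha> T f u0 u1 w"
  shows "is_mild f u0 u1 w"
  unfolding is_mild_def
proof (intro ballI allI)
  fix t0 n assume t0: "t0 \<in> {0..T}"
  have wV: "\<And>t. t \<in> {0..T} \<Longrightarrow> w t \<in> VS \<gamma>"
    and C1: "C1_on T w" and ic: "w 0 = u0" "dt T w 0 = u1"
    using w unfolding weak_solution_def continuous_into_V_def by auto
  obtain D where D: "has_caputo_derivative e lam \<gamma> \<alpha> T w D" "continuous_into_Vdual e lam \<gamma> T D"
    "\<And>v. v \<in> VS \<gamma> \<Longrightarrow> AE t in lebesgue_on {0<..<T}. D t v + E (w t) v = inner (f t) v"
    using w unfolding weak_solution_def by blast
  obtain W where W: "Vdual_derivative e lam \<gamma> T (\<lambda>t v. inner (caputo_integral \<alpha> T w t) v) W" "Vdual_derivative e lam \<gamma> T W D"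
    using D(1) unfolding has_caputo_derivative_def by blast
  have wc: "continuous_on {0..T} w" by (rule C1_continuous[OF C1])
  define J where "J t = inner (caputo_integral \<alpha> T w t) (e n)" for t
  define Wn where "Wn t = W t (e n)" for t
  define Dn where "Dn t = D t (e n)" for t
  define c where "c s = inner (f s) (e n) - lam n * inner (w s) (e n)" for s
  define z where "z s = inner (w s) (e n) - inner u0 (e n) - s * inner u1 (e n)" for s
  have Jd: "(J has_vector_derivative Wn t) (at t within {0..T})" if "t \<in> {0..T}" for t
    unfolding J_def[abs_def] Wn_def using Vdual_derivative_coefficient[OF W(1) that] .
  have Wd: "(Wn has_vector_derivative Dn t) (at t within {0..T})" if "t \<in> {0..T}" for t
    unfolding Wn_def[abs_def] Dn_def using Vdual_derivative_coefficient[OF W(2) that] .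
  have Dc: "continuous_on {0..T} Dn" unfolding Dn_def[abs_def] by (rule continuous_into_Vdual_coefficient[OF D(2)])
  have Wc: "continuous_on {0..T} Wn"
    unfolding continuous_on_eq_continuous_within using Wd by (blast intro: has_vector_derivative_continuous)
  have wnc: "continuous_on {0..T} (\<lambda>s. inner (w s) (e n))" using coefficient_continuous[OF wc] by simp
  have zc: "continuous_on {0..T} z" unfolding z_def by (intro continuous_intros wc)
  have cc: "continuous_on {0..T} c" unfolding c_def by (intro continuous_intros wc f)
  have F: "frac_kernel \<mu> \<in> borel_measurable borel" "0 < \<mu> \<Longrightarrow> 0 \<le> t \<Longrightarrow> integrable (lebesgue_on {0<..<t}) (frac_kernel \<mu>)" for \<mu> t
    using frac_kernel_integrable by auto
  have sub: "continuous_on {0..t} g" if "continuous_on {0..T} g" "t \<le> T" for g :: "real \<Rightarrow> real" and t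
    using that(1) by (rule continuous_on_subset) (use that(2) in auto)
  have JI: "J t = convolve (frac_kernel (2 - \<alpha>)) z t" if "0 \<le> t" "t \<le> T" for t
    unfolding J_def caputo_integral_coefficient[OF wc that] z_def[abs_def] ic ..

  \<comment> \<open>As \<open>J t\<close> is of order \<open>t powr (3 - \<alpha>)\<close>, it vanishes at \<open>0\<close> together with its derivative, so that it is the twofold primitive of \<open>Dn\<close>.\<close>
  have W0: "Wn 0 = 0"
  proof -
    obtain w' where w': "continuous_on {0..T} w'" "\<And>t. t \<in> {0..T} \<Longrightarrow> (w has_vector_derivative w' t) (at t within {0..T})"
      using C1 unfolding C1_on_def by blast
    define g where "g t = inner (w' t) (e n) - inner u1 (e n)" for t
    have gc: "continuous_on {0..T} g" unfolding g_def by (intro continuous_intros w')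
    obtain M where M: "\<And>t. 0 \<le> t \<Longrightarrow> t \<le> T \<Longrightarrow> norm (g t) \<le> M" using continuous_on_interval_bounded[OF gc] by blast
    have M0: "0 \<le> M" using M[of 0] T by (auto intro: order_trans[OF norm_ge_zero])
    have zd: "(z has_field_derivative g t) (at t within {0..T})" if "t \<in> {0..T}" for t
    proof -
      have "((\<lambda>s. inner (w s) (e n)) has_vector_derivative inner (w' t) (e n)) (at t within {0..T})"
        by (rule bounded_linear.has_vector_derivative[OF bounded_linear_inner_left w'(2)[OF that]])
      then have "((\<lambda>s. inner (w s) (e n)) has_field_derivative inner (w' t) (e n)) (at t within {0..T})"
        by (simp add: has_real_derivative_iff_has_vector_derivative)
      then show ?thesis unfolding z_def[abs_def] g_def by (auto intro!: derivative_eq_intros)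
    qed
    have z0: "z 0 = 0" by (simp add: z_def ic)
    have zM: "\<bar>z s\<bar> \<le> M * s" if "0 \<le> s" "s \<le> T" for s
    proof -
      have "norm (z s - z 0) \<le> M * norm (s - 0)"
        by (rule field_differentiable_bound[where S = "{0..T}" and f' = g]) (use zd M that T in auto)
      then show ?thesis using that by (simp add: z0)
    qed
    have JM: "\<bar>J t\<bar> \<le> M * t * frac_kernel (3 - \<alpha>) t" if t: "0 < t" "t \<le> T" for t
    proof -
      have i1: "integrable (lebesgue_on {0<..<t}) (\<lambda>s. frac_kernel (2 - \<alpha>) (t - s) * z s)"
        by (rule convolve_integrand_integrable) (use F t alpha sub[OF zc] in auto)
      have i2: "integrable (lebesgue_on {0<..<t}) (\<lambda>s. frac_kernel (2 - \<alpha>) (t - s))"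
        by (rule integrable_reflect) (use F t alpha in auto)
      have "\<bar>J t\<bar> \<le> (\<integral>s. \<bar>frac_kernel (2 - \<alpha>) (t - s) * z s\<bar> \<partial>lebesgue_on {0<..<t})"
        using JI[of t] t integral_norm_bound[of "lebesgue_on {0<..<t}" "\<lambda>s. frac_kernel (2 - \<alpha>) (t - s) * z s"]
        by (simp add: convolve_def)
      also have "\<dots> \<le> (\<integral>s. M * t * frac_kernel (2 - \<alpha>) (t - s) \<partial>lebesgue_on {0<..<t})"
      proof (rule integral_mono)
        fix s assume "s \<in> space (lebesgue_on {0<..<t})"
        then have s: "0 < s" "s < t" by auto
        have "\<bar>z s\<bar> \<le> M * s" using zM s t by simp
        also have "\<dots> \<le> M * t" using s M0 by (intro mult_left_mono) auto
        finally have "frac_kernel (2 - \<alpha>) (t - s) * \<bar>z s\<bar> \<le> frac_kernel (2 - \<alpha>) (t - s) * (M * t)"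
          using frac_kernel_nonneg[of "2 - \<alpha>"] alpha by (intro mult_left_mono) auto
        then show "\<bar>frac_kernel (2 - \<alpha>) (t - s) * z s\<bar> \<le> M * t * frac_kernel (2 - \<alpha>) (t - s)"
          using frac_kernel_nonneg[of "2 - \<alpha>"] alpha by (simp add: abs_mult mult_ac)
      qed (use i1 i2 in auto)
      also have "\<dots> = M * t * (\<integral>s. frac_kernel (2 - \<alpha>) s \<partial>lebesgue_on {0<..<t})"
        using integral_reflect[of "frac_kernel (2 - \<alpha>)" t] by simp
      also have "(\<integral>s. frac_kernel (2 - \<alpha>) s \<partial>lebesgue_on {0<..<t}) = frac_kernel (3 - \<alpha>) t"
        using frac_kernel_convolution(2)[of 1 "2 - \<alpha>" t] alpha t by (simp add: convolve_frac_one)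
      finally show ?thesis .
    qed
    have J0: "J 0 = 0" using JI[of 0] T by simp
    have "((\<lambda>t. (J t - J 0) / (t - 0)) \<longlongrightarrow> Wn 0) (at 0 within {0..T})"
      using Jd[of 0] T by (simp add: has_field_derivative_iff flip: has_real_derivative_iff_has_vector_derivative)
    moreover have "((\<lambda>t. (J t - J 0) / (t - 0)) \<longlongrightarrow> 0) (at 0 within {0..T})"
    proof (rule Lim_null_comparison)
      show "\<forall>\<^sub>F t in at 0 within {0..T}. norm ((J t - J 0) / (t - 0)) \<le> M * (t powr (2 - \<alpha>) / Gamma (3 - \<alpha>))"
        unfolding eventually_at_filter
      proof (intro always_eventually allI impI)
        fix t assume "t \<noteq> 0" "t \<in> {0..T}"
        then have t: "0 < t" "t \<le> T" by auto
        then show "norm ((J t - J 0) / (t - 0)) \<le> M * (t powr (2 - \<alpha>) / Gamma (3 - \<alpha>))"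
          using JM[OF t] by (simp add: J0 frac_kernel_def divide_le_eq mult_ac)
      qed
      have "((\<lambda>t. M * (t powr (2 - \<alpha>) / Gamma (3 - \<alpha>))) \<longlongrightarrow> M * (0 powr (2 - \<alpha>) / Gamma (3 - \<alpha>))) (at 0 within {0..T})"
      proof -
        have "continuous_on {0..T} (\<lambda>t. M * (t powr (2 - \<alpha>) / Gamma (3 - \<alpha>)))"
          using alpha Gamma_real_pos[of "3 - \<alpha>", THEN less_imp_neq]
          by (intro continuous_on_mult continuous_on_divide continuous_on_powr' continuous_on_const continuous_on_id) auto
        then show ?thesis unfolding continuous_on_def by (rule bspec) (use T in simp)
      qed
      then show "((\<lambda>t. M * (t powr (2 - \<alpha>) / Gamma (3 - \<alpha>))) \<longlongrightarrow> 0) (at 0 within {0..T})" using alpha by simp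
    qed
    ultimately show ?thesis using tendsto_unique[OF interval_islimpt[of 0]] T by simp
  qed
  have WI: "Wn s = convolve (frac_kernel 1) c s" if s: "0 \<le> s" "s \<le> T" for s
  proof -
    have "Wn s = (\<integral>r. Dn r \<partial>lebesgue_on {0<..<s})"
      using primitive_of_derivative[OF Wd Dc s] W0 by simp
    also have "\<dots> = (\<integral>r. c r \<partial>lebesgue_on {0<..<s})"
    proof (rule integral_cong_AE)
      show "Dn \<in> borel_measurable (lebesgue_on {0<..<s})" "c \<in> borel_measurable (lebesgue_on {0<..<s})"
        using continuous_on_lebesgue_integrable[OF sub[OF Dc s(2)]] continuous_on_lebesgue_integrable[OF sub[OF cc s(2)]] by auto
      have "AE r in lebesgue_on {0<..<T}. Dn r = c r"
        using D(3)[OF V_basis(1), of n] AE_space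
      proof eventually_elim
        case (elim r)
        then show ?case using form_basis[OF wV, of r n] by (simp add: Dn_def c_def)
      qed
      then show "AE r in lebesgue_on {0<..<s}. Dn r = c r"
        using s by (auto simp: AE_restrict_space_iff)
    qed
    finally show ?thesis by (simp add: convolve_frac_one)
  qed
  have JJ: "J t = convolve (frac_kernel (2 - \<alpha>)) (convolve (frac_kernel \<alpha>) c) t" if t: "0 \<le> t" "t \<le> T" for t
  proof -
    have "J t = convolve (frac_kernel 1) Wn t"
      using primitive_of_derivative[OF Jd Wc t] JI[of 0] T by (simp add: convolve_frac_one)
    also have "\<dots> = convolve (frac_kernel 1) (convolve (frac_kernel 1) c) t"
      by (rule convolve_cong) (use WI t in auto)
    also have "\<dots> = convolve (convolve (frac_kernel 1) (frac_kernel 1)) c t"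
      by (rule convolve_assoc_continuous) (use F t sub[OF cc] in auto)
    also have "\<dots> = convolve (convolve (frac_kernel (2 - \<alpha>)) (frac_kernel \<alpha>)) c t"
      by (rule convolve_cong) (use alpha in \<open>auto simp: frac_kernel_convolution\<close>)
    also have "\<dots> = convolve (frac_kernel (2 - \<alpha>)) (convolve (frac_kernel \<alpha>) c) t"
      by (rule convolve_assoc_continuous[symmetric]) (use F t alpha sub[OF cc] in auto)
    finally show ?thesis .
  qed
  define y where "y s = z s - convolve (frac_kernel \<alpha>) c s" for s
  have fac: "continuous_on {0..T} (convolve (frac_kernel \<alpha>) c)"
    by (rule convolve_continuous) (use F alpha T cc in auto)
  have yc: "continuous_on {0..T} y" unfolding y_def by (intro continuous_intros zc fac)
  have yz: "convolve (frac_kernel (2 - \<alpha>)) y t = 0" if t: "0 \<le> t" "t \<le> T" for t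
  proof -
    have "convolve (frac_kernel (2 - \<alpha>)) (\<lambda>s. 1 * z s + (- 1) * convolve (frac_kernel \<alpha>) c s) t
      = 1 * convolve (frac_kernel (2 - \<alpha>)) z t + (- 1) * convolve (frac_kernel (2 - \<alpha>)) (convolve (frac_kernel \<alpha>) c) t"
      by (rule convolve_linear) (use F t alpha sub[OF zc] sub[OF fac] in auto)
    then show ?thesis using JI[OF t] JJ[OF t] by (simp add: y_def[abs_def])
  qed
  have yzero: "y t = 0" if t: "0 \<le> t" "t \<le> T" for t
  proof (rule zero_of_zero_primitive[OF yc T _ t])
    fix t assume t: "0 \<le> t" "t \<le> T"
    have "(\<integral>s. y s \<partial>lebesgue_on {0<..<t}) = convolve (convolve (frac_kernel (\<alpha> - 1)) (frac_kernel (2 - \<alpha>))) y t"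
      unfolding convolve_frac_one[symmetric]
      by (rule convolve_cong) (use alpha in \<open>auto simp: frac_kernel_convolution\<close>)
    also have "\<dots> = convolve (frac_kernel (\<alpha> - 1)) (convolve (frac_kernel (2 - \<alpha>)) y) t"
      by (rule convolve_assoc_continuous[symmetric]) (use F t alpha sub[OF yc] in auto)
    also have "\<dots> = convolve (frac_kernel (\<alpha> - 1)) (\<lambda>_. 0) t"
      by (rule convolve_cong) (use yz t in auto)
    finally show "(\<integral>s. y s \<partial>lebesgue_on {0<..<t}) = 0" by (simp add: convolve_def)
  qed
  show "inner (w t0) (e n) = mild f u0 u1 n t0"
  proof (rule volterra_unique[OF f wnc])
    fix t assume t: "0 \<le> t" "t \<le> T"
    show "inner (w t) (e n) - inner u0 (e n) - t * inner u1 (e n)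
      = convolve (frac_kernel \<alpha>) (\<lambda>s. inner (f s) (e n) - lam n * inner (w s) (e n)) t"
      using yzero[OF t] by (simp add: y_def z_def c_def[abs_def])
  qed (use t0 in auto)
qed

section \<open>The operator along a solution\<close>

definition primitive_pair :: "(real \<Rightarrow> 'h) \<Rightarrow> (real \<Rightarrow> 'h) \<Rightarrow> bool" where
  "primitive_pair f f' \<longleftrightarrow> continuous_on {0..T} f \<and> integrable (lebesgue_on {0<..<T}) f' \<and>
     (\<forall>t\<in>{0..T}. f t = f 0 + (\<integral>s. f' s \<partial>lebesgue_on {0<..<t}))"

lemma primitive_pair_continuous: "primitive_pair f f' \<Longrightarrow> continuous_on {0..T} f"
  and primitive_pair_integrable: "primitive_pair f f' \<Longrightarrow> integrable (lebesgue_on {0<..<T}) f'"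
  unfolding primitive_pair_def by blast+

lemma primitive_pair_coefficient:
  assumes "primitive_pair f f'" "0 \<le> t" "t \<le> T"
  shows "inner (f t) (e n) = inner (f 0) (e n) + (\<integral>s. inner (f' s) (e n) \<partial>lebesgue_on {0<..<t})"
proof -
  have "f t = f 0 + (\<integral>s. f' s \<partial>lebesgue_on {0<..<t})" using assms unfolding primitive_pair_def by (meson atLeastAtMost_iff)
  moreover have "integrable (lebesgue_on {0<..<t}) f'"
    by (rule integrable_initial_interval[OF _ assms(3)]) (rule primitive_pair_integrable[OF assms(1)])
  ultimately show ?thesis using integral_inner_left[of "e n" "lebesgue_on {0<..<t}" f'] by (simp add: inner_add_left)
qed

lemma ek_const_convolution: "0 < \<beta> \<Longrightarrow> 0 < t \<Longrightarrow> convolve (ek \<beta> n) (\<lambda>_. 1) t = ek (\<beta> + 1) n t"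
  using convolve_cong[of t "ek \<beta> n" "ek \<beta> n" "\<lambda>_. 1" "frac_kernel 1"] ek_frac[of 1 \<beta> t n]
  by (simp add: frac_kernel_one)

text \<open>Integration by parts, with the primitive of the kernel expressed by an index shift.\<close>

lemma ek_convolution_primitive:
  assumes pp: "primitive_pair f f'" and b: "0 < \<beta>" and t: "0 < t" "t \<le> T"
  shows "convolve (ek \<beta> n) (\<lambda>s. inner (f s) (e n)) t
    = inner (f 0) (e n) * ek (\<beta> + 1) n t + convolve (ek (\<beta> + 1) n) (\<lambda>s. inner (f' s) (e n)) t"
proof -
  define c where "c s = inner (f' s) (e n)" for s
  have ci: "integrable (lebesgue_on {0<..<t}) c"
    unfolding c_def using integrable_initial_interval[OF primitive_pair_integrable[OF pp] t(2)] by auto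
  have f: "continuous_on {0..t} (\<lambda>s. inner (f s) (e n))" by (rule coefficient_continuous[OF primitive_pair_continuous[OF pp] t(2)])
  have K: "ek \<beta> n \<in> borel_measurable borel" "integrable (lebesgue_on {0<..<t}) (ek \<beta> n)"
    using b t ek_integrable by auto
  have fs: "inner (f s) (e n) - inner (f 0) (e n) = convolve (\<lambda>_. 1) c s" if "0 \<le> s" "s \<le> t" for s
    using primitive_pair_coefficient[OF pp, of s n] that t by (simp add: convolve_one c_def)
  have cont: "continuous_on {0..t} (convolve (\<lambda>_. 1) c)"
    by (rule continuous_on_eq[OF continuous_on_diff[OF f continuous_on_const]]) (rule fs, simp_all)
  have "convolve (ek \<beta> n) (\<lambda>s. inner (f s) (e n)) t = convolve (ek \<beta> n) (\<lambda>s. inner (f 0) (e n) * 1 + 1 * convolve (\<lambda>_. 1) c s) t"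
  proof (rule convolve_cong)
    fix s assume "0 < s" "s < t"
    then have "inner (f s) (e n) - inner (f 0) (e n) = convolve (\<lambda>_. 1) c s" by (intro fs) auto
    then show "inner (f s) (e n) = inner (f 0) (e n) * 1 + 1 * convolve (\<lambda>_. 1) c s" by linarith
  qed simp
  also have "\<dots> = inner (f 0) (e n) * convolve (ek \<beta> n) (\<lambda>_. 1) t + 1 * convolve (ek \<beta> n) (convolve (\<lambda>_. 1) c) t"
    by (rule convolve_linear[OF K continuous_on_const cont])
  also have "convolve (ek \<beta> n) (convolve (\<lambda>_. 1) c) t = convolve (convolve (ek \<beta> n) (\<lambda>_. 1)) c t"
    by (rule convolve_assoc_middle_bounded[where B = 1]) (use K ci in auto)
  also have "\<dots> = convolve (ek (\<beta> + 1) n) c t"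
    by (rule convolve_cong) (use ek_const_convolution[OF b] in auto)
  finally show ?thesis using ek_const_convolution[OF b t(1)] by (simp add: c_def[abs_def])
qed

text \<open>Integrating by parts and applying \<open>ek_recurrence\<close> shows that \<open>lam n * convolve (ek \<alpha> n) c\<close> equals
\<open>c - c 0 * E1 n - convolve (E1 n) c'\<close> for the coefficients \<open>c\<close> of \<open>f\<close>. No positive power of the
eigenvalue is left on the source.\<close>

lemma mild_operator_bound:
  obtains K where "0 < K"
    "\<And>f f' u0 u1 u t. primitive_pair f f' \<Longrightarrow> u0 \<in> VS \<gamma> \<Longrightarrow> is_mild f u0 u1 u \<Longrightarrow> 0 < t \<Longrightarrow> t \<le> T \<Longrightarrow>
      u t \<in> DA \<and> norm (A (u t)) \<le> K * t powr (1 - \<alpha>) * (VN \<gamma> u0 + norm u1) + norm (f t)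
        + K * norm (f 0) + K * (\<integral>s. norm (f' s) \<partial>lebesgue_on {0<..<t})"
proof -
  obtain K1 where K1: "0 < K1" "\<And>n t. 0 \<le> t \<Longrightarrow> \<bar>E1 n t\<bar> \<le> K1" by (rule E1_bound) blast
  obtain B1 where B1: "B1 > 0" "\<And>n t s. 0 < t \<Longrightarrow> 0 \<le> s \<Longrightarrow> s \<le> 1 \<Longrightarrow>
    \<bar>lam n powr s * ek 1 n t\<bar> \<le> B1 * t powr (1 - 1 - \<alpha> * s)" using ek_bound[of 1] by auto
  obtain B2 where B2: "B2 > 0" "\<And>n t s. 0 < t \<Longrightarrow> 0 \<le> s \<Longrightarrow> s \<le> 1 \<Longrightarrow>
    \<bar>lam n powr s * ek 2 n t\<bar> \<le> B2 * t powr (2 - 1 - \<alpha> * s)" using ek_bound[of 2] by auto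
  define K where "K = K1 + B1 + B2"
  have KK: "K1 \<le> K" "B1 \<le> K" "B2 \<le> K" "0 < K" using K1 B1 B2 by (auto simp: K_def)
  show thesis
  proof (rule that[OF KK(4)])
    fix f f' u0 u1 u t
    assume pp: "primitive_pair f f'" and u0: "u0 \<in> VS \<gamma>" and u: "is_mild f u0 u1 u" and t: "0 < t" "t \<le> T"
    have f'i: "integrable (lebesgue_on {0<..<t}) f'"
      by (rule integrable_initial_interval[OF primitive_pair_integrable[OF pp] t(2)])
    have b1: "\<bar>lam n powr (1 - \<gamma>) * E1 n t\<bar> \<le> B1 * t powr (1 - \<alpha>)" for n
    proof -
      have "1 - 1 - \<alpha> * (1 - \<gamma>) = 1 - \<alpha>" using gamma by (simp add: right_diff_distrib)
      then show ?thesis using B1(2)[of t "1 - \<gamma>" n] t gamma by (simp add: E1_eq)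
    qed
    have b2: "\<bar>lam n * ek 2 n t\<bar> \<le> B2 * t powr (1 - \<alpha>)" for n
      using B2(2)[of t 1 n] t lam_pos[of n] by (simp add: abs_of_pos)
    have b3: "\<bar>E1 n t\<bar> \<le> K1" for n using K1(2) t by simp
    obtain U where U: "\<And>n. inner U (e n) = convolve (\<lambda>\<tau>. E1 n \<tau>) (\<lambda>\<tau>. inner (f' \<tau>) (e n)) t"
      "norm U \<le> K1 * (\<integral>\<tau>. norm (f' \<tau>) \<partial>lebesgue_on {0<..<t})"
      by (rule diag_convolution_bounded[of "\<lambda>\<tau> n. E1 n \<tau>" t K1 f']) (use K1 f'i in auto)
    define x where "x = diag (\<lambda>n. lam n powr (1 - \<gamma>) * E1 n t) (pow \<gamma> u0) + diag (\<lambda>n. lam n * ek 2 n t) u1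
      + f t - diag (\<lambda>n. E1 n t) (f 0) - U"
    have xn: "inner x (e n) = lam n * inner (u t) (e n)" for n
    proof -
      define c where "c s = inner (f' s) (e n)" for s
      have ci: "integrable (lebesgue_on {0<..<t}) c" unfolding c_def using f'i by auto
      have rec: "lam n * ek (\<alpha> + 1) n s = 1 - E1 n s" if "0 < s" for s
        using ek_recurrence[of 1 s n] that by (simp add: frac_kernel_one E1_eq add.commute)
      have i: "integrable (lebesgue_on {0<..<t}) (\<lambda>\<tau>. E1 n (t - \<tau>) * c \<tau>)"
      proof -
        have "integrable (lebesgue_on {0<..<t}) (\<lambda>\<tau>. c \<tau> * E1 n (t - \<tau>))"
          by (rule integrable_bounded_mult[OF ci, where C = K1]) (use K1 in \<open>auto intro!: borel_measurable_lebesgue_on_borel\<close>)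
        then show ?thesis by (simp add: mult.commute)
      qed
      have "lam n * convolve (ek \<alpha> n) (\<lambda>s. inner (f s) (e n)) t
        = inner (f 0) (e n) * (lam n * ek (\<alpha> + 1) n t) + lam n * convolve (ek (\<alpha> + 1) n) c t"
        using ek_convolution_primitive[OF pp _ t, of \<alpha> n] alpha by (simp add: c_def[abs_def] algebra_simps)
      also have "lam n * convolve (ek (\<alpha> + 1) n) c t = convolve (\<lambda>s. 1 - E1 n s) c t"
        unfolding convolve_cmult_left[symmetric] by (rule convolve_cong) (auto simp: rec)
      also have "\<dots> = (\<integral>s. c s \<partial>lebesgue_on {0<..<t}) - convolve (E1 n) c t"
        unfolding convolve_def using i ci by (simp add: left_diff_distrib)
      also have "(\<integral>s. c s \<partial>lebesgue_on {0<..<t}) = inner (f t) (e n) - inner (f 0) (e n)"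
        using primitive_pair_coefficient[OF pp, of t n] t by (simp add: c_def)
      finally have conv: "lam n * convolve (ek \<alpha> n) (\<lambda>s. inner (f s) (e n)) t
        = inner (f t) (e n) - E1 n t * inner (f 0) (e n) - convolve (E1 n) c t"
        unfolding rec[OF t(1)] by (simp add: algebra_simps)
      have p: "lam n powr (1 - \<gamma>) * E1 n t * (lam n powr \<gamma> * inner u0 (e n)) = lam n * (E1 n t * inner u0 (e n))"
      proof -
        have "lam n powr (1 - \<gamma>) * E1 n t * (lam n powr \<gamma> * inner u0 (e n)) = (lam n powr (1 - \<gamma>) * lam n powr \<gamma>) * (E1 n t * inner u0 (e n))"
          by simp
        then show ?thesis unfolding lam_powr_split .
      qed
      have "inner x (e n) = lam n powr (1 - \<gamma>) * E1 n t * (lam n powr \<gamma> * inner u0 (e n)) + lam n * ek 2 n t * inner u1 (e n)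
         + (inner (f t) (e n) - E1 n t * inner (f 0) (e n) - convolve (E1 n) c t)"
        unfolding x_def inner_add_left inner_diff_left inner_diag[OF b1] inner_diag[OF b2] inner_diag[OF b3] inner_pow[OF u0] U(1)
        by (simp add: c_def[abs_def])
      also have "\<dots> = lam n * mild f u0 u1 n t"
        unfolding p conv[symmetric] by (simp add: mild_def algebra_simps)
      finally show ?thesis using u t by (simp add: is_mild_def)
    qed
    have nx: "norm x \<le> K * t powr (1 - \<alpha>) * (VN \<gamma> u0 + norm u1) + norm (f t)
        + K * norm (f 0) + K * (\<integral>s. norm (f' s) \<partial>lebesgue_on {0<..<t})"
    proof -
      have "norm x \<le> norm (diag (\<lambda>n. lam n powr (1 - \<gamma>) * E1 n t) (pow \<gamma> u0)) + norm (diag (\<lambda>n. lam n * ek 2 n t) u1)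
         + norm (f t) + norm (diag (\<lambda>n. E1 n t) (f 0)) + norm U"
        unfolding x_def by (intro order_trans[OF norm_triangle_ineq4] add_right_mono order_trans[OF norm_triangle_ineq]) simp
      moreover have "norm (diag (\<lambda>n. lam n powr (1 - \<gamma>) * E1 n t) (pow \<gamma> u0)) \<le> K * t powr (1 - \<alpha>) * VN \<gamma> u0"
        unfolding V_norm_pow[OF u0] using KK by (intro order_trans[OF norm_diag_le[OF b1]] mult_right_mono) auto
      moreover have "norm (diag (\<lambda>n. lam n * ek 2 n t) u1) \<le> K * t powr (1 - \<alpha>) * norm u1"
        using KK by (intro order_trans[OF norm_diag_le[OF b2]] mult_right_mono) auto
      moreover have "norm (diag (\<lambda>n. E1 n t) (f 0)) \<le> K * norm (f 0)"
        using KK by (intro order_trans[OF norm_diag_le[OF b3]] mult_right_mono) auto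
      moreover have "norm U \<le> K * (\<integral>s. norm (f' s) \<partial>lebesgue_on {0<..<t})"
        using KK by (intro order_trans[OF U(2)] mult_right_mono) auto
      ultimately show ?thesis by (simp add: algebra_simps)
    qed
    show "u t \<in> DA \<and> norm (A (u t)) \<le> K * t powr (1 - \<alpha>) * (VN \<gamma> u0 + norm u1) + norm (f t)
        + K * norm (f 0) + K * (\<integral>s. norm (f' s) \<partial>lebesgue_on {0<..<t})"
      using DA_intro[OF xn] nx by simp
  qed
qed

section \<open>Mild solutions are strong\<close>

lemma functional_operator:
  assumes u: "u \<in> DA" and v: "v \<in> VS \<gamma>"
    and d: "\<And>n. inner d (e n) * lam n powr \<gamma> = inner g (e n) - lam n * inner u (e n)"
  shows "functional \<gamma> d v = inner (g - A u) v"
  unfolding functional_def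
  by (rule inner_pow_eqI[OF v]) (simp add: d inner_diff_left A_coefficient[OF u])

lemma mild_strong_solution:
  assumes pp: "primitive_pair f f'" and u0: "u0 \<in> VS \<gamma>" and u: "is_mild f u0 u1 u"
  shows "strong_solution e lam E DA A \<alpha> T f u0 u1 u"
proof -
  let ?M = "lebesgue_on {0<..<T}"
  have f: "continuous_on {0..T} f" and f'i: "integrable ?M f'" using primitive_pair_continuous[OF pp] primitive_pair_integrable[OF pp] .
  obtain K where K: "0 < K" "\<And>t. 0 < t \<Longrightarrow> t \<le> T \<Longrightarrow>
      u t \<in> DA \<and> norm (A (u t)) \<le> K * t powr (1 - \<alpha>) * (VN \<gamma> u0 + norm u1) + norm (f t)
        + K * norm (f 0) + K * (\<integral>s. norm (f' s) \<partial>lebesgue_on {0<..<t})"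
    using mild_operator_bound pp u0 u by metis
  obtain Y where Y: "continuous_on {0..T} Y"
    "\<And>t n. 0 \<le> t \<Longrightarrow> t \<le> T \<Longrightarrow> inner (Y t) (e n) = lam n powr \<gamma> * inner (u t) (e n)"
    using mild_V_continuous[OF f u0 u] by blast
  obtain v where v: "continuous_on {0..T} v" "v 0 = u1"
    "\<And>t. t \<in> {0..T} \<Longrightarrow> (u has_vector_derivative v t) (at t within {0..T})"
    using mild_C1[OF f u0 u] by metis
  obtain d where d: "continuous_on {0..T} d"
    "\<And>t n. 0 \<le> t \<Longrightarrow> t \<le> T \<Longrightarrow> inner (d t) (e n) * lam n powr \<gamma> = inner (f t) (e n) - lam n * inner (u t) (e n)"
    "has_caputo_derivative e lam \<gamma> \<alpha> T u (\<lambda>t. functional \<gamma> (d t))"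
    using mild_caputo[OF f u0 u] by blast
  have C1: "C1_on T u" unfolding C1_on_def using v by blast
  have uc: "continuous_on {0..T} u" by (rule C1_continuous[OF C1])
  have ui: "u 0 = u0" "dt T u 0 = u1" using is_mild_zero[OF u] dt_eq[OF _ v(3), of 0] v(2) T by auto
  have dtv: "dt T u t = v t" if "t \<in> {0..T}" for t using dt_eq[OF that v(3)[OF that]] .
  have uV: "u t \<in> VS \<gamma>" if "t \<in> {0..T}" for t by (rule V_spaceI(1)[where x = "Y t"]) (use Y(2) that in auto)
  have op: "functional \<gamma> (d t) v = inner (f t - A (u t)) v" if "t \<in> space ?M" "v \<in> VS \<gamma>" for t v
    by (rule functional_operator) (use K(2)[of t] that d(2) in auto)
  have weak: "weak_solution e lam E \<alpha> T f u0 u1 u"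
    unfolding weak_solution_def
  proof (intro conjI C1 ui)
    show "continuous_into_V e lam \<gamma> T u"
      unfolding continuous_into_V_def
    proof (intro ballI conjI uV)
      fix t assume t: "t \<in> {0..T}"
      have "(Y \<longlongrightarrow> Y t) (at t within {0..T})" using Y(1) t by (simp add: continuous_on_def)
      then have "((\<lambda>r. norm (Y r - Y t)) \<longlongrightarrow> 0) (at t within {0..T})"
        by (intro tendsto_norm_zero) (simp add: LIM_zero)
      moreover have "\<forall>\<^sub>F r in at t within {0..T}. norm (Y r - Y t) = VN \<gamma> (u r - u t)"
        unfolding eventually_at_filter
      proof (intro always_eventually allI impI)
        fix r assume "r \<in> {0..T}"
        then show "norm (Y r - Y t) = VN \<gamma> (u r - u t)"
          using t Y(2) by (intro V_spaceI(3)[symmetric]) (auto simp: inner_diff_left right_diff_distrib)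
      qed
      ultimately show "((\<lambda>r. VN \<gamma> (u r - u t)) \<longlongrightarrow> 0) (at t within {0..T})" by (rule Lim_transform_eventually)
    qed
    show "\<exists>\<sigma> \<beta>. 0 \<le> \<sigma> \<and> \<sigma> < 1 / \<alpha> \<and> 0 < \<beta> \<and> \<beta> \<le> 1 - 1 / \<alpha> \<and>
        ((\<lambda>t. VN \<sigma> (u t - u0)) \<longlongrightarrow> 0) (at_right 0) \<and>
        ((\<lambda>t. Vdual_norm e lam \<beta> (inner (dt T u t - u1))) \<longlongrightarrow> 0) (at_right 0)"
    proof (intro exI conjI)
      \<comment> \<open>Choosing \<open>\<sigma> = 0\<close> and \<open>\<beta> = 1 - 1 / \<alpha>\<close>: both limits follow from convergence in the Hilbert space itself.\<close>
      show "0 \<le> (0::real)" "0 < 1 / \<alpha>" "0 < 1 - 1 / \<alpha>" "1 - 1 / \<alpha> \<le> 1 - 1 / \<alpha>" using gamma by auto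
      have at: "at 0 within {0..T} = at_right (0::real)" by (rule at_within_Icc_at_right[OF T])
      have "(u \<longlongrightarrow> u 0) (at 0 within {0..T})" using uc T by (simp add: continuous_on_def)
      then have "((\<lambda>r. norm (u r - u0)) \<longlongrightarrow> 0) (at_right 0)"
        unfolding at ui by (intro tendsto_norm_zero) (simp add: LIM_zero)
      then show "((\<lambda>t. VN 0 (u t - u0)) \<longlongrightarrow> 0) (at_right 0)" by (simp add: V_space_zero)
      have bb: "\<bar>lam n powr (- (1 - 1 / \<alpha>))\<bar> \<le> lam 0 powr (- (1 - 1 / \<alpha>))" for n
        by (rule lam_powr_le) (use gamma in auto)
      have de: "Vdual_norm e lam (1 - 1 / \<alpha>) (inner h) = norm (diag (\<lambda>n. lam n powr (- (1 - 1 / \<alpha>))) h)" for h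
        proof (rule Vdual_norm_eq)
          fix n
          have "lam n powr (1 - 1 / \<alpha>) * lam n powr (- (1 - 1 / \<alpha>)) = 1"
            unfolding powr_add[symmetric] using lam_pos[of n] by (simp add: less_imp_neq[symmetric])
          then show "inner h (e n) = lam n powr (1 - 1 / \<alpha>) * inner (diag (\<lambda>n. lam n powr (- (1 - 1 / \<alpha>))) h) (e n)"
            unfolding inner_diag[OF bb] mult.assoc[symmetric] by simp
        qed
      have "(v \<longlongrightarrow> v 0) (at 0 within {0..T})" using v(1) T by (simp add: continuous_on_def)
      then have "((\<lambda>r. norm (v r - u1)) \<longlongrightarrow> 0) (at_right 0)"
        unfolding at v(2) by (intro tendsto_norm_zero) (simp add: LIM_zero)
      then have lim: "((\<lambda>r. lam 0 powr (- (1 - 1 / \<alpha>)) * norm (v r - u1)) \<longlongrightarrow> 0) (at_right 0)"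
        by (rule tendsto_mult_right_zero)
      show "((\<lambda>t. Vdual_norm e lam (1 - 1 / \<alpha>) (inner (dt T u t - u1))) \<longlongrightarrow> 0) (at_right 0)"
      proof (rule Lim_null_comparison[OF _ lim])
        show "\<forall>\<^sub>F t in at_right 0. norm (Vdual_norm e lam (1 - 1 / \<alpha>) (inner (dt T u t - u1)))
          \<le> lam 0 powr (- (1 - 1 / \<alpha>)) * norm (v t - u1)"
          unfolding at[symmetric] eventually_at_filter
        proof (intro always_eventually allI impI)
          fix t assume "t \<in> {0..T}"
          then have "dt T u t = v t" by (rule dtv)
          then show "norm (Vdual_norm e lam (1 - 1 / \<alpha>) (inner (dt T u t - u1)))
            \<le> lam 0 powr (- (1 - 1 / \<alpha>)) * norm (v t - u1)"
            using norm_diag_le[OF bb, where h = "v t - u1"] by (simp only: de real_norm_def abs_norm_cancel)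
        qed
      qed
    qed
    show "\<exists>D. has_caputo_derivative e lam (1 / \<alpha>) \<alpha> T u D \<and> continuous_into_Vdual e lam (1 / \<alpha>) T D \<and>
        (\<forall>v\<in>VS (1 / \<alpha>). AE t in ?M. D t v + E (u t) v = inner (f t) v)"
    proof (intro exI conjI ballI)
      show "has_caputo_derivative e lam \<gamma> \<alpha> T u (\<lambda>t. functional \<gamma> (d t))" by (rule d)
      show "continuous_into_Vdual e lam \<gamma> T (\<lambda>t. functional \<gamma> (d t))" by (rule functional_continuous_into_Vdual[OF d(1)])
      fix v assume v: "v \<in> VS \<gamma>"
      show "AE t in ?M. functional \<gamma> (d t) v + E (u t) v = inner (f t) v"
      proof (rule AE_I2)
        fix t assume t: "t \<in> space ?M"
        then have "E (u t) v = inner (A (u t)) v" using K(2)[of t] by (intro form_DA v) auto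
        then show "functional \<gamma> (d t) v + E (u t) v = inner (f t) v" unfolding op[OF t v] by (simp add: inner_diff_left)
      qed
    qed
  qed
  have Ai: "integrable ?M (\<lambda>t. A (u t))"
  proof -
    obtain C where C: "\<And>t. 0 \<le> t \<Longrightarrow> t \<le> T \<Longrightarrow> norm (f t) \<le> C" using continuous_on_interval_bounded[OF f] by blast
    define R where "R = C + K * norm (f 0) + K * (\<integral>s. norm (f' s) \<partial>?M)"
    have "integrable ?M (\<lambda>t. t powr ((2 - \<alpha>) - 1))" by (rule powr_integrable(1)) (use alpha T in auto)
    then have "integrable ?M (\<lambda>t. t powr (1 - \<alpha>))" by simp
    then have dom: "integrable ?M (\<lambda>t. K * (VN \<gamma> u0 + norm u1) * t powr (1 - \<alpha>) + R)"
      by (intro Bochner_Integration.integrable_add integrable_mult_right finite_measure.integrable_const[OF finite_measure_interval])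
    show ?thesis
    proof (rule Bochner_Integration.integrable_bound[OF dom])
      show "(\<lambda>t. A (u t)) \<in> borel_measurable ?M"
      proof (rule borel_measurable_LIMSEQ_metric)
        have [measurable]: "u \<in> borel_measurable ?M" using continuous_on_lebesgue_integrable[OF uc] by auto
        show "(\<lambda>t. \<Sum>n<N. (lam n * inner (u t) (e n)) *\<^sub>R e n) \<in> borel_measurable ?M" for N by measurable
        show "(\<lambda>N. \<Sum>n<N. (lam n * inner (u t) (e n)) *\<^sub>R e n) \<longlonglongrightarrow> A (u t)" if "t \<in> space ?M" for t
        proof -
          have "u t \<in> DA" using K(2)[of t] that by auto
          then show ?thesis using expansion[of "A (u t)"] by (simp add: sums_def A_coefficient)
        qed
      qed
      show "AE t in ?M. norm (A (u t)) \<le> norm (K * (VN \<gamma> u0 + norm u1) * t powr (1 - \<alpha>) + R)"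
      proof (rule AE_I2)
        fix t assume "t \<in> space ?M"
        then have t: "0 < t" "t < T" by auto
        have "(\<integral>s. norm (f' s) \<partial>lebesgue_on {0<..<t}) \<le> (\<integral>s. norm (f' s) \<partial>?M)"
          by (subst integral_initial_interval[of t T]) (use t f'i in \<open>auto intro!: integral_mono_AE'\<close>)
        then have "K * (\<integral>s. norm (f' s) \<partial>lebesgue_on {0<..<t}) \<le> K * (\<integral>s. norm (f' s) \<partial>?M)"
          using K(1) by (intro mult_left_mono) auto
        then have "norm (A (u t)) \<le> K * (VN \<gamma> u0 + norm u1) * t powr (1 - \<alpha>) + R"
          using K(2)[of t] C[of t] t by (simp add: R_def mult_ac)
        then show "norm (A (u t)) \<le> norm (K * (VN \<gamma> u0 + norm u1) * t powr (1 - \<alpha>) + R)" by simp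
      qed
    qed
  qed
  show ?thesis
    unfolding strong_solution_def
  proof (intro conjI weak Ai)
    show "\<exists>D g. has_caputo_derivative e lam (1 / \<alpha>) \<alpha> T u D \<and> integrable ?M g \<and>
        (AE t in ?M. \<forall>v\<in>VS (1 / \<alpha>). D t v = inner (g t) v)"
    proof (intro exI conjI)
      show "has_caputo_derivative e lam \<gamma> \<alpha> T u (\<lambda>t. functional \<gamma> (d t))" by (rule d)
      show "integrable ?M (\<lambda>t. f t - A (u t))"
        by (intro Bochner_Integration.integrable_diff continuous_on_lebesgue_integrable f Ai)
      show "AE t in ?M. \<forall>v\<in>VS \<gamma>. functional \<gamma> (d t) v = inner (f t - A (u t)) v"
        by (rule AE_I2) (use op in blast)
    qed
    show "AE t in ?M. u t \<in> DA" by (rule AE_I2) (use K(2) in auto)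
    show "integrable ?M u" by (rule continuous_on_lebesgue_integrable[OF uc])
  qed
qed

end

section \<open>The second time derivative\<close>

text \<open>Measurability of \<open>g\<close> comes from the completeness of Lebesgue measure.\<close>

lemma integral_lebesgue_on_cong_AE:
  fixes f g :: "real \<Rightarrow> real"
  assumes S: "S \<in> sets lebesgue" and f: "f \<in> borel_measurable (lebesgue_on S)"
    and ae: "AE x in lebesgue_on S. f x = g x"
  shows "integral\<^sup>L (lebesgue_on S) f = integral\<^sup>L (lebesgue_on S) g"
proof -
  have F: "(\<lambda>x. indicator S x *\<^sub>R f x) \<in> borel_measurable lebesgue"
    using f S by (subst (asm) borel_measurable_restrict_space_iff) (auto simp: mult.commute)
  have AE: "AE x in lebesgue. indicator S x *\<^sub>R f x = indicator S x *\<^sub>R g x"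
    using ae S by (auto simp: AE_restrict_space_iff indicator_def elim!: eventually_mono)
  show ?thesis
    using integral_cong_AE[OF F borel_measurable_AE[OF F AE] AE] S by (simp add: integral_restrict_space)
qed

context fractional_evolution
begin

lemma diag_family_integrable:
  assumes m: "\<And>n. (\<lambda>\<tau>. m \<tau> n) \<in> borel_measurable borel" and \<mu>: "0 < \<mu>"
    and B: "\<And>\<tau> n. 0 < \<tau> \<Longrightarrow> \<tau> < T \<Longrightarrow> \<bar>m \<tau> n\<bar> \<le> B * \<tau> powr (\<mu> - 1)"
  shows "integrable (lebesgue_on {0<..<T}) (\<lambda>\<tau>. diag (m \<tau>) h)"
    and "(\<integral>\<tau>. norm (diag (m \<tau>) h) \<partial>lebesgue_on {0<..<T}) \<le> B * (T powr \<mu> / \<mu>) * norm h"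
proof -
  let ?M = "lebesgue_on {0<..<T}"
  have k: "integrable ?M (\<lambda>\<tau>. B * norm h * \<tau> powr (\<mu> - 1))"
    by (rule integrable_mult_right, rule powr_integrable(1)) (use \<mu> T in auto)
  have le: "norm (diag (m \<tau>) h) \<le> B * norm h * \<tau> powr (\<mu> - 1)" if "\<tau> \<in> space ?M" for \<tau>
    using norm_diag_le[of "m \<tau>" "B * \<tau> powr (\<mu> - 1)" h] B that by (simp add: mult_ac)
  show i: "integrable ?M (\<lambda>\<tau>. diag (m \<tau>) h)"
  proof (rule Bochner_Integration.integrable_bound[OF k])
    show "(\<lambda>\<tau>. diag (m \<tau>) h) \<in> borel_measurable ?M"
      by (rule diag_measurable[where K = "\<lambda>\<tau>. B * \<tau> powr (\<mu> - 1)"])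
        (use m B in \<open>auto intro: borel_measurable_lebesgue_on_borel\<close>)
    show "AE \<tau> in ?M. norm (diag (m \<tau>) h) \<le> norm (B * norm h * \<tau> powr (\<mu> - 1))"
      by (rule AE_I2, rule order_trans[OF le]) auto
  qed
  have "(\<integral>\<tau>. norm (diag (m \<tau>) h) \<partial>?M) \<le> (\<integral>\<tau>. B * norm h * \<tau> powr (\<mu> - 1) \<partial>?M)"
    using i k le by (intro integral_mono) auto
  also have "\<dots> = B * norm h * (T powr \<mu> / \<mu>)"
    using powr_integrable(2)[OF \<mu>, of T] T by simp
  finally show "(\<integral>\<tau>. norm (diag (m \<tau>) h) \<partial>?M) \<le> B * (T powr \<mu> / \<mu>) * norm h" by (simp add: mult_ac)
qed

text \<open>Differentiating the formula of \<open>mild_C1\<close> once more, after integration by parts in its last term, gives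
the four terms of the second derivative. Their multipliers \<open>m1\<close>, \<open>m2\<close>, \<open>m3\<close> have integrable
singularities at \<open>0\<close>: the exponents are \<open>\<alpha> * \<sigma> - 2\<close>, \<open>\<alpha> * \<beta> - 1\<close> and \<open>\<alpha> - 2\<close>. The derivative is
therefore taken in the Sobolev sense.\<close>

lemma mild_second_derivative:
  assumes s: "\<gamma> < \<sigma>" "\<sigma> \<le> 1" and b: "0 < \<beta>" "\<beta> \<le> 1"
  obtains C where "0 < C"
    "\<And>f f' u0 u1 u. primitive_pair f f' \<Longrightarrow> u0 \<in> VS \<sigma> \<Longrightarrow> u1 \<in> VS \<beta> \<Longrightarrow> is_mild f u0 u1 u \<Longrightarrow>
      \<exists>v w. sobolev_W1 1 T u v \<and> sobolev_W1 1 T v w \<and>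
        (\<integral>t. norm (w t) \<partial>lebesgue_on {0<..<T}) \<le>
          C * (VN \<sigma> u0 + VN \<beta> u1 + (\<integral>t. norm (f' t) \<partial>lebesgue_on {0<..<T}) + norm (f 0))"
proof -
  let ?M = "lebesgue_on {0<..<T}"
  obtain B3 where B3: "B3 > 0" "\<And>n t s. 0 < t \<Longrightarrow> 0 \<le> s \<Longrightarrow> s \<le> 1 \<Longrightarrow>
    \<bar>lam n powr s * ek \<alpha> n t\<bar> \<le> B3 * t powr (\<alpha> - 1 - \<alpha> * s)" using ek_bound[of \<alpha>] alpha by auto
  obtain B5 where B5: "B5 > 0" "\<And>n t s. 0 < t \<Longrightarrow> 0 \<le> s \<Longrightarrow> s \<le> 1 \<Longrightarrow>
    \<bar>lam n powr s * ek (\<alpha> - 1) n t\<bar> \<le> B5 * t powr (\<alpha> - 1 - 1 - \<alpha> * s)" using ek_bound[of "\<alpha> - 1"] alpha by auto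
  have as: "\<alpha> * \<sigma> > 1" using mult_strict_left_mono[OF s(1), of \<alpha>] alpha gamma(4) by simp
  have ab: "\<alpha> * \<beta> > 0" using alpha b by simp
  define m1 where "m1 t n = lam n powr (1 - \<sigma>) * ek (\<alpha> - 1) n t" for t n
  define m2 where "m2 t n = lam n powr (1 - \<beta>) * ek \<alpha> n t" for t n
  define m3 where "m3 t n = ek (\<alpha> - 1) n t" for t n
  have b1: "\<bar>m1 t n\<bar> \<le> B5 * t powr ((\<alpha> * \<sigma> - 1) - 1)" if "0 < t" for t n
  proof -
    have eq: "\<alpha> - 1 - 1 - \<alpha> * (1 - \<sigma>) = (\<alpha> * \<sigma> - 1) - 1" by (simp add: right_diff_distrib)
    have "0 \<le> 1 - \<sigma>" "1 - \<sigma> \<le> 1" using less_trans[OF gamma(3) s(1)] s(2) by auto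
    from B5(2)[OF that this, of n] show ?thesis unfolding m1_def eq .
  qed
  have b2: "\<bar>m2 t n\<bar> \<le> B3 * t powr (\<alpha> * \<beta> - 1)" if "0 < t" for t n
  proof -
    have eq: "\<alpha> - 1 - \<alpha> * (1 - \<beta>) = \<alpha> * \<beta> - 1" by (simp add: right_diff_distrib)
    have "0 \<le> 1 - \<beta>" "1 - \<beta> \<le> 1" using b by auto
    from B3(2)[OF that this, of n] show ?thesis unfolding m2_def eq .
  qed
  have b3: "\<bar>m3 t n\<bar> \<le> B5 * t powr ((\<alpha> - 1) - 1)" if "0 < t" for t n
    using B5(2)[of t 0 n] that lam_pos[of n] by (simp add: m3_def less_imp_neq[symmetric])
  have meas: "(\<lambda>t. m1 t n) \<in> borel_measurable borel" "(\<lambda>t. m2 t n) \<in> borel_measurable borel"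
    "(\<lambda>t. m3 t n) \<in> borel_measurable borel" for n
    unfolding m1_def m2_def m3_def using alpha by auto
  define C1 C2 C3 where "C1 = B5 * (T powr (\<alpha> * \<sigma> - 1) / (\<alpha> * \<sigma> - 1))"
    and "C2 = B3 * (T powr (\<alpha> * \<beta>) / (\<alpha> * \<beta>))" and "C3 = B5 * (T powr (\<alpha> - 1) / (\<alpha> - 1))"
  have C0: "0 \<le> C1" "0 \<le> C2" "0 < C3" using B3 B5 as ab alpha T by (auto simp: C1_def C2_def C3_def)
  show thesis
  proof (rule that[of "C1 + C2 + C3"])
    show "0 < C1 + C2 + C3" using C0 by simp
    fix f f' u0 u1 u
    assume pp: "primitive_pair f f'" and u0: "u0 \<in> VS \<sigma>" and u1: "u1 \<in> VS \<beta>" and u: "is_mild f u0 u1 u"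
    have f: "continuous_on {0..T} f" and f'i: "integrable ?M f'"
      by (rule primitive_pair_continuous[OF pp] primitive_pair_integrable[OF pp])+
    have u0g: "u0 \<in> VS \<gamma>" by (rule V_mono(1)[OF _ u0]) (use s in simp)
    obtain v where v: "continuous_on {0..T} v" "v 0 = u1"
      "\<And>t. t \<in> {0..T} \<Longrightarrow> (u has_vector_derivative v t) (at t within {0..T})"
      "\<And>t n. 0 \<le> t \<Longrightarrow> t \<le> T \<Longrightarrow> inner (v t) (e n) = - (lam n * ek \<alpha> n t * inner u0 (e n)) + E1 n t * inner u1 (e n)
          + convolve (ek (\<alpha> - 1) n) (\<lambda>\<tau>. inner (f \<tau>) (e n)) t"
      by (rule mild_C1[OF f u0g u]) blast
    define k where "k t = B5 * t powr ((\<alpha> - 1) - 1)" for t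
    have k: "integrable ?M k" "(\<integral>t. \<bar>k t\<bar> \<partial>?M) = C3"
    proof -
      show "integrable ?M k" unfolding k_def
        by (rule integrable_mult_right, rule powr_integrable(1)) (use alpha T in auto)
      have "\<bar>k t\<bar> = k t" for t using B5(1) by (simp add: k_def)
      then show "(\<integral>t. \<bar>k t\<bar> \<partial>?M) = C3"
        unfolding k_def C3_def using powr_integrable(2)[of "\<alpha> - 1" T] alpha T by simp
    qed
    obtain w3 where w3: "integrable ?M w3"
      "AE t in ?M. \<forall>n. inner (w3 t) (e n) = convolve (\<lambda>\<tau>. m3 \<tau> n) (\<lambda>\<tau>. inner (f' \<tau>) (e n)) t"
      "(\<integral>t. norm (w3 t) \<partial>?M) \<le> (\<integral>\<tau>. \<bar>k \<tau>\<bar> \<partial>?M) * (\<integral>\<tau>. norm (f' \<tau>) \<partial>?M)"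
      by (rule diag_convolution_integrable[of m3 k T f']) (use meas k b3 f'i in \<open>auto simp: k_def[abs_def]\<close>)
    define g1 g2 g3 where "g1 t = diag (m1 t) (pow \<sigma> u0)" and "g2 t = diag (m2 t) (pow \<beta> u1)" and "g3 t = diag (m3 t) (f 0)" for t
    have gi: "integrable ?M g1" "integrable ?M g2" "integrable ?M g3"
    proof -
      show "integrable ?M g1" unfolding g1_def
        by (rule diag_family_integrable(1)[OF meas(1) _ b1]) (use as in simp_all)
      show "integrable ?M g2" unfolding g2_def
        by (rule diag_family_integrable(1)[OF meas(2) ab b2]) simp_all
      show "integrable ?M g3" unfolding g3_def
        by (rule diag_family_integrable(1)[OF meas(3) _ b3]) (use alpha in simp_all)
    qed
    have gn: "(\<integral>t. norm (g1 t) \<partial>?M) \<le> C1 * VN \<sigma> u0" "(\<integral>t. norm (g2 t) \<partial>?M) \<le> C2 * VN \<beta> u1"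
      "(\<integral>t. norm (g3 t) \<partial>?M) \<le> C3 * norm (f 0)"
    proof -
      show "(\<integral>t. norm (g1 t) \<partial>?M) \<le> C1 * VN \<sigma> u0" unfolding g1_def C1_def V_norm_pow[OF u0]
        by (rule diag_family_integrable(2)[OF meas(1) _ b1]) (use as in simp_all)
      show "(\<integral>t. norm (g2 t) \<partial>?M) \<le> C2 * VN \<beta> u1" unfolding g2_def C2_def V_norm_pow[OF u1]
        by (rule diag_family_integrable(2)[OF meas(2) ab b2]) simp_all
      show "(\<integral>t. norm (g3 t) \<partial>?M) \<le> C3 * norm (f 0)" unfolding g3_def C3_def
        by (rule diag_family_integrable(2)[OF meas(3) _ b3]) (use alpha in simp_all)
    qed
    define w where "w t = g3 t + w3 t - g1 t - g2 t" for t
    have wi: "integrable ?M w" unfolding w_def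
      by (intro Bochner_Integration.integrable_add Bochner_Integration.integrable_diff gi w3)
    have prim: "inner (v t) (e n) = inner (v 0) (e n) + (\<integral>s. inner (w s) (e n) \<partial>lebesgue_on {0<..<t})"
      if t: "0 < t" "t < T" for t n
    proof -
      let ?N = "lebesgue_on {0<..<t}"
      define c where "c s = inner (f' s) (e n)" for s
      have ci: "integrable ?N c" unfolding c_def using integrable_initial_interval[OF f'i] t by auto
      have i: "integrable ?N (\<lambda>s. inner (g s) (e n))" if "integrable ?M g" for g
        by (intro integrable_inner_left integrable_initial_interval[OF that]) (use t in simp)
      have I1: "(\<integral>s. inner (g1 s) (e n) \<partial>?N) = lam n * inner u0 (e n) * ek \<alpha> n t"
      proof -
        have "(\<integral>s. inner (g1 s) (e n) \<partial>?N) = (\<integral>s. (lam n * inner u0 (e n)) * ek (\<alpha> - 1) n s \<partial>?N)"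
        proof (rule Bochner_Integration.integral_cong[OF refl])
          fix s assume "s \<in> space ?N"
          then have "inner (g1 s) (e n) = m1 s n * (lam n powr \<sigma> * inner u0 (e n))"
            unfolding g1_def inner_pow[OF u0, symmetric] by (intro inner_diag[OF b1]) simp
          also have "\<dots> = (lam n powr (1 - \<sigma>) * lam n powr \<sigma>) * inner u0 (e n) * ek (\<alpha> - 1) n s" by (simp add: m1_def)
          finally show "inner (g1 s) (e n) = (lam n * inner u0 (e n)) * ek (\<alpha> - 1) n s" unfolding lam_powr_split .
        qed
        then show ?thesis using ek_primitive[of "\<alpha> - 1" t n] alpha t by simp
      qed
      have I2: "(\<integral>s. inner (g2 s) (e n) \<partial>?N) = inner u1 (e n) * (1 - E1 n t)"
      proof -
        have "(\<integral>s. inner (g2 s) (e n) \<partial>?N) = (\<integral>s. (lam n * inner u1 (e n)) * ek \<alpha> n s \<partial>?N)"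
        proof (rule Bochner_Integration.integral_cong[OF refl])
          fix s assume "s \<in> space ?N"
          then have "inner (g2 s) (e n) = m2 s n * (lam n powr \<beta> * inner u1 (e n))"
            unfolding g2_def inner_pow[OF u1, symmetric] by (intro inner_diag[OF b2]) simp
          also have "\<dots> = (lam n powr (1 - \<beta>) * lam n powr \<beta>) * inner u1 (e n) * ek \<alpha> n s" by (simp add: m2_def)
          finally show "inner (g2 s) (e n) = (lam n * inner u1 (e n)) * ek \<alpha> n s" unfolding lam_powr_split .
        qed
        also have "\<dots> = inner u1 (e n) * (lam n * ek (1 + \<alpha>) n t)"
          using ek_primitive[of \<alpha> t n] alpha t by (simp add: add.commute)
        also have "lam n * ek (1 + \<alpha>) n t = 1 - E1 n t"
          using ek_recurrence[of 1 t n] t by (simp add: frac_kernel_one E1_eq)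
        finally show ?thesis .
      qed
      have I3: "(\<integral>s. inner (g3 s) (e n) \<partial>?N) = inner (f 0) (e n) * ek \<alpha> n t"
      proof -
        have "(\<integral>s. inner (g3 s) (e n) \<partial>?N) = (\<integral>s. inner (f 0) (e n) * ek (\<alpha> - 1) n s \<partial>?N)"
        proof (rule Bochner_Integration.integral_cong[OF refl])
          fix s assume "s \<in> space ?N"
          then have "inner (g3 s) (e n) = m3 s n * inner (f 0) (e n)"
            unfolding g3_def by (intro inner_diag[OF b3]) simp
          then show "inner (g3 s) (e n) = inner (f 0) (e n) * ek (\<alpha> - 1) n s" by (simp add: m3_def)
        qed
        then show ?thesis using ek_primitive[of "\<alpha> - 1" t n] alpha t by simp
      qed
      have I4: "(\<integral>s. inner (w3 s) (e n) \<partial>?N) = convolve (ek \<alpha> n) c t"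
      proof -
        have "AE s in ?N. \<forall>n. inner (w3 s) (e n) = convolve (\<lambda>\<tau>. m3 \<tau> n) (\<lambda>\<tau>. inner (f' \<tau>) (e n)) s"
          using w3(2) t by (auto simp: AE_restrict_space_iff)
        then have ae: "AE s in ?N. convolve (ek (\<alpha> - 1) n) c s = inner (w3 s) (e n)"
          by eventually_elim (simp add: m3_def c_def[abs_def])
        have assoc: "convolve (\<lambda>_. 1) (convolve (ek (\<alpha> - 1) n) c) t = convolve (convolve (\<lambda>_. 1) (ek (\<alpha> - 1) n)) c t"
          by (rule convolve_assoc_left_bounded[where A = 1]) (use alpha t ek_integrable ci in auto)
        have i3: "integrable ?N (\<lambda>s. inner (w3 s) (e n))" by (rule i[OF w3(1)])
        have "(\<integral>s. inner (w3 s) (e n) \<partial>?N) = (\<integral>s. convolve (ek (\<alpha> - 1) n) c s \<partial>?N)"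
          by (rule integral_lebesgue_on_cong_AE) (use ae i3 in \<open>auto elim!: eventually_mono\<close>)
        also have "\<dots> = convolve (convolve (\<lambda>_. 1) (ek (\<alpha> - 1) n)) c t" unfolding assoc[symmetric] convolve_one ..
        also have "\<dots> = convolve (ek \<alpha> n) c t"
          by (rule convolve_cong) (use ek_primitive[of "\<alpha> - 1"] alpha in \<open>auto simp: convolve_one\<close>)
        finally show ?thesis .
      qed
      have "(\<integral>s. inner (w s) (e n) \<partial>?N) = (\<integral>s. inner (g3 s) (e n) + inner (w3 s) (e n) - inner (g1 s) (e n) - inner (g2 s) (e n) \<partial>?N)"
        by (simp add: w_def inner_add_left inner_diff_left)
      also have "\<dots> = (\<integral>s. inner (g3 s) (e n) \<partial>?N) + (\<integral>s. inner (w3 s) (e n) \<partial>?N) - (\<integral>s. inner (g1 s) (e n) \<partial>?N) - (\<integral>s. inner (g2 s) (e n) \<partial>?N)"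
        using i[OF gi(1)] i[OF gi(2)] i[OF gi(3)] i[OF w3(1)] by simp
      finally have "(\<integral>s. inner (w s) (e n) \<partial>?N) = inner (f 0) (e n) * ek \<alpha> n t + convolve (ek \<alpha> n) c t
         - lam n * inner u0 (e n) * ek \<alpha> n t - inner u1 (e n) * (1 - E1 n t)"
        unfolding I1 I2 I3 I4 .
      moreover have "inner (v t) (e n) = - (lam n * ek \<alpha> n t * inner u0 (e n)) + E1 n t * inner u1 (e n)
         + (inner (f 0) (e n) * ek \<alpha> n t + convolve (ek \<alpha> n) c t)"
        using v(4)[of t n] ek_convolution_primitive[OF pp, of "\<alpha> - 1" t n] alpha t by (simp add: c_def[abs_def])
      ultimately show ?thesis using v(2) by (simp add: algebra_simps)
    qed
    have "sobolev_W1 1 T v w" by (rule primitive_sobolev[OF v(1) wi T prim])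
    moreover have "sobolev_W1 1 T u v"
    proof (rule primitive_sobolev)
      show "continuous_on {0..T} u" using v(1,3) by (intro C1_continuous) (auto simp: C1_on_def)
      show "integrable ?M v" by (rule continuous_on_lebesgue_integrable[OF v(1)])
      fix t n assume t: "0 < t" "t < T"
      have "((\<lambda>t. inner (u t) (e n)) has_vector_derivative inner (v r) (e n)) (at r within {0..T})" if "r \<in> {0..T}" for r
        by (rule bounded_linear.has_vector_derivative[OF bounded_linear_inner_left v(3)[OF that]])
      then show "inner (u t) (e n) = inner (u 0) (e n) + (\<integral>s. inner (v s) (e n) \<partial>lebesgue_on {0<..<t})"
        by (rule primitive_of_derivative) (use t coefficient_continuous[OF v(1)] in auto)
    qed (rule T)
    moreover have "(\<integral>t. norm (w t) \<partial>?M) \<le> (C1 + C2 + C3) * (VN \<sigma> u0 + VN \<beta> u1 + (\<integral>t. norm (f' t) \<partial>?M) + norm (f 0))"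
    proof -
      have "(\<integral>t. norm (w t) \<partial>?M) \<le> (\<integral>t. norm (g3 t) + norm (w3 t) + norm (g1 t) + norm (g2 t) \<partial>?M)"
      proof (rule integral_mono)
        show "integrable ?M (\<lambda>t. norm (w t))" using wi by auto
        show "integrable ?M (\<lambda>t. norm (g3 t) + norm (w3 t) + norm (g1 t) + norm (g2 t))"
          by (intro Bochner_Integration.integrable_add integrable_norm gi w3)
        show "norm (w t) \<le> norm (g3 t) + norm (w3 t) + norm (g1 t) + norm (g2 t)" for t
          unfolding w_def by (intro order_trans[OF norm_triangle_ineq4] add_right_mono norm_triangle_ineq)
      qed
      also have "\<dots> = (\<integral>t. norm (g3 t) \<partial>?M) + (\<integral>t. norm (w3 t) \<partial>?M) + (\<integral>t. norm (g1 t) \<partial>?M) + (\<integral>t. norm (g2 t) \<partial>?M)"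
        using gi w3(1) by simp
      also have "\<dots> \<le> C3 * norm (f 0) + C3 * (\<integral>t. norm (f' t) \<partial>?M) + C1 * VN \<sigma> u0 + C2 * VN \<beta> u1"
        using gn w3(3) unfolding k(2) by (intro add_mono)
      also have "\<dots> \<le> (C1 + C2 + C3) * norm (f 0) + (C1 + C2 + C3) * (\<integral>t. norm (f' t) \<partial>?M)
          + (C1 + C2 + C3) * VN \<sigma> u0 + (C1 + C2 + C3) * VN \<beta> u1"
        using C0 by (intro add_mono mult_right_mono) (auto simp: V_norm_pow[OF u0] V_norm_pow[OF u1])
      finally show ?thesis by (simp add: algebra_simps)
    qed
    ultimately show "\<exists>v w. sobolev_W1 1 T u v \<and> sobolev_W1 1 T v w \<and>
        (\<integral>t. norm (w t) \<partial>?M) \<le> (C1 + C2 + C3) * (VN \<sigma> u0 + VN \<beta> u1 + (\<integral>t. norm (f' t) \<partial>?M) + norm (f 0))"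
      by blast
  qed
qed

section \<open>The three assertions\<close>

lemma sobolev_primitive_pair:
  assumes p: "1 \<le> p" "1 / ennreal p + 1 / q = 1" and f: "sobolev_W1 q T f f'" "continuous_on {0..T} f"
  shows "primitive_pair f f'"
    and "0 \<le> t \<Longrightarrow> t \<le> T \<Longrightarrow> (\<integral>s. norm (f' s) \<partial>lebesgue_on {0<..<t}) \<le> t powr (1 / p) * Lq_norm q (lebesgue_on {0<..<T}) f'"
proof -
  have *: "f' \<in> Lq_space q (lebesgue_on {0<..<T})" "weak_derivative T f f'" using f(1) by (auto simp: sobolev_W1_def)
  have i: "integrable (lebesgue_on {0<..<T}) f'" by (rule Lq_integral_bound(1)[OF p *(1)])
  show "primitive_pair f f'"
    unfolding primitive_pair_def
  proof (intro conjI ballI f(2) i)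
    show "f t = f 0 + (\<integral>s. f' s \<partial>lebesgue_on {0<..<t})" if "t \<in> {0..T}" for t
      by (rule weak_derivative_primitive[OF *(2) f(2) i]) (use that in auto)
  qed
  show "0 \<le> t \<Longrightarrow> t \<le> T \<Longrightarrow> (\<integral>s. norm (f' s) \<partial>lebesgue_on {0<..<t}) \<le> t powr (1 / p) * Lq_norm q (lebesgue_on {0<..<T}) f'"
    by (rule Lq_integral_bound(2)[OF p *(1)])
qed

lemma mild_exists:
  assumes f: "continuous_on {0..T} f"
  obtains u where "is_mild f u0 u1 u"
    "\<And>t. t \<in> {0..T} \<Longrightarrow> \<exists>a b c.
      (\<lambda>n. (inner u0 (e n) * mittag_leffler \<alpha> 1 (- lam n * t powr \<alpha>)) *\<^sub>R e n) sums a \<and>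
      (\<lambda>n. (inner u1 (e n) * t * mittag_leffler \<alpha> 2 (- lam n * t powr \<alpha>)) *\<^sub>R e n) sums b \<and>
      (\<lambda>n. (\<integral>\<tau>. inner (f \<tau>) (e n) * (t - \<tau>) powr (\<alpha> - 1) *
                mittag_leffler \<alpha> \<alpha> (- lam n * (t - \<tau>) powr \<alpha>)
              \<partial>lebesgue_on {0<..<t}) *\<^sub>R e n) sums c \<and>
      u t = a + b + c"
proof -
  obtain K where K: "\<And>n t. 0 \<le> t \<Longrightarrow> \<bar>E1 n t\<bar> \<le> K" by (rule E1_bound) blast
  obtain B2 where B2: "B2 > 0" "\<And>n t s. 0 < t \<Longrightarrow> 0 \<le> s \<Longrightarrow> s \<le> 1 \<Longrightarrow>
    \<bar>lam n powr s * ek 2 n t\<bar> \<le> B2 * t powr (2 - 1 - \<alpha> * s)" using ek_bound[of 2] by auto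
  obtain B3 where B3: "B3 > 0" "\<And>n t s. 0 < t \<Longrightarrow> 0 \<le> s \<Longrightarrow> s \<le> 1 \<Longrightarrow>
    \<bar>lam n powr s * ek \<alpha> n t\<bar> \<le> B3 * t powr (\<alpha> - 1 - \<alpha> * s)" using ek_bound[of \<alpha>] alpha by auto
  have b2: "\<bar>ek 2 n t\<bar> \<le> B2 * t" if "0 \<le> t" for n t
    using B2(2)[of t 0 n] that lam_pos[of n] by (cases "t = 0") (auto simp: ek_zero less_imp_neq[symmetric])
  have b3: "\<bar>ek \<alpha> n t\<bar> \<le> B3 * t powr (\<alpha> - 1)" if "0 < t" for n t
    using B3(2)[of t 0 n] that lam_pos[of n] by (simp add: less_imp_neq[symmetric])
  have i3: "integrable (lebesgue_on {0<..<T}) (\<lambda>t. B3 * t powr (\<alpha> - 1))"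
    by (rule integrable_mult_right, rule powr_integrable(1)) (use alpha T in auto)
  obtain U where U: "\<And>t n. 0 \<le> t \<Longrightarrow> t \<le> T \<Longrightarrow> inner (U t) (e n) = convolve (\<lambda>\<tau>. ek \<alpha> n \<tau>) (\<lambda>\<tau>. inner (f \<tau>) (e n)) t"
    by (rule diag_convolution_continuous[of "\<lambda>\<tau> n. ek \<alpha> n \<tau>" T "\<lambda>t. B3 * t powr (\<alpha> - 1)", OF _ i3 b3 f])
      (use alpha in auto)
  define u where "u t = diag (\<lambda>n. E1 n t) u0 + diag (\<lambda>n. ek 2 n t) u1 + U t" for t
  show thesis
  proof (rule that[of u])
    show "is_mild f u0 u1 u"
      unfolding is_mild_def
    proof (intro ballI allI)
      fix t n assume "t \<in> {0..T}"
      then have t: "0 \<le> t" "t \<le> T" by auto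
      show "inner (u t) (e n) = mild f u0 u1 n t"
        unfolding u_def inner_add_left U[OF t] mild_def inner_diag[of "\<lambda>n. E1 n t", OF K[OF t(1)]] inner_diag[of "\<lambda>n. ek 2 n t", OF b2[OF t(1)]]
        by simp
    qed
    fix t assume "t \<in> {0..T}"
    then have t: "0 \<le> t" "t \<le> T" by auto
    have "(\<lambda>n. (inner u0 (e n) * mittag_leffler \<alpha> 1 (- lam n * t powr \<alpha>)) *\<^sub>R e n) sums diag (\<lambda>n. E1 n t) u0"
      using diag_sums[of "\<lambda>n. E1 n t" K u0, OF K[OF t(1)]] by (simp add: E1_def mult.commute)
    moreover have "(\<lambda>n. (inner u1 (e n) * t * mittag_leffler \<alpha> 2 (- lam n * t powr \<alpha>)) *\<^sub>R e n) sums diag (\<lambda>n. ek 2 n t) u1"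
      using diag_sums[of "\<lambda>n. ek 2 n t" "B2 * t" u1, OF b2[OF t(1)]] t by (simp add: ml_kernel_def mult_ac)
    moreover have "(\<lambda>n. (\<integral>\<tau>. inner (f \<tau>) (e n) * (t - \<tau>) powr (\<alpha> - 1) *
                mittag_leffler \<alpha> \<alpha> (- lam n * (t - \<tau>) powr \<alpha>) \<partial>lebesgue_on {0<..<t}) *\<^sub>R e n) sums U t"
    proof -
      have "inner (U t) (e n) = (\<integral>\<tau>. inner (f \<tau>) (e n) * (t - \<tau>) powr (\<alpha> - 1) *
                mittag_leffler \<alpha> \<alpha> (- lam n * (t - \<tau>) powr \<alpha>) \<partial>lebesgue_on {0<..<t})" for n
        unfolding U[OF t] convolve_def ml_kernel_def by (intro Bochner_Integration.integral_cong) (auto simp: mult_ac)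
      then show ?thesis using expansion[of "U t"] by simp
    qed
    ultimately show "\<exists>a b c.
      (\<lambda>n. (inner u0 (e n) * mittag_leffler \<alpha> 1 (- lam n * t powr \<alpha>)) *\<^sub>R e n) sums a \<and>
      (\<lambda>n. (inner u1 (e n) * t * mittag_leffler \<alpha> 2 (- lam n * t powr \<alpha>)) *\<^sub>R e n) sums b \<and>
      (\<lambda>n. (\<integral>\<tau>. inner (f \<tau>) (e n) * (t - \<tau>) powr (\<alpha> - 1) *
                mittag_leffler \<alpha> \<alpha> (- lam n * (t - \<tau>) powr \<alpha>)
              \<partial>lebesgue_on {0<..<t}) *\<^sub>R e n) sums c \<and>
      u t = a + b + c"
      unfolding u_def by blast
  qed
qed

lemma strong_solution_is_mild:
  "continuous_on {0..T} f \<Longrightarrow> strong_solution e lam E DA A \<alpha> T f u0 u1 w \<Longrightarrow> is_mild f u0 u1 w"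
  unfolding strong_solution_def by (blast intro: weak_solution_is_mild)

lemma is_mild_unique: "is_mild f u0 u1 w \<Longrightarrow> is_mild f u0 u1 u \<Longrightarrow> t \<in> {0..T} \<Longrightarrow> w t = u t"
  by (rule basis_eqI) (simp add: is_mild_def)

lemma strong_solution_estimate:
  assumes p: "1 \<le> p" "1 / ennreal p + 1 / q = 1"
  shows "\<exists>C>0. \<forall>f f' u0 u1 u D. \<forall>t\<in>{0<..<T}.
        sobolev_W1 q T f f' \<and> continuous_on {0..T} f \<and> u0 \<in> VS \<gamma> \<and>
        strong_solution e lam E DA A \<alpha> T f u0 u1 u \<and>
        has_caputo_derivative e lam \<gamma> \<alpha> T u D \<longrightarrow>
        u t \<in> DA \<and>
        (\<exists>d. (\<forall>v\<in>VS \<gamma>. D t v = inner d v) \<and>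
           norm d + norm (A (u t)) \<le>
             C * t powr (1 - \<alpha>) * (VN \<gamma> u0 + norm u1) +
             C * (norm (f t) + norm (f 0) +
                  C * t powr (1 / p) * Lq_norm q (lebesgue_on {0<..<T}) f'))"
proof -
  obtain K where K: "0 < K" "\<And>f f' u0 u1 u t. primitive_pair f f' \<Longrightarrow> u0 \<in> VS \<gamma> \<Longrightarrow> is_mild f u0 u1 u \<Longrightarrow> 0 < t \<Longrightarrow> t \<le> T \<Longrightarrow>
      u t \<in> DA \<and> norm (A (u t)) \<le> K * t powr (1 - \<alpha>) * (VN \<gamma> u0 + norm u1) + norm (f t)
        + K * norm (f 0) + K * (\<integral>s. norm (f' s) \<partial>lebesgue_on {0<..<t})"
    by (rule mild_operator_bound) blast
  \<comment> \<open>The last summand of the estimate carries \<open>C * C\<close>, which has to exceed \<open>2 * K\<close> as well.\<close>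
  define C where "C = 2 * K + 3"
  have C: "0 < C" "2 * K \<le> C" "3 \<le> C" "2 * K \<le> C * C"
  proof -
    show "0 < C" "2 * K \<le> C" "3 \<le> C" using K(1) by (auto simp: C_def)
    then show "2 * K \<le> C * C" using mult_mono[of 1 C "2 * K" C] K(1) by simp
  qed
  show ?thesis
  proof (intro exI[of _ C] conjI C(1) allI ballI impI; elim conjE)
    fix f f' u0 u1 u D t
    assume t: "t \<in> {0<..<T}" and f: "sobolev_W1 q T f f'" "continuous_on {0..T} f" and u0: "u0 \<in> VS \<gamma>"
      and ss: "strong_solution e lam E DA A \<alpha> T f u0 u1 u" and D: "has_caputo_derivative e lam \<gamma> \<alpha> T u D"
    have tt: "0 < t" "t \<le> T" "t \<in> {0..T}" using t by auto
    have pp: "primitive_pair f f'" by (rule sobolev_primitive_pair(1)[OF p f])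
    have u: "is_mild f u0 u1 u" by (rule strong_solution_is_mild[OF f(2) ss])
    note Au = K(2)[OF pp u0 u tt(1,2)]
    show "u t \<in> DA" using Au by blast
    obtain d where d: "\<And>t n. 0 \<le> t \<Longrightarrow> t \<le> T \<Longrightarrow> inner (d t) (e n) * lam n powr \<gamma> = inner (f t) (e n) - lam n * inner (u t) (e n)"
      "has_caputo_derivative e lam \<gamma> \<alpha> T u (\<lambda>t. functional \<gamma> (d t))"
      using mild_caputo[OF f(2) u0 u] by metis
    have Dv: "D t v = inner (f t - A (u t)) v" if v: "v \<in> VS \<gamma>" for v
    proof -
      have "D t v = functional \<gamma> (d t) v" by (rule caputo_derivative_unique[OF D d(2) tt(3) v])
      also have "\<dots> = inner (f t - A (u t)) v" by (rule functional_operator[OF _ v d(1)]) (use Au tt in auto)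
      finally show ?thesis .
    qed
    define L where "L = t powr (1 / p) * Lq_norm q (lebesgue_on {0<..<T}) f'"
    define I where "I = (\<integral>s. norm (f' s) \<partial>lebesgue_on {0<..<t})"
    define P where "P = t powr (1 - \<alpha>) * (VN \<gamma> u0 + norm u1)"
    have I: "0 \<le> I" "I \<le> L" unfolding I_def L_def
      by (simp, rule sobolev_primitive_pair(2)[OF p f]) (use tt in auto)
    have P: "0 \<le> P" unfolding P_def by (intro mult_nonneg_nonneg add_nonneg_nonneg) (auto simp: V_norm_pow[OF u0])
    have "norm (f t - A (u t)) + norm (A (u t)) \<le> norm (f t) + 2 * norm (A (u t))"
      using norm_triangle_ineq4[of "f t" "A (u t)"] by simp
    also have "\<dots> \<le> norm (f t) + 2 * (K * P + norm (f t) + K * norm (f 0) + K * I)"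
      using Au by (simp add: I_def P_def mult.assoc)
    also have "\<dots> = (2 * K) * P + 3 * norm (f t) + (2 * K) * norm (f 0) + (2 * K) * I" by simp
    also have "\<dots> \<le> C * P + C * norm (f t) + C * norm (f 0) + (C * C) * L"
      using C I P K(1) by (intro add_mono mult_mono) auto
    finally have "norm (f t - A (u t)) + norm (A (u t)) \<le>
             C * t powr (1 - \<alpha>) * (VN \<gamma> u0 + norm u1) +
             C * (norm (f t) + norm (f 0) + C * t powr (1 / p) * Lq_norm q (lebesgue_on {0<..<T}) f')"
      by (simp add: P_def L_def algebra_simps)
    then show "\<exists>d. (\<forall>v\<in>VS \<gamma>. D t v = inner d v) \<and>
           norm d + norm (A (u t)) \<le>
             C * t powr (1 - \<alpha>) * (VN \<gamma> u0 + norm u1) +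
             C * (norm (f t) + norm (f 0) +
                  C * t powr (1 / p) * Lq_norm q (lebesgue_on {0<..<T}) f')"
      using Dv by blast
  qed
qed

text \<open>Here \<open>T\<close> is fixed, so its powers in the estimate are absorbed by the constant.\<close>

lemma strong_solution_second_derivative:
  assumes p: "1 \<le> p" "1 / ennreal p + 1 / q = 1" and s: "\<sigma> > 1 / \<alpha>" and b: "\<beta> > (\<alpha> - 1) / \<alpha>"
  shows "\<exists>C>0. \<forall>f f' u0 u1 u.
          sobolev_W1 q T f f' \<and> continuous_on {0..T} f \<and>
          u0 \<in> VS \<sigma> \<and> u1 \<in> VS \<beta> \<and>
          strong_solution e lam E DA A \<alpha> T f u0 u1 u \<longrightarrow>
          (\<exists>v w. sobolev_W1 1 T u v \<and> sobolev_W1 1 T v w \<and>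
             Lq_norm 1 (lebesgue_on {0<..<T}) w \<le>
               C * (T powr (\<alpha> * \<sigma> - 1) * VN \<sigma> u0 +
                    T powr (1 - \<alpha> * (1 - \<beta>)) * VN \<beta> u1 +
                    T powr (1 / p + \<alpha> - 1) * Lq_norm q (lebesgue_on {0<..<T}) f' +
                    T powr (\<alpha> - 1) * norm (f 0))) \<and>
          ((\<lambda>t. VN \<gamma> (u t - u0)) \<longlongrightarrow> 0) (at_right 0) \<and>
          ((\<lambda>t. norm (dt T u t - u1)) \<longlongrightarrow> 0) (at_right 0)"
proof -
  \<comment> \<open>The kernel bounds interpolate up to the first power of the eigenvalue only; larger exponents are reduced to \<open>1\<close>.\<close>
  define \<sigma>' where "\<sigma>' = min \<sigma> 1"
  define \<beta>' where "\<beta>' = min \<beta> 1"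
  have "0 < (\<alpha> - 1) / \<alpha>" using alpha by simp
  then have b0: "0 < \<beta>" using b by linarith
  have s': "\<gamma> < \<sigma>'" "\<sigma>' \<le> 1" "\<sigma>' \<le> \<sigma>" and b': "0 < \<beta>'" "\<beta>' \<le> 1" "\<beta>' \<le> \<beta>"
    using s b0 gamma by (auto simp: \<sigma>'_def \<beta>'_def)
  obtain C0 where C0: "0 < C0"
    "\<And>f f' u0 u1 u. primitive_pair f f' \<Longrightarrow> u0 \<in> VS \<sigma>' \<Longrightarrow> u1 \<in> VS \<beta>' \<Longrightarrow> is_mild f u0 u1 u \<Longrightarrow>
      \<exists>v w. sobolev_W1 1 T u v \<and> sobolev_W1 1 T v w \<and>
        (\<integral>t. norm (w t) \<partial>lebesgue_on {0<..<T}) \<le>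
          C0 * (VN \<sigma>' u0 + VN \<beta>' u1 + (\<integral>t. norm (f' t) \<partial>lebesgue_on {0<..<T}) + norm (f 0))"
    by (rule mild_second_derivative[OF s'(1,2) b'(1,2)]) blast
  define x1 x2 x3 where "x1 = lam 0 powr (\<sigma>' - \<sigma>) / T powr (\<alpha> * \<sigma> - 1)"
    and "x2 = lam 0 powr (\<beta>' - \<beta>) / T powr (1 - \<alpha> * (1 - \<beta>))" and "x3 = 1 / T powr (\<alpha> - 1)"
  have x: "0 < x1" "0 < x2" "0 < x3" using T lam_pos[of 0] by (auto simp: x1_def x2_def x3_def)
  define C where "C = C0 * (x1 + x2 + x3)"
  have C: "0 < C" "C0 * x1 \<le> C" "C0 * x2 \<le> C" "C0 * x3 \<le> C"
    using x C0(1) by (auto simp: C_def intro!: mult_pos_pos mult_left_mono)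
  show ?thesis
  proof (intro exI[of _ C] conjI C(1) allI impI; elim conjE)
    fix f f' u0 u1 u
    assume f: "sobolev_W1 q T f f'" "continuous_on {0..T} f" and u0: "u0 \<in> VS \<sigma>" and u1: "u1 \<in> VS \<beta>"
      and ss: "strong_solution e lam E DA A \<alpha> T f u0 u1 u"
    let ?M = "lebesgue_on {0<..<T}"
    have pp: "primitive_pair f f'" by (rule sobolev_primitive_pair(1)[OF p f])
    have u: "is_mild f u0 u1 u" by (rule strong_solution_is_mild[OF f(2) ss])
    have u0': "u0 \<in> VS \<sigma>'" "VN \<sigma>' u0 \<le> lam 0 powr (\<sigma>' - \<sigma>) * VN \<sigma> u0"
      and u1': "u1 \<in> VS \<beta>'" "VN \<beta>' u1 \<le> lam 0 powr (\<beta>' - \<beta>) * VN \<beta> u1"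
      using V_mono[OF s'(3) u0] V_mono[OF b'(3) u1] by auto
    obtain v w where vw: "sobolev_W1 1 T u v" "sobolev_W1 1 T v w"
      "(\<integral>t. norm (w t) \<partial>?M) \<le> C0 * (VN \<sigma>' u0 + VN \<beta>' u1 + (\<integral>t. norm (f' t) \<partial>?M) + norm (f 0))"
      using C0(2)[OF pp u0'(1) u1'(1) u] by blast
    define X1 X2 X3 X4 where "X1 = T powr (\<alpha> * \<sigma> - 1) * VN \<sigma> u0" and "X2 = T powr (1 - \<alpha> * (1 - \<beta>)) * VN \<beta> u1"
      and "X3 = T powr (1 / p + \<alpha> - 1) * Lq_norm q ?M f'" and "X4 = T powr (\<alpha> - 1) * norm (f 0)"
    have I: "(\<integral>t. norm (f' t) \<partial>?M) \<le> T powr (1 / p) * Lq_norm q ?M f'"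
      by (rule sobolev_primitive_pair(2)[OF p f]) (use T in auto)
    have e1: "lam 0 powr (\<sigma>' - \<sigma>) * VN \<sigma> u0 = x1 * X1" "lam 0 powr (\<beta>' - \<beta>) * VN \<beta> u1 = x2 * X2"
      "norm (f 0) = x3 * X4"
      using T by (simp_all add: x1_def x2_def x3_def X1_def X2_def X4_def)
    have e3: "T powr (1 / p) * Lq_norm q ?M f' = x3 * X3"
    proof -
      have "T powr (1 / p + \<alpha> - 1) = T powr (\<alpha> - 1) * T powr (1 / p)"
        unfolding powr_add[symmetric] by (simp add: algebra_simps)
      then show ?thesis using T by (simp add: x3_def X3_def)
    qed
    have "0 \<le> T powr (1 / p) * Lq_norm q ?M f'" by (rule order_trans[OF _ I]) simp
    then have X: "0 \<le> X1" "0 \<le> X2" "0 \<le> X3" "0 \<le> X4"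
      using x(3) by (auto simp: e3 X1_def X2_def X4_def V_norm_pow[OF u0] V_norm_pow[OF u1] zero_le_mult_iff)
    have "(\<integral>t. norm (w t) \<partial>?M) \<le> C0 * (x1 * X1 + x2 * X2 + x3 * X3 + x3 * X4)"
      using C0(1) u0'(2) u1'(2) I unfolding e1 e3
      by (intro order_trans[OF vw(3)] mult_left_mono add_mono) (auto simp: e1)
    also have "\<dots> = (C0 * x1) * X1 + (C0 * x2) * X2 + (C0 * x3) * X3 + (C0 * x3) * X4" by (simp add: algebra_simps)
    also have "\<dots> \<le> C * X1 + C * X2 + C * X3 + C * X4"
      using C X by (intro add_mono mult_right_mono) auto
    finally have "Lq_norm 1 ?M w \<le> C * (X1 + X2 + X3 + X4)"
      unfolding Lq_norm_one by (simp add: algebra_simps)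
    then show "\<exists>v w. sobolev_W1 1 T u v \<and> sobolev_W1 1 T v w \<and>
             Lq_norm 1 ?M w \<le>
               C * (T powr (\<alpha> * \<sigma> - 1) * VN \<sigma> u0 +
                    T powr (1 - \<alpha> * (1 - \<beta>)) * VN \<beta> u1 +
                    T powr (1 / p + \<alpha> - 1) * Lq_norm q ?M f' +
                    T powr (\<alpha> - 1) * norm (f 0))"
      unfolding X1_def X2_def X3_def X4_def using vw by blast
    have at: "at 0 within {0..T} = at_right (0::real)" by (rule at_within_Icc_at_right[OF T])
    have ws: "continuous_into_V e lam \<gamma> T u" "C1_on T u" "u 0 = u0" "dt T u 0 = u1"
      using ss unfolding strong_solution_def weak_solution_def by auto
    show "((\<lambda>t. VN \<gamma> (u t - u0)) \<longlongrightarrow> 0) (at_right 0)"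
      using ws(1) T unfolding continuous_into_V_def at[symmetric] ws(3)[symmetric] by auto
    obtain u' where u': "continuous_on {0..T} u'" "\<And>t. t \<in> {0..T} \<Longrightarrow> (u has_vector_derivative u' t) (at t within {0..T})"
      using ws(2) unfolding C1_on_def by blast
    have du: "dt T u t = u' t" if "t \<in> {0..T}" for t using dt_eq[OF that u'(2)[OF that]] .
    have "(u' \<longlongrightarrow> u' 0) (at 0 within {0..T})" using u'(1) T by (simp add: continuous_on_def)
    then have "((\<lambda>t. norm (u' t - u1)) \<longlongrightarrow> 0) (at 0 within {0..T})"
      using du[of 0] T ws(4) by (intro tendsto_norm_zero) (simp add: LIM_zero)
    moreover have "\<forall>\<^sub>F t in at 0 within {0..T}. norm (u' t - u1) = norm (dt T u t - u1)"
      unfolding eventually_at_filter using du by (intro always_eventually) simp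
    ultimately show "((\<lambda>t. norm (dt T u t - u1)) \<longlongrightarrow> 0) (at_right 0)"
      unfolding at[symmetric] by (rule Lim_transform_eventually)
  qed
qed

lemma strong_solution_exists_unique:
  assumes p: "1 \<le> p" "1 / ennreal p + 1 / q = 1"
    and f: "sobolev_W1 q T f f'" "continuous_on {0..T} f" and u0: "u0 \<in> VS \<gamma>"
  shows "\<exists>u. strong_solution e lam E DA A \<alpha> T f u0 u1 u \<and>
           (\<forall>w. strong_solution e lam E DA A \<alpha> T f u0 u1 w \<longrightarrow> (\<forall>t\<in>{0..T}. w t = u t)) \<and>
           (\<forall>t\<in>{0..T}. \<exists>a b c.
              (\<lambda>n. (inner u0 (e n) * mittag_leffler \<alpha> 1 (- lam n * t powr \<alpha>)) *\<^sub>R e n) sums a \<and>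
              (\<lambda>n. (inner u1 (e n) * t * mittag_leffler \<alpha> 2 (- lam n * t powr \<alpha>)) *\<^sub>R e n) sums b \<and>
              (\<lambda>n. (\<integral>\<tau>. inner (f \<tau>) (e n) * (t - \<tau>) powr (\<alpha> - 1) *
                        mittag_leffler \<alpha> \<alpha> (- lam n * (t - \<tau>) powr \<alpha>)
                      \<partial>lebesgue_on {0<..<t}) *\<^sub>R e n) sums c \<and>
              u t = a + b + c)"
    (is "\<exists>u. _ \<and> _ \<and> (\<forall>t\<in>{0..T}. ?S u t)")
proof -
  have pp: "primitive_pair f f'" by (rule sobolev_primitive_pair(1)[OF p f])
  show ?thesis
  proof (rule mild_exists[OF f(2), of u0 u1])
    fix u assume u: "is_mild f u0 u1 u" and S: "\<And>t. t \<in> {0..T} \<Longrightarrow> ?S u t"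
    have "strong_solution e lam E DA A \<alpha> T f u0 u1 u" by (rule mild_strong_solution[OF pp u0 u])
    moreover have "w t = u t" if "strong_solution e lam E DA A \<alpha> T f u0 u1 w" "t \<in> {0..T}" for w t
      by (rule is_mild_unique[OF strong_solution_is_mild[OF f(2) that(1)] u that(2)])
    ultimately show ?thesis using S by blast
  qed
qed

end

theorem theorem3p4:
  fixes X :: "'x::metric_space set" and m :: "'x measure"
    and cls :: "('x \<Rightarrow> real) \<Rightarrow> 'h::{real_inner,banach,second_countable_topology}"
    and V DA :: "'h set" and E :: "'h \<Rightarrow> 'h \<Rightarrow> real" and A :: "'h \<Rightarrow> 'h"
    and e :: "nat \<Rightarrow> 'h" and lam :: "nat \<Rightarrow> real"
    and q\<^sub>A \<alpha> \<gamma> T p :: real and q :: ennreal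
  assumes "compact (closure X)" "radon_measure_on X m" "measure_supp m = X" "emeasure m X < \<infinity>"
    and "is_L2 m cls"
    and "dirichlet_form m cls V E"
    and "compactly_embedded V E"
    and "q\<^sub>A > 1" "embedded_in_Lr (2 * q\<^sub>A) m cls V E"
    and "nonneg_selfadjoint DA A"
    and "eigenbasis DA A e lam"
    and "associated_operator V E DA A e lam"
    and "1 < \<alpha>" "\<alpha> < 2" "\<gamma> = 1 / \<alpha>" "T > 0"
    and "1 \<le> p" "p < 1 / (2 - \<alpha>)" "1 / ennreal p + 1 / q = 1"
  shows
    "(\<forall>f f' u0 u1. sobolev_W1 q T f f' \<and> continuous_on {0..T} f \<and> u0 \<in> V_space e lam \<gamma> \<longrightarrow>
        (\<exists>u. strong_solution e lam E DA A \<alpha> T f u0 u1 u \<and>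
           (\<forall>w. strong_solution e lam E DA A \<alpha> T f u0 u1 w \<longrightarrow> (\<forall>t\<in>{0..T}. w t = u t)) \<and>
           (\<forall>t\<in>{0..T}. \<exists>a b c.
              (\<lambda>n. (inner u0 (e n) * mittag_leffler \<alpha> 1 (- lam n * t powr \<alpha>)) *\<^sub>R e n) sums a \<and>
              (\<lambda>n. (inner u1 (e n) * t * mittag_leffler \<alpha> 2 (- lam n * t powr \<alpha>)) *\<^sub>R e n) sums b \<and>
              (\<lambda>n. (\<integral>\<tau>. inner (f \<tau>) (e n) * (t - \<tau>) powr (\<alpha> - 1) *
                        mittag_leffler \<alpha> \<alpha> (- lam n * (t - \<tau>) powr \<alpha>)
                      \<partial>lebesgue_on {0<..<t}) *\<^sub>R e n) sums c \<and>
              u t = a + b + c)))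
     \<and>
     (\<exists>C>0. \<forall>f f' u0 u1 u D. \<forall>t\<in>{0<..<T}.
        sobolev_W1 q T f f' \<and> continuous_on {0..T} f \<and> u0 \<in> V_space e lam \<gamma> \<and>
        strong_solution e lam E DA A \<alpha> T f u0 u1 u \<and>
        has_caputo_derivative e lam \<gamma> \<alpha> T u D \<longrightarrow>
        u t \<in> DA \<and>
        (\<exists>d. (\<forall>v\<in>V_space e lam \<gamma>. D t v = inner d v) \<and>
           norm d + norm (A (u t)) \<le>
             C * t powr (1 - \<alpha>) * (V_norm e lam \<gamma> u0 + norm u1) +
             C * (norm (f t) + norm (f 0) +
                  C * t powr (1 / p) * Lq_norm q (lebesgue_on {0<..<T}) f')))
     \<and>
     (\<forall>\<sigma> \<beta>. \<sigma> > 1 / \<alpha> \<and> \<beta> > (\<alpha> - 1) / \<alpha> \<longrightarrow>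
       (\<exists>C>0. \<forall>f f' u0 u1 u.
          sobolev_W1 q T f f' \<and> continuous_on {0..T} f \<and>
          u0 \<in> V_space e lam \<sigma> \<and> u1 \<in> V_space e lam \<beta> \<and>
          strong_solution e lam E DA A \<alpha> T f u0 u1 u \<longrightarrow>
          (\<exists>v w. sobolev_W1 1 T u v \<and> sobolev_W1 1 T v w \<and>
             Lq_norm 1 (lebesgue_on {0<..<T}) w \<le>
               C * (T powr (\<alpha> * \<sigma> - 1) * V_norm e lam \<sigma> u0 +
                    T powr (1 - \<alpha> * (1 - \<beta>)) * V_norm e lam \<beta> u1 +
                    T powr (1 / p + \<alpha> - 1) * Lq_norm q (lebesgue_on {0<..<T}) f' +
                    T powr (\<alpha> - 1) * norm (f 0))) \<and>
          ((\<lambda>t. V_norm e lam \<gamma> (u t - u0)) \<longlongrightarrow> 0) (at_right 0) \<and>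
          ((\<lambda>t. norm (dt T u t - u1)) \<longlongrightarrow> 0) (at_right 0)))"
proof -
  interpret fractional_evolution V DA E A e lam \<alpha> T
    using assms by unfold_locales (auto simp: dirichlet_form_def)
  note p = \<open>1 \<le> p\<close> \<open>1 / ennreal p + 1 / q = 1\<close>
  show ?thesis
    unfolding \<open>\<gamma> = 1 / \<alpha>\<close>
    by (intro conjI[OF _ conjI] allI impI strong_solution_estimate[OF p]; elim conjE)
      (rule strong_solution_exists_unique[OF p] strong_solution_second_derivative[OF p]; assumption)+
qed

end
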